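(* Let $x>0$. After forgetting the spine (but keeping the root), the tree $\hat{H}^{(x)}$ has the law of $H^{(x)}$ tilted in proportion to the total progeny. The same holds when both distributions are conditioned on the root age. Moreover, conditioned on $\hat{H}^{(x)}$ being isomorphic (as an age-labelled rooted tree) to $(T,\rho,a)$, the spine is the shortest path from the root $\rho$ to a uniform random vertex of $T$. Conditioned on $\hat{H}^{(x)}$ being isomorphic as an age-labelled unrooted tree to $(T,a)$, the spine is the oriented path between two independent uniform random vertices of $T$.
   Context: For $x\ge0$ and $b\ge0$ let $\lambda_b^{(x)}$ be the measure on $[0,\infty)$ with density $(b\wedge a)\,\tfrac12\operatorname{sech}^2\left(\tfrac{a+x}{2}\right)da$. $H^{(x)}$ is the multitype Galton--Watson tree with types (ages) in $[0,\infty)$ in which the root age satisfies $\mathbb{P}(a(\rho^{(x)})>y)=\frac{1-\tanh((x+y)/2)}{1-\tanh(x/2)}$, and independently for each vertex the ages of the children of a vertex of age $b$ form a Poisson random measure of intensity $\lambda_b^{(x)}$. The total progeny is the number of vertices. $\hat{H}^{(x)}$ is the following multitype Galton--Watson tree whose vertices have ages in $[0,\infty)$ and are either spinal or non-spinal. The root $\hat\rho^{(x)}$ is spinal and its age has $\mathbb{P}(a(\hat\rho^{(x)})>y)=\cosh^2(\tfrac{x}{2})/\cosh^2(\tfrac{x+y}{2})$. All children of a non-spinal vertex are non-spinal, and the ages of the children of a non-spinal vertex of age $b$ form a Poisson random measure of intensity $\lambda_b^{(x)}$. The children of a spinal vertex of age $b$ consist of non-spinal children, whose ages form a Poisson random measure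 of intensity $\lambda_b^{(x)}$, together with, independently, at most one spinal child: there is no spinal child with probability $\tanh(\tfrac{x}{2})/\tanh(\tfrac{b+x}{2})$, and otherwise there is exactly one, whose age has the probability density $$\frac{(b\wedge a)\operatorname{sech}^2(\tfrac{a+x}{2})\tanh(\tfrac{a+x}{2})}{2\left(\tanh(\tfrac{b+x}{2})-\tanh(\tfrac{x}{2})\right)}\,da .$$ The spine is the path formed by the spinal vertices, oriented away from the root. *)

theory Defs
  imports "HOL-Probability.Probability" "HOL-Real_Asymp.Real_Asymp"
begin

section \<open>Labelled rooted trees\<close>

text \<open>
  A tree with vertex labels in \<open>'l\<close> is a partial map from Ulam--Harris addresses to labels: its
  vertices are the addresses in the domain, the root is the empty address, and the children of
  the vertex \<open>u\<close> are the vertices of the form \<open>u @ [i]\<close>. The addresses of the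
  siblings of a family carry no meaning; every event below is invariant under isomorphism.
\<close>

type_synonym 'l ltree = "nat list \<rightharpoonup> 'l"

definition ltrees :: "'l ltree set" where
  "ltrees = {t. [] \<in> dom t \<and> (\<forall>u i. u @ [i] \<in> dom t \<longrightarrow> u \<in> dom t)}"

definition adjacent :: "'l ltree \<Rightarrow> nat list \<Rightarrow> nat list \<Rightarrow> bool" where
  "adjacent t u v \<longleftrightarrow> u \<in> dom t \<and> v \<in> dom t \<and> (\<exists>i. v = u @ [i] \<or> u = v @ [i])"

definition walk :: "'l ltree \<Rightarrow> nat list \<Rightarrow> nat list \<Rightarrow> nat list list \<Rightarrow> bool" where
  "walk t u v p \<longleftrightarrow>
     p \<noteq> [] \<and> hd p = u \<and> last p = v \<and> set p \<subseteq> dom t \<and> successively (adjacent t) p"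

definition shortest_path :: "'l ltree \<Rightarrow> nat list \<Rightarrow> nat list \<Rightarrow> nat list list" where
  "shortest_path t u v = (ARG_MIN length p. walk t u v p)"

definition unrooted_iso :: "'l ltree \<Rightarrow> 'l ltree \<Rightarrow> (nat list \<Rightarrow> nat list) \<Rightarrow> bool" where
  "unrooted_iso t s f \<longleftrightarrow>
     bij_betw f (dom t) (dom s) \<and>
     (\<forall>u\<in>dom t. \<forall>v\<in>dom t. adjacent s (f u) (f v) \<longleftrightarrow> adjacent t u v) \<and>
     (\<forall>u\<in>dom t. s (f u) = t u)"

definition rooted_iso :: "'l ltree \<Rightarrow> 'l ltree \<Rightarrow> (nat list \<Rightarrow> nat list) \<Rightarrow> bool" where
  "rooted_iso t s f \<longleftrightarrow> unrooted_iso t s f \<and> f [] = []"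

text \<open>The value \<open>\<infinity>\<close> is taken at infinite trees.\<close>

definition progeny :: "'l ltree \<Rightarrow> ennreal" where
  "progeny t = emeasure (count_space UNIV) (dom t)"

definition option_space :: "'l measure \<Rightarrow> 'l option measure" where
  "option_space S = sigma (insert None (Some ` space S)) (insert {None} ((`) Some ` sets S))"

definition tree_space :: "'l measure \<Rightarrow> 'l ltree measure" where
  "tree_space S = PiM UNIV (\<lambda>_. option_space S)"

text \<open>
  For \<open>R\<close> one of \<open>unrooted_iso\<close> and \<open>rooted_iso\<close>: the events that
  depend only on the isomorphism class of an age-labelled tree, respectively of an age-labelled
  tree carrying a finite sequence of vertices. Both collections are sigma-algebras. All the laws
  below are concentrated on \<open>ltrees\<close>.
\<close>

definition iso_events ::
    "(real ltree \<Rightarrow> real ltree \<Rightarrow> (nat list \<Rightarrow> nat list) \<Rightarrow> bool) \<Rightarrow> real ltree set set" where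
  "iso_events R = {A \<in> sets (tree_space borel).
     \<forall>t\<in>ltrees. \<forall>s\<in>ltrees. \<forall>f. R t s f \<longrightarrow> t \<in> A \<longrightarrow> s \<in> A}"

definition iso_path_events ::
    "(real ltree \<Rightarrow> real ltree \<Rightarrow> (nat list \<Rightarrow> nat list) \<Rightarrow> bool) \<Rightarrow>
     (real ltree \<times> nat list list) set set" where
  "iso_path_events R = {B \<in> sets (tree_space borel \<Otimes>\<^sub>M count_space UNIV).
     \<forall>t\<in>ltrees. \<forall>s\<in>ltrees. \<forall>f p. R t s f \<longrightarrow> set p \<subseteq> dom t \<longrightarrow>
       (t, p) \<in> B \<longrightarrow> (s, map f p) \<in> B}"


section \<open>Poisson random measures\<close>

text \<open>
  A finite point configuration is a pair \<open>(N, X)\<close> that stands for the points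
  \<open>X 0, ..., X (N - 1)\<close>, with multiplicity; the remaining values of \<open>X\<close> are irrelevant.
\<close>

definition config_space :: "'a measure \<Rightarrow> (nat \<times> (nat \<Rightarrow> 'a)) measure" where
  "config_space S = count_space UNIV \<Otimes>\<^sub>M PiM UNIV (\<lambda>_. S)"

definition no_points :: "nat \<times> (nat \<Rightarrow> 'a)" where
  "no_points = (0, \<lambda>_. undefined)"

definition num_points :: "nat \<times> (nat \<Rightarrow> 'a) \<Rightarrow> 'a set \<Rightarrow> nat" where
  "num_points c A = card {i. i < fst c \<and> snd c i \<in> A}"

definition poisson_random_measure ::
    "'w measure \<Rightarrow> 'a measure \<Rightarrow> ('w \<Rightarrow> 'a set \<Rightarrow> nat) \<Rightarrow> bool" where
  "poisson_random_measure P \<Lambda> \<xi> \<longleftrightarrow>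
     prob_space P \<and>
     (\<forall>A\<in>sets \<Lambda>. (\<lambda>\<omega>. \<xi> \<omega> A) \<in> measurable P (count_space UNIV) \<and>
        (\<forall>k. measure P {\<omega>\<in>space P. \<xi> \<omega> A = k} =
           measure \<Lambda> A ^ k / fact k * exp (- measure \<Lambda> A))) \<and>
     (\<forall>(J :: nat set) A. finite J \<longrightarrow> A ` J \<subseteq> sets \<Lambda> \<longrightarrow> disjoint_family_on A J \<longrightarrow>
        prob_space.indep_vars P (\<lambda>_. count_space UNIV) (\<lambda>j \<omega>. \<xi> \<omega> (A j)) J)"

text \<open>
  For finite \<open>\<Lambda>\<close>: the points of a Poisson random measure of intensity \<open>\<Lambda>\<close>,
  enumerated in exchangeable order; see \<open>poisson_random_measure_poisson_points\<close>. The
  separate case is needed because \<open>\<Lambda> = 0\<close> cannot be normalised.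
\<close>

definition poisson_points :: "'a measure \<Rightarrow> (nat \<times> (nat \<Rightarrow> 'a)) measure" where
  "poisson_points \<Lambda> =
     (if measure \<Lambda> (space \<Lambda>) = 0 then return (config_space \<Lambda>) no_points
      else measure_pmf (poisson_pmf (measure \<Lambda> (space \<Lambda>))) \<Otimes>\<^sub>M
           PiM UNIV (\<lambda>_. uniform_measure \<Lambda> (space \<Lambda>)))"

definition poisson_or_zero :: "real \<Rightarrow> nat pmf" where
  "poisson_or_zero r = (if r = 0 then return_pmf 0 else poisson_pmf r)"

lemma pmf_poisson_or_zero:
  "r \<ge> 0 \<Longrightarrow> pmf (poisson_or_zero r) k = r ^ k / fact k * exp (- r)"
  by (cases "r = 0") (auto simp: poisson_or_zero_def power_0_left)

lemma emeasure_multinomial_counts: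
  fixes \<nu> :: "'a measure" and A :: "'j \<Rightarrow> 'a set"
  assumes "prob_space \<nu>" and J: "finite J" and A: "\<And>j. j \<in> J \<Longrightarrow> A j \<in> sets \<nu>"
    and disj: "disjoint_family_on A J" and cover: "(\<Union>j\<in>J. A j) = space \<nu>"
  shows "emeasure (PiM UNIV (\<lambda>_. \<nu>))
      {X \<in> space (PiM UNIV (\<lambda>_. \<nu>)). \<forall>j\<in>J. num_points (n, X) (A j) = k j} =
    ennreal (if sum k J = n then fact n * (\<Prod>j\<in>J. measure \<nu> (A j) ^ k j / fact (k j)) else 0)"
proof (induction n arbitrary: k)
  case 0
  interpret \<nu>: prob_space \<nu> by fact
  interpret sequence_space \<nu> by unfold_locales
  show ?case
  proof (cases "\<forall>j\<in>J. k j = 0")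
    case True
    then show ?thesis by (simp add: num_points_def P.emeasure_space_1)
  next
    case False
    then have *: "{X \<in> space S. \<forall>j\<in>J. num_points (0, X) (A j) = k j} = {}"
      by (auto simp: num_points_def)
    show ?thesis using J False by (auto simp: * simp del: space_PiM)
  qed
next
  case (Suc n)
  interpret \<nu>: prob_space \<nu> by fact
  interpret sequence_space \<nu> by unfold_locales
  note A' [measurable] = A
  define E where "E n k = {X \<in> space S. \<forall>j\<in>J. num_points (n, X) (A j) = k j}"
    for n :: nat and k :: "'j \<Rightarrow> nat"
  have count_meas: "(\<lambda>X. num_points (n, X) (A j)) \<in> measurable S (count_space UNIV)"
    if "j \<in> J" for n j
  proof -
    have "(\<lambda>X. num_points (n, X) (A j)) = (\<lambda>X. \<Sum>i<n. if X i \<in> A j then 1 else 0)"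
      by (auto simp: num_points_def sum.If_cases fun_eq_iff intro!: arg_cong[where f = card])
    then show ?thesis using A'[OF that] by simp
  qed
  have E_meas [measurable]: "E n k \<in> sets S" for n k
    unfolding E_def using J count_meas by measurable
  have count_case: "num_points (Suc n, case_nat s \<omega>) B
      = (if s \<in> B then Suc (num_points (n, \<omega>) B) else num_points (n, \<omega>) B)" for s \<omega> B
  proof -
    have "{i. i < Suc n \<and> case_nat s \<omega> i \<in> B}
        = (if s \<in> B then {0} else {}) \<union> Suc ` {i. i < n \<and> \<omega> i \<in> B}"
    proof (rule set_eqI)
      fix i show "i \<in> {i. i < Suc n \<and> case_nat s \<omega> i \<in> B} \<longleftrightarrow>
          i \<in> (if s \<in> B then {0} else {}) \<union> Suc ` {i. i < n \<and> \<omega> i \<in> B}"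
        by (cases i) auto
    qed
    moreover have "card ((if s \<in> B then {0} else {}) \<union> Suc ` {i. i < n \<and> \<omega> i \<in> B})
        = (if s \<in> B then Suc (card {i. i < n \<and> \<omega> i \<in> B}) else card {i. i < n \<and> \<omega> i \<in> B})"
      by (auto simp: card_image card_insert_if)
    ultimately show ?thesis by (simp add: num_points_def)
  qed
  define c where "c m = (if k m = 0 then 0 else emeasure S (E n (k(m := k m - 1))))" for m
  have slice: "emeasure S ({\<omega> \<in> space S. case_nat s \<omega> \<in> E (Suc n) k}) = (\<Sum>m\<in>J. c m * indicator (A m) s)"
    if s: "s \<in> space \<nu>" for s
  proof -
    obtain m where m: "m \<in> J" "s \<in> A m" using cover s by auto
    have uniq: "s \<in> A j \<longleftrightarrow> j = m" if "j \<in> J" for j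
      using disj m that by (auto simp: disjoint_family_on_def)
    have "(\<Sum>j\<in>J. c j * indicator (A j) s) = (\<Sum>j\<in>J. if j = m then c m else 0)"
      by (intro sum.cong) (auto simp: uniq)
    also have "\<dots> = c m" using m J by simp
    also have "{\<omega> \<in> space S. case_nat s \<omega> \<in> E (Suc n) k} = (if k m = 0 then {} else E n (k(m := k m - 1)))"
    proof -
      have "case_nat s \<omega> \<in> space S" if "\<omega> \<in> space S" for \<omega>
        using that s by (auto simp: space_PiM PiE_iff split: nat.splits)
      then show ?thesis
        using m by (auto simp: E_def count_case uniq split: if_splits)
    qed
    ultimately show ?thesis by (auto simp: c_def)
  qed
  have "emeasure S (E (Suc n) k)
      = emeasure (distr (\<nu> \<Otimes>\<^sub>M S) S (\<lambda>(s, \<omega>). case_nat s \<omega>)) (E (Suc n) k)"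
    by (simp add: PiM_iter)
  also have "\<dots> = (\<integral>\<^sup>+s. emeasure S {\<omega> \<in> space S. case_nat s \<omega> \<in> E (Suc n) k} \<partial>\<nu>)"
    by (subst emeasure_distr, measurable, subst P.emeasure_pair_measure_alt, measurable)
      (auto intro!: nn_integral_cong arg_cong2[where f = emeasure] simp: space_pair_measure)
  also have "\<dots> = (\<integral>\<^sup>+s. (\<Sum>m\<in>J. c m * indicator (A m) s) \<partial>\<nu>)"
    by (intro nn_integral_cong slice)
  also have "\<dots> = (\<Sum>m\<in>J. c m * emeasure \<nu> (A m))"
    by (subst nn_integral_sum) (auto simp: nn_integral_cmult_indicator)
  also have "\<dots> = (\<Sum>m\<in>J. ennreal ((if sum k J = Suc n then
      fact n * (\<Prod>j\<in>J. measure \<nu> (A j) ^ k j / fact (k j)) * k m else 0)))"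
  proof (intro sum.cong refl)
    fix m assume m: "m \<in> J"
    let ?p = "\<lambda>j. measure \<nu> (A j)"
    show "c m * emeasure \<nu> (A m) = ennreal (if sum k J = Suc n then
      fact n * (\<Prod>j\<in>J. ?p j ^ k j / fact (k j)) * k m else 0)"
    proof (cases "k m = 0")
      case True then show ?thesis by (simp add: c_def)
    next
      case False
      define k' where "k' = k(m := k m - 1)"
      have sum: "sum k J = Suc (sum k' J)"
      proof -
        have "sum k' (J - {m}) = sum k (J - {m})"
          by (intro sum.cong) (auto simp: k'_def)
        moreover have "k m = Suc (k' m)" using False by (simp add: k'_def)
        ultimately show ?thesis
          using sum.remove[OF J m, of k] sum.remove[OF J m, of k'] by simp
      qed
      have prod: "(\<Prod>j\<in>J. ?p j ^ k' j / fact (k' j)) * ?p m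
          = (\<Prod>j\<in>J. ?p j ^ k j / fact (k j)) * k m"
      proof -
        have *: "(\<Prod>j\<in>J - {m}. ?p j ^ k' j / fact (k' j)) = (\<Prod>j\<in>J - {m}. ?p j ^ k j / fact (k j))"
          by (intro prod.cong) (auto simp: k'_def)
        obtain q where q: "k m = Suc q" using False by (cases "k m") auto
        have "?p m ^ q / fact q = ?p m ^ q / fact (Suc q) * real (Suc q)"
          by (simp add: fact_Suc field_simps del: of_nat_Suc)
        then have "?p m ^ k' m / fact (k' m) * ?p m = ?p m ^ k m / fact (k m) * k m"
          by (simp add: k'_def q del: fact_Suc of_nat_Suc)
        moreover have "\<And>a b c d R :: real. a * b = c * d \<Longrightarrow> a * R * b = c * R * d"
          by (metis mult.commute mult.left_commute)
        ultimately show ?thesis unfolding prod.remove[OF J m] * by blast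
      qed
      have "c m = ennreal (if sum k' J = n then fact n * (\<Prod>j\<in>J. ?p j ^ k' j / fact (k' j)) else 0)"
        using False Suc.IH[of k'] by (simp add: c_def E_def k'_def)
      then have "c m * emeasure \<nu> (A m) = ennreal ((if sum k' J = n then
          fact n * (\<Prod>j\<in>J. ?p j ^ k' j / fact (k' j)) else 0) * ?p m)"
        by (simp only: \<nu>.emeasure_eq_measure) (simp add: ennreal_mult'')
      also have "\<dots> = ennreal (if sum k J = Suc n then
          fact n * ((\<Prod>j\<in>J. ?p j ^ k' j / fact (k' j)) * ?p m) else 0)"
        by (simp add: sum mult.assoc)
      finally show ?thesis by (simp add: prod mult.assoc)
    qed
  qed
  also have "\<dots> = ennreal (\<Sum>m\<in>J. (if sum k J = Suc n then
      fact n * (\<Prod>j\<in>J. measure \<nu> (A j) ^ k j / fact (k j)) * k m else 0))"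
    by (intro sum_ennreal) (auto intro!: mult_nonneg_nonneg prod_nonneg)
  also have "(\<Sum>m\<in>J. (if sum k J = Suc n then
      fact n * (\<Prod>j\<in>J. measure \<nu> (A j) ^ k j / fact (k j)) * k m else 0))
    = (if sum k J = Suc n then fact (Suc n) * (\<Prod>j\<in>J. measure \<nu> (A j) ^ k j / fact (k j)) else 0)"
  proof (cases "sum k J = Suc n")
    case True
    then have "(\<Sum>m\<in>J. real (k m)) = real (Suc n)" by (metis of_nat_sum)
    then show ?thesis using True
      by (simp add: sum_distrib_left[symmetric] fact_Suc del: of_nat_Suc)
  qed simp
  finally show ?case unfolding E_def .
qed


lemma sets_poisson_points: "sets (poisson_points \<Lambda>) = sets (config_space \<Lambda>)"
  unfolding poisson_points_def config_space_def
  by (auto intro!: sets_pair_measure_cong sets_PiM_cong)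

lemma measurable_num_points:
  assumes "A \<in> sets S"
  shows "(\<lambda>c. num_points c A) \<in> measurable (config_space S) (count_space UNIV)"
proof -
  have "(\<lambda>X. num_points (n, X) A) \<in> measurable (PiM UNIV (\<lambda>_. S)) (count_space UNIV)" for n
  proof -
    have "(\<lambda>X. num_points (n, X) A) = (\<lambda>X. \<Sum>i<n. if X i \<in> A then 1 else 0)"
      by (auto simp: num_points_def sum.If_cases fun_eq_iff intro!: arg_cong[where f = card])
    then show ?thesis using assms by simp
  qed
  then show ?thesis
    unfolding config_space_def
    by (intro measurable_pair_measure_countable1) (auto simp: comp_def)
qed

lemma prob_space_poisson_points:
  assumes "finite_measure \<Lambda>" and that: "space \<Lambda> = UNIV"
  shows "prob_space (poisson_points \<Lambda>)"
proof (cases "measure \<Lambda> (space \<Lambda>) = 0")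
  case True
  then show ?thesis
    using that by (auto simp: poisson_points_def config_space_def space_pair_measure space_PiM
      no_points_def intro!: prob_space_return)
next
  case False
  then interpret \<nu>: prob_space "uniform_measure \<Lambda> (space \<Lambda>)"
    by (intro prob_space_uniform_measure) (auto simp: measure_def)
  interpret sequence_space "uniform_measure \<Lambda> (space \<Lambda>)" by unfold_locales
  show ?thesis
    using False
    by (simp add: poisson_points_def prob_space_pair prob_space_measure_pmf P.prob_space_axioms)
qed

lemma emeasure_poisson_points_partition:
  fixes \<Lambda> :: "'a measure" and A :: "'j \<Rightarrow> 'a set"
  assumes "finite_measure \<Lambda>" and UN: "space \<Lambda> = UNIV" and J: "finite J" and A: "\<And>j. j \<in> J \<Longrightarrow> A j \<in> sets \<Lambda>"
    and disj: "disjoint_family_on A J" and cover: "(\<Union>j\<in>J. A j) = space \<Lambda>"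
  shows "emeasure (poisson_points \<Lambda>)
      {c \<in> space (poisson_points \<Lambda>). \<forall>j\<in>J. num_points c (A j) = k j} =
    (\<Prod>j\<in>J. ennreal (pmf (poisson_or_zero (measure \<Lambda> (A j))) (k j)))"
proof (cases "measure \<Lambda> (space \<Lambda>) = 0")
  case True
  interpret finite_measure \<Lambda> by fact
  have 0: "measure \<Lambda> (A j) = 0" if "j \<in> J" for j
    using True A[OF that] by (metis bounded_measure measure_nonneg order_antisym)
  let ?E = "{c \<in> space (config_space \<Lambda>). \<forall>j\<in>J. num_points c (A j) = k j}"
  have E: "?E \<in> sets (config_space \<Lambda>)"
    using J measurable_num_points[OF A] by measurable
  have "emeasure (poisson_points \<Lambda>)
      {c \<in> space (poisson_points \<Lambda>). \<forall>j\<in>J. num_points c (A j) = k j} = indicator ?E no_points"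
    using E True by (simp add: poisson_points_def)
  also have "\<dots> = indicator {k. \<forall>j\<in>J. k j = 0} k"
    using UN by (auto simp: indicator_def num_points_def no_points_def config_space_def
       space_pair_measure space_PiM)
  also have "\<dots> = (\<Prod>j\<in>J. ennreal (pmf (poisson_or_zero (measure \<Lambda> (A j))) (k j)))"
    using J by (auto simp: 0 poisson_or_zero_def indicator_def prod_zero_iff)
  finally show ?thesis .
next
  case False
  interpret finite_measure \<Lambda> by fact
  define r where "r = measure \<Lambda> (space \<Lambda>)"
  define \<nu> where "\<nu> = uniform_measure \<Lambda> (space \<Lambda>)"
  have r: "r > 0" using False measure_nonneg[of \<Lambda> "space \<Lambda>"] by (simp add: r_def less_le)
  interpret \<nu>: prob_space \<nu>
    using False unfolding \<nu>_def
    by (intro prob_space_uniform_measure) (auto simp: measure_def)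
  interpret sequence_space \<nu> by unfold_locales
  have P: "poisson_points \<Lambda> = measure_pmf (poisson_pmf r) \<Otimes>\<^sub>M S"
    using False by (simp add: poisson_points_def r_def \<nu>_def)
  have sets_\<nu>: "sets \<nu> = sets \<Lambda>" and space_\<nu>: "space \<nu> = space \<Lambda>" by (simp_all add: \<nu>_def)
  have meas_\<nu>: "measure \<nu> (A j) = measure \<Lambda> (A j) / r" if "j \<in> J" for j
  proof -
    have "space \<Lambda> \<inter> A j = A j" using A[OF that] sets.sets_into_space by blast
    then show ?thesis
      using A[OF that] r unfolding \<nu>_def
      by (subst measure_uniform_measure) (auto simp: r_def measure_def[of \<Lambda> "space \<Lambda>"])
  qed
  define g where "g = fact (sum k J) * (\<Prod>j\<in>J. measure \<nu> (A j) ^ k j / fact (k j))"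
  have g: "g \<ge> 0" unfolding g_def by (intro mult_nonneg_nonneg prod_nonneg) auto
  let ?E = "{c \<in> space (poisson_points \<Lambda>). \<forall>j\<in>J. num_points c (A j) = k j}"
  have E: "?E \<in> sets (poisson_points \<Lambda>)"
    using J measurable_num_points[OF A]
    unfolding measurable_cong_sets[OF sets_poisson_points[symmetric] refl] by measurable
  have "emeasure (poisson_points \<Lambda>) ?E =
      (\<integral>\<^sup>+n. emeasure S (Pair n -` ?E) \<partial>measure_pmf (poisson_pmf r))"
    using E unfolding P by (rule P.emeasure_pair_measure_alt)
  also have "\<dots> = (\<integral>\<^sup>+n. ennreal g * indicator {sum k J} n \<partial>measure_pmf (poisson_pmf r))"
  proof (intro nn_integral_cong)
    fix n
    have "Pair n -` ?E = {X \<in> space S. \<forall>j\<in>J. num_points (n, X) (A j) = k j}"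
      by (auto simp: P space_pair_measure)
    also have "emeasure S \<dots> = ennreal g * indicator {sum k J} n"
      by (subst emeasure_multinomial_counts[OF \<nu>.prob_space_axioms J _ disj])
        (auto simp: sets_\<nu> space_\<nu> A cover g_def)
    finally show "emeasure S (Pair n -` ?E) = ennreal g * indicator {sum k J} n" .
  qed
  also have "\<dots> = ennreal g * ennreal (pmf (poisson_pmf r) (sum k J))"
    by (simp add: nn_integral_cmult_indicator emeasure_pmf_single)
  also have "\<dots> = ennreal (g * pmf (poisson_pmf r) (sum k J))"
    using g by (simp add: ennreal_mult)
  also have "g * pmf (poisson_pmf r) (sum k J)
      = (\<Prod>j\<in>J. pmf (poisson_or_zero (measure \<Lambda> (A j))) (k j))"
  proof -
    have r_sum: "r = (\<Sum>j\<in>J. measure \<Lambda> (A j))"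
      unfolding r_def cover[symmetric]
      using J A disj by (intro finite_measure.finite_measure_finite_Union[OF assms(1)]) (auto simp: image_subset_iff)
    have "g * pmf (poisson_pmf r) (sum k J)
        = (\<Prod>j\<in>J. (measure \<Lambda> (A j) / r) ^ k j / fact (k j)) * (\<Prod>j\<in>J. r ^ k j) * exp (- r)"
      using r by (simp add: g_def meas_\<nu> power_sum cong: prod.cong)
    also have "exp (- r) = (\<Prod>j\<in>J. exp (- measure \<Lambda> (A j)))"
      using J by (simp add: r_sum exp_sum sum_negf[symmetric] del: sum_negf)
    also have "(\<Prod>j\<in>J. (measure \<Lambda> (A j) / r) ^ k j / fact (k j)) * (\<Prod>j\<in>J. r ^ k j) *
         (\<Prod>j\<in>J. exp (- measure \<Lambda> (A j)))
       = (\<Prod>j\<in>J. measure \<Lambda> (A j) ^ k j / fact (k j) * exp (- measure \<Lambda> (A j)))"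
      unfolding prod.distrib[symmetric]
      using r by (intro prod.cong) (auto simp: power_divide)
    finally show ?thesis by (simp add: pmf_poisson_or_zero)
  qed
  finally show ?thesis by (simp add: prod_ennreal)
qed

lemma poisson_points_partition:
  fixes \<Lambda> :: "'a measure" and A :: "'j \<Rightarrow> 'a set"
  assumes "finite_measure \<Lambda>" and UN: "space \<Lambda> = UNIV"
    and J: "finite J" and A: "\<And>j. j \<in> J \<Longrightarrow> A j \<in> sets \<Lambda>"
    and disj: "disjoint_family_on A J" and cover: "(\<Union>j\<in>J. A j) = space \<Lambda>"
  shows "prob_space.indep_vars (poisson_points \<Lambda>) (\<lambda>_. count_space UNIV)
           (\<lambda>j c. num_points c (A j)) J"
    and "j \<in> J \<Longrightarrow> distr (poisson_points \<Lambda>) (count_space UNIV) (\<lambda>c. num_points c (A j))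
           = measure_pmf (poisson_or_zero (measure \<Lambda> (A j)))"
proof -
  interpret P: prob_space "poisson_points \<Lambda>"
    using assms(1) UN by (intro prob_space_poisson_points) auto
  let ?P = "poisson_points \<Lambda>" and ?C = "count_space (UNIV :: nat set)"
  let ?X = "\<lambda>j c. num_points c (A j)"
  let ?\<pi> = "\<lambda>j. measure_pmf (poisson_or_zero (measure \<Lambda> (A j)))"
  have ne: "J \<noteq> {}" using cover UN by auto
  have X: "?X j \<in> measurable ?P ?C" if "j \<in> J" for j
    using measurable_num_points[OF A[OF that]]
    by (simp add: measurable_cong_sets[OF sets_poisson_points refl])
  have sets_C: "sets (PiM J (\<lambda>_. ?C)) = Pow (PiE J (\<lambda>_. UNIV))"
    using J by (simp add: count_space_PiM_finite)
  have joint: "distr ?P (PiM J (\<lambda>_. ?C)) (\<lambda>c. \<lambda>j\<in>J. ?X j c) = PiM J ?\<pi>"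
  proof (rule measure_eqI_countable)
    interpret \<pi>: product_prob_space ?\<pi> J
      by (intro product_prob_spaceI prob_space_measure_pmf)
    show "sets (distr ?P (PiM J (\<lambda>_. ?C)) (\<lambda>c. \<lambda>j\<in>J. ?X j c)) = Pow (PiE J (\<lambda>_. UNIV))"
      by (simp add: sets_C)
    show "sets (PiM J ?\<pi>) = Pow (PiE J (\<lambda>_. UNIV))"
      using sets_C by (subst sets_PiM_cong[OF refl, where N = "\<lambda>_. ?C"]) auto
    show "countable (PiE J (\<lambda>_. UNIV :: nat set))" using J by (intro countable_PiE) auto
    fix k assume k: "k \<in> PiE J (\<lambda>_. UNIV :: nat set)"
    have "(\<lambda>c. \<lambda>j\<in>J. ?X j c) -` {k} \<inter> space ?P = {c \<in> space ?P. \<forall>j\<in>J. ?X j c = k j}"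
      using k by (auto simp: fun_eq_iff PiE_def extensional_def)
    then have "emeasure (distr ?P (PiM J (\<lambda>_. ?C)) (\<lambda>c. \<lambda>j\<in>J. ?X j c)) {k}
        = (\<Prod>j\<in>J. ennreal (pmf (poisson_or_zero (measure \<Lambda> (A j))) (k j)))"
      using k X emeasure_poisson_points_partition[OF assms(1) UN J A disj cover]
      by (subst emeasure_distr) (auto simp: sets_C intro!: measurable_restrict)
    also have "\<dots> = emeasure (PiM J ?\<pi>) (PiE J (\<lambda>j. {k j}))"
      using J by (subst \<pi>.emeasure_PiM) (auto simp: emeasure_pmf_single)
    also have "PiE J (\<lambda>j. {k j}) = {k}" using k by (intro PiE_singleton) (simp add: PiE_def)
    finally show "emeasure (distr ?P (PiM J (\<lambda>_. ?C)) (\<lambda>c. \<lambda>j\<in>J. ?X j c)) {k}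
        = emeasure (PiM J ?\<pi>) {k}" .
  qed
  have marg: "distr ?P ?C (?X j) = ?\<pi> j" if j: "j \<in> J" for j
  proof -
    have "distr ?P ?C (?X j) = distr (distr ?P (PiM J (\<lambda>_. ?C)) (\<lambda>c. \<lambda>j\<in>J. ?X j c)) ?C (\<lambda>\<omega>. \<omega> j)"
      using X j by (subst distr_distr) (auto simp: comp_def intro!: measurable_restrict distr_cong)
    also have "\<dots> = distr (PiM J ?\<pi>) (?\<pi> j) (\<lambda>\<omega>. \<omega> j)"
      unfolding joint by (intro distr_cong) auto
    also have "\<dots> = ?\<pi> j" using j by (intro distr_PiM_component prob_space_measure_pmf)
    finally show ?thesis .
  qed
  show "P.indep_vars (\<lambda>_. ?C) ?X J"
    using ne X by (subst P.indep_vars_iff_distr_eq_PiM') (auto simp: joint marg cong: PiM_cong)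
  show "j \<in> J \<Longrightarrow> distr ?P ?C (?X j) = ?\<pi> j" by (rule marg)
qed

lemma poisson_random_measure_poisson_points:
  assumes fin: "finite_measure \<Lambda>" and UN: "space \<Lambda> = UNIV"
  shows "poisson_random_measure (poisson_points \<Lambda>) \<Lambda> num_points"
  unfolding poisson_random_measure_def
proof (intro conjI ballI allI impI)
  show P: "prob_space (poisson_points \<Lambda>)"
    using fin UN by (intro prob_space_poisson_points) auto
  interpret prob_space "poisson_points \<Lambda>" by fact
  show "(\<lambda>c. num_points c A) \<in> measurable (poisson_points \<Lambda>) (count_space UNIV)"
    if "A \<in> sets \<Lambda>" for A
    using measurable_num_points[OF that]
    by (simp add: measurable_cong_sets[OF sets_poisson_points refl])
  then have meas: "{c \<in> space (poisson_points \<Lambda>). num_points c A = k} \<in> sets (poisson_points \<Lambda>)"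
    if "A \<in> sets \<Lambda>" for A k using that by measurable
  show "measure (poisson_points \<Lambda>) {c \<in> space (poisson_points \<Lambda>). num_points c A = k}
      = measure \<Lambda> A ^ k / fact k * exp (- measure \<Lambda> A)" if A: "A \<in> sets \<Lambda>" for A k
  proof -
    let ?A = "\<lambda>b. if b then A else space \<Lambda> - A"
    have "distr (poisson_points \<Lambda>) (count_space UNIV) (\<lambda>c. num_points c (?A True))
        = measure_pmf (poisson_or_zero (measure \<Lambda> (?A True)))"
      using A UN sets.compl_sets[OF A]
      by (intro poisson_points_partition(2)[OF fin UN, where J = UNIV and A = ?A and j = True])
        (auto simp: disjoint_family_on_def UNIV_bool split: if_splits)
    then have "measure (distr (poisson_points \<Lambda>) (count_space UNIV) (\<lambda>c. num_points c A)) {k}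
        = pmf (poisson_or_zero (measure \<Lambda> A)) k"
      by (simp add: measure_pmf_single)
    moreover have "(\<lambda>c. num_points c A) -` {k} \<inter> space (poisson_points \<Lambda>)
        = {c \<in> space (poisson_points \<Lambda>). num_points c A = k}" by auto
    ultimately show ?thesis
      using measurable_num_points[OF A]
      by (simp add: measure_distr pmf_poisson_or_zero measurable_cong_sets[OF sets_poisson_points refl])
  qed
  fix J :: "nat set" and A :: "nat \<Rightarrow> _"
  assume J: "finite J" "A ` J \<subseteq> sets \<Lambda>" "disjoint_family_on A J"
  obtain m where m: "m \<notin> J" using J(1) ex_new_if_finite[OF infinite_UNIV_nat] by blast
  define B where "B = A(m := space \<Lambda> - (\<Union>j\<in>J. A j))"
  have B: "B j = A j" if "j \<in> J" for j using m that by (auto simp: B_def)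
  have "indep_vars (\<lambda>_. count_space UNIV) (\<lambda>j c. num_points c (B j)) (insert m J)"
  proof (rule poisson_points_partition(1)[OF fin UN])
    show "B j \<in> sets \<Lambda>" if "j \<in> insert m J" for j
      using that J by (auto simp: B_def)
    show "disjoint_family_on B (insert m J)"
      using J(3) m by (auto simp: B_def disjoint_family_on_def)
    show "(\<Union>j\<in>insert m J. B j) = space \<Lambda>"
      using m UN by (auto simp: B_def split: if_splits)
  qed (use J in auto)
  then have "indep_vars (\<lambda>_. count_space UNIV) (\<lambda>j c. num_points c (B j)) J"
    by (rule indep_vars_subset) auto
  then show "indep_vars (\<lambda>_. count_space UNIV) (\<lambda>j c. num_points c (A j)) J"
    by (subst indep_vars_cong[where Y = "\<lambda>j c. num_points c (B j)"]) (auto simp: B)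
qed


section \<open>Multitype Galton--Watson trees\<close>

definition up_to_height :: "nat \<Rightarrow> 'l ltree \<Rightarrow> 'l ltree" where
  "up_to_height n t = t |` {u. length u \<le> n}"

text \<open>
  \<open>S\<close> is the type space and \<open>K l\<close> the law of the children of a vertex of type \<open>l\<close>.
  Given a tree of height at most \<open>n\<close>, every vertex of height \<open>n\<close> independently
  receives children; the absent addresses are given no children.
\<close>

definition next_generation ::
    "'l measure \<Rightarrow> ('l \<Rightarrow> (nat \<times> (nat \<Rightarrow> 'l)) measure) \<Rightarrow> nat \<Rightarrow> 'l ltree \<Rightarrow> 'l ltree measure" where
  "next_generation S K n t =
     distr (PiM UNIV (\<lambda>u. case t u of None \<Rightarrow> return (config_space S) no_points | Some l \<Rightarrow> K l))
       (tree_space S)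
       (\<lambda>c u. if length u = Suc n
              then if last u < fst (c (butlast u)) then Some (snd (c (butlast u)) (last u)) else None
              else t u)"

text \<open>\<open>M\<close> is the law of the Galton--Watson tree whose root has a type with law \<open>\<mu>\<close>.\<close>

definition galton_watson ::
    "'l measure \<Rightarrow> 'l measure \<Rightarrow> ('l \<Rightarrow> (nat \<times> (nat \<Rightarrow> 'l)) measure) \<Rightarrow> 'l ltree measure \<Rightarrow> bool" where
  "galton_watson S \<mu> K M \<longleftrightarrow>
     prob_space M \<and> sets M = sets (tree_space S) \<and>
     distr M (tree_space S) (up_to_height 0) = distr \<mu> (tree_space S) (\<lambda>l. [[] \<mapsto> l]) \<and>
     (\<forall>n. distr M (tree_space S) (up_to_height (Suc n)) =
            distr M (tree_space S) (up_to_height n) \<bind> next_generation S K n)"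


section \<open>The two trees\<close>

definition sech :: "real \<Rightarrow> real" where
  "sech z = 1 / cosh z"

definition child_intensity :: "real \<Rightarrow> real \<Rightarrow> real measure" where
  "child_intensity x b = density lborel
     (\<lambda>a. ennreal (indicator {0..} a * (min b a * (1 / 2) * (sech ((a + x) / 2))\<^sup>2)))"

lemma borel_measurable_sech [measurable]: "sech \<in> borel_measurable borel"
proof -
  have "cosh z \<noteq> 0" for z :: real using cosh_real_pos[of z] by linarith
  then show ?thesis
    unfolding sech_def by (intro borel_measurable_continuous_onI continuous_intros) auto
qed

lemma finite_measure_child_intensity: "finite_measure (child_intensity x b)"
proof (rule finite_measureI)
  define g where "g a = \<bar>b\<bar> * (1 / 2) * (sech ((a + x) / 2))\<^sup>2" for a
  have sech2: "(sech z)\<^sup>2 = 1 - (tanh z)\<^sup>2" for z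
  proof -
    have "1 + (sinh z)\<^sup>2 \<noteq> 0" by (smt (verit) zero_le_power2)
    then show ?thesis
      using cosh_square_eq[of z] by (simp add: sech_def tanh_def power_divide add.commute divide_simps)
  qed
  have [measurable]: "g \<in> borel_measurable borel"
    unfolding g_def by measurable
  have "emeasure (child_intensity x b) (space (child_intensity x b)) =
      (\<integral>\<^sup>+a. ennreal (indicator {0..} a * (min b a * (1 / 2) * (sech ((a + x) / 2))\<^sup>2)) \<partial>lborel)"
    unfolding child_intensity_def by (subst emeasure_density) auto
  also have "\<dots> \<le> (\<integral>\<^sup>+a. ennreal (g a) * indicator {0..} a \<partial>lborel)"
    by (intro nn_integral_mono) (auto simp: g_def indicator_def intro!: ennreal_leI mult_right_mono)
  also have "\<dots> = ennreal (\<bar>b\<bar> - \<bar>b\<bar> * tanh ((0 + x) / 2))"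
  proof (rule nn_integral_FTC_atLeast)
    show "((\<lambda>a. \<bar>b\<bar> * tanh ((a + x) / 2)) has_real_derivative g a) (at a)" for a
      by (auto intro!: derivative_eq_intros simp: g_def sech2)
    have "filterlim (\<lambda>a. (a + x) / 2) at_top at_top" by real_asymp
    then have "((\<lambda>a. \<bar>b\<bar> * tanh ((a + x) / 2)) \<longlongrightarrow> \<bar>b\<bar> * 1) at_top"
      by (intro tendsto_intros filterlim_compose[OF tanh_real_at_top])
    then show "((\<lambda>a. \<bar>b\<bar> * tanh ((a + x) / 2)) \<longlongrightarrow> \<bar>b\<bar>) at_top" by simp
  qed (auto simp: g_def)
  finally show "emeasure (child_intensity x b) (space (child_intensity x b)) \<noteq> \<infinity>"
    by (auto simp: top_unique)
qed

lemma poisson_random_measure_children: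
  "poisson_random_measure (poisson_points (child_intensity x b)) (child_intensity x b) num_points"
  by (intro poisson_random_measure_poisson_points finite_measure_child_intensity)
    (simp add: child_intensity_def)

definition H_root_age :: "real \<Rightarrow> real measure" where
  "H_root_age x = interval_measure
     (\<lambda>y. if y < 0 then 0 else 1 - (1 - tanh ((x + y) / 2)) / (1 - tanh (x / 2)))"

definition H_law :: "real \<Rightarrow> real ltree measure \<Rightarrow> bool" where
  "H_law x M \<longleftrightarrow>
     galton_watson borel (H_root_age x) (\<lambda>b. poisson_points (child_intensity x b)) M"

text \<open>
  In the second tree a label \<open>(b, s)\<close> consists of the age \<open>b\<close> and the flag \<open>s\<close>
  telling whether the vertex is spinal.
\<close>

definition Hhat_root_age :: "real \<Rightarrow> real measure" where
  "Hhat_root_age x = interval_measure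
     (\<lambda>y. if y < 0 then 0 else 1 - (cosh (x / 2))\<^sup>2 / (cosh ((x + y) / 2))\<^sup>2)"

text \<open>
  At \<open>b = 0\<close> the probability of having no spinal child is \<open>1\<close> and the age density is
  undefined; negative ages do not occur.
\<close>

definition spinal_child :: "real \<Rightarrow> real \<Rightarrow> real option measure" where
  "spinal_child x b =
     (if b \<le> 0 then return (option_space borel) None
      else measure_pmf (bernoulli_pmf (tanh (x / 2) / tanh ((b + x) / 2))) \<bind>
        (\<lambda>none. if none then return (option_space borel) None
          else distr
            (density lborel (\<lambda>a. ennreal (indicator {0..} a *
               (min b a * (sech ((a + x) / 2))\<^sup>2 * tanh ((a + x) / 2) /
                (2 * (tanh ((b + x) / 2) - tanh (x / 2)))))))
            (option_space borel) Some))"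

text \<open>
  The spinal child, if any, is inserted at position \<open>j\<close> among its siblings. Below,
  \<open>j\<close> is uniform, so that the order of all siblings is exchangeable.
\<close>

definition insert_spinal ::
    "nat \<Rightarrow> real option \<Rightarrow> nat \<times> (nat \<Rightarrow> real) \<Rightarrow> nat \<times> (nat \<Rightarrow> real \<times> bool)" where
  "insert_spinal j z c = (case c of (N, X) \<Rightarrow>
     case z of None \<Rightarrow> (N, \<lambda>i. (X i, False))
     | Some a \<Rightarrow> (Suc N, \<lambda>i. if i < j then (X i, False)
                           else if i = j then (a, True)
                           else (X (i - 1), False)))"

abbreviation age_spine_space :: "(real \<times> bool) measure" where
  "age_spine_space \<equiv> borel \<Otimes>\<^sub>M count_space UNIV"

definition Hhat_children :: "real \<Rightarrow> real \<times> bool \<Rightarrow> (nat \<times> (nat \<Rightarrow> real \<times> bool)) measure" where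
  "Hhat_children x l = (case l of (b, s) \<Rightarrow>
     poisson_points (child_intensity x b) \<bind> (\<lambda>c.
       (if s then spinal_child x b else return (option_space borel) None) \<bind> (\<lambda>z.
         measure_pmf (pmf_of_set {..fst c}) \<bind> (\<lambda>j.
           return (config_space age_spine_space) (insert_spinal j z c)))))"

definition Hhat_law :: "real \<Rightarrow> (real \<times> bool) ltree measure \<Rightarrow> bool" where
  "Hhat_law x M \<longleftrightarrow>
     galton_watson age_spine_space
       (distr (Hhat_root_age x) age_spine_space (\<lambda>b. (b, True))) (Hhat_children x) M"

definition forget_spine :: "(real \<times> bool) ltree \<Rightarrow> real ltree" where
  "forget_spine t = map_option fst \<circ> t"

text \<open>The spinal vertices, listed away from the root.\<close>

definition spine :: "(real \<times> bool) ltree \<Rightarrow> nat list list" where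
  "spine t = (THE p. set p = {u. \<exists>b. t u = Some (b, True)} \<and>
                     sorted_wrt (\<lambda>u v. length u < length v) p)"


section \<open>Tilting and conditioning\<close>

definition tilted :: "('a \<Rightarrow> ennreal) \<Rightarrow> 'a measure \<Rightarrow> 'a measure" where
  "tilted f M = density M (\<lambda>\<omega>. f \<omega> / (\<integral>\<^sup>+\<omega>'. f \<omega>' \<partial>M))"

definition root_age :: "real ltree \<Rightarrow> real" where
  "root_age t = the (t [])"

definition regular_conditional_law ::
    "'a measure \<Rightarrow> ('a \<Rightarrow> real) \<Rightarrow> (real \<Rightarrow> 'a measure) \<Rightarrow> bool" where
  "regular_conditional_law M X \<kappa> \<longleftrightarrow>
     \<kappa> \<in> measurable borel (prob_algebra M) \<and>
     (\<forall>A\<in>sets M. \<forall>B\<in>sets borel.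
        emeasure M {\<omega>\<in>A. X \<omega> \<in> B} = (\<integral>\<^sup>+b\<in>B. emeasure (\<kappa> b) A \<partial>distr M borel X))"

text \<open>The sigma-algebra generated by the isomorphism class of the tree without its spine.\<close>

definition iso_class_algebra ::
    "(real ltree \<Rightarrow> real ltree \<Rightarrow> (nat list \<Rightarrow> nat list) \<Rightarrow> bool) \<Rightarrow> (real \<times> bool) ltree measure" where
  "iso_class_algebra R = sigma UNIV ((\<lambda>A. forget_spine -` A) ` iso_events R)"

end

theory Submission
  imports Defs "HOL-Library.Sublist"
begin

text \<open>
  Write \<open>t = tanh (x / 2)\<close>. In the tree \<open>H\<close> a vertex of age \<open>b\<close> has, on average,
  \<open>m b = tanh ((b + x) / 2) / t\<close> vertices in the subtree above it: the function \<open>m\<close> solves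
  \<open>m b = 1 + \<integral> m a \<lambda>\<^sub>b(da)\<close>. Let \<open>E\<close> be the mean of \<open>m\<close> under the law of the root age, so that
  \<open>E\<close> is the mean total progeny of \<open>H\<close>. The hatted tree is the transform of \<open>H\<close> by \<open>m\<close>: its
  root law has density \<open>m / E\<close> with respect to that of \<open>H\<close>, and at a spinal vertex of age \<open>b\<close>
  the spine stops with probability \<open>1 / m b\<close> and otherwise moves to a child of age \<open>a\<close> with weight
  \<open>m a \<lambda>\<^sub>b(da) / m b\<close>. By the Mecke formula, the extra spinal child among the Poisson children has
  the same effect as a sum over the ordinary children (\<open>nn_integral_Hhat_children_True\<close>).
  Multiplying these factors from generation to generation, all values of \<open>m\<close> cancel except at the
  current end of the spine, which in the limit disappears as well: this gives
  \<open>spine_identity\<close>, by which the hatted tree with its spine is distributed as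
  \<open>H\<close> with the path to a vertex \<open>v\<close>, summed over all vertices \<open>v\<close> and divided by \<open>E\<close>.

  Everything about the rooted tree follows. Summing over \<open>v\<close> gives the law tilted by the total
  progeny (\<open>distr_forget_spine\<close>), this law disintegrates along the root age
  (\<open>conditional_distr_forget_spine\<close>), and the end of the spine is uniform given the tree
  (\<open>cond_exp_spine_rooted\<close>).

  For the unrooted tree, the root itself has to be exchangeable with a uniform vertex. This is
  unimodularity of the law of \<open>H\<close> in the form of the mass transport principle (\<open>mass_transport\<close>).
  It holds because \<open>(b \<and> a)\<close> is symmetric and the remaining factor
  \<open>sech\<^sup>2 ((a + x) / 2) / 2\<close> of the child intensity is proportional to the density of the root age:
  deleting an edge between the root and one of its children leaves two independent copies of
  \<open>H\<close>, weighted by a symmetric function of their root ages (\<open>edge_identity\<close>), and reattaching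
  them the other way round moves the root to the other end of the edge. A path of length \<open>n\<close> is
  crossed one edge at a time. Combined with \<open>spine_identity\<close>, this makes the two ends of the spine
  independent and uniform given the unrooted tree (\<open>cond_exp_spine_unrooted\<close>).

  The trees are built generation by generation, and so are the identities: each one is proved for
  the trees cut off at a finite height and then extended by \<open>measure_eqI_up_to_height\<close>.
\<close>

section \<open>Infinite products\<close>

text \<open>
  Independence of infinitely many random elements is a statement about finitely many of them at a
  time.
\<close>

lemma distr_eq_PiM:
  fixes Y :: "'i \<Rightarrow> 'w \<Rightarrow> 'a"
  assumes P: "prob_space P" and M: "\<And>i. prob_space (M i)"
    and Y: "\<And>i. Y i \<in> P \<rightarrow>\<^sub>M M i"
    and cyl: "\<And>J A. finite J \<Longrightarrow> (\<And>i. i \<in> J \<Longrightarrow> A i \<in> sets (M i)) \<Longrightarrow>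
      emeasure P {\<omega> \<in> space P. \<forall>i\<in>J. Y i \<omega> \<in> A i} = (\<Prod>i\<in>J. emeasure (M i) (A i))"
  shows "distr P (PiM UNIV M) (\<lambda>\<omega> i. Y i \<omega>) = PiM UNIV M"
proof -
  interpret product_prob_space M UNIV using M by (intro product_prob_spaceI)
  have meas: "(\<lambda>\<omega> i. Y i \<omega>) \<in> P \<rightarrow>\<^sub>M PiM UNIV M"
    by (intro measurable_PiM_single') (use Y measurable_space[OF Y] in auto)
  show ?thesis
  proof (rule PiM_eq)
    fix J A assume J: "finite J" "J \<subseteq> UNIV" and A: "\<And>j. j \<in> J \<Longrightarrow> A j \<in> sets (M j)"
    have "(\<lambda>\<omega> i. Y i \<omega>) -` prod_emb UNIV M J (Pi\<^sub>E J A) \<inter> space P = {\<omega> \<in> space P. \<forall>i\<in>J. Y i \<omega> \<in> A i}"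
      using measurable_space[OF Y] by (auto simp: prod_emb_def space_PiM PiE_iff)
    then show "emeasure (distr P (PiM UNIV M) (\<lambda>\<omega> i. Y i \<omega>)) (prod_emb UNIV M J (Pi\<^sub>E J A))
        = (\<Prod>j\<in>J. emeasure (M j) (A j))"
      using J A by (simp add: emeasure_distr[OF meas] sets_PiM_I cyl)
  qed simp
qed

lemma emeasure_PiM_cylinder:
  assumes L: "\<And>i. prob_space (L i)" and J: "finite J" and g: "inj_on g J"
    and A: "\<And>j. j \<in> J \<Longrightarrow> A j \<in> sets (L (g j))"
  shows "emeasure (PiM UNIV L) {\<omega> \<in> space (PiM UNIV L). \<forall>j\<in>J. \<omega> (g j) \<in> A j}
    = (\<Prod>j\<in>J. emeasure (L (g j)) (A j))"
proof -
  interpret product_prob_space L UNIV using L by (intro product_prob_spaceI)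
  have inv: "the_inv_into J g (g j) = j" if "j \<in> J" for j
    using g that by (rule the_inv_into_f_f)
  have "{\<omega> \<in> space (PiM UNIV L). \<forall>j\<in>J. \<omega> (g j) \<in> A j}
      = {\<omega> \<in> space (PiM UNIV L). \<forall>k\<in>g`J. \<omega> k \<in> A (the_inv_into J g k)}"
    by (auto simp: inv)
  also have "emeasure (PiM UNIV L) \<dots> = (\<Prod>k\<in>g`J. emeasure (L k) (A (the_inv_into J g k)))"
    using J A by (intro emeasure_PiM_Collect) (auto simp: inv)
  also have "\<dots> = (\<Prod>j\<in>J. emeasure (L (g j)) (A j))"
    using g by (subst prod.reindex) (auto simp: inv)
  finally show ?thesis .
qed

text \<open>
  An independent family stays one if its coordinates are read off from two independent families,
  provided that no coordinate is read twice. Two families appear because an edge splits the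
  addresses of a tree into the descendants of a child and the other vertices.
\<close>

lemma PiM_merge:
  assumes M: "\<And>i. prob_space (M i)" and L1: "\<And>i. prob_space (L1 i)" and L0: "\<And>i. prob_space (L0 i)"
    and g1: "inj_on g1 D" "\<And>i. i \<in> D \<Longrightarrow> L1 (g1 i) = M i"
    and g0: "inj_on g0 (- D)" "\<And>i. i \<notin> D \<Longrightarrow> L0 (g0 i) = M i"
  shows "distr (PiM UNIV L1 \<Otimes>\<^sub>M PiM UNIV L0) (PiM UNIV M)
      (\<lambda>\<omega> i. if i \<in> D then fst \<omega> (g1 i) else snd \<omega> (g0 i)) = PiM UNIV M"
proof (rule distr_eq_PiM)
  interpret P1: prob_space "PiM UNIV L1" by (intro prob_space_PiM L1)
  interpret P0: prob_space "PiM UNIV L0" by (intro prob_space_PiM L0)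
  show "prob_space (PiM UNIV L1 \<Otimes>\<^sub>M PiM UNIV L0)"
    by (intro prob_space_pair) unfold_locales
  show "(\<lambda>\<omega>. if i \<in> D then fst \<omega> (g1 i) else snd \<omega> (g0 i)) \<in>
      PiM UNIV L1 \<Otimes>\<^sub>M PiM UNIV L0 \<rightarrow>\<^sub>M M i" for i
  proof (cases "i \<in> D")
    case True
    have "(\<lambda>\<omega>. fst \<omega> (g1 i)) \<in> PiM UNIV L1 \<Otimes>\<^sub>M PiM UNIV L0 \<rightarrow>\<^sub>M L1 (g1 i)"
      by measurable
    then show ?thesis using True g1(2) by simp
  next
    case False
    have "(\<lambda>\<omega>. snd \<omega> (g0 i)) \<in> PiM UNIV L1 \<Otimes>\<^sub>M PiM UNIV L0 \<rightarrow>\<^sub>M L0 (g0 i)"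
      by measurable
    then show ?thesis using False g0(2) by simp
  qed
  fix J :: "_ set" and A assume J: "finite J" and A: "\<And>i. i \<in> J \<Longrightarrow> A i \<in> sets (M i)"
  let ?C1 = "{\<omega> \<in> space (PiM UNIV L1). \<forall>i\<in>J \<inter> D. \<omega> (g1 i) \<in> A i}"
  let ?C0 = "{\<omega> \<in> space (PiM UNIV L0). \<forall>i\<in>J - D. \<omega> (g0 i) \<in> A i}"
  have e1: "emeasure (PiM UNIV L1) ?C1 = (\<Prod>i\<in>J \<inter> D. emeasure (L1 (g1 i)) (A i))"
    using J A g1 by (intro emeasure_PiM_cylinder L1) (auto intro: inj_on_subset)
  have e0: "emeasure (PiM UNIV L0) ?C0 = (\<Prod>i\<in>J - D. emeasure (L0 (g0 i)) (A i))"
    using J A g0 by (intro emeasure_PiM_cylinder L0) (auto intro: inj_on_subset)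
  have m1: "{\<omega> \<in> space (PiM UNIV L1). \<omega> (g1 i) \<in> A i} \<in> sets (PiM UNIV L1)" if "i \<in> J \<inter> D" for i
    using that A[of i] g1(2)[of i] measurable_sets[OF measurable_component_singleton[of "g1 i" UNIV L1], of "A i"]
    by (simp add: vimage_def Int_def conj_commute)
  have m0: "{\<omega> \<in> space (PiM UNIV L0). \<omega> (g0 i) \<in> A i} \<in> sets (PiM UNIV L0)" if "i \<in> J - D" for i
    using that A[of i] g0(2)[of i] measurable_sets[OF measurable_component_singleton[of "g0 i" UNIV L0], of "A i"]
    by (simp add: vimage_def Int_def conj_commute)
  have s1: "?C1 \<in> sets (PiM UNIV L1)"
    using J m1 by (intro sets.sets_Collect_finite_All) auto
  have s0: "?C0 \<in> sets (PiM UNIV L0)"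
    using J m0 by (intro sets.sets_Collect_finite_All) auto
  have "{\<omega> \<in> space (PiM UNIV L1 \<Otimes>\<^sub>M PiM UNIV L0).
      \<forall>i\<in>J. (if i \<in> D then fst \<omega> (g1 i) else snd \<omega> (g0 i)) \<in> A i} = ?C1 \<times> ?C0"
    by (auto simp: space_pair_measure)
  also have "emeasure (PiM UNIV L1 \<Otimes>\<^sub>M PiM UNIV L0) \<dots>
      = (\<Prod>i\<in>J \<inter> D. emeasure (M i) (A i)) * (\<Prod>i\<in>J - D. emeasure (M i) (A i))"
    using s1 s0 by (simp add: P0.emeasure_pair_measure_Times e1 e0 g1 g0)
  also have "\<dots> = (\<Prod>i\<in>J. emeasure (M i) (A i))"
    using J by (subst prod.Int_Diff[OF J, of _ D]) auto
  finally show "emeasure (PiM UNIV L1 \<Otimes>\<^sub>M PiM UNIV L0) {\<omega> \<in> space (PiM UNIV L1 \<Otimes>\<^sub>M PiM UNIV L0).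
      \<forall>i\<in>J. (if i \<in> D then fst \<omega> (g1 i) else snd \<omega> (g0 i)) \<in> A i} = (\<Prod>i\<in>J. emeasure (M i) (A i))" .
qed (rule M)

lemma nn_integral_PiM_merge:
  assumes M: "\<And>i. prob_space (M i)" and L1: "\<And>i. prob_space (L1 i)" and L0: "\<And>i. prob_space (L0 i)"
    and g1: "inj_on g1 D" "\<And>i. i \<in> D \<Longrightarrow> L1 (g1 i) = M i"
    and g0: "inj_on g0 (- D)" "\<And>i. i \<notin> D \<Longrightarrow> L0 (g0 i) = M i"
    and \<Phi>: "\<Phi> \<in> borel_measurable (PiM UNIV M)"
  shows "(\<integral>\<^sup>+\<omega>. \<Phi> \<omega> \<partial>PiM UNIV M) =
    (\<integral>\<^sup>+\<omega>1. (\<integral>\<^sup>+\<omega>0. \<Phi> (\<lambda>i. if i \<in> D then \<omega>1 (g1 i) else \<omega>0 (g0 i)) \<partial>PiM UNIV L0) \<partial>PiM UNIV L1)"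
    and "(\<integral>\<^sup>+\<omega>. \<Phi> \<omega> \<partial>PiM UNIV M) =
    (\<integral>\<^sup>+\<omega>0. (\<integral>\<^sup>+\<omega>1. \<Phi> (\<lambda>i. if i \<in> D then \<omega>1 (g1 i) else \<omega>0 (g0 i)) \<partial>PiM UNIV L1) \<partial>PiM UNIV L0)"
proof -
  interpret P1: prob_space "PiM UNIV L1" by (intro prob_space_PiM L1)
  interpret P0: prob_space "PiM UNIV L0" by (intro prob_space_PiM L0)
  interpret pair_prob_space "PiM UNIV L1" "PiM UNIV L0" ..
  let ?m = "\<lambda>\<omega> i. if i \<in> D then fst \<omega> (g1 i) else snd \<omega> (g0 i)"
  have c1: "(\<lambda>\<omega>. fst \<omega> (g1 i)) \<in> PiM UNIV L1 \<Otimes>\<^sub>M PiM UNIV L0 \<rightarrow>\<^sub>M L1 (g1 i)" for i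
    by measurable
  have c0: "(\<lambda>\<omega>. snd \<omega> (g0 i)) \<in> PiM UNIV L1 \<Otimes>\<^sub>M PiM UNIV L0 \<rightarrow>\<^sub>M L0 (g0 i)" for i
    by measurable
  have comp: "(\<lambda>\<omega>. ?m \<omega> i) \<in> PiM UNIV L1 \<Otimes>\<^sub>M PiM UNIV L0 \<rightarrow>\<^sub>M M i" for i
    using c1[of i] c0[of i] g1(2)[of i] g0(2)[of i] by (cases "i \<in> D") simp_all
  have m: "?m \<in> PiM UNIV L1 \<Otimes>\<^sub>M PiM UNIV L0 \<rightarrow>\<^sub>M PiM UNIV M"
    by (intro measurable_PiM_single' comp) (use measurable_space[OF comp] in auto)
  have \<Phi>m: "(\<lambda>\<omega>. \<Phi> (?m \<omega>)) \<in> borel_measurable (PiM UNIV L1 \<Otimes>\<^sub>M PiM UNIV L0)"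
    by (rule measurable_compose[OF m \<Phi>])
  have "(\<integral>\<^sup>+\<omega>. \<Phi> \<omega> \<partial>PiM UNIV M) = (\<integral>\<^sup>+\<omega>. \<Phi> (?m \<omega>) \<partial>(PiM UNIV L1 \<Otimes>\<^sub>M PiM UNIV L0))"
    by (subst PiM_merge[where M = M and D = D, OF M L1 L0 g1 g0, symmetric]) (simp_all add: nn_integral_distr m \<Phi>)
  also have "\<dots> = (\<integral>\<^sup>+\<omega>1. (\<integral>\<^sup>+\<omega>0. \<Phi> (\<lambda>i. if i \<in> D then \<omega>1 (g1 i) else \<omega>0 (g0 i)) \<partial>PiM UNIV L0) \<partial>PiM UNIV L1)"
    by (subst P0.nn_integral_fst[symmetric, OF \<Phi>m]) (simp cong del: if_weak_cong)
  finally show "(\<integral>\<^sup>+\<omega>. \<Phi> \<omega> \<partial>PiM UNIV M) =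
    (\<integral>\<^sup>+\<omega>1. (\<integral>\<^sup>+\<omega>0. \<Phi> (\<lambda>i. if i \<in> D then \<omega>1 (g1 i) else \<omega>0 (g0 i)) \<partial>PiM UNIV L0) \<partial>PiM UNIV L1)" .
  also have "\<dots> = (\<integral>\<^sup>+\<omega>0. (\<integral>\<^sup>+\<omega>1. \<Phi> (\<lambda>i. if i \<in> D then \<omega>1 (g1 i) else \<omega>0 (g0 i)) \<partial>PiM UNIV L1) \<partial>PiM UNIV L0)"
    using Fubini'[where f = "\<lambda>a b. \<Phi> (?m (a, b))"] \<Phi>m by (simp add: split_beta cong del: if_weak_cong)
  finally show "(\<integral>\<^sup>+\<omega>. \<Phi> \<omega> \<partial>PiM UNIV M) =
    (\<integral>\<^sup>+\<omega>0. (\<integral>\<^sup>+\<omega>1. \<Phi> (\<lambda>i. if i \<in> D then \<omega>1 (g1 i) else \<omega>0 (g0 i)) \<partial>PiM UNIV L1) \<partial>PiM UNIV L0)" .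
qed

text \<open>
  Resampling one coordinate. The map \<open>g\<close> allows the other coordinates to be renumbered, which is
  needed when a point is removed from a sequence.
\<close>

lemma nn_integral_PiM_coordinate:
  assumes M: "\<And>i. prob_space (M i)" and L: "\<And>i. prob_space (L i)"
    and g: "inj_on g (- {v})" "\<And>i. i \<noteq> v \<Longrightarrow> L (g i) = M i"
    and \<Phi>: "\<Phi> \<in> borel_measurable (PiM UNIV M)"
  shows "(\<integral>\<^sup>+\<omega>. \<Phi> \<omega> \<partial>PiM UNIV M) = (\<integral>\<^sup>+\<omega>. (\<integral>\<^sup>+c. \<Phi> (\<lambda>i. if i = v then c else \<omega> (g i)) \<partial>M v) \<partial>PiM UNIV L)"
    and "(\<integral>\<^sup>+\<omega>. \<Phi> \<omega> \<partial>PiM UNIV M) = (\<integral>\<^sup>+c. (\<integral>\<^sup>+\<omega>. \<Phi> (\<lambda>i. if i = v then c else \<omega> (g i)) \<partial>PiM UNIV L) \<partial>M v)"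
proof -
  interpret PL: prob_space "PiM UNIV L" by (intro prob_space_PiM L)
  have ins: "(\<lambda>\<omega> i. if i = v then fst \<omega> else snd \<omega> (g i)) \<in> M v \<Otimes>\<^sub>M PiM UNIV L \<rightarrow>\<^sub>M PiM UNIV M"
  proof -
    have c0: "(\<lambda>\<omega>. snd \<omega> (g i)) \<in> M v \<Otimes>\<^sub>M PiM UNIV L \<rightarrow>\<^sub>M L (g i)" for i by measurable
    have "(\<lambda>\<omega>. if i = v then fst \<omega> else snd \<omega> (g i)) \<in> M v \<Otimes>\<^sub>M PiM UNIV L \<rightarrow>\<^sub>M M i" for i
      using c0[of i] g(2)[of i] by (cases "i = v") simp_all
    from this measurable_space[OF this] show ?thesis by (intro measurable_PiM_single') auto
  qed
  note \<Phi>' = measurable_compose[OF ins \<Phi>]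
  have pair: "(\<lambda>(\<omega>, c). \<Phi> (\<lambda>i. if i = v then c else \<omega> (g i))) \<in> borel_measurable (PiM UNIV L \<Otimes>\<^sub>M M v)"
    using measurable_compose[OF measurable_pair_swap' \<Phi>'] by (simp add: split_beta cong del: if_weak_cong)
  interpret Mv: prob_space "M v" by (rule M)
  have comp: "distr (PiM UNIV M) (M v) (\<lambda>\<omega>. \<omega> v) = M v"
    by (intro distr_PiM_component M) auto
  have sect: "(\<lambda>c. \<Phi> (\<lambda>i. if i = v then c else \<omega> (g i))) \<in> borel_measurable (M v)"
    if "\<omega> \<in> space (PiM UNIV L)" for \<omega>
    using measurable_Pair2[OF pair that] by simp
  have "(\<integral>\<^sup>+\<omega>. \<Phi> \<omega> \<partial>PiM UNIV M) =
    (\<integral>\<^sup>+\<omega>. (\<integral>\<^sup>+\<omega>1. \<Phi> (\<lambda>i. if i = v then \<omega>1 i else \<omega> (g i)) \<partial>PiM UNIV M) \<partial>PiM UNIV L)"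
    using nn_integral_PiM_merge(2)[of M M L "\<lambda>i. i" "{v}" g \<Phi>] M L g \<Phi> by simp
  also have "\<dots> = (\<integral>\<^sup>+\<omega>. (\<integral>\<^sup>+c. \<Phi> (\<lambda>i. if i = v then c else \<omega> (g i)) \<partial>M v) \<partial>PiM UNIV L)"
  proof (intro nn_integral_cong)
    fix \<omega> assume \<omega>: "\<omega> \<in> space (PiM UNIV L)"
    have "(\<integral>\<^sup>+c. \<Phi> (\<lambda>i. if i = v then c else \<omega> (g i)) \<partial>M v)
      = (\<integral>\<^sup>+c. \<Phi> (\<lambda>i. if i = v then c else \<omega> (g i)) \<partial>distr (PiM UNIV M) (M v) (\<lambda>\<omega>. \<omega> v))"
      by (simp only: comp)
    also have "\<dots> = (\<integral>\<^sup>+\<omega>1. \<Phi> (\<lambda>i. if i = v then \<omega>1 v else \<omega> (g i)) \<partial>PiM UNIV M)"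
      using sect[OF \<omega>] by (simp add: nn_integral_distr)
    also have "(\<lambda>\<omega>1. \<Phi> (\<lambda>i. if i = v then \<omega>1 v else \<omega> (g i))) = (\<lambda>\<omega>1. \<Phi> (\<lambda>i. if i = v then \<omega>1 i else \<omega> (g i)))"
      by (intro ext arg_cong[where f = \<Phi>]) auto
    finally show "(\<integral>\<^sup>+\<omega>1. \<Phi> (\<lambda>i. if i = v then \<omega>1 i else \<omega> (g i)) \<partial>PiM UNIV M) =
        (\<integral>\<^sup>+c. \<Phi> (\<lambda>i. if i = v then c else \<omega> (g i)) \<partial>M v)" by simp
  qed
  finally show A: "(\<integral>\<^sup>+\<omega>. \<Phi> \<omega> \<partial>PiM UNIV M) = (\<integral>\<^sup>+\<omega>. (\<integral>\<^sup>+c. \<Phi> (\<lambda>i. if i = v then c else \<omega> (g i)) \<partial>M v) \<partial>PiM UNIV L)" .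
  interpret pair_prob_space "PiM UNIV L" "M v" ..
  show "(\<integral>\<^sup>+\<omega>. \<Phi> \<omega> \<partial>PiM UNIV M) = (\<integral>\<^sup>+c. (\<integral>\<^sup>+\<omega>. \<Phi> (\<lambda>i. if i = v then c else \<omega> (g i)) \<partial>PiM UNIV L) \<partial>M v)"
    unfolding A using Fubini'[OF pair] by simp
qed

lemma PiM_distr:
  assumes K: "\<And>i. prob_space (K i)" and \<phi>: "\<And>i. \<phi> i \<in> K i \<rightarrow>\<^sub>M S i"
  shows "PiM UNIV (\<lambda>i. distr (K i) (S i) (\<phi> i)) = distr (PiM UNIV K) (PiM UNIV S) (\<lambda>\<omega> i. \<phi> i (\<omega> i))"
proof -
  have \<phi>': "(\<lambda>\<omega>. \<phi> i (\<omega> i)) \<in> PiM UNIV K \<rightarrow>\<^sub>M distr (K i) (S i) (\<phi> i)" for i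
    using measurable_compose[OF measurable_component_singleton[of i UNIV K] \<phi>] by simp
  have "distr (PiM UNIV K) (PiM UNIV (\<lambda>i. distr (K i) (S i) (\<phi> i))) (\<lambda>\<omega> i. \<phi> i (\<omega> i))
      = PiM UNIV (\<lambda>i. distr (K i) (S i) (\<phi> i))"
  proof (rule distr_eq_PiM)
    show "prob_space (PiM UNIV K)" by (intro prob_space_PiM K)
    show "prob_space (distr (K i) (S i) (\<phi> i))" for i
      by (intro prob_space.prob_space_distr K \<phi>)
    fix J :: "_ set" and A assume J: "finite J" and A: "\<And>i. i \<in> J \<Longrightarrow> A i \<in> sets (distr (K i) (S i) (\<phi> i))"
    have "{\<omega> \<in> space (PiM UNIV K). \<forall>i\<in>J. \<phi> i (\<omega> i) \<in> A i}
        = {\<omega> \<in> space (PiM UNIV K). \<forall>i\<in>J. \<omega> i \<in> \<phi> i -` A i \<inter> space (K i)}"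
      by (auto simp: space_PiM PiE_iff)
    also have "emeasure (PiM UNIV K) \<dots> = (\<Prod>i\<in>J. emeasure (K i) (\<phi> i -` A i \<inter> space (K i)))"
      using A by (intro emeasure_PiM_cylinder K J) (auto intro!: measurable_sets[OF \<phi>])
    also have "\<dots> = (\<Prod>i\<in>J. emeasure (distr (K i) (S i) (\<phi> i)) (A i))"
      using A by (intro prod.cong refl) (auto simp: emeasure_distr \<phi>)
    finally show "emeasure (PiM UNIV K) {\<omega> \<in> space (PiM UNIV K). \<forall>i\<in>J. \<phi> i (\<omega> i) \<in> A i}
      = (\<Prod>i\<in>J. emeasure (distr (K i) (S i) (\<phi> i)) (A i))" .
  qed (rule \<phi>')
  then show ?thesis
    by (subst (asm) distr_cong[OF refl sets_PiM_cong[OF refl, of UNIV _ S] refl]) auto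
qed

text \<open>
  The children of the vertices of a tree are independent with laws that depend on the tree, so that
  the law of the next generation is a product kernel in this sense.
\<close>

lemma measurable_PiM_kernel:
  assumes K: "\<And>i. (\<lambda>x. K x i) \<in> N \<rightarrow>\<^sub>M prob_algebra (S i)"
  shows "(\<lambda>x. PiM UNIV (K x)) \<in> N \<rightarrow>\<^sub>M prob_algebra (PiM UNIV S)"
proof (rule measurable_prob_algebra_generated[OF sets_PiM Int_stable_prod_algebra prod_algebra_sets_into_space])
  have Kx: "prob_space (K x i)" "sets (K x i) = sets (S i)" if "x \<in> space N" for x i
    using measurable_space[OF K that] by (auto simp: space_prob_algebra)
  show "prob_space (PiM UNIV (K x))" if "x \<in> space N" for x
    using Kx[OF that] by (intro prob_space_PiM)
  show "sets (PiM UNIV (K x)) = sets (PiM UNIV S)" if "x \<in> space N" for x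
    using Kx[OF that] by (intro sets_PiM_cong) auto
  fix E assume "E \<in> prod_algebra UNIV S"
  then obtain J A where E: "E = prod_emb UNIV S J (Pi\<^sub>E J A)" "finite J" "\<And>i. i \<in> J \<Longrightarrow> A i \<in> sets (S i)"
    by (rule prod_algebraE) auto
  have "emeasure (PiM UNIV (K x)) E = (\<Prod>i\<in>J. emeasure (K x i) (A i))" if x: "x \<in> space N" for x
  proof -
    have "space (S i) = space (K x i)" for i using Kx[OF x] by (metis sets_eq_imp_space_eq)
    then have "E = prod_emb UNIV (K x) J (Pi\<^sub>E J A)"
      by (simp add: E prod_emb_def)
    then show ?thesis using E Kx[OF x] by (simp add: emeasure_PiM_emb)
  qed
  moreover have "(\<lambda>x. \<Prod>i\<in>J. emeasure (K x i) (A i)) \<in> borel_measurable N"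
    using E(3) by (intro borel_measurable_prod_ennreal measurable_emeasure_kernel[OF measurable_prob_algebraD[OF K]])
  ultimately show "(\<lambda>x. emeasure (PiM UNIV (K x)) E) \<in> borel_measurable N"
    by (subst measurable_cong) auto
qed

lemma nn_integral_PiM_depends_on:
  assumes K: "\<And>i. prob_space (K i)" and K': "\<And>i. prob_space (K' i)"
    and eq: "\<And>i. i \<in> D \<Longrightarrow> K i = K' i" and \<Phi>: "\<Phi> \<in> borel_measurable (PiM UNIV K)"
    and dep: "\<And>\<omega> \<omega>'. (\<And>i. i \<in> D \<Longrightarrow> \<omega> i = \<omega>' i) \<Longrightarrow> \<Phi> \<omega> = \<Phi> \<omega>'"
  shows "(\<integral>\<^sup>+\<omega>. \<Phi> \<omega> \<partial>PiM UNIV K) = (\<integral>\<^sup>+\<omega>. \<Phi> \<omega> \<partial>PiM UNIV K')"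
proof -
  interpret PK: prob_space "PiM UNIV K" by (intro prob_space_PiM K)
  have "(\<integral>\<^sup>+\<omega>. \<Phi> \<omega> \<partial>PiM UNIV K) = (\<integral>\<^sup>+\<omega>1. (\<integral>\<^sup>+\<omega>0. \<Phi> (\<lambda>i. if i \<in> D then \<omega>1 i else \<omega>0 i) \<partial>PiM UNIV K) \<partial>PiM UNIV K')"
    using eq by (intro nn_integral_PiM_merge(1)[OF K K' K _ _ _ _ \<Phi>]) auto
  also have "\<dots> = (\<integral>\<^sup>+\<omega>1. (\<integral>\<^sup>+\<omega>0. \<Phi> \<omega>1 \<partial>PiM UNIV K) \<partial>PiM UNIV K')"
    by (intro nn_integral_cong dep) auto
  finally show ?thesis by (simp add: PK.emeasure_space_1)
qed

section \<open>Measurability on spaces of labelled trees\<close>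

lemma sets_option_space_generator: "insert {None} ((`) Some ` sets S) \<subseteq> Pow (insert None (Some ` space S))"
  using sets.sets_into_space by blast

lemma space_option_space: "space (option_space S) = insert None (Some ` space S)"
  unfolding option_space_def using sets_option_space_generator by (rule space_measure_of)

lemma sets_option_space:
  "sets (option_space S) = sigma_sets (insert None (Some ` space S)) (insert {None} ((`) Some ` sets S))"
  unfolding option_space_def using sets_option_space_generator by (rule sets_measure_of)

lemma None_in_sets_option_space [simp]: "{None} \<in> sets (option_space S)"
  unfolding sets_option_space by auto

lemma image_Some_in_sets_option_space [simp]: "A \<in> sets S \<Longrightarrow> Some ` A \<in> sets (option_space S)"
  unfolding sets_option_space by auto

lemma measurable_Some [measurable]: "Some \<in> S \<rightarrow>\<^sub>M option_space S"
  unfolding option_space_def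
proof (rule measurable_sigma_sets[OF sets_measure_of[OF sets_option_space_generator] sets_option_space_generator])
  fix A assume "A \<in> insert {None} ((`) Some ` sets S)"
  then consider "A = {None}" | B where "B \<in> sets S" "A = Some ` B" by auto
  then show "Some -` A \<inter> space S \<in> sets S"
  proof cases
    case 1
    then have "Some -` A \<inter> space S = {}" by auto
    then show ?thesis by simp
  next
    case 2
    then have "Some -` A \<inter> space S = B" using sets.sets_into_space by auto
    then show ?thesis using 2 by simp
  qed
qed simp

lemma measurable_case_option:
  assumes c: "c \<in> space N" and g: "g \<in> S \<rightarrow>\<^sub>M N"
  shows "case_option c g \<in> option_space S \<rightarrow>\<^sub>M N"
proof (rule measurableI)
  show "case_option c g x \<in> space N" if "x \<in> space (option_space S)" for x
    using that c measurable_space[OF g] by (cases x) (auto simp: space_option_space)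
  fix A assume A: "A \<in> sets N"
  have "case_option c g -` A \<inter> space (option_space S)
      = (if c \<in> A then {None} else {}) \<union> Some ` (g -` A \<inter> space S)"
    by (auto simp: space_option_space split: option.splits)
  then show "case_option c g -` A \<inter> space (option_space S) \<in> sets (option_space S)"
    using measurable_sets[OF g A] by (auto simp del: Un_insert_left intro!: sets.Un)
qed

lemma measurable_map_option: "f \<in> S \<rightarrow>\<^sub>M T \<Longrightarrow> map_option f \<in> option_space S \<rightarrow>\<^sub>M option_space T"
  unfolding map_option_case[abs_def]
  by (rule measurable_case_option[OF _ measurable_compose[OF _ measurable_Some]]) (auto simp: space_option_space)

lemma space_option_space_UNIV: "space S = UNIV \<Longrightarrow> space (option_space S) = UNIV"
  by (simp add: space_option_space UNIV_option_conv)

lemma space_tree_space: "space S = UNIV \<Longrightarrow> space (tree_space S) = UNIV"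
  by (auto simp: tree_space_def space_PiM space_option_space_UNIV)

lemma space_config_space: "space S = UNIV \<Longrightarrow> space (config_space S) = UNIV"
  by (auto simp: config_space_def space_pair_measure space_PiM)

lemma measurable_tree_component [measurable]: "(\<lambda>t. t u) \<in> tree_space S \<rightarrow>\<^sub>M option_space S"
  unfolding tree_space_def by measurable

lemma measurable_into_tree_space:
  assumes S: "space S = UNIV" and f: "\<And>u. (\<lambda>x. f x u) \<in> N \<rightarrow>\<^sub>M option_space S"
  shows "f \<in> N \<rightarrow>\<^sub>M tree_space S"
  unfolding tree_space_def
  by (rule measurable_PiM_single') (use f in \<open>auto simp: space_option_space_UNIV[OF S]\<close>)

lemma measurable_in_dom [measurable]: "Measurable.pred (tree_space S) (\<lambda>t. u \<in> dom t)"
proof -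
  have "Measurable.pred (option_space S) (case_option False (\<lambda>_. True))"
    by (rule measurable_case_option) auto
  from measurable_compose[OF measurable_tree_component this]
  show ?thesis by (rule measurable_cong[THEN iffD1, rotated]) (auto split: option.splits)
qed

lemma measurable_tree_label:
  assumes "f \<in> S \<rightarrow>\<^sub>M N" and "space S = UNIV"
  shows "(\<lambda>t. f (the (t u))) \<in> tree_space S \<rightarrow>\<^sub>M N"
proof -
  have "case_option (f (the None)) f \<in> option_space S \<rightarrow>\<^sub>M N"
    using assms measurable_space[OF assms(1)] by (intro measurable_case_option) auto
  from measurable_compose[OF measurable_tree_component[of u] this]
  show ?thesis by (rule measurable_cong[THEN iffD1, rotated]) (auto split: option.splits)
qed

lemma measurable_up_to_height [measurable]:
  "space S = UNIV \<Longrightarrow> up_to_height n \<in> tree_space S \<rightarrow>\<^sub>M tree_space S"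
proof (rule measurable_into_tree_space)
  fix u :: "nat list"
  show "(\<lambda>t. up_to_height n t u) \<in> tree_space S \<rightarrow>\<^sub>M option_space S"
    by (cases "length u \<le> n") (auto simp: up_to_height_def restrict_map_def space_option_space)
qed

lemma up_to_height_up_to_height: "up_to_height n (up_to_height m t) = up_to_height (min n m) t"
  by (auto simp: up_to_height_def restrict_map_def fun_eq_iff)

text \<open>
  The events that depend on the tree up to a finite height generate the sigma-algebra, and they are
  stable under intersection because heights can be increased. Any initial heights may be left out.
\<close>

lemma measure_eqI_up_to_height:
  assumes S: "space S = UNIV" and A: "finite_measure A" "sets A = sets (tree_space S)"
    and B: "sets B = sets (tree_space S)"
    and eq: "\<And>n X. n \<ge> k \<Longrightarrow> X \<in> sets (tree_space S) \<Longrightarrow>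
      emeasure A (up_to_height n -` X) = emeasure B (up_to_height n -` X)"
  shows "A = B"
proof -
  interpret A: finite_measure A by (rule A)
  define G where "G = {up_to_height n -` X | n X. n \<ge> k \<and> X \<in> sets (tree_space S)}"
  have UN: "space A = UNIV" "space B = UNIV" "space (tree_space S) = UNIV"
    using A(2) B sets_eq_imp_space_eq space_tree_space[OF S] by metis+
  have up: "up_to_height n -` X \<in> sets (tree_space S)" if "X \<in> sets (tree_space S)" for n X
    using measurable_sets[OF measurable_up_to_height[OF S] that] UN(3) by simp
  have gen: "sets (tree_space S) = sigma_sets UNIV G"
  proof (rule antisym)
    have "sets (tree_space S) = sigma_sets (space (tree_space S))
        {{f \<in> UNIV \<rightarrow>\<^sub>E space (option_space S). f i \<in> X} |i X. i \<in> UNIV \<and> X \<in> sets (option_space S)}"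
      unfolding tree_space_def space_PiM by (rule sets_PiM_single)
    also have "\<dots> \<subseteq> sigma_sets UNIV G"
      unfolding UN
    proof (rule sigma_sets_mono)
      show "{{f \<in> UNIV \<rightarrow>\<^sub>E space (option_space S). f i \<in> X} |i X. i \<in> UNIV \<and> X \<in> sets (option_space S)}
          \<subseteq> sigma_sets UNIV G"
      proof safe
        fix u X assume X: "X \<in> sets (option_space S)"
        have "{f. f u \<in> X} \<in> sets (tree_space S)"
          using measurable_sets[OF measurable_tree_component X, of u] UN by (simp add: vimage_def)
        then have "up_to_height (max k (length u)) -` {f. f u \<in> X} \<in> G" 
          unfolding G_def by (intro CollectI exI[of _ "max k (length u)"] exI[of _ "{f. f u \<in> X}"]) simp
        moreover have "up_to_height (max k (length u)) -` {f. f u \<in> X}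
            = {f \<in> UNIV \<rightarrow>\<^sub>E space (option_space S). f u \<in> X}"
          by (auto simp: up_to_height_def restrict_map_def space_option_space_UNIV[OF S])
        ultimately show "{f \<in> UNIV \<rightarrow>\<^sub>E space (option_space S). f u \<in> X} \<in> sigma_sets UNIV G" by auto
      qed
    qed
    finally show "sets (tree_space S) \<subseteq> sigma_sets UNIV G" .
    show "sigma_sets UNIV G \<subseteq> sets (tree_space S)"
      using up sets.sigma_sets_subset[of G "tree_space S"] UN by (auto simp: G_def)
  qed
  show ?thesis
  proof (rule measure_eqI_generator_eq[where E = G and \<Omega> = UNIV and A = "\<lambda>_. UNIV"])
    show "Int_stable G"
    proof (rule Int_stableI)
      fix a b assume "a \<in> G" "b \<in> G"
      then obtain n X m Y where a: "a = up_to_height n -` X" "n \<ge> k" "X \<in> sets (tree_space S)"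
        and b: "b = up_to_height m -` Y" "m \<ge> k" "Y \<in> sets (tree_space S)" unfolding G_def by blast
      have ab: "a \<inter> b = up_to_height (max n m) -` (a \<inter> b)"
        by (auto simp: a b up_to_height_up_to_height min_def max_def)
      have sets: "a \<inter> b \<in> sets (tree_space S)" using up a b by auto
      show "a \<inter> b \<in> G"
        unfolding G_def using a(2)
        by (intro CollectI exI[of _ "max n m"] exI[of _ "a \<inter> b"] conjI ab sets) simp
    qed
    show "emeasure A X = emeasure B X" if "X \<in> G" for X
      using that eq by (auto simp: G_def)
    show "range (\<lambda>_. UNIV) \<subseteq> G"
      unfolding G_def using sets.top[of "tree_space S"] UN by (auto intro!: exI[of _ k] exI[of _ UNIV])
  qed (use gen A B in \<open>auto simp: A.emeasure_finite\<close>)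
qed

lemma measurable_fst_config [measurable]: "fst \<in> config_space S \<rightarrow>\<^sub>M count_space UNIV"
  unfolding config_space_def by measurable

lemma measurable_snd_config [measurable]: "(\<lambda>c. snd c i) \<in> config_space S \<rightarrow>\<^sub>M S"
  unfolding config_space_def by measurable

lemma measurable_into_config_space:
  assumes "space S = UNIV" "(\<lambda>x. fst (f x)) \<in> N \<rightarrow>\<^sub>M count_space UNIV" "\<And>i. (\<lambda>x. snd (f x) i) \<in> N \<rightarrow>\<^sub>M S"
  shows "f \<in> N \<rightarrow>\<^sub>M config_space S"
proof -
  have "(\<lambda>x. snd (f x)) \<in> N \<rightarrow>\<^sub>M PiM UNIV (\<lambda>_. S)"
    by (rule measurable_PiM_single') (use assms in auto)
  from measurable_Pair[OF assms(2) this] show ?thesis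
    unfolding config_space_def by simp
qed

section \<open>One generation of a Galton--Watson tree\<close>

text \<open>
  One step of the construction of a Galton--Watson tree, with the family of all child configurations
  made visible: it is a product measure, and \<open>add_generation\<close> is a deterministic map.
\<close>

definition children_law ::
    "'l measure \<Rightarrow> ('l \<Rightarrow> (nat \<times> (nat \<Rightarrow> 'l)) measure) \<Rightarrow> 'l ltree \<Rightarrow> nat list \<Rightarrow> (nat \<times> (nat \<Rightarrow> 'l)) measure" where
  "children_law S K t u = (case t u of None \<Rightarrow> return (config_space S) no_points | Some l \<Rightarrow> K l)"

definition add_generation :: "nat \<Rightarrow> 'l ltree \<Rightarrow> (nat list \<Rightarrow> nat \<times> (nat \<Rightarrow> 'l)) \<Rightarrow> 'l ltree" where
  "add_generation n t c u = (if length u = Suc n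
     then if last u < fst (c (butlast u)) then Some (snd (c (butlast u)) (last u)) else None
     else t u)"

locale offspring_kernel =
  fixes S :: "'l measure" and K :: "'l \<Rightarrow> (nat \<times> (nat \<Rightarrow> 'l)) measure"
  assumes space_S: "space S = UNIV" and K: "K \<in> S \<rightarrow>\<^sub>M prob_algebra (config_space S)"
begin

lemma next_generation_eq:
  "next_generation S K n t = distr (PiM UNIV (children_law S K t)) (tree_space S) (add_generation n t)"
  by (simp add: next_generation_def children_law_def[abs_def] add_generation_def[abs_def])

lemma measurable_children_law: "(\<lambda>t. children_law S K t u) \<in> tree_space S \<rightarrow>\<^sub>M prob_algebra (config_space S)"
  unfolding children_law_def
proof (rule measurable_compose[OF measurable_tree_component])
  show "case_option (return (config_space S) no_points) K \<in> option_space S \<rightarrow>\<^sub>M prob_algebra (config_space S)"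
    by (rule measurable_case_option[OF _ K])
      (simp add: space_prob_algebra prob_space_return space_config_space space_S)
qed

lemma children_law:
  "prob_space (children_law S K t u)" "sets (children_law S K t u) = sets (config_space S)"
  using measurable_space[OF measurable_children_law, of t u]
  by (auto simp: space_prob_algebra space_tree_space space_S)

lemma sets_PiM_children_law [measurable_cong]:
  "sets (PiM UNIV (children_law S K t)) = sets (PiM UNIV (\<lambda>_. config_space S))"
  by (intro sets_PiM_cong refl children_law)

lemma AE_children_law_absent:
  "AE c in PiM UNIV (children_law S K t). \<forall>u. t u = None \<longrightarrow> fst (c u) = 0"
  unfolding AE_all_countable
proof
  fix u
  show "AE c in PiM UNIV (children_law S K t). t u = None \<longrightarrow> fst (c u) = 0"
  proof (cases "t u = None")
    case True
    have "Measurable.pred (config_space S) (\<lambda>c. fst c = 0)"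
      by (rule measurable_compose[OF measurable_fst_config]) simp
    then have "AE c in return (config_space S) no_points. fst c = 0"
      by (subst AE_return) (simp_all add: no_points_def space_config_space[OF space_S])
    moreover have "children_law S K t u = return (config_space S) no_points"
      using True by (simp add: children_law_def)
    ultimately have "AE c in children_law S K t u. fst c = 0" by (simp only:)
    then have "AE c in PiM UNIV (children_law S K t). fst (c u) = 0"
      by (intro AE_PiM_component[where P = "\<lambda>c. fst c = 0"] children_law) auto
    then show ?thesis by eventually_elim simp
  next
    case False
    then show ?thesis by (intro AE_I2) blast
  qed
qed

lemma measurable_add_generation2:
  "(\<lambda>(t, c). add_generation n t c) \<in> tree_space S \<Otimes>\<^sub>M PiM UNIV (\<lambda>_. config_space S) \<rightarrow>\<^sub>M tree_space S"
proof (rule measurable_into_tree_space[OF space_S])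
  fix u :: "nat list"
  show "(\<lambda>x. (case x of (t, c) \<Rightarrow> add_generation n t c) u)
      \<in> tree_space S \<Otimes>\<^sub>M PiM UNIV (\<lambda>_. config_space S) \<rightarrow>\<^sub>M option_space S"
  proof (cases "length u = Suc n")
    case True
    have c: "(\<lambda>x. snd x (butlast u)) \<in> tree_space S \<Otimes>\<^sub>M PiM UNIV (\<lambda>_. config_space S) \<rightarrow>\<^sub>M config_space S"
      by (rule measurable_compose[OF measurable_snd measurable_component_singleton]) simp
    have l: "(\<lambda>x. Some (snd (snd x (butlast u)) (last u)))
        \<in> tree_space S \<Otimes>\<^sub>M PiM UNIV (\<lambda>_. config_space S) \<rightarrow>\<^sub>M option_space S"
      by (rule measurable_compose[OF measurable_compose[OF c measurable_snd_config] measurable_Some])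
    have p: "Measurable.pred (tree_space S \<Otimes>\<^sub>M PiM UNIV (\<lambda>_. config_space S))
        (\<lambda>x. last u < fst (snd x (butlast u)))"
      by (rule measurable_compose[OF measurable_compose[OF c measurable_fst_config]]) simp
    have m: "(\<lambda>x. if last u < fst (snd x (butlast u)) then Some (snd (snd x (butlast u)) (last u)) else None)
        \<in> tree_space S \<Otimes>\<^sub>M PiM UNIV (\<lambda>_. config_space S) \<rightarrow>\<^sub>M option_space S"
      using p by (intro measurable_If l) (auto simp: space_option_space pred_def)
    show ?thesis
      by (rule measurable_cong[THEN iffD1, rotated, OF m]) (use True in \<open>simp add: add_generation_def split_beta\<close>)
  next
    case False
    show ?thesis
      by (rule measurable_cong[THEN iffD1, rotated, OF measurable_compose[OF measurable_fst measurable_tree_component[of u]]])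
        (use False in \<open>simp add: add_generation_def split_beta\<close>)
  qed
qed

lemma measurable_add_generation: "add_generation n t \<in> PiM UNIV (\<lambda>_. config_space S) \<rightarrow>\<^sub>M tree_space S"
proof -
  have "t \<in> space (tree_space S)" by (simp add: space_tree_space space_S)
  from measurable_Pair2[OF measurable_add_generation2 this, of n] show ?thesis by (simp only: prod.case)
qed

lemma measurable_next_generation:
  "next_generation S K n \<in> tree_space S \<rightarrow>\<^sub>M prob_algebra (tree_space S)"
  unfolding next_generation_eq
  by (rule measurable_distr_prob_space2[OF _ measurable_add_generation2])
    (rule measurable_PiM_kernel[OF measurable_children_law])

lemma nn_integral_next_generation:
  assumes "f \<in> borel_measurable (tree_space S)"
  shows "(\<integral>\<^sup>+s. f s \<partial>next_generation S K n t)
    = (\<integral>\<^sup>+c. f (add_generation n t c) \<partial>PiM UNIV (children_law S K t))"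
  unfolding next_generation_eq using measurable_add_generation assms
  by (subst nn_integral_distr) (simp_all add: measurable_cong_sets[OF sets_PiM_children_law refl])

lemma measurable_nn_integral_next_generation:
  assumes "f \<in> borel_measurable (tree_space S)"
  shows "(\<lambda>t. \<integral>\<^sup>+s. f s \<partial>next_generation S K n t) \<in> borel_measurable (tree_space S)"
  using measurable_compose[OF measurable_prob_algebraD[OF measurable_next_generation]
      nn_integral_measurable_subprob_algebra[OF assms]] .

end

locale galton_watson_tree = offspring_kernel S K for S :: "'l measure" and K +
  fixes \<mu> :: "'l measure" and M :: "'l ltree measure"
  assumes gw: "galton_watson S \<mu> K M" and sets_\<mu>: "sets \<mu> = sets S"
begin

sublocale M: prob_space M
  using gw by (simp add: galton_watson_def)

lemma sets_M [measurable_cong]: "sets M = sets (tree_space S)"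
  using gw by (simp add: galton_watson_def)

lemma space_M: "space M = UNIV"
  using sets_eq_imp_space_eq[OF sets_M] space_tree_space[OF space_S] by simp

lemma measurable_up [measurable]: "up_to_height n \<in> tree_space S \<rightarrow>\<^sub>M tree_space S"
  by (rule measurable_up_to_height[OF space_S])

lemma measurable_up_M [measurable]: "up_to_height n \<in> M \<rightarrow>\<^sub>M tree_space S"
  using measurable_up by (simp add: measurable_cong_sets[OF sets_M refl])

lemma nn_integral_up_to_height_0:
  assumes f: "f \<in> borel_measurable (tree_space S)"
  shows "(\<integral>\<^sup>+t. f (up_to_height 0 t) \<partial>M) = (\<integral>\<^sup>+l. f [[] \<mapsto> l] \<partial>\<mu>)"
proof -
  have root: "(\<lambda>l. [[] \<mapsto> l]) \<in> \<mu> \<rightarrow>\<^sub>M tree_space S"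
  proof (rule measurable_into_tree_space[OF space_S])
    fix u :: "nat list"
    have "Some \<in> \<mu> \<rightarrow>\<^sub>M option_space S"
      using measurable_Some by (simp add: measurable_cong_sets[OF sets_\<mu> refl])
    then show "(\<lambda>l. [[] \<mapsto> l] u) \<in> \<mu> \<rightarrow>\<^sub>M option_space S"
      by (cases "u = []") (auto simp: space_option_space)
  qed
  have "(\<integral>\<^sup>+t. f (up_to_height 0 t) \<partial>M) = (\<integral>\<^sup>+t. f t \<partial>distr M (tree_space S) (up_to_height 0))"
    using f by (simp add: nn_integral_distr)
  also have "distr M (tree_space S) (up_to_height 0) = distr \<mu> (tree_space S) (\<lambda>l. [[] \<mapsto> l])"
    using gw by (simp add: galton_watson_def)
  also have "(\<integral>\<^sup>+t. f t \<partial>\<dots>) = (\<integral>\<^sup>+l. f [[] \<mapsto> l] \<partial>\<mu>)"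
    using f root by (simp add: nn_integral_distr)
  finally show ?thesis .
qed

lemma nn_integral_up_to_height_Suc:
  assumes f: "f \<in> borel_measurable (tree_space S)"
  shows "(\<integral>\<^sup>+t. f (up_to_height (Suc n) t) \<partial>M)
    = (\<integral>\<^sup>+t. (\<integral>\<^sup>+s. f s \<partial>next_generation S K n (up_to_height n t)) \<partial>M)"
proof -
  have "(\<integral>\<^sup>+t. f (up_to_height (Suc n) t) \<partial>M) = (\<integral>\<^sup>+t. f t \<partial>distr M (tree_space S) (up_to_height (Suc n)))"
    using f by (simp add: nn_integral_distr)
  also have "distr M (tree_space S) (up_to_height (Suc n))
      = distr M (tree_space S) (up_to_height n) \<bind> next_generation S K n"
    using gw by (simp add: galton_watson_def)
  also have "(\<integral>\<^sup>+t. f t \<partial>\<dots>)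
      = (\<integral>\<^sup>+t. (\<integral>\<^sup>+s. f s \<partial>next_generation S K n t) \<partial>distr M (tree_space S) (up_to_height n))"
    using measurable_prob_algebraD[OF measurable_next_generation]
    by (subst nn_integral_bind[OF f]) (simp_all add: measurable_cong_sets[OF sets_distr refl])
  also have "\<dots> = (\<integral>\<^sup>+t. (\<integral>\<^sup>+s. f s \<partial>next_generation S K n (up_to_height n t)) \<partial>M)"
    using measurable_nn_integral_next_generation[OF f] by (simp add: nn_integral_distr)
  finally show ?thesis .
qed

text \<open>
  Addresses without a vertex receive no children, so that no vertex can appear without its parent.
\<close>

lemma AE_ltrees: "AE t in M. t \<in> ltrees"
proof -
  have root: "AE t in M. [] \<in> dom t"
  proof -
    have "(\<integral>\<^sup>+t. indicator {t. [] \<notin> dom t} (up_to_height 0 t) \<partial>M) = (\<integral>\<^sup>+l. indicator {t :: 'l ltree. [] \<notin> dom t} [[] \<mapsto> l] \<partial>\<mu>)"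
      by (rule nn_integral_up_to_height_0) (simp add: space_tree_space[OF space_S, symmetric])
    then have "(\<integral>\<^sup>+t. indicator {t. [] \<notin> dom t} (up_to_height 0 t) \<partial>M) = 0" by simp
    moreover have "(\<lambda>t. indicator {t. [] \<notin> dom t} (up_to_height 0 t) :: ennreal) \<in> borel_measurable M"
      by (rule measurable_compose[OF measurable_up_M]) (simp add: space_tree_space[OF space_S, symmetric])
    ultimately have "AE t in M. indicator {t. [] \<notin> dom t} (up_to_height 0 t) = (0 :: ennreal)"
      by (simp add: nn_integral_0_iff_AE)
    then show ?thesis by eventually_elim (auto simp: up_to_height_def indicator_def split: if_splits)
  qed
  have step: "AE t in M. u @ [i] \<in> dom t \<longrightarrow> u \<in> dom t" for u i
  proof -
    let ?B = "{t :: 'l ltree. u @ [i] \<in> dom t \<and> u \<notin> dom t}" and ?n = "length u"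
    have B: "?B \<in> sets (tree_space S)"
    proof -
      have "Measurable.pred (tree_space S) (\<lambda>t :: 'l ltree. u @ [i] \<in> dom t \<and> \<not> u \<in> dom t)"
        by (intro pred_intros_logic measurable_in_dom)
      then show ?thesis by (simp add: pred_def space_tree_space[OF space_S])
    qed
    have "(\<integral>\<^sup>+s. indicator ?B s \<partial>next_generation S K ?n t) = 0" for t
    proof (cases "t u = None")
      case True
      have "AE c in PiM UNIV (children_law S K t). fst (c u) = 0"
        using AE_children_law_absent[of t] by eventually_elim (use True in blast)
      then have "(\<integral>\<^sup>+c. indicator ?B (add_generation ?n t c) \<partial>PiM UNIV (children_law S K t)) = (\<integral>\<^sup>+c. 0 \<partial>PiM UNIV (children_law S K t))"
        by (intro nn_integral_cong_AE) (auto simp: add_generation_def indicator_def dom_def elim!: eventually_mono)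
      then show ?thesis using B by (simp add: nn_integral_next_generation)
    next
      case False
      then have "indicator ?B (add_generation ?n t c) = (0 :: ennreal)" for c
        by (auto simp: add_generation_def indicator_def dom_def)
      then show ?thesis using B by (simp add: nn_integral_next_generation)
    qed
    then have "(\<integral>\<^sup>+t. indicator ?B (up_to_height (Suc ?n) t) \<partial>M) = 0"
      using B by (subst nn_integral_up_to_height_Suc) auto
    moreover have "(\<lambda>t. indicator ?B (up_to_height (Suc ?n) t) :: ennreal) \<in> borel_measurable M"
      using B by (intro measurable_compose[OF measurable_up_M]) auto
    ultimately have "AE t in M. indicator ?B (up_to_height (Suc ?n) t) = (0 :: ennreal)"
      by (simp add: nn_integral_0_iff_AE)
    then show ?thesis
      by eventually_elim (auto simp: up_to_height_def indicator_def restrict_map_def dom_def split: if_splits)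
  qed
  have "AE t in M. \<forall>u i. u @ [i] \<in> dom t \<longrightarrow> u \<in> dom t"
    using step unfolding AE_all_countable by blast
  with root show ?thesis by eventually_elim (auto simp: ltrees_def)
qed

end

section \<open>The Mecke formula for Poisson points\<close>

definition insert_point :: "nat \<Rightarrow> 'a \<Rightarrow> (nat \<Rightarrow> 'a) \<Rightarrow> nat \<Rightarrow> 'a" where
  "insert_point j a X = (\<lambda>k. if k = j then a else X (if k < j then k else k - 1))"

lemma measurable_insert_point:
  assumes S: "space S = UNIV"
  shows "(\<lambda>(a, X). insert_point j a X) \<in> S \<Otimes>\<^sub>M PiM UNIV (\<lambda>_. S) \<rightarrow>\<^sub>M PiM UNIV (\<lambda>_. S)"
proof (rule measurable_PiM_single')
  fix k
  have "(\<lambda>p. snd p (if k < j then k else k - 1)) \<in> S \<Otimes>\<^sub>M PiM UNIV (\<lambda>_. S) \<rightarrow>\<^sub>M S"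
    by (rule measurable_compose[OF measurable_snd measurable_component_singleton]) simp
  then show "(\<lambda>p. (case p of (a, X) \<Rightarrow> insert_point j a X) k) \<in> S \<Otimes>\<^sub>M PiM UNIV (\<lambda>_. S) \<rightarrow>\<^sub>M S"
    using measurable_fst[of S "PiM UNIV (\<lambda>_. S)"] by (cases "k = j") (simp_all add: insert_point_def split_beta)
qed (simp add: S)

lemma nn_integral_poisson_points:
  assumes fin: "finite_measure \<Lambda>" and UN: "space \<Lambda> = UNIV" and pos: "measure \<Lambda> UNIV \<noteq> 0"
    and f: "f \<in> borel_measurable (config_space \<Lambda>)"
  shows "(\<integral>\<^sup>+c. f c \<partial>poisson_points \<Lambda>) =
    (\<Sum>n. ennreal (pmf (poisson_pmf (measure \<Lambda> UNIV)) n) *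
      (\<integral>\<^sup>+X. f (n, X) \<partial>PiM UNIV (\<lambda>_. uniform_measure \<Lambda> UNIV)))"
proof -
  let ?\<nu> = "uniform_measure \<Lambda> UNIV" and ?p = "poisson_pmf (measure \<Lambda> UNIV)"
  interpret \<nu>: prob_space ?\<nu>
    using pos by (intro prob_space_uniform_measure) (auto simp: measure_def)
  interpret sequence_space ?\<nu> ..
  have eq: "poisson_points \<Lambda> = measure_pmf ?p \<Otimes>\<^sub>M S"
    using pos UN by (simp add: poisson_points_def)
  have "f \<in> borel_measurable (measure_pmf ?p \<Otimes>\<^sub>M S)"
    using f unfolding eq[symmetric] by (simp add: measurable_cong_sets[OF sets_poisson_points refl])
  from P.nn_integral_fst[OF this, symmetric]
  show ?thesis by (simp add: eq nn_integral_measure_pmf nn_integral_count_space_nat)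
qed

lemma measurable_sum_lessThan_fst:
  fixes f :: "nat \<Rightarrow> nat \<times> (nat \<Rightarrow> 'a) \<Rightarrow> ennreal"
  assumes "\<And>i. f i \<in> borel_measurable (config_space S)"
  shows "(\<lambda>c. \<Sum>i<fst c. f i c) \<in> borel_measurable (config_space S)"
proof -
  have "(\<lambda>c. \<Sum>i<fst c. f i c) = (\<lambda>c. \<Sum>i. (if i < fst c then 1 else 0) * f i c)"
  proof
    fix c show "(\<Sum>i<fst c. f i c) = (\<Sum>i. (if i < fst c then 1 else 0) * f i c)"
      by (subst suminf_finite[of "{..<fst c}"]) auto
  qed
  also have "\<dots> \<in> borel_measurable (config_space S)"
    using assms by measurable
  finally show ?thesis .
qed

text \<open>
  An independent point inserted at a uniform position into \<open>n\<close> points is one of \<open>n + 1\<close>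
  exchangeable points, and \<open>(n + 1)\<close> times the Poisson weight of \<open>n + 1\<close> is the total
  mass times the weight of \<open>n\<close>.
\<close>

theorem nn_integral_poisson_points_Mecke:
  fixes f :: "nat \<Rightarrow> nat \<times> (nat \<Rightarrow> 'a) \<Rightarrow> ennreal"
  assumes fin: "finite_measure \<Lambda>" and UN: "space \<Lambda> = UNIV"
    and f: "\<And>i. f i \<in> borel_measurable (config_space \<Lambda>)"
  shows "(\<integral>\<^sup>+c. (\<Sum>i<fst c. f i c) \<partial>poisson_points \<Lambda>) =
    (\<integral>\<^sup>+a. (\<integral>\<^sup>+c. (\<Sum>j\<le>fst c. f j (Suc (fst c), insert_point j a (snd c))) / of_nat (Suc (fst c))
      \<partial>poisson_points \<Lambda>) \<partial>\<Lambda>)"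
proof (cases "measure \<Lambda> UNIV = 0")
  case True
  interpret finite_measure \<Lambda> by fact
  have null: "emeasure \<Lambda> (space \<Lambda>) = 0" using True UN by (simp add: emeasure_eq_measure)
  have "AE a in \<Lambda>. False" by (rule AE_I[where N = "space \<Lambda>"]) (use null in auto)
  then have "(\<integral>\<^sup>+a. g a \<partial>\<Lambda>) = 0" for g :: "'a \<Rightarrow> ennreal"
  proof -
    have "AE a in \<Lambda>. g a = 0" using \<open>AE a in \<Lambda>. False\<close> by eventually_elim simp
    from nn_integral_cong_AE[OF this] show ?thesis by simp
  qed
  moreover have "(\<integral>\<^sup>+c. (\<Sum>i<fst c. f i c) \<partial>poisson_points \<Lambda>) = 0"
  proof -
    show ?thesis
      using True UN measurable_sum_lessThan_fst[OF f] by (simp add: poisson_points_def nn_integral_return space_config_space no_points_def)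
  qed
  ultimately show ?thesis by simp
next
  case False
  interpret finite_measure \<Lambda> by fact
  define r where "r = measure \<Lambda> UNIV"
  have r: "r > 0" using False measure_nonneg[of \<Lambda> UNIV] by (simp add: r_def less_le)
  let ?\<nu> = "uniform_measure \<Lambda> UNIV"
  interpret \<nu>: prob_space ?\<nu>
    using False by (intro prob_space_uniform_measure) (auto simp: measure_def)
  interpret SS: sequence_space ?\<nu> ..
  let ?S = "PiM UNIV (\<lambda>_ :: nat. ?\<nu>)"
  define p where "p n = ennreal (pmf (poisson_pmf r) n)" for n
  have p: "p (Suc n) = p n * ennreal r / of_nat (Suc n)" for n
  proof -
    have "pmf (poisson_pmf r) (Suc n) = pmf (poisson_pmf r) n * r / real (Suc n)"
      using r by (simp add: field_simps)
    then show ?thesis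
      using r by (simp add: p_def ennreal_mult[symmetric] divide_ennreal[symmetric] ennreal_of_nat_eq_real_of_nat del: of_nat_Suc pmf_poisson)
  qed
  have cong: "sets ?S = sets (PiM UNIV (\<lambda>_. \<Lambda>))" by (intro sets_PiM_cong) auto
  have fm: "(\<lambda>X. f i (n, X)) \<in> borel_measurable ?S" for i n
  proof -
    have "(\<lambda>X. f i (n, X)) \<in> borel_measurable (PiM UNIV (\<lambda>_. \<Lambda>))"
      using f[of i] unfolding config_space_def by measurable
    then show ?thesis by (simp add: measurable_cong_sets[OF cong refl])
  qed
  define I where "I j n a = (\<integral>\<^sup>+X. f j (Suc n, insert_point j a X) \<partial>?S)" for j n a
  have ins: "(\<lambda>(a, X). f j (Suc n, insert_point j a X)) \<in> borel_measurable (?\<nu> \<Otimes>\<^sub>M ?S)" for j n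
    using measurable_compose[OF measurable_insert_point[of ?\<nu> j] fm[of j "Suc n"]] UN
    by (simp add: split_beta)
  have I_meas: "I j n \<in> borel_measurable \<Lambda>" for j n
    using SS.P.borel_measurable_nn_integral_fst[OF ins, of j n]
    by (simp add: I_def[abs_def] measurable_cong_sets[of ?\<nu> \<Lambda>])
  have I: "(\<integral>\<^sup>+X. f j (Suc n, X) \<partial>?S) = (\<integral>\<^sup>+a. I j n a \<partial>?\<nu>)" for j n
    unfolding I_def insert_point_def
  proof (rule nn_integral_PiM_coordinate(2)[OF \<nu>.prob_space_axioms \<nu>.prob_space_axioms])
    show "inj_on (\<lambda>k. if k < j then k else k - 1) (- {j})" by (auto simp: inj_on_def split: if_splits)
  qed (use fm in auto)
  have \<Lambda>: "ennreal r * (\<integral>\<^sup>+a. g a \<partial>?\<nu>) = (\<integral>\<^sup>+a. g a \<partial>\<Lambda>)" if "g \<in> borel_measurable \<Lambda>" for g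
  proof -
    have "emeasure \<Lambda> UNIV = ennreal r" by (simp add: r_def emeasure_eq_measure)
    then show ?thesis
      using that r UN by (simp add: nn_integral_uniform_measure sets.top[of \<Lambda>, unfolded UN] ennreal_times_divide mult.commute[of "ennreal r"] mult_divide_eq_ennreal)
  qed
  note sum_meas = measurable_sum_lessThan_fst[OF f]
  have ins_meas: "(\<lambda>c. (\<Sum>j\<le>fst c. f j (Suc (fst c), insert_point j a (snd c))) / of_nat (Suc (fst c)))
      \<in> borel_measurable (config_space \<Lambda>)" for a
    unfolding config_space_def
  proof (rule measurable_pair_measure_countable1)
    fix n :: nat
    have "(\<lambda>X. f j (Suc n, insert_point j a X)) \<in> borel_measurable (PiM UNIV (\<lambda>_. \<Lambda>))" for j
      using measurable_Pair2[OF ins, of a j n] UN by (simp add: measurable_cong_sets[OF cong refl])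
    then show "(\<lambda>X. (\<Sum>j\<le>fst (n, X). f j (Suc (fst (n, X)), insert_point j a (snd (n, X)))) / of_nat (Suc (fst (n, X))))
        \<in> borel_measurable (PiM UNIV (\<lambda>_. \<Lambda>))" by simp
  qed simp
  have "(\<integral>\<^sup>+c. (\<Sum>i<fst c. f i c) \<partial>poisson_points \<Lambda>)
      = (\<Sum>n. p n * (\<integral>\<^sup>+X. (\<Sum>i<n. f i (n, X)) \<partial>?S))"
    using nn_integral_poisson_points[OF fin UN False sum_meas] by (simp add: p_def r_def)
  also have "\<dots> = (\<Sum>n. p n * (\<Sum>i<n. \<integral>\<^sup>+X. f i (n, X) \<partial>?S))"
    using fm by (simp add: nn_integral_sum)
  also have "\<dots> = (\<Sum>n. p (Suc n) * (\<Sum>i<Suc n. \<integral>\<^sup>+X. f i (Suc n, X) \<partial>?S))"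
    by (subst suminf_offset[of _ 1]) auto
  also have "\<dots> = (\<Sum>n. p n * ((\<Sum>j\<le>n. \<integral>\<^sup>+a. I j n a \<partial>\<Lambda>) / of_nat (Suc n)))"
  proof (intro suminf_cong)
    fix n
    have "p (Suc n) * (\<Sum>i<Suc n. \<integral>\<^sup>+X. f i (Suc n, X) \<partial>?S)
        = p n * (ennreal r * (\<Sum>j\<le>n. \<integral>\<^sup>+a. I j n a \<partial>?\<nu>)) / of_nat (Suc n)"
      unfolding p I lessThan_Suc_atMost by (simp only: ennreal_times_divide[symmetric] divide_ennreal_def ac_simps)
    also have "ennreal r * (\<Sum>j\<le>n. \<integral>\<^sup>+a. I j n a \<partial>?\<nu>) = (\<Sum>j\<le>n. \<integral>\<^sup>+a. I j n a \<partial>\<Lambda>)"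
      by (simp add: sum_distrib_left \<Lambda> I_meas)
    finally show "p (Suc n) * (\<Sum>i<Suc n. \<integral>\<^sup>+X. f i (Suc n, X) \<partial>?S)
        = p n * ((\<Sum>j\<le>n. \<integral>\<^sup>+a. I j n a \<partial>\<Lambda>) / of_nat (Suc n))"
      by (simp add: ennreal_times_divide)
  qed
  also have "\<dots> = (\<Sum>n. \<integral>\<^sup>+a. p n * ((\<Sum>j\<le>n. I j n a) / of_nat (Suc n)) \<partial>\<Lambda>)"
    using I_meas by (simp add: nn_integral_cmult nn_integral_divide nn_integral_sum measurable_const del: of_nat_Suc)
  also have "\<dots> = (\<integral>\<^sup>+a. (\<Sum>n. p n * ((\<Sum>j\<le>n. I j n a) / of_nat (Suc n))) \<partial>\<Lambda>)"
  proof (rule nn_integral_suminf[symmetric])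
    have "(\<lambda>a. p n * ((\<Sum>j\<le>n. I j n a) / d)) \<in> borel_measurable \<Lambda>" for n d
      using I_meas by measurable
    then show "(\<lambda>a. p n * ((\<Sum>j\<le>n. I j n a) / of_nat (Suc n))) \<in> borel_measurable \<Lambda>" for n .
  qed
  also have "\<dots> = (\<integral>\<^sup>+a. (\<integral>\<^sup>+c. (\<Sum>j\<le>fst c. f j (Suc (fst c), insert_point j a (snd c))) / of_nat (Suc (fst c))
      \<partial>poisson_points \<Lambda>) \<partial>\<Lambda>)"
  proof (intro nn_integral_cong)
    fix a
    have m: "(\<lambda>X. f j (Suc n, insert_point j a X)) \<in> borel_measurable ?S" for j n
      using measurable_Pair2[OF ins, of a j n] UN by simp
    show "(\<Sum>n. p n * ((\<Sum>j\<le>n. I j n a) / of_nat (Suc n))) =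
      (\<integral>\<^sup>+c. (\<Sum>j\<le>fst c. f j (Suc (fst c), insert_point j a (snd c))) / of_nat (Suc (fst c)) \<partial>poisson_points \<Lambda>)"
      using nn_integral_poisson_points[OF fin UN False ins_meas] m
      by (simp add: p_def r_def I_def nn_integral_divide nn_integral_sum measurable_const del: of_nat_Suc)
  qed
  finally show ?thesis .
qed

lemma measurable_poisson_points:
  assumes fin: "\<And>b. finite_measure (\<Lambda> b)" and sets: "\<And>b. sets (\<Lambda> b) = sets S" and S: "space S = UNIV"
    and meas: "\<And>A. A \<in> sets S \<Longrightarrow> (\<lambda>b. emeasure (\<Lambda> b) A) \<in> borel_measurable N"
  shows "(\<lambda>b. poisson_points (\<Lambda> b)) \<in> N \<rightarrow>\<^sub>M prob_algebra (config_space S)"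
proof -
  have sp: "space (\<Lambda> b) = UNIV" for b using sets_eq_imp_space_eq[OF sets] S by simp
  have top: "UNIV \<in> sets S" using sets.top[of S] S by simp
  define r where "r b = measure (\<Lambda> b) UNIV" for b
  have [measurable]: "r \<in> borel_measurable N"
    unfolding r_def[abs_def] measure_def using meas[OF top] by measurable
  have r0: "r b \<ge> 0" for b by (simp add: r_def)
  have em: "emeasure (\<Lambda> b) UNIV = ennreal (r b)" for b
    using fin by (simp add: r_def finite_measure.emeasure_eq_measure)
  define \<nu> where "\<nu> b = (if r b = 0 then return S undefined else uniform_measure (\<Lambda> b) UNIV)" for b
  have \<nu>_prob: "prob_space (\<nu> b)" for b
    using em[of b] r0[of b] S by (auto simp: \<nu>_def prob_space_return intro!: prob_space_uniform_measure)
  have \<nu>_meas: "\<nu> \<in> N \<rightarrow>\<^sub>M prob_algebra S"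
  proof (rule measurable_prob_algebraI[OF \<nu>_prob measurable_subprob_algebra])
    show "subprob_space (\<nu> b)" for b by (intro prob_space_imp_subprob_space \<nu>_prob)
    show "sets (\<nu> b) = sets S" for b by (simp add: \<nu>_def sets)
    fix A assume A: "A \<in> sets S"
    have "emeasure (\<nu> b) A = (if r b = 0 then indicator A undefined else emeasure (\<Lambda> b) A / ennreal (r b))" for b
      using A top by (simp add: \<nu>_def sets em)
    then show "(\<lambda>b. emeasure (\<nu> b) A) \<in> borel_measurable N"
      using meas[OF A] by simp
  qed
  have pois: "(\<lambda>b. measure_pmf (poisson_or_zero (r b))) \<in> N \<rightarrow>\<^sub>M prob_algebra (count_space UNIV)"
  proof (rule measurable_prob_algebraI[OF prob_space_measure_pmf measurable_subprob_algebra])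
    show "subprob_space (measure_pmf (poisson_or_zero (r b)))" for b
      by (intro prob_space_imp_subprob_space prob_space_measure_pmf)
    fix A :: "nat set"
    have "emeasure (measure_pmf (poisson_or_zero (r b))) A
        = (\<Sum>n. ennreal (r b ^ n / fact n * exp (- r b)) * indicator A n)" for b
    proof -
      have "emeasure (measure_pmf (poisson_or_zero (r b))) A = (\<integral>\<^sup>+n. indicator A n \<partial>measure_pmf (poisson_or_zero (r b)))"
        by simp
      also have "\<dots> = (\<Sum>n. ennreal (pmf (poisson_or_zero (r b)) n) * indicator A n)"
        by (simp only: nn_integral_measure_pmf nn_integral_count_space_nat)
      finally show ?thesis using r0 by (simp add: pmf_poisson_or_zero)
    qed
    then show "(\<lambda>b. emeasure (measure_pmf (poisson_or_zero (r b))) A) \<in> borel_measurable N" by simp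
  qed simp
  have "(\<lambda>b. measure_pmf (poisson_or_zero (r b)) \<Otimes>\<^sub>M PiM UNIV (\<lambda>_ :: nat. \<nu> b)) \<in> N \<rightarrow>\<^sub>M prob_algebra (config_space S)"
    unfolding config_space_def
    by (rule measurable_pair_prob[OF pois]) (rule measurable_PiM_kernel[OF \<nu>_meas])
  moreover have "return (config_space S) no_points \<in> space (prob_algebra (config_space S))"
    using S by (simp add: space_prob_algebra prob_space_return space_config_space)
  ultimately have "(\<lambda>b. if r b = 0 then return (config_space S) no_points
      else measure_pmf (poisson_or_zero (r b)) \<Otimes>\<^sub>M PiM UNIV (\<lambda>_. \<nu> b)) \<in> N \<rightarrow>\<^sub>M prob_algebra (config_space S)"
    by (intro measurable_If) auto
  moreover have "poisson_points (\<Lambda> b) = (if r b = 0 then return (config_space S) no_points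
      else measure_pmf (poisson_or_zero (r b)) \<Otimes>\<^sub>M PiM UNIV (\<lambda>_. \<nu> b))" for b
  proof -
    have "sets (config_space (\<Lambda> b)) = sets (config_space S)"
      unfolding config_space_def by (intro sets_pair_measure_cong sets_PiM_cong refl sets)
    then have "return (config_space (\<Lambda> b)) no_points = return (config_space S) no_points"
      by (rule return_cong)
    then show ?thesis
      by (simp add: poisson_points_def sp r_def poisson_or_zero_def \<nu>_def)
  qed
  ultimately show ?thesis by simp
qed

section \<open>The harmonic function and the root laws\<close>

lemma tanh_half_bounds: "- 1 < tanh (z :: real)" "tanh (z :: real) < 1"
  using tanh_real_bounds[of z] by auto

lemma sech_square: "(sech z)\<^sup>2 = 1 - (tanh z)\<^sup>2"
proof -
  have "1 + (sinh z)\<^sup>2 \<noteq> 0" by (smt (verit) zero_le_power2)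
  then show ?thesis
    using cosh_square_eq[of z] by (simp add: sech_def tanh_def power_divide add.commute divide_simps)
qed

lemma sech_square_pos: "(sech z)\<^sup>2 > 0"
  using cosh_real_pos[of z] by (simp add: sech_def)

lemma tanh_shift_at_top: "((\<lambda>a :: real. tanh ((a + x) / 2)) \<longlongrightarrow> 1) at_top"
proof -
  have "filterlim (\<lambda>a. (a + x) / 2) at_top at_top" by real_asymp
  then show ?thesis by (rule filterlim_compose[OF tanh_real_at_top])
qed

lemma borel_measurable_tanh_shift [measurable]: "(\<lambda>a :: real. tanh ((a + x) / 2)) \<in> borel_measurable borel"
  by (intro borel_measurable_continuous_onI continuous_intros) auto

text \<open>
  The mean progeny of a vertex of age \<open>b\<close>. Negative arguments never occur as ages; the value 1
  there agrees with the fact that such a vertex would have no children.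
\<close>

definition mean_progeny :: "real \<Rightarrow> real \<Rightarrow> real" where
  "mean_progeny x b = tanh ((max b 0 + x) / 2) / tanh (x / 2)"

lemma borel_measurable_mean_progeny [measurable]: "mean_progeny x \<in> borel_measurable borel"
proof -
  have "(\<lambda>b :: real. tanh ((max b 0 + x) / 2)) \<in> borel_measurable borel"
    by (rule measurable_compose[OF _ borel_measurable_tanh_shift]) simp
  then show ?thesis unfolding mean_progeny_def[abs_def] by simp
qed

lemma mean_progeny_bounds:
  assumes "x > 0" shows "1 \<le> mean_progeny x b" "mean_progeny x b \<le> 1 / tanh (x / 2)"
proof -
  have t: "tanh (x / 2) > 0" using assms by simp
  have "tanh (x / 2) \<le> tanh ((max b 0 + x) / 2)" by simp
  then show "1 \<le> mean_progeny x b" using t by (simp add: mean_progeny_def)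
  show "mean_progeny x b \<le> 1 / tanh (x / 2)"
    using t tanh_half_bounds[of "(max b 0 + x) / 2"] by (simp add: mean_progeny_def divide_right_mono)
qed

text \<open>
  This integral says that \<open>mean_progeny\<close> exceeds 1 by its integral against the child intensity. It
  is also the normalisation of the age density of a spinal child.
\<close>

lemma nn_integral_min_sech_tanh:
  assumes x: "x > 0" and b: "b \<ge> 0"
  shows "(\<integral>\<^sup>+a. ennreal (indicator {0..} a * (min b a * (sech ((a + x) / 2))\<^sup>2 * tanh ((a + x) / 2) / 2)) \<partial>lborel)
    = ennreal (tanh ((b + x) / 2) - tanh (x / 2))"
proof -
  define T where "T a = tanh ((a + x) / 2)" for a
  have [measurable]: "T \<in> borel_measurable borel" unfolding T_def[abs_def] by measurable
  have T: "0 < T a" "T a < 1" if "a \<ge> 0" for a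
    using that x tanh_half_bounds by (auto simp: T_def)
  have s: "0 < 1 - (T a)\<^sup>2" for a
    using sech_square_pos[of "(a + x) / 2"] by (simp add: sech_square T_def)
  have dT: "(T has_real_derivative (1 - (T a)\<^sup>2) / 2) (at a)" for a
    unfolding T_def[abs_def] by (auto intro!: derivative_eq_intros)
  \<comment> \<open>Antiderivatives on \<open>[0, b]\<close> and on \<open>[b, \<infinity>)\<close>, from
    \<open>d/da (1 - T\<^sup>2) = - T (1 - T\<^sup>2)\<close> and an integration by parts for the factor \<open>a\<close>.\<close>
  define G1 where "G1 a = T a - a * (1 - (T a)\<^sup>2) / 2" for a
  define G2 where "G2 a = - (b * (1 - (T a)\<^sup>2)) / 2" for a
  have G1: "(G1 has_real_derivative a * (1 - (T a)\<^sup>2) * T a / 2) (at a)" for a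
    unfolding G1_def[abs_def]
    by (rule derivative_eq_intros dT refl | simp add: field_simps power2_eq_square)+
  have G2: "(G2 has_real_derivative b * (1 - (T a)\<^sup>2) * T a / 2) (at a)" for a
    unfolding G2_def[abs_def]
    by (rule derivative_eq_intros dT refl | simp add: field_simps power2_eq_square)+
  have nonneg: "0 \<le> c * (1 - (T a)\<^sup>2) * T a / 2" if "a \<ge> 0" "c \<ge> 0" for a c
    using s[of a] T[OF that(1)] that(2) by (intro divide_nonneg_pos mult_nonneg_nonneg) auto
  have limT: "(T \<longlongrightarrow> 1) at_top" unfolding T_def[abs_def] by (rule tanh_shift_at_top)
  have lim: "(G2 \<longlongrightarrow> - (b * (1 - 1\<^sup>2)) / 2) at_top"
    unfolding G2_def[abs_def] by (intro tendsto_intros limT) auto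
  have "(\<integral>\<^sup>+a. ennreal (indicator {0..} a * (min b a * (sech ((a + x) / 2))\<^sup>2 * tanh ((a + x) / 2) / 2)) \<partial>lborel)
    = (\<integral>\<^sup>+a. ennreal (a * (1 - (T a)\<^sup>2) * T a / 2) * indicator {0..b} a
        + ennreal (b * (1 - (T a)\<^sup>2) * T a / 2) * indicator {b..} a \<partial>lborel)"
    using AE_lborel_singleton[of b] b
    by (intro nn_integral_cong_AE) (auto simp: indicator_def sech_square T_def elim!: eventually_mono)
  also have "\<dots> = (\<integral>\<^sup>+a. ennreal (a * (1 - (T a)\<^sup>2) * T a / 2) * indicator {0..b} a \<partial>lborel)
        + (\<integral>\<^sup>+a. ennreal (b * (1 - (T a)\<^sup>2) * T a / 2) * indicator {b..} a \<partial>lborel)"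
    by (rule nn_integral_add) measurable
  also have "(\<integral>\<^sup>+a. ennreal (a * (1 - (T a)\<^sup>2) * T a / 2) * indicator {0..b} a \<partial>lborel) = ennreal (G1 b - G1 0)"
    using b nonneg G1 by (intro nn_integral_FTC_Icc) auto
  also have "(\<integral>\<^sup>+a. ennreal (b * (1 - (T a)\<^sup>2) * T a / 2) * indicator {b..} a \<partial>lborel) = ennreal (0 - G2 b)"
    using b nonneg lim by (intro nn_integral_FTC_atLeast G2) auto
  also have "ennreal (G1 b - G1 0) + ennreal (0 - G2 b) = ennreal (G1 b - G1 0 + (0 - G2 b))"
  proof (rule ennreal_plus[symmetric])
    show "0 \<le> 0 - G2 b" using b s[of b] by (simp add: G2_def)
    show "0 \<le> G1 b - G1 0"
    proof -
      have "G1 0 \<le> G1 b"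
      proof (rule DERIV_nonneg_imp_nondecreasing[OF b])
        fix a :: real assume "0 \<le> a"
        then show "\<exists>y. (G1 has_real_derivative y) (at a) \<and> 0 \<le> y"
          using G1[of a] s[of a] T[of a] by (intro exI[of _ "a * (1 - (T a)\<^sup>2) * T a / 2"]) auto
      qed
      then show ?thesis by simp
    qed
  qed
  also have "G1 b - G1 0 + (0 - G2 b) = tanh ((b + x) / 2) - tanh (x / 2)"
    by (simp add: G1_def G2_def T_def field_simps)
  finally show ?thesis .
qed

lemma interval_measure_eq_density:
  fixes F f :: "real \<Rightarrow> real"
  assumes f: "f \<in> borel_measurable borel" "\<And>y. y \<ge> 0 \<Longrightarrow> f y \<ge> 0"
    and F: "\<And>y. y \<ge> 0 \<Longrightarrow> (F has_real_derivative f y) (at y)" "F 0 = 0" "(F \<longlongrightarrow> 1) at_top"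
  shows "interval_measure (\<lambda>y. if y < 0 then 0 else F y) = density lborel (\<lambda>y. ennreal (indicator {0..} y * f y))"
    and "prob_space (density lborel (\<lambda>y. ennreal (indicator {0..} y * f y)))"
proof -
  let ?D = "density lborel (\<lambda>y. ennreal (indicator {0..} y * f y))"
  note [measurable] = f(1)
  have ind: "ennreal (indicator {0..} y * f y) = ennreal (f y) * indicator {0..} y" for y
    by (simp add: indicator_def)
  have "emeasure ?D (space ?D) = (\<integral>\<^sup>+y. ennreal (f y) * indicator {0..} y \<partial>lborel)"
    by (simp add: emeasure_density ind)
  also have "\<dots> = ennreal (1 - F 0)"
    by (rule nn_integral_FTC_atLeast[OF f(1) F(1) f(2) F(3)])
  finally show D: "prob_space ?D" using F(2) by (intro prob_spaceI) simp
  interpret D: real_distribution ?D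
    using D by (auto simp: real_distribution_def real_distribution_axioms_def)
  have cdf: "cdf ?D y = (if y < 0 then 0 else F y)" for y
  proof (cases "y < 0")
    case True
    have "emeasure ?D {..y} = (\<integral>\<^sup>+z. ennreal (indicator {0..} z * f z) * indicator {..y} z \<partial>lborel)"
      by (rule emeasure_density) simp_all
    also have "\<dots> = (\<integral>\<^sup>+z. 0 \<partial>(lborel :: real measure))"
      using True by (intro nn_integral_cong) (auto simp: indicator_def)
    finally have "emeasure ?D {..y} = 0" by simp
    then show ?thesis using True by (simp add: cdf_def measure_def)
  next
    case False
    have "emeasure ?D {..y} = (\<integral>\<^sup>+z. ennreal (f z) * indicator {0..y} z \<partial>lborel)"
      by (auto simp: emeasure_density indicator_def intro!: nn_integral_cong)
    also have "\<dots> = ennreal (F y - F 0)"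
      using False by (intro nn_integral_FTC_Icc) (auto intro!: has_field_derivative_at_within[OF F(1)] f)
    also have "F y \<ge> 0"
    proof -
      have "F 0 \<le> F y"
        using False F(1) f(2) by (intro DERIV_nonneg_imp_nondecreasing[of 0 y F]) auto
      then show ?thesis using F(2) by simp
    qed
    then have "ennreal (F y - F 0) = ennreal (F y)" by (simp add: F(2))
    finally show ?thesis using False \<open>F y \<ge> 0\<close> by (simp add: cdf_def measure_def)
  qed
  have "cdf (interval_measure (cdf ?D)) = cdf ?D"
    by (intro cdf_interval_measure D.cdf_nondecreasing D.cdf_is_right_cont D.cdf_lim_at_bot)
  moreover have "real_distribution (interval_measure (cdf ?D))"
    by (intro real_distribution_interval_measure D.cdf_nondecreasing D.cdf_is_right_cont
        D.cdf_lim_at_bot D.cdf_lim_at_top_prob)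
  ultimately have "interval_measure (cdf ?D) = ?D"
    by (intro cdf_unique D.real_distribution_axioms) auto
  then show "interval_measure (\<lambda>y. if y < 0 then 0 else F y) = ?D"
    by (simp only: cdf[abs_def, symmetric])
qed

definition H_root_density :: "real \<Rightarrow> real \<Rightarrow> real" where
  "H_root_density x y = (sech ((y + x) / 2))\<^sup>2 / (2 * (1 - tanh (x / 2)))"

lemma borel_measurable_H_root_density [measurable]: "H_root_density x \<in> borel_measurable borel"
  unfolding H_root_density_def[abs_def] by measurable

lemma H_root_density_pos: "H_root_density x y > 0"
  using sech_square_pos[of "(y + x) / 2"] tanh_half_bounds[of "x / 2"] by (simp add: H_root_density_def)

lemma H_root_age_eq:
  "H_root_age x = density lborel (\<lambda>y. ennreal (indicator {0..} y * H_root_density x y))"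
  "prob_space (H_root_age x)"
proof -
  define F where "F y = 1 - (1 - tanh ((x + y) / 2)) / (1 - tanh (x / 2))" for y
  have F: "(F has_real_derivative H_root_density x y) (at y)" for y
    unfolding F_def[abs_def] H_root_density_def
    using tanh_half_bounds[of "x / 2"]
    by (auto intro!: derivative_eq_intros simp: sech_square add.commute)
  have lim: "(F \<longlongrightarrow> 1 - (1 - 1) / (1 - tanh (x / 2))) at_top"
    unfolding F_def[abs_def] using tanh_shift_at_top[of x] tanh_half_bounds[of "x / 2"]
    by (intro tendsto_intros) (auto simp: add.commute)
  have *: "H_root_age x = interval_measure (\<lambda>y. if y < 0 then 0 else F y)"
    by (simp only: H_root_age_def F_def)
  have "F 0 = 0" using tanh_half_bounds[of "x / 2"] by (simp add: F_def)
  then have D: "interval_measure (\<lambda>y. if y < 0 then 0 else F y) = density lborel (\<lambda>y. ennreal (indicator {0..} y * H_root_density x y))"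
    "prob_space (density lborel (\<lambda>y. ennreal (indicator {0..} y * H_root_density x y)))"
    using lim F H_root_density_pos[of x] by (auto intro!: interval_measure_eq_density[where F = F] less_imp_le)
  show "H_root_age x = density lborel (\<lambda>y. ennreal (indicator {0..} y * H_root_density x y))"
    using D(1) * by simp
  then show "prob_space (H_root_age x)" using D(2) by simp
qed

text \<open>
  The mean of \<open>mean_progeny\<close> under the law of the root age: in the variable
  \<open>T = tanh ((b + x) / 2)\<close> that law is uniform on \<open>[t, 1]\<close> with \<open>t = tanh (x / 2)\<close>, and the mean of
  \<open>T / t\<close> is \<open>(1 + t) / (2 t)\<close>.
\<close>

definition mean_total_progeny :: "real \<Rightarrow> real" where
  "mean_total_progeny x = (1 + tanh (x / 2)) / (2 * tanh (x / 2))"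

lemma mean_total_progeny_pos: "x > 0 \<Longrightarrow> mean_total_progeny x > 0"
  using tanh_half_bounds[of "x / 2"] by (simp add: mean_total_progeny_def)

lemma Hhat_root_age_eq:
  assumes x: "x > 0"
  shows "Hhat_root_age x = density lborel (\<lambda>y. ennreal (indicator {0..} y *
      (H_root_density x y * mean_progeny x y / mean_total_progeny x)))"
    and "prob_space (Hhat_root_age x)"
proof -
  define t where "t = tanh (x / 2)"
  have t: "0 < t" "t < 1" using x tanh_half_bounds by (auto simp: t_def)
  define f where "f y = H_root_density x y * mean_progeny x y / mean_total_progeny x" for y
  define F where "F y = 1 - (cosh (x / 2))\<^sup>2 / (cosh ((x + y) / 2))\<^sup>2" for y
  have F_eq: "F y = 1 - (cosh (x / 2))\<^sup>2 * (1 - (tanh ((y + x) / 2))\<^sup>2)" for y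
  proof -
    have "F y = 1 - (cosh (x / 2))\<^sup>2 * (sech ((y + x) / 2))\<^sup>2"
      by (simp add: F_def sech_def power_divide add.commute)
    then show ?thesis by (simp only: sech_square)
  qed
  have c: "(cosh (x / 2))\<^sup>2 * (1 - t\<^sup>2) = 1"
  proof -
    have "1 - t\<^sup>2 = 1 / (cosh (x / 2))\<^sup>2"
      using sech_square[of "x / 2"] by (simp add: sech_def t_def power_divide)
    then show ?thesis using cosh_real_pos[of "x / 2"] by simp
  qed
  have nz: "1 - t\<^sup>2 \<noteq> 0" using c by auto
  have c': "(cosh (x / 2))\<^sup>2 = 1 / (1 - t\<^sup>2)" using c nz by (simp add: field_simps)
  have f_eq: "f y = (cosh (x / 2))\<^sup>2 * (1 - (tanh ((y + x) / 2))\<^sup>2) * tanh ((y + x) / 2)" if "y \<ge> 0" for y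
    using that t nz
    by (simp add: f_def c' H_root_density_def mean_progeny_def mean_total_progeny_def t_def[symmetric] sech_square)
      (simp add: divide_simps power2_eq_square, simp add: algebra_simps)
  have F: "(F has_real_derivative f y) (at y)" if "y \<ge> 0" for y
    unfolding F_eq[abs_def] f_eq[OF that]
    by (auto intro!: derivative_eq_intros)
  have lim: "(F \<longlongrightarrow> 1 - (cosh (x / 2))\<^sup>2 * (1 - 1\<^sup>2)) at_top"
    unfolding F_eq[abs_def] by (intro tendsto_intros tanh_shift_at_top)
  have *: "Hhat_root_age x = interval_measure (\<lambda>y. if y < 0 then 0 else F y)"
    by (simp only: Hhat_root_age_def F_def)
  have fm: "f \<in> borel_measurable borel" unfolding f_def[abs_def] by measurable
  have f0: "f y \<ge> 0" for y
    using H_root_density_pos[of x y] mean_progeny_bounds[OF x, of y] mean_total_progeny_pos[OF x]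
    by (simp add: f_def)
  have "F 0 = 0" by (simp add: F_def)
  then have D: "interval_measure (\<lambda>y. if y < 0 then 0 else F y) = density lborel (\<lambda>y. ennreal (indicator {0..} y * f y))"
    "prob_space (density lborel (\<lambda>y. ennreal (indicator {0..} y * f y)))"
    using lim F f0 fm by (auto intro!: interval_measure_eq_density[where F = F])
  show "Hhat_root_age x = density lborel (\<lambda>y. ennreal (indicator {0..} y *
      (H_root_density x y * mean_progeny x y / mean_total_progeny x)))"
    using D(1) * by (simp add: f_def)
  then show "prob_space (Hhat_root_age x)" using D(2) by (simp add: f_def)
qed

lemma nn_integral_H_root_age:
  assumes "f \<in> borel_measurable borel"
  shows "(\<integral>\<^sup>+b. f b \<partial>H_root_age x) = (\<integral>\<^sup>+b. ennreal (indicator {0..} b * H_root_density x b) * f b \<partial>lborel)"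
  unfolding H_root_age_eq using assms by (subst nn_integral_density) auto

lemma nn_integral_Hhat_root_age:
  assumes x: "x > 0" and f: "f \<in> borel_measurable borel"
  shows "(\<integral>\<^sup>+b. f b \<partial>Hhat_root_age x)
    = (\<integral>\<^sup>+b. ennreal (mean_progeny x b) * f b \<partial>H_root_age x) / ennreal (mean_total_progeny x)"
proof -
  let ?E = "mean_total_progeny x"
  have E: "?E > 0" by (rule mean_total_progeny_pos[OF x])
  have "(\<integral>\<^sup>+b. f b \<partial>Hhat_root_age x) = (\<integral>\<^sup>+b. ennreal (indicator {0..} b *
      (H_root_density x b * mean_progeny x b / ?E)) * f b \<partial>lborel)"
    unfolding Hhat_root_age_eq[OF x] using f by (subst nn_integral_density) auto
  also have "\<dots> = (\<integral>\<^sup>+b. ennreal (indicator {0..} b * H_root_density x b) * (ennreal (mean_progeny x b) * f b) / ennreal ?E \<partial>lborel)"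
  proof (intro nn_integral_cong)
    fix b
    have "ennreal (indicator {0..} b * (H_root_density x b * mean_progeny x b / ?E))
        = ennreal (indicator {0..} b * H_root_density x b) * ennreal (mean_progeny x b) / ennreal ?E"
      using H_root_density_pos[of x b] mean_progeny_bounds[OF x, of b] E
      by (simp add: ennreal_mult[symmetric] divide_ennreal)
    then show "ennreal (indicator {0..} b * (H_root_density x b * mean_progeny x b / ?E)) * f b
        = ennreal (indicator {0..} b * H_root_density x b) * (ennreal (mean_progeny x b) * f b) / ennreal ?E"
      by (simp add: divide_ennreal_def mult_ac)
  qed
  also have "\<dots> = (\<integral>\<^sup>+b. ennreal (mean_progeny x b) * f b \<partial>H_root_age x) / ennreal ?E"
    using f by (simp add: nn_integral_H_root_age nn_integral_divide)
  finally show ?thesis .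
qed

lemma child_intensity_simps [simp, measurable_cong]:
  "sets (child_intensity x b) = sets borel" "space (child_intensity x b) = UNIV"
  by (simp_all add: child_intensity_def)

lemma nn_integral_child_intensity:
  assumes "f \<in> borel_measurable borel"
  shows "(\<integral>\<^sup>+a. f a \<partial>child_intensity x b)
    = (\<integral>\<^sup>+a. ennreal (indicator {0..} a * (min b a * (1 / 2) * (sech ((a + x) / 2))\<^sup>2)) * f a \<partial>lborel)"
  unfolding child_intensity_def using assms by (subst nn_integral_density) auto

text \<open>
  The child intensity splits into a symmetric function of the two ages and the law of the root age.
  This is the source of the symmetry between the two ends of an edge.
\<close>

lemma nn_integral_child_intensity_root:
  assumes f: "f \<in> borel_measurable borel"
  shows "(\<integral>\<^sup>+a. f a \<partial>child_intensity x b)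
    = ennreal (1 - tanh (x / 2)) * (\<integral>\<^sup>+a. ennreal (min b a) * f a \<partial>H_root_age x)"
proof -
  have t: "0 < 1 - tanh (x / 2)" using tanh_half_bounds[of "x / 2"] by simp
  have "ennreal (indicator {0..} a * (min b a * (1 / 2) * (sech ((a + x) / 2))\<^sup>2)) * f a
      = ennreal (1 - tanh (x / 2)) * (ennreal (indicator {0..} a * H_root_density x a) * (ennreal (min b a) * f a))" for a
  proof (cases "a \<ge> 0 \<and> b \<ge> 0")
    case True
    have "min b a * (1 / 2) * (sech ((a + x) / 2))\<^sup>2 = (1 - tanh (x / 2)) * (H_root_density x a * min b a)"
    proof -
      have "min b a * (1 / 2) * s = d * (s / (2 * d) * min b a)" if "d > 0" for s d :: real
        using that by (simp add: field_simps)
      from this[OF t] show ?thesis by (simp only: H_root_density_def)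
    qed
    then have "ennreal (indicator {0..} a * (min b a * (1 / 2) * (sech ((a + x) / 2))\<^sup>2))
        = ennreal (1 - tanh (x / 2)) * (ennreal (H_root_density x a) * ennreal (min b a))"
      using True t H_root_density_pos[of x a] by (simp add: ennreal_mult[symmetric])
    then show ?thesis using True by (simp add: mult_ac)
  next
    case False
    then show ?thesis
    proof (cases "a \<ge> 0")
      case True
      with False have "min b a < 0" by auto
      moreover have "indicator {0..} a * (min b a * (1 / 2) * (sech ((a + x) / 2))\<^sup>2) \<le> 0"
        using \<open>min b a < 0\<close> by (auto simp: indicator_def mult_nonpos_nonneg)
      ultimately show ?thesis by (simp add: ennreal_neg)
    qed simp
  qed
  then show ?thesis
    using f by (simp add: nn_integral_child_intensity nn_integral_H_root_age nn_integral_cmult)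
qed

lemma child_intensity_nonpos:
  assumes "b \<le> 0" shows "(\<integral>\<^sup>+a. f a \<partial>child_intensity x b) = 0"
proof -
  have "child_intensity x b = density lborel (\<lambda>_. 0)"
    unfolding child_intensity_def
  proof (rule density_cong)
    show "AE a in lborel. ennreal (indicator {0..} a * (min b a * (1 / 2) * (sech ((a + x) / 2))\<^sup>2)) = 0"
      using assms by (intro AE_I2) (auto simp: indicator_def ennreal_eq_0_iff mult_nonpos_nonneg)
  qed auto
  moreover have "emeasure (density lborel (\<lambda>_. 0)) A = 0" if "A \<in> sets borel" for A :: "real set"
    using that by (simp add: emeasure_density)
  ultimately have "AE a in child_intensity x b. False"
    by (intro AE_I[where N = UNIV]) auto
  then have "AE a in child_intensity x b. f a = 0" by eventually_elim simp
  from nn_integral_cong_AE[OF this] show ?thesis by simp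
qed

lemma measurable_poisson_child_intensity:
  "(\<lambda>b. poisson_points (child_intensity x b)) \<in> borel \<rightarrow>\<^sub>M prob_algebra (config_space borel)"
proof (rule measurable_poisson_points[OF finite_measure_child_intensity])
  fix A :: "real set" assume A [measurable]: "A \<in> sets borel"
  have "emeasure (child_intensity x b) A = (\<integral>\<^sup>+a. ennreal (indicator {0..} a * (min b a * (1 / 2) * (sech ((a + x) / 2))\<^sup>2)) * indicator A a \<partial>lborel)" for b
    unfolding child_intensity_def using A by (intro emeasure_density) simp_all
  moreover have "(\<lambda>b. \<integral>\<^sup>+a. ennreal (indicator {0..} a * (min b a * (1 / 2) * (sech ((a + x) / 2))\<^sup>2)) * indicator A a \<partial>lborel) \<in> borel_measurable borel"
    using A by (intro lborel.borel_measurable_nn_integral) measurable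
  ultimately show "(\<lambda>b. emeasure (child_intensity x b) A) \<in> borel_measurable borel" by simp
qed auto

section \<open>The children of a spinal vertex\<close>

text \<open>
  The spine moves by the Doob transform of the child intensity by \<open>mean_progeny\<close>: stopping has
  weight 1 and moving to a child of age \<open>a\<close> has weight \<open>mean_progeny x a\<close>, and these weights add
  up to \<open>mean_progeny x b\<close>.
\<close>

lemma spinal_child_in_prob_algebra:
  assumes x: "x > 0"
  shows "spinal_child x b \<in> space (prob_algebra (option_space borel))" (is ?in)
    and nn_integral_spinal_child: "\<phi> \<in> borel_measurable (option_space borel) \<Longrightarrow>
      ennreal (mean_progeny x b) * (\<integral>\<^sup>+z. \<phi> z \<partial>spinal_child x b)
        = \<phi> None + (\<integral>\<^sup>+a. ennreal (mean_progeny x a) * \<phi> (Some a) \<partial>child_intensity x b)" (is "_ \<Longrightarrow> ?eq")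
proof -
  let ?O = "option_space (borel :: real measure)"
  have sO: "space ?O = UNIV" by (simp add: space_option_space_UNIV)
  have "?in \<and> (\<phi> \<in> borel_measurable ?O \<longrightarrow> ?eq)"
  \<comment> \<open>At age zero \<open>mean_progeny\<close> is 1, there is no spinal child, and the child intensity vanishes.\<close>
  proof (cases "b \<le> 0")
    case True
    then show ?thesis
      using x by (simp add: spinal_child_def space_prob_algebra prob_space_return sO nn_integral_return
          child_intensity_nonpos mean_progeny_def)
  next
    case False
    define t where "t = tanh (x / 2)"
    define T where "T = tanh ((b + x) / 2)"
    have t: "0 < t" "t < T" "T < 1" using x False tanh_half_bounds by (auto simp: t_def T_def)
    define d where "d a = indicator {0..} a * (min b a * (sech ((a + x) / 2))\<^sup>2 * tanh ((a + x) / 2) / (2 * (T - t)))" for a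
    have [measurable]: "d \<in> borel_measurable borel" unfolding d_def[abs_def] by measurable
    have d0: "d a \<ge> 0" for a
      using False x t by (auto simp: d_def indicator_def intro!: divide_nonneg_pos mult_nonneg_nonneg)
    let ?D = "density lborel (\<lambda>a. ennreal (d a))"
    have "emeasure ?D (space ?D) = (\<integral>\<^sup>+a. ennreal (1 / (T - t)) * ennreal (indicator {0..} a * (min b a * (sech ((a + x) / 2))\<^sup>2 * tanh ((a + x) / 2) / 2)) \<partial>lborel)"
      using t by (auto simp: emeasure_density d_def ennreal_mult'[symmetric] intro!: nn_integral_cong arg_cong[where f = ennreal])
    also have "\<dots> = ennreal (1 / (T - t)) * ennreal (T - t)"
      using nn_integral_min_sech_tanh[OF x, of b] False by (simp add: nn_integral_cmult T_def t_def)
    also have "\<dots> = 1" using t by (simp add: ennreal_mult'[symmetric])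
    finally have D: "prob_space ?D" by (intro prob_spaceI)
    define k where "k none = (if none then return ?O None else distr ?D ?O Some)" for none
    have Some_m: "Some \<in> ?D \<rightarrow>\<^sub>M ?O" using measurable_Some[of borel] by simp
    have k_prob: "prob_space (k none)" "sets (k none) = sets ?O" for none
      using prob_space.prob_space_distr[OF D Some_m] by (auto simp: k_def prob_space_return sO)
    have k: "k \<in> measure_pmf (bernoulli_pmf (t / T)) \<rightarrow>\<^sub>M prob_algebra ?O"
      using k_prob by (simp add: space_prob_algebra)
    have Z: "spinal_child x b = measure_pmf (bernoulli_pmf (t / T)) \<bind> k"
      unfolding spinal_child_def k_def d_def T_def t_def using False by simp
    have pm: "measure_pmf (bernoulli_pmf (t / T)) \<in> space (prob_algebra (count_space UNIV))"
      by (simp add: space_prob_algebra prob_space_measure_pmf)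
    have k': "k \<in> count_space UNIV \<rightarrow>\<^sub>M prob_algebra ?O" using k by simp
    have ?in
      unfolding Z using prob_space_bind'[OF pm k'] sets_bind'[OF pm k'] by (simp add: space_prob_algebra)
    moreover have ?eq if \<phi>: "\<phi> \<in> borel_measurable ?O"
    proof -
      have m: "(\<lambda>a. \<phi> (Some a)) \<in> borel_measurable borel"
        using measurable_compose[OF measurable_Some \<phi>] .
      have "(\<integral>\<^sup>+z. \<phi> z \<partial>spinal_child x b) = (\<integral>\<^sup>+none. (\<integral>\<^sup>+z. \<phi> z \<partial>k none) \<partial>measure_pmf (bernoulli_pmf (t / T)))"
        unfolding Z by (rule nn_integral_bind[OF \<phi> measurable_prob_algebraD[OF k]])
      also have "\<dots> = \<phi> None * ennreal (t / T) + (\<integral>\<^sup>+a. ennreal (d a) * \<phi> (Some a) \<partial>lborel) * ennreal (1 - t / T)"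
        using t \<phi> m Some_m by (simp add: k_def nn_integral_return sO nn_integral_distr nn_integral_density)
      finally have I: "(\<integral>\<^sup>+z. \<phi> z \<partial>spinal_child x b) = \<dots>" .
      have M: "mean_progeny x b = T / t" using False by (simp add: mean_progeny_def T_def t_def)
      have 1: "ennreal (T / t) * ennreal (t / T) = 1" using t by (simp add: ennreal_mult'[symmetric])
      have 2: "ennreal (T / t) * ennreal (1 - t / T) = ennreal ((T - t) / t)"
        using t by (simp add: ennreal_mult'[symmetric] field_simps)
      have 3: "ennreal ((T - t) / t) * ennreal (d a) = ennreal (indicator {0..} a * (min b a * (1 / 2) * (sech ((a + x) / 2))\<^sup>2)) * ennreal (mean_progeny x a)" for a
      proof (cases "a \<ge> 0")
        case True
        have eq: "(T - t) / t * d a = min b a * (1 / 2) * (sech ((a + x) / 2))\<^sup>2 * mean_progeny x a"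
          using True t by (simp add: d_def mean_progeny_def t_def[symmetric] field_simps)
        have "ennreal ((T - t) / t) * ennreal (d a) = ennreal ((T - t) / t * d a)"
          using t d0[of a] by (intro ennreal_mult[symmetric]) auto
        also have "\<dots> = ennreal (min b a * (1 / 2) * (sech ((a + x) / 2))\<^sup>2 * mean_progeny x a)"
          by (simp only: eq)
        also have "\<dots> = ennreal (min b a * (1 / 2) * (sech ((a + x) / 2))\<^sup>2) * ennreal (mean_progeny x a)"
          using True False mean_progeny_bounds(1)[OF x, of a] by (intro ennreal_mult) auto
        finally show ?thesis using True by simp
      qed (simp add: d_def)
      have "ennreal (mean_progeny x b) * (\<integral>\<^sup>+z. \<phi> z \<partial>spinal_child x b)
        = (ennreal (T / t) * ennreal (t / T)) * \<phi> None
          + (ennreal (T / t) * ennreal (1 - t / T)) * (\<integral>\<^sup>+a. ennreal (d a) * \<phi> (Some a) \<partial>lborel)"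
        unfolding I M by (simp only: distrib_left mult_ac)
      also have "\<dots> = \<phi> None + (\<integral>\<^sup>+a. ennreal ((T - t) / t) * (ennreal (d a) * \<phi> (Some a)) \<partial>lborel)"
        unfolding 1 2 using m by (simp add: nn_integral_cmult)
      also have "(\<integral>\<^sup>+a. ennreal ((T - t) / t) * (ennreal (d a) * \<phi> (Some a)) \<partial>lborel)
          = (\<integral>\<^sup>+a. ennreal (mean_progeny x a) * \<phi> (Some a) \<partial>child_intensity x b)"
        using m by (subst nn_integral_child_intensity) (simp_all add: mult.assoc[symmetric] 3)
      finally show ?eq .
    qed
    ultimately show ?thesis by blast
  qed
  then show ?in "\<phi> \<in> borel_measurable ?O \<Longrightarrow> ?eq" by auto
qed

text \<open>
  The two possible child configurations of a spinal vertex, obtained from an unlabelled one: no child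
  is spinal, or exactly the child with index \<open>i\<close> is.
\<close>

definition unmarked :: "nat \<times> (nat \<Rightarrow> real) \<Rightarrow> nat \<times> (nat \<Rightarrow> real \<times> bool)" where
  "unmarked c = (fst c, \<lambda>i. (snd c i, False))"

definition mark_child :: "nat \<Rightarrow> nat \<times> (nat \<Rightarrow> real) \<Rightarrow> nat \<times> (nat \<Rightarrow> real \<times> bool)" where
  "mark_child i c = (fst c, \<lambda>k. (snd c k, k = i))"

lemma insert_spinal_None: "insert_spinal j None c = unmarked c"
  by (simp add: insert_spinal_def unmarked_def split_beta)

lemma insert_spinal_Some: "insert_spinal j (Some a) c = mark_child j (Suc (fst c), insert_point j a (snd c))"
  by (auto simp: insert_spinal_def mark_child_def insert_point_def split_beta fun_eq_iff)

lemma space_age_spine_space: "space age_spine_space = UNIV"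
  by (simp add: space_pair_measure)

lemma measurable_unmarked: "unmarked \<in> config_space borel \<rightarrow>\<^sub>M config_space age_spine_space"
  by (rule measurable_into_config_space[OF space_age_spine_space]) (simp_all add: unmarked_def)

lemma measurable_mark_child: "mark_child i \<in> config_space borel \<rightarrow>\<^sub>M config_space age_spine_space"
  by (rule measurable_into_config_space[OF space_age_spine_space]) (simp_all add: mark_child_def)

lemma measurable_is_None [measurable]: "Measurable.pred (option_space S) (\<lambda>z. z = None)"
  using measurable_case_option[of True "count_space UNIV" "\<lambda>_. False" S]
  by (rule measurable_cong[THEN iffD1, rotated]) (auto split: option.splits)

lemma measurable_the [measurable]: "(the :: real option \<Rightarrow> real) \<in> option_space borel \<rightarrow>\<^sub>M borel"
  using measurable_case_option[of "the None" borel "\<lambda>a :: real. a" borel]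
  by (rule measurable_cong[THEN iffD1, rotated]) (auto split: option.splits)

lemma measurable_insert_spinal:
  "(\<lambda>p. insert_spinal j (snd p) (fst p)) \<in> config_space borel \<Otimes>\<^sub>M option_space borel \<rightarrow>\<^sub>M config_space age_spine_space"
proof (rule measurable_into_config_space[OF space_age_spine_space])
  let ?P = "config_space (borel :: real measure) \<Otimes>\<^sub>M option_space (borel :: real measure)"
  have N: "Measurable.pred ?P (\<lambda>p. snd p = None)"
    by (rule measurable_compose[OF measurable_snd measurable_is_None])
  have f: "(\<lambda>p. fst (fst p)) \<in> ?P \<rightarrow>\<^sub>M count_space UNIV"
    by (rule measurable_compose[OF measurable_fst measurable_fst_config])
  have s: "(\<lambda>p. snd (fst p) i) \<in> ?P \<rightarrow>\<^sub>M borel" for i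
    by (rule measurable_compose[OF measurable_fst measurable_snd_config])
  have t: "(\<lambda>p. the (snd p)) \<in> ?P \<rightarrow>\<^sub>M borel"
    by (rule measurable_compose[OF measurable_snd measurable_the])
  have "(\<lambda>p. if snd p = None then fst (fst p) else Suc (fst (fst p))) \<in> ?P \<rightarrow>\<^sub>M count_space UNIV"
    using N f by measurable
  then show "(\<lambda>p. fst (insert_spinal j (snd p) (fst p))) \<in> ?P \<rightarrow>\<^sub>M count_space UNIV"
    by (rule measurable_cong[THEN iffD1, rotated]) (auto simp: insert_spinal_def split: option.splits)
  fix i
  have "(\<lambda>p. if snd p = None \<or> i < j then (snd (fst p) i, False)
      else if i = j then (the (snd p), True) else (snd (fst p) (i - 1), False)) \<in> ?P \<rightarrow>\<^sub>M age_spine_space"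
    using N s t by measurable
  then show "(\<lambda>p. snd (insert_spinal j (snd p) (fst p)) i) \<in> ?P \<rightarrow>\<^sub>M age_spine_space"
    by (rule measurable_cong[THEN iffD1, rotated]) (auto simp: insert_spinal_def split: option.splits)
qed

text \<open>
  The spinal child is inserted at a uniform position among the other children; integrals over the
  position are averages.
\<close>

lemma spinal_insertion:
  assumes P: "P \<in> space (prob_algebra (config_space borel))"
    and Z: "Z \<in> space (prob_algebra (option_space borel))"
  defines "L \<equiv> P \<bind> (\<lambda>c. Z \<bind> (\<lambda>z. measure_pmf (pmf_of_set {..fst c}) \<bind> (\<lambda>j.
      return (config_space age_spine_space) (insert_spinal j z c))))"
  shows "L \<in> space (prob_algebra (config_space age_spine_space))"
    and "\<phi> \<in> borel_measurable (config_space age_spine_space) \<Longrightarrow> (\<integral>\<^sup>+d. \<phi> d \<partial>L) =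
      (\<integral>\<^sup>+c. (\<integral>\<^sup>+z. (\<Sum>j\<le>fst c. \<phi> (insert_spinal j z c)) / of_nat (Suc (fst c)) \<partial>Z) \<partial>P)"
proof -
  let ?C = "config_space (borel :: real measure)" and ?O = "option_space (borel :: real measure)"
  let ?C' = "config_space age_spine_space"
  have i: "(\<lambda>q. return ?C' (insert_spinal (snd q) (snd (fst q)) (fst (fst q)))) \<in> (?C \<Otimes>\<^sub>M ?O) \<Otimes>\<^sub>M count_space UNIV \<rightarrow>\<^sub>M prob_algebra ?C'"
  proof (rule measurable_compose[OF _ measurable_return_prob_space])
    show "(\<lambda>q. insert_spinal (snd q) (snd (fst q)) (fst (fst q))) \<in> (?C \<Otimes>\<^sub>M ?O) \<Otimes>\<^sub>M count_space UNIV \<rightarrow>\<^sub>M ?C'"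
      by (rule measurable_compose_countable[where f = "\<lambda>j q. insert_spinal j (snd (fst q)) (fst (fst q))", OF _ measurable_snd])
        (rule measurable_compose[OF measurable_fst measurable_insert_spinal])
  qed
  have u: "(\<lambda>p. measure_pmf (pmf_of_set {..fst (fst p)})) \<in> ?C \<Otimes>\<^sub>M ?O \<rightarrow>\<^sub>M prob_algebra (count_space UNIV)"
    by (rule measurable_compose[OF measurable_compose[OF measurable_fst measurable_fst_config]])
      (simp add: space_prob_algebra prob_space_measure_pmf)
  have k: "(\<lambda>p. measure_pmf (pmf_of_set {..fst (fst p)}) \<bind> (\<lambda>j. return ?C' (insert_spinal j (snd p) (fst p)))) \<in> ?C \<Otimes>\<^sub>M ?O \<rightarrow>\<^sub>M prob_algebra ?C'"
    by (rule measurable_bind_prob_space2[OF u]) (use i in \<open>simp add: split_beta\<close>)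
  have k1: "(\<lambda>c. Z \<bind> (\<lambda>z. measure_pmf (pmf_of_set {..fst c}) \<bind> (\<lambda>j. return ?C' (insert_spinal j z c)))) \<in> ?C \<rightarrow>\<^sub>M prob_algebra ?C'"
    by (rule measurable_bind_prob_space2[OF measurable_const[OF Z]]) (use k in \<open>simp add: split_beta\<close>)
  show "L \<in> space (prob_algebra ?C')"
    using prob_space_bind'[OF P k1] sets_bind'[OF P k1] by (simp add: L_def space_prob_algebra)
  assume \<phi>: "\<phi> \<in> borel_measurable ?C'"
  have sP: "sets P = sets ?C" "space P = UNIV" and sZ: "sets Z = sets ?O" "space Z = UNIV"
    using P Z sets_eq_imp_space_eq[of P ?C] sets_eq_imp_space_eq[of Z ?O]
    by (auto simp: space_prob_algebra space_config_space space_option_space_UNIV)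
  have k2: "(\<lambda>z. measure_pmf (pmf_of_set {..fst c}) \<bind> (\<lambda>j. return ?C' (insert_spinal j z c))) \<in> ?O \<rightarrow>\<^sub>M prob_algebra ?C'" for c
    using measurable_Pair2[OF k, of c] by (simp add: space_config_space)
  have j: "(\<integral>\<^sup>+d. \<phi> d \<partial>(measure_pmf (pmf_of_set {..fst c}) \<bind> (\<lambda>j. return ?C' (insert_spinal j z c))))
      = (\<Sum>j\<le>fst c. \<phi> (insert_spinal j z c)) / of_nat (Suc (fst c))" for c z
  proof -
    have "(\<integral>\<^sup>+d. \<phi> d \<partial>(measure_pmf (pmf_of_set {..fst c}) \<bind> (\<lambda>j. return ?C' (insert_spinal j z c))))
      = (\<integral>\<^sup>+j. (\<integral>\<^sup>+d. \<phi> d \<partial>return ?C' (insert_spinal j z c)) \<partial>measure_pmf (pmf_of_set {..fst c}))"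
      by (rule nn_integral_bind[OF \<phi>])
        (simp add: space_subprob_algebra subprob_space_return space_config_space space_age_spine_space)
    also have "\<dots> = (\<integral>\<^sup>+j. \<phi> (insert_spinal j z c) \<partial>measure_pmf (pmf_of_set {..fst c}))"
      using \<phi> by (simp add: nn_integral_return space_config_space space_age_spine_space)
    finally show ?thesis by (simp add: nn_integral_pmf_of_set)
  qed
  have "(\<integral>\<^sup>+d. \<phi> d \<partial>L) = (\<integral>\<^sup>+c. (\<integral>\<^sup>+d. \<phi> d \<partial>(Z \<bind> (\<lambda>z. measure_pmf (pmf_of_set {..fst c}) \<bind> (\<lambda>j. return ?C' (insert_spinal j z c))))) \<partial>P)"
    unfolding L_def using measurable_prob_algebraD[OF k1]
    by (intro nn_integral_bind[OF \<phi>]) (simp add: measurable_cong_sets[OF sP(1) refl])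
  also have "\<dots> = (\<integral>\<^sup>+c. (\<integral>\<^sup>+z. (\<integral>\<^sup>+d. \<phi> d \<partial>(measure_pmf (pmf_of_set {..fst c}) \<bind> (\<lambda>j. return ?C' (insert_spinal j z c)))) \<partial>Z) \<partial>P)"
    using measurable_prob_algebraD[OF k2] unfolding measurable_cong_sets[OF sZ(1) refl, symmetric]
    by (intro nn_integral_cong) (rule nn_integral_bind[OF \<phi>])
  finally show "(\<integral>\<^sup>+d. \<phi> d \<partial>L) =
      (\<integral>\<^sup>+c. (\<integral>\<^sup>+z. (\<Sum>j\<le>fst c. \<phi> (insert_spinal j z c)) / of_nat (Suc (fst c)) \<partial>Z) \<partial>P)"
    by (simp only: j)
qed

lemma average_const: "(\<Sum>j\<le>(n::nat). (c :: ennreal)) / of_nat (Suc n) = c"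
proof -
  have "(\<Sum>j\<le>n. c) / of_nat (Suc n) = c * of_nat (Suc n) / of_nat (Suc n)"
    by (simp add: mult.commute)
  also have "\<dots> = c" by (rule mult_divide_eq_ennreal) (auto simp del: of_nat_Suc)
  finally show ?thesis .
qed

lemma poisson_child_in: "poisson_points (child_intensity x b) \<in> space (prob_algebra (config_space borel))"
  using measurable_space[OF measurable_poisson_child_intensity, of b x] by simp

lemma Hhat_children_in:
  assumes x: "x > 0"
  shows "Hhat_children x l \<in> space (prob_algebra (config_space age_spine_space))"
proof -
  obtain b s where l: "l = (b, s)" by (cases l)
  have "(if s then spinal_child x b else return (option_space borel) None) \<in> space (prob_algebra (option_space borel))"
    using spinal_child_in_prob_algebra(1)[OF x, of b]
    by (auto simp: space_prob_algebra prob_space_return space_option_space_UNIV)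
  from spinal_insertion(1)[OF poisson_child_in this] show ?thesis
    by (simp add: l Hhat_children_def)
qed

lemma nn_integral_Hhat_children_False:
  assumes \<phi>: "\<phi> \<in> borel_measurable (config_space age_spine_space)"
  shows "(\<integral>\<^sup>+d. \<phi> d \<partial>Hhat_children x (b, False)) = (\<integral>\<^sup>+c. \<phi> (unmarked c) \<partial>poisson_points (child_intensity x b))"
proof -
  have Z: "return (option_space borel) None \<in> space (prob_algebra (option_space (borel :: real measure)))"
    by (auto simp: space_prob_algebra prob_space_return space_option_space_UNIV)
  have m: "(\<lambda>z. (\<Sum>j\<le>fst c. \<phi> (insert_spinal j z c)) / d) \<in> borel_measurable (option_space borel)" for c d
  proof -
    have "(\<lambda>z. insert_spinal j z c) \<in> option_space borel \<rightarrow>\<^sub>M config_space age_spine_space" for j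
      using measurable_Pair2[OF measurable_insert_spinal, of c j] by (simp add: space_config_space)
    from measurable_compose[OF this \<phi>] show ?thesis by measurable
  qed
  show ?thesis
    unfolding Hhat_children_def using spinal_insertion(2)[OF poisson_child_in[of x b] Z \<phi>] m
    by (simp add: nn_integral_return space_option_space_UNIV insert_spinal_None average_const del: of_nat_Suc sum_constant)
qed

lemma Hhat_children_False:
  assumes x: "x > 0"
  shows "Hhat_children x (b, False) = distr (poisson_points (child_intensity x b)) (config_space age_spine_space) unmarked"
proof (rule measure_eqI)
  have sets: "sets (Hhat_children x (b, False)) = sets (config_space age_spine_space)"
    using Hhat_children_in[OF x] by (simp add: space_prob_algebra)
  have s: "sets (poisson_points (child_intensity x b)) = sets (config_space borel)"
    using poisson_child_in by (simp add: space_prob_algebra)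
  show "sets (Hhat_children x (b, False)) = sets (distr (poisson_points (child_intensity x b)) (config_space age_spine_space) unmarked)"
    by (simp add: sets)
  fix A assume "A \<in> sets (Hhat_children x (b, False))"
  then have A: "A \<in> sets (config_space age_spine_space)" by (simp add: sets)
  have um: "unmarked \<in> poisson_points (child_intensity x b) \<rightarrow>\<^sub>M config_space age_spine_space"
    using measurable_unmarked by (simp add: measurable_cong_sets[OF s refl])
  have "emeasure (Hhat_children x (b, False)) A = (\<integral>\<^sup>+d. indicator A d \<partial>Hhat_children x (b, False))"
    using A sets by simp
  also have "\<dots> = (\<integral>\<^sup>+c. indicator A (unmarked c) \<partial>poisson_points (child_intensity x b))"
    using A by (intro nn_integral_Hhat_children_False) simp
  also have "\<dots> = (\<integral>\<^sup>+d. indicator A d \<partial>distr (poisson_points (child_intensity x b)) (config_space age_spine_space) unmarked)"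
    using A um by (subst nn_integral_distr) simp_all
  finally show "emeasure (Hhat_children x (b, False)) A
      = emeasure (distr (poisson_points (child_intensity x b)) (config_space age_spine_space) unmarked) A"
    using A by simp
qed

text \<open>
  Seen from a spinal vertex, adding a spinal child to the Poisson children amounts to choosing one of
  the Poisson children as the spinal one: the Mecke formula turns the inserted child, whose position
  is uniform, into a sum over the existing children, and the weights are those of
  \<open>nn_integral_spinal_child\<close>.
\<close>

theorem nn_integral_Hhat_children_True:
  assumes x: "x > 0" and \<phi>: "\<phi> \<in> borel_measurable (config_space age_spine_space)"
  shows "ennreal (mean_progeny x b) * (\<integral>\<^sup>+d. \<phi> d \<partial>Hhat_children x (b, True))
    = (\<integral>\<^sup>+c. \<phi> (unmarked c) + (\<Sum>i<fst c. ennreal (mean_progeny x (snd c i)) * \<phi> (mark_child i c))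
        \<partial>poisson_points (child_intensity x b))"
proof -
  let ?C = "config_space (borel :: real measure)" and ?O = "option_space (borel :: real measure)"
  let ?P = "poisson_points (child_intensity x b)" and ?Z = "spinal_child x b"
  let ?L = "child_intensity x b"
  define S where "S c z = (\<Sum>j\<le>fst c. \<phi> (insert_spinal j z c)) / of_nat (Suc (fst c))" for c z
  interpret P: prob_space ?P using poisson_child_in by (simp add: space_prob_algebra)
  interpret L: finite_measure ?L by (rule finite_measure_child_intensity)
  interpret PL: pair_sigma_finite ?P ?L ..
  have sP: "sets ?P = sets ?C" using poisson_child_in by (simp add: space_prob_algebra)
  have Sm: "(\<lambda>p. S (fst p) (snd p)) \<in> borel_measurable (?C \<Otimes>\<^sub>M ?O)"
  proof -
    have f: "(\<lambda>p. fst (fst p)) \<in> ?C \<Otimes>\<^sub>M ?O \<rightarrow>\<^sub>M count_space UNIV"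
      by (rule measurable_compose[OF measurable_fst measurable_fst_config])
    have "(\<lambda>p. (\<Sum>j\<le>n. \<phi> (insert_spinal j (snd p) (fst p))) / of_nat (Suc n)) \<in> borel_measurable (?C \<Otimes>\<^sub>M ?O)" for n
    proof -
      have "(\<lambda>p. (\<Sum>j\<le>n. \<phi> (insert_spinal j (snd p) (fst p))) / d) \<in> borel_measurable (?C \<Otimes>\<^sub>M ?O)" for d
        using measurable_compose[OF measurable_insert_spinal \<phi>] by measurable
      then show ?thesis .
    qed
    from measurable_compose_countable[OF this f] show ?thesis by (simp add: S_def)
  qed
  have Sz: "S c \<in> borel_measurable ?O" for c
    using measurable_Pair2[OF Sm, of c] by (simp add: space_config_space)
  have SN: "S c None = \<phi> (unmarked c)" for c
    unfolding S_def insert_spinal_None by (rule average_const)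
  have Sa: "(\<lambda>p. S (fst p) (Some (snd p))) \<in> borel_measurable (?C \<Otimes>\<^sub>M borel)"
  proof -
    have "(\<lambda>p. (fst p, Some (snd p))) \<in> ?C \<Otimes>\<^sub>M borel \<rightarrow>\<^sub>M ?C \<Otimes>\<^sub>M ?O"
      by (intro measurable_Pair measurable_fst measurable_compose[OF measurable_snd measurable_Some])
    from measurable_compose[OF this Sm] show ?thesis by simp
  qed
  have pair: "(\<lambda>(c, a). ennreal (mean_progeny x a) * S c (Some a)) \<in> borel_measurable (?P \<Otimes>\<^sub>M ?L)"
  proof -
    have "(\<lambda>p. ennreal (mean_progeny x (snd p))) \<in> borel_measurable (?C \<Otimes>\<^sub>M borel)"
      by (rule measurable_compose[OF measurable_snd]) measurable
    with Sa have "(\<lambda>p. ennreal (mean_progeny x (snd p)) * S (fst p) (Some (snd p))) \<in> borel_measurable (?C \<Otimes>\<^sub>M borel)"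
      by measurable
    then show ?thesis
      by (simp add: split_beta measurable_cong_sets[OF sets_pair_measure_cong[OF sP child_intensity_simps(1)] refl])
  qed
  define f where "f i c = ennreal (mean_progeny x (snd c i)) * \<phi> (mark_child i c)" for i c
  have fm: "f i \<in> borel_measurable ?C" for i
  proof -
    have "(\<lambda>c. ennreal (mean_progeny x (snd c i))) \<in> borel_measurable ?C"
      by (rule measurable_compose[OF measurable_snd_config]) measurable
    then show ?thesis unfolding f_def[abs_def]
      using measurable_compose[OF measurable_mark_child \<phi>] by measurable
  qed
  have S0: "(\<lambda>c. S c None) \<in> borel_measurable ?P"
    unfolding SN using measurable_compose[OF measurable_unmarked \<phi>] by (simp add: measurable_cong_sets[OF sP refl])
  have "ennreal (mean_progeny x b) * (\<integral>\<^sup>+d. \<phi> d \<partial>Hhat_children x (b, True))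
      = ennreal (mean_progeny x b) * (\<integral>\<^sup>+c. (\<integral>\<^sup>+z. S c z \<partial>?Z) \<partial>?P)"
    using spinal_insertion(2)[OF poisson_child_in[of x b] spinal_child_in_prob_algebra(1)[OF x, of b] \<phi>]
    by (simp add: Hhat_children_def S_def)
  also have "\<dots> = (\<integral>\<^sup>+c. ennreal (mean_progeny x b) * (\<integral>\<^sup>+z. S c z \<partial>?Z) \<partial>?P)"
  proof (rule nn_integral_cmult[symmetric])
    have "sets ?Z = sets ?O" using spinal_child_in_prob_algebra(1)[OF x, of b] by (simp add: space_prob_algebra)
    then have Z: "?Z \<in> space (subprob_algebra ?O)"
      using spinal_child_in_prob_algebra(1)[OF x, of b] by (simp add: space_prob_algebra space_subprob_algebra prob_space_imp_subprob_space)
    have "(\<lambda>c. \<integral>\<^sup>+z. S c z \<partial>?Z) \<in> borel_measurable ?C"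
      using nn_integral_measurable_subprob_algebra2[of S ?C ?O "\<lambda>_. ?Z"] Sm Z by (simp add: split_beta)
    then show "(\<lambda>c. \<integral>\<^sup>+z. S c z \<partial>?Z) \<in> borel_measurable ?P"
      by (simp add: measurable_cong_sets[OF sP refl])
  qed
  also have "\<dots> = (\<integral>\<^sup>+c. S c None + (\<integral>\<^sup>+a. ennreal (mean_progeny x a) * S c (Some a) \<partial>?L) \<partial>?P)"
    by (intro nn_integral_cong nn_integral_spinal_child[OF x] Sz)
  also have "\<dots> = (\<integral>\<^sup>+c. S c None \<partial>?P) + (\<integral>\<^sup>+c. (\<integral>\<^sup>+a. ennreal (mean_progeny x a) * S c (Some a) \<partial>?L) \<partial>?P)"
    using pair by (intro nn_integral_add S0 L.borel_measurable_nn_integral) simp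
  also have "(\<integral>\<^sup>+c. (\<integral>\<^sup>+a. ennreal (mean_progeny x a) * S c (Some a) \<partial>?L) \<partial>?P)
      = (\<integral>\<^sup>+a. (\<integral>\<^sup>+c. ennreal (mean_progeny x a) * S c (Some a) \<partial>?P) \<partial>?L)"
    using PL.Fubini'[OF pair] by simp
  also have "\<dots> = (\<integral>\<^sup>+a. (\<integral>\<^sup>+c. (\<Sum>j\<le>fst c. f j (Suc (fst c), insert_point j a (snd c))) / of_nat (Suc (fst c)) \<partial>?P) \<partial>?L)"
    by (intro nn_integral_cong)
      (simp add: S_def f_def insert_spinal_Some insert_point_def sum_distrib_left[symmetric] ennreal_times_divide del: of_nat_Suc)
  also have "\<dots> = (\<integral>\<^sup>+c. (\<Sum>i<fst c. f i c) \<partial>?P)"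
  proof (rule nn_integral_poisson_points_Mecke[symmetric, OF finite_measure_child_intensity])
    have "sets (config_space ?L) = sets ?C"
      unfolding config_space_def by (intro sets_pair_measure_cong sets_PiM_cong) auto
    then show "f i \<in> borel_measurable (config_space ?L)" for i
      using fm by (simp cong: measurable_cong_sets)
  qed simp
  also have "(\<integral>\<^sup>+c. S c None \<partial>?P) + (\<integral>\<^sup>+c. (\<Sum>i<fst c. f i c) \<partial>?P) = (\<integral>\<^sup>+c. S c None + (\<Sum>i<fst c. f i c) \<partial>?P)"
    using measurable_sum_lessThan_fst[OF fm] by (intro nn_integral_add[symmetric] S0) (simp add: measurable_cong_sets[OF sP refl])
  finally show ?thesis by (simp add: SN f_def)
qed

lemma measurable_Hhat_children:
  assumes x: "x > 0"
  shows "Hhat_children x \<in> age_spine_space \<rightarrow>\<^sub>M prob_algebra (config_space age_spine_space)"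
proof -
  let ?C' = "config_space age_spine_space"
  have L: "prob_space (Hhat_children x l)" "sets (Hhat_children x l) = sets ?C'" for l
    using Hhat_children_in[OF x] by (auto simp: space_prob_algebra)
  have K: "(\<lambda>b. poisson_points (child_intensity x b)) \<in> borel \<rightarrow>\<^sub>M subprob_algebra (config_space borel)"
    by (rule measurable_prob_algebraD[OF measurable_poisson_child_intensity])
  have "(\<lambda>b. emeasure (Hhat_children x (b, s)) A) \<in> borel_measurable borel" if A: "A \<in> sets ?C'" for s A
  proof (cases s)
    case True
    have ind: "(\<lambda>d. indicator A d :: ennreal) \<in> borel_measurable ?C'" using A by simp
    let ?g = "\<lambda>c. indicator A (unmarked c) + (\<Sum>i<fst c. ennreal (mean_progeny x (snd c i)) * indicator A (mark_child i c)) :: ennreal"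
    have "emeasure (Hhat_children x (b, True)) A = (\<integral>\<^sup>+c. ?g c \<partial>poisson_points (child_intensity x b)) / ennreal (mean_progeny x b)" for b
    proof -
      have m: "mean_progeny x b > 0" using mean_progeny_bounds(1)[OF x, of b] by simp
      have "(\<integral>\<^sup>+c. ?g c \<partial>poisson_points (child_intensity x b)) = ennreal (mean_progeny x b) * emeasure (Hhat_children x (b, True)) A"
        using nn_integral_Hhat_children_True[OF x ind, of b] A L(2) by simp
      then show ?thesis
        using m by (simp add: mult.commute[of "ennreal (mean_progeny x b)"] mult_divide_eq_ennreal)
    qed
    moreover have "?g \<in> borel_measurable (config_space borel)"
    proof -
      have "(\<lambda>c. ennreal (mean_progeny x (snd c i))) \<in> borel_measurable (config_space borel)" for i
        by (rule measurable_compose[OF measurable_snd_config]) measurable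
      then have "(\<lambda>c. ennreal (mean_progeny x (snd c i)) * indicator A (mark_child i c)) \<in> borel_measurable (config_space borel)" for i
        using measurable_compose[OF measurable_mark_child ind] by measurable
      from measurable_sum_lessThan_fst[OF this] show ?thesis
        using measurable_compose[OF measurable_unmarked ind] by measurable
    qed
    from measurable_compose[OF K nn_integral_measurable_subprob_algebra[OF this]]
    have "(\<lambda>b. (\<integral>\<^sup>+c. ?g c \<partial>poisson_points (child_intensity x b)) / ennreal (mean_progeny x b)) \<in> borel_measurable borel"
      by measurable
    ultimately show ?thesis using True by simp
  next
    case False
    have um: "unmarked \<in> poisson_points (child_intensity x b) \<rightarrow>\<^sub>M ?C'" for b
      using measurable_unmarked poisson_child_in[of x b]
      by (simp add: space_prob_algebra cong: measurable_cong_sets)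
    have "emeasure (Hhat_children x (b, False)) A = emeasure (poisson_points (child_intensity x b)) (unmarked -` A)" for b
      using A um poisson_child_in[of x b]
      by (simp add: Hhat_children_False[OF x] emeasure_distr space_prob_algebra)
        (metis Int_UNIV_right sets_eq_imp_space_eq space_borel space_config_space)
    moreover have "unmarked -` A \<in> sets (config_space borel)"
      using measurable_sets[OF measurable_unmarked A] by (simp add: space_config_space)
    ultimately show ?thesis
      using False measurable_emeasure_kernel[OF K] by simp
  qed
  then have "(\<lambda>l. emeasure (Hhat_children x l) A) \<in> borel_measurable age_spine_space" if "A \<in> sets ?C'" for A
    using measurable_compose_countable[of "\<lambda>s l. emeasure (Hhat_children x (fst l, s)) A" age_spine_space borel snd] that
      measurable_compose[OF measurable_fst[of borel "count_space UNIV"]] by simp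
  then show ?thesis
    using L by (intro measurable_prob_algebraI measurable_subprob_algebra) (auto intro: prob_space_imp_subprob_space)
qed

section \<open>The spine as the path to a vertex of the size-biased tree\<close>

lemma measurable_nn_integral_count_space:
  fixes g :: "'c :: countable \<Rightarrow> 'a \<Rightarrow> ennreal"
  assumes "\<And>v. g v \<in> borel_measurable N"
  shows "(\<lambda>t. \<integral>\<^sup>+v. g v t \<partial>count_space UNIV) \<in> borel_measurable N"
proof -
  interpret sigma_finite_measure "count_space (UNIV :: 'c set)"
    by (rule sigma_finite_measure_count_space)
  have "(\<lambda>p. g (snd p) (fst p)) \<in> borel_measurable (N \<Otimes>\<^sub>M count_space UNIV)"
    by (rule measurable_compose_countable[where f = "\<lambda>v p. g v (fst p)", OF _ measurable_snd])
      (rule measurable_compose[OF measurable_fst assms])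
  then show ?thesis by (intro borel_measurable_nn_integral) (simp add: split_beta)
qed

lemma nn_integral_count_space_snoc:
  fixes g :: "'c :: countable list \<Rightarrow> ennreal"
  shows "(\<integral>\<^sup>+v. (\<integral>\<^sup>+i. g (v @ [i]) \<partial>count_space UNIV) \<partial>count_space UNIV)
    = (\<integral>\<^sup>+w. (if w = [] then 0 else g w) \<partial>count_space UNIV)"
proof -
  have "(\<integral>\<^sup>+v. (\<integral>\<^sup>+i. g (v @ [i]) \<partial>count_space UNIV) \<partial>count_space UNIV)
      = (\<integral>\<^sup>+p. g (fst p @ [snd p]) \<partial>count_space UNIV)"
    using nn_integral_fst_count_space[of "\<lambda>p. g (fst p @ [snd p])"] by simp
  also have "\<dots> = (\<integral>\<^sup>+w. g w \<partial>count_space {w. w \<noteq> []})"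
  proof (rule nn_integral_bij_count_space)
    show "bij_betw (\<lambda>p :: 'c list \<times> 'c. fst p @ [snd p]) UNIV {w. w \<noteq> []}"
      by (rule bij_betwI[where g = "\<lambda>w. (butlast w, last w)"]) auto
  qed
  also have "\<dots> = (\<integral>\<^sup>+w. g w * indicator {w. w \<noteq> []} w \<partial>count_space UNIV)"
    by (simp add: nn_integral_count_space_indicator)
  also have "\<dots> = (\<integral>\<^sup>+w. (if w = [] then 0 else g w) \<partial>count_space UNIV)"
    by (intro nn_integral_cong) auto
  finally show ?thesis .
qed

text \<open>
  The tree in which the spine is the path from the root to \<open>v\<close>: its vertices are the ancestors of
  \<open>v\<close>, which are the prefixes of its address.
\<close>

definition mark :: "nat list \<Rightarrow> real ltree \<Rightarrow> (real \<times> bool) ltree" where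
  "mark v t u = map_option (\<lambda>b. (b, prefix u v)) (t u)"

lemma mark_up_to_height: "mark v (up_to_height n t) = up_to_height n (mark v t)"
  by (auto simp: mark_def up_to_height_def restrict_map_def fun_eq_iff)

lemma measurable_mark: "mark v \<in> tree_space borel \<rightarrow>\<^sub>M tree_space age_spine_space"
proof (rule measurable_into_tree_space[OF space_age_spine_space])
  fix u
  have "map_option (\<lambda>b. (b, prefix u v)) \<in> option_space borel \<rightarrow>\<^sub>M option_space age_spine_space"
    by (rule measurable_map_option) simp
  from measurable_compose[OF measurable_tree_component this]
  show "(\<lambda>t. mark v t u) \<in> tree_space borel \<rightarrow>\<^sub>M option_space age_spine_space"
    by (simp add: mark_def)
qed

lemma ltrees_prefix: "t \<in> ltrees \<Longrightarrow> v \<in> dom t \<Longrightarrow> prefix u v \<Longrightarrow> u \<in> dom t"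
proof (induction v rule: rev_induct)
  case (snoc i v)
  then show ?case by (auto simp: ltrees_def dom_def) metis+
qed simp

locale spinal_trees =
  fixes x :: real and M :: "real ltree measure" and M' :: "(real \<times> bool) ltree measure"
  assumes x_pos: "x > 0" and H_law: "H_law x M" and Hhat_law: "Hhat_law x M'"
begin

abbreviation E where "E \<equiv> mean_total_progeny x"
abbreviation m where "m \<equiv> mean_progeny x"
abbreviation K where "K \<equiv> \<lambda>b. poisson_points (child_intensity x b)"
abbreviation K' where "K' \<equiv> Hhat_children x"
abbreviation C where "C \<equiv> config_space (borel :: real measure)"
abbreviation C' where "C' \<equiv> config_space age_spine_space"
abbreviation T where "T \<equiv> tree_space (borel :: real measure)"
abbreviation T' where "T' \<equiv> tree_space age_spine_space"

sublocale H: galton_watson_tree borel K "H_root_age x" M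
  using H_law by unfold_locales
    (auto simp: H_law_def H_root_age_eq intro: measurable_poisson_child_intensity)

sublocale Hhat: galton_watson_tree age_spine_space K'
    "distr (Hhat_root_age x) age_spine_space (\<lambda>b. (b, True))" M'
  using Hhat_law by unfold_locales
    (auto simp: Hhat_law_def space_age_spine_space intro: measurable_Hhat_children[OF x_pos])

text \<open>
  The configurations at absent vertices are normalised separately, because their irrelevant
  points are arbitrary.
\<close>

definition erase_marks :: "real ltree \<Rightarrow> (nat list \<Rightarrow> nat \<times> (nat \<Rightarrow> real)) \<Rightarrow> nat list \<Rightarrow> nat \<times> (nat \<Rightarrow> real \<times> bool)" where
  "erase_marks t c u = (if t u = None then no_points else unmarked (c u))"

lemma measurable_erase_marks: "erase_marks t \<in> PiM UNIV (\<lambda>_. C) \<rightarrow>\<^sub>M PiM UNIV (\<lambda>_. C')"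
proof (rule measurable_PiM_single')
  show "(\<lambda>c. erase_marks t c u) \<in> PiM UNIV (\<lambda>_. C) \<rightarrow>\<^sub>M C'" for u
  proof (cases "t u")
    case None
    then show ?thesis by (simp add: erase_marks_def space_config_space[OF space_age_spine_space])
  next
    case (Some b)
    have "(\<lambda>c. unmarked (c u)) \<in> PiM UNIV (\<lambda>_. C) \<rightarrow>\<^sub>M C'"
      by (rule measurable_compose[OF measurable_component_singleton[of u UNIV "\<lambda>_. C"] measurable_unmarked]) simp
    then show ?thesis using Some by (simp add: erase_marks_def)
  qed
qed (simp add: space_config_space[OF space_age_spine_space])

definition unmarked_law :: "real ltree \<Rightarrow> nat list \<Rightarrow> (nat \<times> (nat \<Rightarrow> real \<times> bool)) measure" where
  "unmarked_law t u = distr (children_law borel K t u) C' (\<lambda>c. if t u = None then no_points else unmarked c)"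

lemma measurable_unmarked_law:
  "(\<lambda>c. if t u = None then no_points else unmarked c) \<in> children_law borel K t u \<rightarrow>\<^sub>M C'"
  using measurable_unmarked H.children_law(2)[of t u]
  by (simp add: space_config_space[OF space_age_spine_space] measurable_cong_sets[OF H.children_law(2)[of t u] refl])

lemma prob_space_unmarked_law: "prob_space (unmarked_law t u)"
  unfolding unmarked_law_def by (intro prob_space.prob_space_distr H.children_law measurable_unmarked_law)

lemma nn_integral_PiM_unmarked_law:
  assumes F: "F \<in> borel_measurable (PiM UNIV (\<lambda>_. C'))"
  shows "(\<integral>\<^sup>+c. F c \<partial>PiM UNIV (unmarked_law t)) = (\<integral>\<^sup>+c. F (erase_marks t c) \<partial>PiM UNIV (children_law borel K t))"
proof -
  have "PiM UNIV (unmarked_law t) = distr (PiM UNIV (children_law borel K t)) (PiM UNIV (\<lambda>_. C'))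
      (\<lambda>c u. if t u = None then no_points else unmarked (c u))"
    unfolding unmarked_law_def[abs_def] by (rule PiM_distr[OF H.children_law(1) measurable_unmarked_law])
  also have "(\<lambda>c u. if t u = None then no_points else unmarked (c u)) = erase_marks t"
    by (simp add: erase_marks_def fun_eq_iff)
  finally show ?thesis
    using F measurable_erase_marks[of t]
    by (simp add: nn_integral_distr measurable_cong_sets[OF H.sets_PiM_children_law refl])
qed

text \<open>
  Off the spine, and at absent addresses, the children in a marked tree have the law of the children
  in the tree without marks.
\<close>

lemma children_law_mark:
  "children_law age_spine_space K' (mark v t) u = (if t u \<noteq> None \<and> prefix u v then K' (the (t u), True) else unmarked_law t u)"
proof (cases "t u")
  case None
  have "distr (return C no_points) C' (\<lambda>c. no_points) = return C' no_points"
    using space_config_space[OF space_age_spine_space] space_config_space[of "borel :: real measure"]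
    by (intro distr_return) auto
  then show ?thesis using None by (simp add: children_law_def unmarked_law_def mark_def)
next
  case (Some b)
  then show ?thesis
    by (simp add: children_law_def mark_def unmarked_law_def Hhat_children_False[OF x_pos])
qed

lemma add_generation_erase_marks:
  assumes "length v \<le> n" and "\<And>u. t u = None \<Longrightarrow> fst (c u) = 0"
  shows "add_generation n (mark v t) (erase_marks t c) = mark v (add_generation n t c)"
proof
  fix u
  show "add_generation n (mark v t) (erase_marks t c) u = mark v (add_generation n t c) u"
  proof (cases "length u = Suc n")
    case True
    then have "\<not> prefix u v" using assms(1) by (auto dest: prefix_length_le)
    then show ?thesis
      using True assms(2)[of "butlast u"]
      by (auto simp: add_generation_def erase_marks_def mark_def unmarked_def no_points_def)
  qed (simp add: add_generation_def mark_def)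
qed

lemma add_generation_mark_child:
  assumes v: "length v = n" "t v \<noteq> None" and c: "\<And>u. t u = None \<Longrightarrow> fst (c u) = 0" and i: "i < fst (c v)"
  shows "add_generation n (mark v t) (\<lambda>u. if u = v then mark_child i (c v) else erase_marks t c u)
    = mark (v @ [i]) (add_generation n t c)"
proof
  fix u
  show "add_generation n (mark v t) (\<lambda>u. if u = v then mark_child i (c v) else erase_marks t c u) u
    = mark (v @ [i]) (add_generation n t c) u"
  proof (cases "length u = Suc n")
    case True
    then obtain w k where u: "u = w @ [k]" by (cases u rule: rev_cases) auto
    have "prefix u (v @ [i]) \<longleftrightarrow> w = v \<and> k = i"
      using True v(1) u by (auto simp: prefix_def)
    then show ?thesis
      using True u c[of w] v
      by (auto simp: add_generation_def erase_marks_def mark_def unmarked_def mark_child_def no_points_def)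
  next
    case False
    have "prefix u (v @ [i]) \<longleftrightarrow> prefix u v"
      using False v(1) by auto
    then show ?thesis using False by (simp add: add_generation_def mark_def)
  qed
qed

text \<open>
  If the spine ended below the last generation, the next generation contains no spinal vertex, and
  it is distributed as in \<open>H\<close>.
\<close>

lemma nn_integral_next_generation_mark_old:
  assumes v: "length v < n" and f: "f \<in> borel_measurable T'"
  shows "(\<integral>\<^sup>+s. f s \<partial>next_generation age_spine_space K' n (mark v t))
    = (\<integral>\<^sup>+s. f (mark v s) \<partial>next_generation borel K n t)"
proof -
  define F where "F c = f (add_generation n (mark v t) c)" for c
  have F: "F \<in> borel_measurable (PiM UNIV (\<lambda>_. C'))"
    unfolding F_def by (rule measurable_compose[OF Hhat.measurable_add_generation f])
  have "(\<integral>\<^sup>+s. f s \<partial>next_generation age_spine_space K' n (mark v t))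
      = (\<integral>\<^sup>+c. F c \<partial>PiM UNIV (children_law age_spine_space K' (mark v t)))"
    unfolding F_def by (rule Hhat.nn_integral_next_generation[OF f])
  also have "\<dots> = (\<integral>\<^sup>+c. F c \<partial>PiM UNIV (unmarked_law t))"
  proof (rule nn_integral_PiM_depends_on[where D = "{u. length u = n}"])
    show "children_law age_spine_space K' (mark v t) u = unmarked_law t u" if "u \<in> {u. length u = n}" for u
      using that v by (auto simp: children_law_mark dest: prefix_length_le)
    show "F c = F c'" if "\<And>u. u \<in> {u. length u = n} \<Longrightarrow> c u = c' u" for c c'
      using that unfolding F_def by (intro arg_cong[where f = f]) (auto simp: add_generation_def fun_eq_iff)
  qed (use F Hhat.children_law prob_space_unmarked_law in \<open>simp_all add: measurable_cong_sets[OF Hhat.sets_PiM_children_law refl]\<close>)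
  also have "\<dots> = (\<integral>\<^sup>+c. F (erase_marks t c) \<partial>PiM UNIV (children_law borel K t))"
    by (rule nn_integral_PiM_unmarked_law[OF F])
  also have "\<dots> = (\<integral>\<^sup>+c. f (mark v (add_generation n t c)) \<partial>PiM UNIV (children_law borel K t))"
    using H.AE_children_law_absent[of t]
    by (intro nn_integral_cong_AE) (auto simp: F_def add_generation_erase_marks[OF less_imp_le[OF v]] elim!: eventually_mono)
  also have "\<dots> = (\<integral>\<^sup>+s. f (mark v s) \<partial>next_generation borel K n t)"
    by (rule H.nn_integral_next_generation[symmetric]) (rule measurable_compose[OF measurable_mark f])
  finally show ?thesis .
qed

text \<open>
  If the spine has reached a vertex \<open>v\<close> in the last generation, then after multiplication by its mean
  progeny the spine either ends there, with weight 1, or continues to one of the children of \<open>v\<close>, with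
  the mean progeny of this child as its weight.
\<close>

lemma nn_integral_next_generation_mark_leaf:
  assumes v: "length v = n" "t v = Some b" and f: "f \<in> borel_measurable T'"
  shows "ennreal (m b) * (\<integral>\<^sup>+s. f s \<partial>next_generation age_spine_space K' n (mark v t))
    = (\<integral>\<^sup>+s. f (mark v s) + (\<integral>\<^sup>+i. (if v @ [i] \<in> dom s then ennreal (m (the (s (v @ [i])))) * f (mark (v @ [i]) s) else 0)
        \<partial>count_space UNIV) \<partial>next_generation borel K n t)"
proof -
  let ?Kt = "children_law borel K t"
  define F where "F c = f (add_generation n (mark v t) c)" for c
  have F: "F \<in> borel_measurable (PiM UNIV (\<lambda>_. C'))"
    unfolding F_def by (rule measurable_compose[OF Hhat.measurable_add_generation f])
  define Q where "Q u = (if u = v then K' (b, True) else unmarked_law t u)" for u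
  have K': "prob_space (K' (b, True))" "sets (K' (b, True)) = sets C'"
    using Hhat_children_in[OF x_pos, of "(b, True)"] by (auto simp: space_prob_algebra)
  have Q: "prob_space (Q u)" "sets (Q u) = sets C'" for u
    using K' prob_space_unmarked_law by (auto simp: Q_def unmarked_law_def)
  have sQ: "sets (PiM UNIV Q) = sets (PiM UNIV (\<lambda>_. C'))" by (intro sets_PiM_cong Q refl)
  define upd where "upd c d = (\<lambda>u. if u = v then d else erase_marks t c u)" for c d
  have upd: "(\<lambda>c. upd c (g c)) \<in> PiM UNIV (\<lambda>_. C) \<rightarrow>\<^sub>M PiM UNIV (\<lambda>_. C')"
    if "g \<in> PiM UNIV (\<lambda>_. C) \<rightarrow>\<^sub>M C'" for g
  proof (rule measurable_PiM_single')
    show "(\<lambda>c. upd c (g c) u) \<in> PiM UNIV (\<lambda>_. C) \<rightarrow>\<^sub>M C'" for u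
      using that measurable_compose[OF measurable_erase_marks measurable_component_singleton[of u UNIV]]
      by (cases "u = v") (auto simp: upd_def)
  qed (simp add: space_config_space[OF space_age_spine_space])
  have updd: "(\<lambda>d. F (upd c d)) \<in> borel_measurable C'" for c
  proof (rule measurable_compose[OF _ F], rule measurable_PiM_single')
    show "(\<lambda>d. upd c d u) \<in> C' \<rightarrow>\<^sub>M C'" for u
      by (cases "u = v") (auto simp: upd_def space_config_space[OF space_age_spine_space])
  qed (simp add: space_config_space[OF space_age_spine_space])
  have updj: "(\<lambda>p. F (upd (fst p) (snd p))) \<in> borel_measurable (PiM UNIV (\<lambda>_. C) \<Otimes>\<^sub>M C')"
  proof (rule measurable_compose[OF _ F], rule measurable_PiM_single')
    show "(\<lambda>p. upd (fst p) (snd p) u) \<in> PiM UNIV (\<lambda>_. C) \<Otimes>\<^sub>M C' \<rightarrow>\<^sub>M C'" for u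
      using measurable_compose[OF measurable_fst measurable_compose[OF measurable_erase_marks measurable_component_singleton[of u UNIV]]]
      by (cases "u = v") (simp_all add: upd_def)
  qed (simp add: space_config_space[OF space_age_spine_space])
  define G where "G c = F (erase_marks t c) + (\<Sum>i<fst (c v). ennreal (m (snd (c v) i)) * F (upd c (mark_child i (c v))))" for c
  have cv: "(\<lambda>c. c v) \<in> PiM UNIV (\<lambda>_. C) \<rightarrow>\<^sub>M C" by simp
  have G: "G \<in> borel_measurable (PiM UNIV (\<lambda>_. C))"
  proof -
    have "(\<lambda>c. ennreal (m (snd (c v) i))) \<in> borel_measurable (PiM UNIV (\<lambda>_. C))" for i
      by (rule measurable_compose[OF measurable_compose[OF cv measurable_snd_config]]) measurable
    moreover have "(\<lambda>c. F (upd c (mark_child i (c v)))) \<in> borel_measurable (PiM UNIV (\<lambda>_. C))" for i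
      by (rule measurable_compose[OF upd F]) (rule measurable_compose[OF cv measurable_mark_child])
    ultimately have "(\<lambda>c. \<Sum>i<N. ennreal (m (snd (c v) i)) * F (upd c (mark_child i (c v)))) \<in> borel_measurable (PiM UNIV (\<lambda>_. C))" for N
      by measurable
    from measurable_compose_countable[OF this measurable_compose[OF cv measurable_fst_config]]
    show ?thesis unfolding G_def
      using measurable_compose[OF measurable_erase_marks F] by measurable
  qed
  have "(\<integral>\<^sup>+s. f s \<partial>next_generation age_spine_space K' n (mark v t))
      = (\<integral>\<^sup>+c. F c \<partial>PiM UNIV (children_law age_spine_space K' (mark v t)))"
    unfolding F_def by (rule Hhat.nn_integral_next_generation[OF f])
  \<comment> \<open>Only the children of the vertices in the last generation are added; among these, \<open>v\<close> is the only
    spinal vertex.\<close>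
  also have "\<dots> = (\<integral>\<^sup>+c. F c \<partial>PiM UNIV Q)"
  proof (rule nn_integral_PiM_depends_on[where D = "{u. length u = n}"])
    show "children_law age_spine_space K' (mark v t) u = Q u" if "u \<in> {u. length u = n}" for u
    proof (cases "u = v")
      case False
      then have "\<not> prefix u v" using that v(1) by (auto simp: prefix_def)
      then show ?thesis using False by (simp add: children_law_mark Q_def)
    qed (use v in \<open>simp add: children_law_mark Q_def\<close>)
    show "F c = F c'" if "\<And>u. u \<in> {u. length u = n} \<Longrightarrow> c u = c' u" for c c'
      using that unfolding F_def by (intro arg_cong[where f = f]) (auto simp: add_generation_def fun_eq_iff)
  qed (use F Hhat.children_law Q in \<open>simp_all add: measurable_cong_sets[OF Hhat.sets_PiM_children_law refl]\<close>)
  also have "\<dots> = (\<integral>\<^sup>+c. (\<integral>\<^sup>+d. F (\<lambda>u. if u = v then d else c u) \<partial>Q v) \<partial>PiM UNIV (unmarked_law t))"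
    using F by (intro nn_integral_PiM_coordinate(1)[where g = "\<lambda>u. u"] Q prob_space_unmarked_law)
      (auto simp: Q_def measurable_cong_sets[OF sQ refl])
  also have "\<dots> = (\<integral>\<^sup>+c. (\<integral>\<^sup>+d. F (upd c d) \<partial>K' (b, True)) \<partial>PiM UNIV ?Kt)"
  proof -
    have "(\<lambda>p. F (\<lambda>u. if u = v then snd p else fst p u)) \<in> borel_measurable (PiM UNIV (\<lambda>_. C') \<Otimes>\<^sub>M C')"
    proof (rule measurable_compose[OF _ F], rule measurable_PiM_single')
      show "(\<lambda>p. if u = v then snd p else fst p u) \<in> PiM UNIV (\<lambda>_. C') \<Otimes>\<^sub>M C' \<rightarrow>\<^sub>M C'" for u
        using measurable_compose[OF measurable_fst measurable_component_singleton[of u UNIV "\<lambda>_. C'"]]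
        by (cases "u = v") simp_all
    qed (simp add: space_config_space[OF space_age_spine_space])
    moreover have "K' (b, True) \<in> space (subprob_algebra C')"
      using K' by (simp add: space_subprob_algebra prob_space_imp_subprob_space)
    ultimately have "(\<lambda>c. \<integral>\<^sup>+d. F (\<lambda>u. if u = v then d else c u) \<partial>K' (b, True)) \<in> borel_measurable (PiM UNIV (\<lambda>_. C'))"
      by (intro nn_integral_measurable_subprob_algebra2[where N = C'] measurable_const) (simp add: split_beta)
    from nn_integral_PiM_unmarked_law[OF this]
    show ?thesis by (simp add: Q_def upd_def)
  qed
  finally have "ennreal (m b) * (\<integral>\<^sup>+s. f s \<partial>next_generation age_spine_space K' n (mark v t))
      = ennreal (m b) * (\<integral>\<^sup>+c. (\<integral>\<^sup>+d. F (upd c d) \<partial>K' (b, True)) \<partial>PiM UNIV ?Kt)"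
    by simp
  also have "\<dots> = (\<integral>\<^sup>+c. ennreal (m b) * (\<integral>\<^sup>+d. F (upd c d) \<partial>K' (b, True)) \<partial>PiM UNIV ?Kt)"
  proof -
    have "K' (b, True) \<in> space (subprob_algebra C')"
      using K' by (simp add: space_subprob_algebra prob_space_imp_subprob_space)
    then have "(\<lambda>c. \<integral>\<^sup>+d. F (upd c d) \<partial>K' (b, True)) \<in> borel_measurable (PiM UNIV (\<lambda>_. C))"
      using updj by (intro nn_integral_measurable_subprob_algebra2[where N = C'] measurable_const) (simp add: split_beta)
    then show ?thesis
      by (intro nn_integral_cmult[symmetric]) (simp add: measurable_cong_sets[OF H.sets_PiM_children_law refl])
  qed
  also have "\<dots> = (\<integral>\<^sup>+c. (\<integral>\<^sup>+d. G (\<lambda>u. if u = v then d else c u) \<partial>?Kt v) \<partial>PiM UNIV ?Kt)"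
  proof (intro nn_integral_cong)
    fix c :: "nat list \<Rightarrow> nat \<times> (nat \<Rightarrow> real)"
    have e: "erase_marks t (\<lambda>u. if u = v then d else c u) = upd c (unmarked d)" for d
      using v by (auto simp: erase_marks_def upd_def fun_eq_iff)
    have e': "upd (\<lambda>u. if u = v then d else c u) d' = upd c d'" for d d'
      by (auto simp: erase_marks_def upd_def fun_eq_iff)
    have "ennreal (m b) * (\<integral>\<^sup>+d. F (upd c d) \<partial>K' (b, True))
        = (\<integral>\<^sup>+d. F (upd c (unmarked d)) + (\<Sum>i<fst d. ennreal (m (snd d i)) * F (upd c (mark_child i d))) \<partial>K b)"
      by (rule nn_integral_Hhat_children_True[OF x_pos updd])
    also have "K b = ?Kt v" using v by (simp add: children_law_def)
    finally show "ennreal (m b) * (\<integral>\<^sup>+d. F (upd c d) \<partial>K' (b, True)) = (\<integral>\<^sup>+d. G (\<lambda>u. if u = v then d else c u) \<partial>?Kt v)"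
      by (simp add: G_def e e')
  qed
  also have "\<dots> = (\<integral>\<^sup>+c. G c \<partial>PiM UNIV ?Kt)"
    using G by (intro nn_integral_PiM_coordinate(1)[where g = "\<lambda>u. u", symmetric] H.children_law)
      (auto simp: measurable_cong_sets[OF H.sets_PiM_children_law refl])
  also have "\<dots> = (\<integral>\<^sup>+c. f (mark v (add_generation n t c)) + (\<integral>\<^sup>+i. (if v @ [i] \<in> dom (add_generation n t c)
      then ennreal (m (the (add_generation n t c (v @ [i])))) * f (mark (v @ [i]) (add_generation n t c)) else 0)
      \<partial>count_space UNIV) \<partial>PiM UNIV ?Kt)"
  proof (rule nn_integral_cong_AE)
    show "AE c in PiM UNIV ?Kt. G c = f (mark v (add_generation n t c)) + (\<integral>\<^sup>+i. (if v @ [i] \<in> dom (add_generation n t c)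
      then ennreal (m (the (add_generation n t c (v @ [i])))) * f (mark (v @ [i]) (add_generation n t c)) else 0)
      \<partial>count_space UNIV)"
      using H.AE_children_law_absent[of t]
    proof eventually_elim
      fix c :: "nat list \<Rightarrow> nat \<times> (nat \<Rightarrow> real)"
      assume "\<forall>u. t u = None \<longrightarrow> fst (c u) = 0"
      then have c: "\<And>u. t u = None \<Longrightarrow> fst (c u) = 0" by blast
      let ?s = "add_generation n t c"
      have s: "?s (v @ [i]) = (if i < fst (c v) then Some (snd (c v) i) else None)" for i
        using v by (simp add: add_generation_def)
      have "(\<integral>\<^sup>+i. (if v @ [i] \<in> dom ?s then ennreal (m (the (?s (v @ [i])))) * f (mark (v @ [i]) ?s) else 0) \<partial>count_space UNIV)
        = (\<integral>\<^sup>+i. (if v @ [i] \<in> dom ?s then ennreal (m (the (?s (v @ [i])))) * f (mark (v @ [i]) ?s) else 0) * indicator {..<fst (c v)} i \<partial>count_space UNIV)"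
        using s by (intro nn_integral_cong) (auto simp: dom_def)
      also have "\<dots> = (\<Sum>i<fst (c v). (if v @ [i] \<in> dom ?s then ennreal (m (the (?s (v @ [i])))) * f (mark (v @ [i]) ?s) else 0))"
        by (simp add: nn_integral_count_space_indicator[symmetric] nn_integral_count_space_finite)
      also have "\<dots> = (\<Sum>i<fst (c v). ennreal (m (snd (c v) i)) * F (upd c (mark_child i (c v))))"
        using s v c by (intro sum.cong refl) (auto simp: F_def upd_def add_generation_mark_child dom_def)
      finally show "G c = f (mark v ?s) + (\<integral>\<^sup>+i. (if v @ [i] \<in> dom ?s
          then ennreal (m (the (?s (v @ [i])))) * f (mark (v @ [i]) ?s) else 0) \<partial>count_space UNIV)"
        using add_generation_erase_marks[of v n t c] v c by (simp add: G_def F_def)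
    qed
  qed
  also have "\<dots> = (\<integral>\<^sup>+s. f (mark v s) + (\<integral>\<^sup>+i. (if v @ [i] \<in> dom s then ennreal (m (the (s (v @ [i])))) * f (mark (v @ [i]) s) else 0)
        \<partial>count_space UNIV) \<partial>next_generation borel K n t)"
  proof (rule H.nn_integral_next_generation[symmetric])
    have "(\<lambda>s. if v @ [i] \<in> dom s then ennreal (m (the (s (v @ [i])))) * f (mark (v @ [i]) s) else 0) \<in> borel_measurable T" for i
    proof -
      have "(\<lambda>s. ennreal (m (the (s (v @ [i]))))) \<in> borel_measurable T"
        by (rule measurable_tree_label) auto
      then show ?thesis using measurable_compose[OF measurable_mark f] by measurable
    qed
    from measurable_nn_integral_count_space[OF this]
    show "(\<lambda>s. f (mark v s) + (\<integral>\<^sup>+i. (if v @ [i] \<in> dom s then ennreal (m (the (s (v @ [i])))) * f (mark (v @ [i]) s) else 0)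
        \<partial>count_space UNIV)) \<in> borel_measurable T"
      using measurable_compose[OF measurable_mark f] by measurable
  qed
  finally show ?thesis .
qed

text \<open>
  The weight of \<open>v\<close> as the end of the spine in a tree of height \<open>n\<close>. A vertex in the last
  generation stands for all its unborn descendants, hence the factor \<open>m\<close>.
\<close>

definition spine_weight :: "nat \<Rightarrow> nat list \<Rightarrow> real ltree \<Rightarrow> ennreal" where
  "spine_weight n v t = (if v \<notin> dom t \<or> length v > n then 0
     else if length v < n then 1 else ennreal (m (the (t v))))"

definition marked_sum :: "nat \<Rightarrow> ((real \<times> bool) ltree \<Rightarrow> ennreal) \<Rightarrow> real ltree \<Rightarrow> ennreal" where
  "marked_sum n f t = (\<integral>\<^sup>+v. spine_weight n v t * f (mark v t) \<partial>count_space UNIV)"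

lemma measurable_label_m: "(\<lambda>t. ennreal (m (the (t v)))) \<in> borel_measurable T"
  by (rule measurable_tree_label) auto

lemma measurable_spine_weight: "spine_weight n v \<in> borel_measurable T"
  unfolding spine_weight_def[abs_def] using measurable_label_m by measurable

lemma measurable_marked_sum: "f \<in> borel_measurable T' \<Longrightarrow> marked_sum n f \<in> borel_measurable T"
  unfolding marked_sum_def[abs_def]
  using measurable_spine_weight measurable_compose[OF measurable_mark]
  by (intro measurable_nn_integral_count_space borel_measurable_times_ennreal)

lemma spine_weight_up_to_height: "spine_weight n v (up_to_height n t) = spine_weight n v t"
  by (auto simp: spine_weight_def up_to_height_def restrict_map_def dom_def)

lemma marked_sum_Suc:
  "marked_sum (Suc n) f s = (\<integral>\<^sup>+v. (if length v < n then (if v \<in> dom s then f (mark v s) else 0)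
      else if length v = n then (if v \<in> dom s then f (mark v s) else 0) +
        (\<integral>\<^sup>+i. (if v @ [i] \<in> dom s then ennreal (m (the (s (v @ [i])))) * f (mark (v @ [i]) s) else 0) \<partial>count_space UNIV)
      else 0) \<partial>count_space UNIV)"
proof -
  define g where "g w = (if length w = Suc n \<and> w \<in> dom s then ennreal (m (the (s w))) * f (mark w s) else 0)" for w
  have "marked_sum (Suc n) f s = (\<integral>\<^sup>+v. (if length v \<le> n \<and> v \<in> dom s then f (mark v s) else 0) + (if v = [] then 0 else g v) \<partial>count_space UNIV)"
    unfolding marked_sum_def by (intro nn_integral_cong) (auto simp: spine_weight_def g_def)
  also have "\<dots> = (\<integral>\<^sup>+v. (if length v \<le> n \<and> v \<in> dom s then f (mark v s) else 0) \<partial>count_space UNIV)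
      + (\<integral>\<^sup>+v. (\<integral>\<^sup>+i. g (v @ [i]) \<partial>count_space UNIV) \<partial>count_space UNIV)"
    unfolding nn_integral_count_space_snoc by (rule nn_integral_add) auto
  also have "\<dots> = (\<integral>\<^sup>+v. (if length v \<le> n \<and> v \<in> dom s then f (mark v s) else 0)
      + (\<integral>\<^sup>+i. g (v @ [i]) \<partial>count_space UNIV) \<partial>count_space UNIV)"
    by (rule nn_integral_add[symmetric]) auto
  also have "\<dots> = (\<integral>\<^sup>+v. (if length v < n then (if v \<in> dom s then f (mark v s) else 0)
      else if length v = n then (if v \<in> dom s then f (mark v s) else 0) +
        (\<integral>\<^sup>+i. (if v @ [i] \<in> dom s then ennreal (m (the (s (v @ [i])))) * f (mark (v @ [i]) s) else 0) \<partial>count_space UNIV)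
      else 0) \<partial>count_space UNIV)"
    by (intro nn_integral_cong) (auto simp: g_def)
  finally show ?thesis .
qed

text \<open>
  The weights of \<open>marked_sum\<close> are a martingale: growing \<open>H\<close> by one generation and then choosing the
  end of the spine is the same as choosing it before and then growing the marked tree.
\<close>

lemma nn_integral_marked_sum_Suc:
  assumes f: "f \<in> borel_measurable T'"
  shows "(\<integral>\<^sup>+s. marked_sum (Suc n) f s \<partial>next_generation borel K n t)
    = marked_sum n (\<lambda>t'. \<integral>\<^sup>+s. f s \<partial>next_generation age_spine_space K' n t') t"
proof -
  let ?N = "next_generation borel K n t"
  have sN: "sets ?N = sets T"
    using measurable_space[OF H.measurable_next_generation, of t n]
    by (simp add: space_prob_algebra space_tree_space)
  interpret N: prob_space ?N
    using measurable_space[OF H.measurable_next_generation, of t n]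
    by (simp add: space_prob_algebra space_tree_space)
  define B where "B v s = (if length v < n then (if v \<in> dom s then f (mark v s) else 0)
      else if length v = n then (if v \<in> dom s then f (mark v s) else 0) +
        (\<integral>\<^sup>+i. (if v @ [i] \<in> dom s then ennreal (m (the (s (v @ [i])))) * f (mark (v @ [i]) s) else 0) \<partial>count_space UNIV)
      else 0)" for v s
  have fm: "(\<lambda>s. f (mark w s)) \<in> borel_measurable T" for w
    by (rule measurable_compose[OF measurable_mark f])
  have kids: "(\<lambda>s. \<integral>\<^sup>+i. (if v @ [i] \<in> dom s then ennreal (m (the (s (v @ [i])))) * f (mark (v @ [i]) s) else 0) \<partial>count_space UNIV)
      \<in> borel_measurable T" for v
    by (rule measurable_nn_integral_count_space) (use fm measurable_label_m in measurable)
  have B: "B v \<in> borel_measurable T" for v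
    unfolding B_def[abs_def] using fm kids by measurable
  have "(\<integral>\<^sup>+s. marked_sum (Suc n) f s \<partial>?N) = (\<integral>\<^sup>+v. (\<integral>\<^sup>+s. B v s \<partial>?N) \<partial>count_space UNIV)"
    unfolding marked_sum_Suc B_def[symmetric]
    using B by (intro nn_integral_count_space_nn_integral) (simp_all add: measurable_cong_sets[OF sN refl])
  also have "\<dots> = marked_sum n (\<lambda>t'. \<integral>\<^sup>+s. f s \<partial>next_generation age_spine_space K' n t') t"
    unfolding marked_sum_def
  proof (intro nn_integral_cong)
    fix v :: "nat list"
    have step: "(\<integral>\<^sup>+s. g s \<partial>?N) = (\<integral>\<^sup>+c. g (add_generation n t c) \<partial>PiM UNIV (children_law borel K t))"
      if "g \<in> borel_measurable T" for g by (rule H.nn_integral_next_generation[OF that])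
    have old: "add_generation n t c v = t v" if "length v \<le> n" for c
      using that by (simp add: add_generation_def)
    consider "length v < n" | "length v = n" | "length v > n" by linarith
    then show "(\<integral>\<^sup>+s. B v s \<partial>?N)
        = spine_weight n v t * (\<integral>\<^sup>+s. f s \<partial>next_generation age_spine_space K' n (mark v t))"
    proof cases
      case 1
      have "(\<integral>\<^sup>+s. B v s \<partial>?N) = (\<integral>\<^sup>+c. (if v \<in> dom t then f (mark v (add_generation n t c)) else 0) \<partial>PiM UNIV (children_law borel K t))"
        unfolding step[OF B] using 1 old by (intro nn_integral_cong) (auto simp: B_def dom_def)
      also have "\<dots> = (if v \<in> dom t then (\<integral>\<^sup>+s. f (mark v s) \<partial>?N) else 0)"
        by (simp add: step[OF fm])
      finally show ?thesis
        using 1 nn_integral_next_generation_mark_old[OF 1 f, of t] by (simp add: spine_weight_def)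
    next
      case 2
      show ?thesis
      proof (cases "t v")
        case None
        have "(\<integral>\<^sup>+s. B v s \<partial>?N) = (\<integral>\<^sup>+c. 0 \<partial>PiM UNIV (children_law borel K t))"
          unfolding step[OF B] using H.AE_children_law_absent[of t] None 2 old
          by (intro nn_integral_cong_AE) (auto simp: B_def add_generation_def dom_def elim!: eventually_mono)
        then show ?thesis using None by (simp add: spine_weight_def dom_def)
      next
        case (Some b)
        have "(\<integral>\<^sup>+s. B v s \<partial>?N) = (\<integral>\<^sup>+s. f (mark v s) + (\<integral>\<^sup>+i. (if v @ [i] \<in> dom s then ennreal (m (the (s (v @ [i])))) * f (mark (v @ [i]) s) else 0)
          \<partial>count_space UNIV) \<partial>?N)"
        proof -
          have m: "(\<lambda>s. f (mark v s) + (\<integral>\<^sup>+i. (if v @ [i] \<in> dom s then ennreal (m (the (s (v @ [i])))) * f (mark (v @ [i]) s) else 0)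
            \<partial>count_space UNIV)) \<in> borel_measurable T"
            by (rule borel_measurable_add[OF fm kids])
          show ?thesis unfolding step[OF B] step[OF m]
            using 2 old Some by (intro nn_integral_cong) (auto simp: B_def dom_def)
        qed
        also have "\<dots> = ennreal (m b) * (\<integral>\<^sup>+s. f s \<partial>next_generation age_spine_space K' n (mark v t))"
          by (rule nn_integral_next_generation_mark_leaf[where t = t and v = v, OF 2 Some f, symmetric])
        finally show ?thesis using 2 Some by (simp add: spine_weight_def dom_def)
      qed
    next
      case 3
      then show ?thesis by (simp add: B_def spine_weight_def)
    qed
  qed
  finally show ?thesis .
qed

lemma E_pos: "E > 0" by (rule mean_total_progeny_pos[OF x_pos])

text \<open>
  Both trees are grown one generation at a time. At the root, the age laws differ by the density
  \<open>m / E\<close>, which is the weight of the root as the end of the spine divided by \<open>E\<close>.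
\<close>

lemma truncated_spine_identity:
  assumes f: "f \<in> borel_measurable T'"
  shows "(\<integral>\<^sup>+t. f (up_to_height n t) \<partial>M') = (\<integral>\<^sup>+t. marked_sum n f (up_to_height n t) \<partial>M) / ennreal E"
  using f
proof (induction n arbitrary: f)
  case 0
  have root: "marked_sum 0 f [[] \<mapsto> b] = ennreal (m b) * f [[] \<mapsto> (b, True)]" for b
  proof -
    have "mark [] [[] \<mapsto> b] = [[] \<mapsto> (b, True)]" by (auto simp: mark_def fun_eq_iff)
    then have "marked_sum 0 f [[] \<mapsto> b] = (\<integral>\<^sup>+v. (ennreal (m b) * f [[] \<mapsto> (b, True)]) * indicator {[] :: nat list} v \<partial>count_space UNIV)"
      unfolding marked_sum_def by (intro nn_integral_cong) (auto simp: spine_weight_def)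
    then show ?thesis by (simp add: nn_integral_cmult_indicator)
  qed
  have r: "(\<lambda>b. [[] \<mapsto> (b, True)]) \<in> borel \<rightarrow>\<^sub>M T'"
  proof (rule measurable_into_tree_space[OF space_age_spine_space])
    fix u :: "nat list"
    have "(\<lambda>b. Some (b, True)) \<in> borel \<rightarrow>\<^sub>M option_space age_spine_space"
      by (rule measurable_compose[OF _ measurable_Some]) simp
    then show "(\<lambda>b. [[] \<mapsto> (b, True)] u) \<in> borel \<rightarrow>\<^sub>M option_space age_spine_space"
      by (cases "u = []") (auto simp: space_option_space)
  qed
  have r': "(\<lambda>l. [[] \<mapsto> l]) \<in> age_spine_space \<rightarrow>\<^sub>M T'"
  proof (rule measurable_into_tree_space[OF space_age_spine_space])
    fix u :: "nat list"
    show "(\<lambda>l. [[] \<mapsto> l] u) \<in> age_spine_space \<rightarrow>\<^sub>M option_space age_spine_space"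
      by (cases "u = []") (auto simp: space_option_space)
  qed
  have "(\<integral>\<^sup>+t. f (up_to_height 0 t) \<partial>M')
      = (\<integral>\<^sup>+l. f [[] \<mapsto> l] \<partial>distr (Hhat_root_age x) age_spine_space (\<lambda>b. (b, True)))"
    by (rule Hhat.nn_integral_up_to_height_0[OF 0])
  also have "\<dots> = (\<integral>\<^sup>+b. f [[] \<mapsto> (b, True)] \<partial>Hhat_root_age x)"
  proof -
    have "(\<lambda>b. (b, True)) \<in> Hhat_root_age x \<rightarrow>\<^sub>M age_spine_space"
      by (simp add: Hhat_root_age_def)
    then show ?thesis
      by (rule nn_integral_distr) (use measurable_compose[OF r' 0] in \<open>simp only: measurable_distr_eq1\<close>)
  qed
  also have "\<dots> = (\<integral>\<^sup>+b. marked_sum 0 f [[] \<mapsto> b] \<partial>H_root_age x) / ennreal E"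
    unfolding root by (rule nn_integral_Hhat_root_age[OF x_pos measurable_compose[OF r 0]])
  also have "(\<integral>\<^sup>+b. marked_sum 0 f [[] \<mapsto> b] \<partial>H_root_age x) = (\<integral>\<^sup>+t. marked_sum 0 f (up_to_height 0 t) \<partial>M)"
    by (rule H.nn_integral_up_to_height_0[OF measurable_marked_sum[OF 0], symmetric])
  finally show ?case .
next
  case (Suc n)
  let ?f' = "\<lambda>t'. \<integral>\<^sup>+s. f s \<partial>next_generation age_spine_space K' n t'"
  have "(\<integral>\<^sup>+t. f (up_to_height (Suc n) t) \<partial>M') = (\<integral>\<^sup>+t. ?f' (up_to_height n t) \<partial>M')"
    by (rule Hhat.nn_integral_up_to_height_Suc[OF Suc.prems])
  also have "\<dots> = (\<integral>\<^sup>+t. marked_sum n ?f' (up_to_height n t) \<partial>M) / ennreal E"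
    by (rule Suc.IH[OF Hhat.measurable_nn_integral_next_generation[OF Suc.prems]])
  also have "(\<integral>\<^sup>+t. marked_sum n ?f' (up_to_height n t) \<partial>M)
      = (\<integral>\<^sup>+t. (\<integral>\<^sup>+s. marked_sum (Suc n) f s \<partial>next_generation borel K n (up_to_height n t)) \<partial>M)"
    by (simp only: nn_integral_marked_sum_Suc[OF Suc.prems])
  also have "\<dots> = (\<integral>\<^sup>+t. marked_sum (Suc n) f (up_to_height (Suc n) t) \<partial>M)"
    by (rule H.nn_integral_up_to_height_Suc[OF measurable_marked_sum[OF Suc.prems], symmetric])
  finally show ?case .
qed

text \<open>
  The candidate for the law of the hatted tree, restricted to spines that end in \<open>V\<close>. The
  restriction to short spines is what can be compared with trees of finite height.
\<close>

definition marked_law :: "nat list set \<Rightarrow> (real \<times> bool) ltree measure" where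
  "marked_law V = distr (density (M \<Otimes>\<^sub>M count_space UNIV)
     (\<lambda>p. (if snd p \<in> V \<and> snd p \<in> dom (fst p) then 1 else 0) / ennreal E)) T' (\<lambda>p. mark (snd p) (fst p))"

lemma sets_marked_law [simp]: "sets (marked_law V) = sets T'"
  by (simp add: marked_law_def)

lemma nn_integral_marked_law:
  assumes f: "f \<in> borel_measurable T'"
  shows "(\<integral>\<^sup>+s. f s \<partial>marked_law V) =
    (\<integral>\<^sup>+t. (\<integral>\<^sup>+v. (if v \<in> V \<and> v \<in> dom t then f (mark v t) else 0) \<partial>count_space UNIV) \<partial>M) / ennreal E"
proof -
  interpret C: sigma_finite_measure "count_space (UNIV :: nat list set)"
    by (rule sigma_finite_measure_count_space)
  let ?D = "M \<Otimes>\<^sub>M count_space (UNIV :: nat list set)"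
  have sD: "sets ?D = sets (T \<Otimes>\<^sub>M count_space UNIV)"
    by (intro sets_pair_measure_cong H.sets_M refl)
  have mk: "(\<lambda>p. mark (snd p) (fst p)) \<in> ?D \<rightarrow>\<^sub>M T'"
    unfolding measurable_cong_sets[OF sD refl]
    by (rule measurable_compose_countable[where f = "\<lambda>v p. mark v (fst p)", OF _ measurable_snd])
      (rule measurable_compose[OF measurable_fst measurable_mark])
  have ind: "(\<lambda>p. (if snd p \<in> V \<and> snd p \<in> dom (fst p) then 1 else 0) / ennreal E) \<in> borel_measurable ?D"
    unfolding measurable_cong_sets[OF sD refl]
  proof (rule measurable_compose_countable[where f = "\<lambda>v p. (if v \<in> V \<and> v \<in> dom (fst p) then 1 else 0) / ennreal E", OF _ measurable_snd])
    fix v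
    have "Measurable.pred (T \<Otimes>\<^sub>M count_space UNIV) (\<lambda>p. v \<in> dom (fst p))"
      by (rule measurable_compose[OF measurable_fst measurable_in_dom])
    then show "(\<lambda>p. (if v \<in> V \<and> v \<in> dom (fst p) then 1 else 0) / ennreal E) \<in> borel_measurable (T \<Otimes>\<^sub>M count_space UNIV)"
      by measurable
  qed
  have "(\<integral>\<^sup>+s. f s \<partial>marked_law V) = (\<integral>\<^sup>+p. f (mark (snd p) (fst p)) \<partial>density ?D
      (\<lambda>p. (if snd p \<in> V \<and> snd p \<in> dom (fst p) then 1 else 0) / ennreal E))"
    unfolding marked_law_def using mk f by (subst nn_integral_distr) simp_all
  also have "\<dots> = (\<integral>\<^sup>+p. (if snd p \<in> V \<and> snd p \<in> dom (fst p) then 1 else 0) / ennreal E * f (mark (snd p) (fst p)) \<partial>?D)"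
    by (rule nn_integral_density[OF ind measurable_compose[OF mk f]])
  also have "\<dots> = (\<integral>\<^sup>+p. (if snd p \<in> V \<and> snd p \<in> dom (fst p) then 1 else 0) * f (mark (snd p) (fst p)) / ennreal E \<partial>?D)"
    by (intro nn_integral_cong) (simp add: divide_ennreal_def mult_ac)
  also have "\<dots> = (\<integral>\<^sup>+t. (\<integral>\<^sup>+v. (if v \<in> V \<and> v \<in> dom t then 1 else 0) * f (mark v t) / ennreal E \<partial>count_space UNIV) \<partial>M)"
  proof (subst C.nn_integral_fst[symmetric])
    have "(\<lambda>p. (if snd p \<in> V \<and> snd p \<in> dom (fst p) then 1 else 0) / ennreal E * f (mark (snd p) (fst p))) \<in> borel_measurable ?D"
      by (rule borel_measurable_times_ennreal[OF ind measurable_compose[OF mk f]])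
    then show "(\<lambda>p. (if snd p \<in> V \<and> snd p \<in> dom (fst p) then 1 else 0) * f (mark (snd p) (fst p)) / ennreal E) \<in> borel_measurable ?D"
      by (simp only: divide_ennreal_def mult_ac)
  qed simp
  also have "\<dots> = (\<integral>\<^sup>+t. (\<integral>\<^sup>+v. (if v \<in> V \<and> v \<in> dom t then f (mark v t) else 0) \<partial>count_space UNIV) / ennreal E \<partial>M)"
    by (intro nn_integral_cong, subst nn_integral_divide[symmetric]) (auto intro!: nn_integral_cong)
  also have "\<dots> = (\<integral>\<^sup>+t. (\<integral>\<^sup>+v. (if v \<in> V \<and> v \<in> dom t then f (mark v t) else 0) \<partial>count_space UNIV) \<partial>M) / ennreal E"
  proof (rule nn_integral_divide)
    have "(\<lambda>t. if v \<in> V \<and> v \<in> dom t then f (mark v t) else 0) \<in> borel_measurable T" for v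
      using measurable_compose[OF measurable_mark f] by measurable
    from measurable_nn_integral_count_space[OF this]
    show "(\<lambda>t. \<integral>\<^sup>+v. (if v \<in> V \<and> v \<in> dom t then f (mark v t) else 0) \<partial>count_space UNIV) \<in> borel_measurable M"
      by (simp add: measurable_cong_sets[OF H.sets_M refl])
  qed
  finally show ?thesis .
qed

lemma emeasure_marked_law:
  assumes "A \<in> sets T'"
  shows "emeasure (marked_law V) A =
    (\<integral>\<^sup>+t. (\<integral>\<^sup>+v. (if v \<in> V \<and> v \<in> dom t then indicator A (mark v t) else 0) \<partial>count_space UNIV) \<partial>M) / ennreal E"
  using nn_integral_marked_law[of "indicator A" V] assms by simp

lemma emeasure_marked_law_UNION:
  assumes A: "A \<in> sets T'" and disj: "disjoint_family V"
  shows "emeasure (marked_law (\<Union>i::nat. V i)) A = (\<Sum>i. emeasure (marked_law (V i)) A)"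
proof -
  let ?g = "\<lambda>i t v. if v \<in> V i \<and> v \<in> dom t then indicator A (mark v t) else 0 :: ennreal"
  have sum: "(if v \<in> (\<Union>i. V i) \<and> v \<in> dom t then indicator A (mark v t) else 0) = (\<Sum>i. ?g i t v)" for v and t :: "real ltree"
  proof (cases "\<exists>i. v \<in> V i")
    case True
    then obtain i where i: "v \<in> V i" ..
    then have "v \<in> V j \<longleftrightarrow> j = i" for j
      using disj by (auto simp: disjoint_family_on_def)
    then have "(\<Sum>j. ?g j t v) = (\<Sum>j\<in>{i}. ?g j t v)"
      by (intro suminf_finite) auto
    then show ?thesis using i by auto
  qed auto
  have gm: "(\<lambda>t. \<integral>\<^sup>+v. ?g i t v \<partial>count_space UNIV) \<in> borel_measurable M" for i
  proof -
    have "(\<lambda>t. ?g i t v) \<in> borel_measurable T" for v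
      using measurable_compose[OF measurable_mark borel_measurable_indicator[OF A]] by measurable
    from measurable_nn_integral_count_space[OF this] show ?thesis
      by (simp add: measurable_cong_sets[OF H.sets_M refl])
  qed
  have "(\<integral>\<^sup>+t. (\<integral>\<^sup>+v. (\<Sum>i. ?g i t v) \<partial>count_space UNIV) \<partial>M) = (\<Sum>i. \<integral>\<^sup>+t. (\<integral>\<^sup>+v. ?g i t v \<partial>count_space UNIV) \<partial>M)"
    using gm by (simp add: nn_integral_suminf)
  then show ?thesis
    unfolding emeasure_marked_law[OF A] sum by (simp add: divide_ennreal_def ennreal_suminf_multc)
qed

text \<open>
  The spine has no vertex at height \<open>k\<close> or above; as the spine is a path from the root, it suffices
  to look at height \<open>k\<close> itself.
\<close>

definition spine_below :: "nat \<Rightarrow> (real \<times> bool) ltree set" where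
  "spine_below k = {t. \<forall>u. length u = k \<longrightarrow> (\<forall>b. t u \<noteq> Some (b, True))}"

lemma spine_below_in_sets: "spine_below k \<in> sets T'"
proof -
  have "Measurable.pred age_spine_space (\<lambda>l. \<not> snd l)" by measurable
  then have "Measurable.pred (option_space age_spine_space) (case_option True (\<lambda>l. \<not> snd l))"
    by (intro measurable_case_option) auto
  from measurable_compose[OF measurable_tree_component this]
  have "Measurable.pred T' (\<lambda>t. case_option True (\<lambda>l. \<not> snd l) (t u))" for u .
  then have "Measurable.pred T' (\<lambda>t. \<forall>u. length u = k \<longrightarrow> case_option True (\<lambda>l. \<not> snd l) (t u))"
    by measurable
  moreover have "{t \<in> space T'. \<forall>u. length u = k \<longrightarrow> case_option True (\<lambda>l. \<not> snd l) (t u)} = spine_below k"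
    by (auto simp: spine_below_def space_tree_space[OF space_age_spine_space] split: option.splits)
  ultimately show ?thesis by (simp add: pred_def)
qed

lemma spine_below_up_to_height: "k \<le> n \<Longrightarrow> up_to_height n t \<in> spine_below k \<longleftrightarrow> t \<in> spine_below k"
  by (auto simp: spine_below_def up_to_height_def restrict_map_def)

lemma mark_spine_below:
  assumes "t \<in> ltrees" "v \<in> dom t"
  shows "mark v t \<in> spine_below k \<longleftrightarrow> length v < k"
proof
  show "mark v t \<in> spine_below k" if "length v < k"
    using that by (auto simp: spine_below_def mark_def dest!: prefix_length_le)
  assume *: "mark v t \<in> spine_below k"
  show "length v < k"
  proof (rule ccontr)
    assume "\<not> length v < k"
    moreover have "prefix (take k v) v" by (rule take_is_prefix)
    moreover from this have "take k v \<in> dom t" using assms ltrees_prefix by blast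
    ultimately show False using * by (auto simp: spine_below_def mark_def dom_def)
  qed
qed

text \<open>
  A spine that has ended below height \<open>k \<le> n\<close> ends at a vertex of weight 1, so that on this event the
  weights do not depend on the height at which the tree is cut off.
\<close>

lemma emeasure_up_to_height_spine_below:
  assumes X: "X \<in> sets T'" and kn: "k \<le> n"
  shows "emeasure M' (up_to_height n -` X \<inter> spine_below k) = emeasure (marked_law {v. length v < k}) (up_to_height n -` X)"
proof -
  let ?A = "X \<inter> spine_below k"
  have A: "?A \<in> sets T'" using X spine_below_in_sets by auto
  have up: "up_to_height n -` Y \<in> sets T'" if "Y \<in> sets T'" for Y
    using measurable_sets[OF measurable_up_to_height[OF space_age_spine_space] that] by (simp add: space_tree_space[OF space_age_spine_space])
  have "up_to_height n -` X \<inter> spine_below k = up_to_height n -` ?A"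
    using spine_below_up_to_height[OF kn] by auto
  then have "emeasure M' (up_to_height n -` X \<inter> spine_below k) = (\<integral>\<^sup>+t. indicator (up_to_height n -` ?A) t \<partial>M')"
    using up[OF A] by (simp add: Hhat.sets_M)
  also have "\<dots> = (\<integral>\<^sup>+t. indicator ?A (up_to_height n t) \<partial>M')"
    by (intro nn_integral_cong) (auto simp: indicator_def)
  also have "\<dots> = (\<integral>\<^sup>+t. marked_sum n (indicator ?A) (up_to_height n t) \<partial>M) / ennreal E"
    using A by (intro truncated_spine_identity) simp
  also have "(\<integral>\<^sup>+t. marked_sum n (indicator ?A) (up_to_height n t) \<partial>M)
      = (\<integral>\<^sup>+t. (\<integral>\<^sup>+v. (if v \<in> {v. length v < k} \<and> v \<in> dom t then indicator (up_to_height n -` X) (mark v t) else 0) \<partial>count_space UNIV) \<partial>M)"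
  proof (rule nn_integral_cong_AE)
    show "AE t in M. marked_sum n (indicator ?A) (up_to_height n t)
      = (\<integral>\<^sup>+v. (if v \<in> {v. length v < k} \<and> v \<in> dom t then indicator (up_to_height n -` X) (mark v t) else 0) \<partial>count_space UNIV)"
      using H.AE_ltrees
    proof eventually_elim
      fix t :: "real ltree" assume t: "t \<in> ltrees"
      have "spine_weight n v t * indicator ?A (mark v (up_to_height n t))
          = (if v \<in> {v. length v < k} \<and> v \<in> dom t then indicator (up_to_height n -` X) (mark v t) else 0)" for v
        using mark_spine_below[OF t, of v k] kn
        by (auto simp: mark_up_to_height spine_weight_def indicator_def spine_below_up_to_height)
      then show "marked_sum n (indicator ?A) (up_to_height n t)
          = (\<integral>\<^sup>+v. (if v \<in> {v. length v < k} \<and> v \<in> dom t then indicator (up_to_height n -` X) (mark v t) else 0) \<partial>count_space UNIV)"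
        by (simp add: marked_sum_def spine_weight_up_to_height)
    qed
  qed
  also have "\<dots> / ennreal E = emeasure (marked_law {v. length v < k}) (up_to_height n -` X)"
    by (rule emeasure_marked_law[OF up[OF X], symmetric])
  finally show ?thesis .
qed

lemma emeasure_spine_below:
  assumes A: "A \<in> sets T'"
  shows "emeasure M' (A \<inter> spine_below k) = emeasure (marked_law {v. length v < k}) A"
proof -
  let ?D = "density M' (indicator (spine_below k))"
  have D: "emeasure ?D Y = emeasure M' (Y \<inter> spine_below k)" if "Y \<in> sets T'" for Y
  proof -
    have "emeasure ?D Y = (\<integral>\<^sup>+t. indicator (spine_below k) t * indicator Y t \<partial>M')"
      using that spine_below_in_sets[of k] by (intro emeasure_density) (simp_all add: Hhat.sets_M)
    also have "\<dots> = (\<integral>\<^sup>+t. indicator (Y \<inter> spine_below k) t \<partial>M')"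
      by (intro nn_integral_cong) (auto simp: indicator_def)
    also have "\<dots> = emeasure M' (Y \<inter> spine_below k)"
      using that spine_below_in_sets[of k] by (intro nn_integral_indicator) (simp add: Hhat.sets_M)
    finally show ?thesis .
  qed
  have "?D = marked_law {v. length v < k}"
  proof (rule measure_eqI_up_to_height[OF space_age_spine_space])
    show "finite_measure ?D"
    proof (rule finite_measureI)
      have "UNIV \<in> sets T'" using sets.top[of T'] by (simp add: space_tree_space[OF space_age_spine_space])
      then show "emeasure ?D (space ?D) \<noteq> \<infinity>" by (simp add: D Hhat.space_M Hhat.M.emeasure_finite)
    qed
    fix n X assume nX: "k \<le> n" "X \<in> sets T'"
    then have "up_to_height n -` X \<in> sets T'"
      using measurable_sets[OF measurable_up_to_height[OF space_age_spine_space] nX(2)] by (simp add: space_tree_space[OF space_age_spine_space])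
    then show "emeasure ?D (up_to_height n -` X) = emeasure (marked_law {v. length v < k}) (up_to_height n -` X)"
      by (simp add: D emeasure_up_to_height_spine_below[OF nX(2,1)])
  qed (simp_all add: Hhat.sets_M)
  then show ?thesis using D[OF A] by simp
qed

text \<open>
  A spine that reaches height \<open>k\<close> carries there a weight \<open>m \<le> 1 / tanh (x / 2)\<close>, which is bounded
  because \<open>x > 0\<close>.
\<close>

lemma emeasure_not_spine_below:
  "emeasure M' (- spine_below k) \<le> ennreal (1 / tanh (x / 2)) * emeasure (marked_law {v. length v = k}) UNIV"
proof -
  let ?A = "- spine_below k"
  have A: "?A \<in> sets T'"
    using sets.compl_sets[OF spine_below_in_sets[of k]] by (simp add: space_tree_space[OF space_age_spine_space] Compl_eq_Diff_UNIV)
  have U: "UNIV \<in> sets T'" using sets.top[of T'] by (simp add: space_tree_space[OF space_age_spine_space])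
  let ?g = "\<lambda>t. \<integral>\<^sup>+v. (if v \<in> {v. length v = k} \<and> v \<in> dom t then indicator UNIV (mark v t) else 0 :: ennreal) \<partial>count_space UNIV"
  have gm: "?g \<in> borel_measurable M"
  proof -
    have "(\<lambda>t. if v \<in> {v. length v = k} \<and> v \<in> dom t then indicator UNIV (mark v t) else 0 :: ennreal) \<in> borel_measurable T" for v
      by simp
    from measurable_nn_integral_count_space[OF this] show ?thesis
      by (simp add: measurable_cong_sets[OF H.sets_M refl])
  qed
  have "emeasure M' ?A = (\<integral>\<^sup>+t. indicator ?A (up_to_height k t) \<partial>M')"
  proof -
    have "(\<integral>\<^sup>+t. indicator ?A (up_to_height k t) \<partial>M') = (\<integral>\<^sup>+t. indicator ?A t \<partial>M')"
      by (intro nn_integral_cong) (auto simp: indicator_def spine_below_up_to_height)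
    also have "\<dots> = emeasure M' ?A"
      using A by (intro nn_integral_indicator) (simp add: Hhat.sets_M)
    finally show ?thesis by simp
  qed
  also have "\<dots> = (\<integral>\<^sup>+t. marked_sum k (indicator ?A) (up_to_height k t) \<partial>M) / ennreal E"
    using A by (intro truncated_spine_identity) simp
  also have "(\<integral>\<^sup>+t. marked_sum k (indicator ?A) (up_to_height k t) \<partial>M) \<le> (\<integral>\<^sup>+t. ennreal (1 / tanh (x / 2)) * ?g t \<partial>M)"
  proof (intro nn_integral_mono)
    fix t
    have "marked_sum k (indicator ?A) (up_to_height k t)
        \<le> (\<integral>\<^sup>+v. ennreal (1 / tanh (x / 2)) * (if v \<in> {v. length v = k} \<and> v \<in> dom t then indicator UNIV (mark v t) else 0) \<partial>count_space UNIV)"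
      unfolding marked_sum_def spine_weight_up_to_height
    proof (intro nn_integral_mono)
      fix v
      have "mark v (up_to_height k t) \<in> spine_below k" if "length v < k"
        using that by (auto simp: spine_below_def mark_def dest!: prefix_length_le)
      then show "spine_weight k v t * indicator ?A (mark v (up_to_height k t))
          \<le> ennreal (1 / tanh (x / 2)) * (if v \<in> {v. length v = k} \<and> v \<in> dom t then indicator UNIV (mark v t) else 0)"
        using mean_progeny_bounds(2)[OF x_pos, of "the (t v)"]
        by (auto simp: spine_weight_def indicator_def intro!: ennreal_leI)
    qed
    then show "marked_sum k (indicator ?A) (up_to_height k t) \<le> ennreal (1 / tanh (x / 2)) * ?g t"
      by (simp add: nn_integral_cmult)
  qed
  also have "\<dots> = ennreal (1 / tanh (x / 2)) * (\<integral>\<^sup>+t. ?g t \<partial>M)"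
    by (rule nn_integral_cmult[OF gm])
  finally have "emeasure M' ?A \<le> ennreal (1 / tanh (x / 2)) * (\<integral>\<^sup>+t. ?g t \<partial>M) / ennreal E"
    by (simp add: divide_right_mono_ennreal)
  also have "\<dots> = ennreal (1 / tanh (x / 2)) * emeasure (marked_law {v. length v = k}) UNIV"
    unfolding emeasure_marked_law[OF U] by (rule ennreal_times_divide[symmetric])
  finally show ?thesis .
qed

text \<open>
  On the event that the spine ends below height \<open>k\<close> both measures agree. The marked law has finite
  total mass, hence its mass at spines of length exactly \<open>k\<close> tends to 0, and by
  \<open>emeasure_not_spine_below\<close> so does the probability that the spine reaches height \<open>k\<close>.
\<close>

lemma M'_eq_marked_law: "M' = marked_law UNIV"
proof (rule measure_eqI)
  show "sets M' = sets (marked_law UNIV)" by (simp add: Hhat.sets_M)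
  fix A assume "A \<in> sets M'"
  then have A: "A \<in> sets T'" by (simp add: Hhat.sets_M)
  have U: "UNIV \<in> sets T'" using sets.top[of T'] by (simp add: space_tree_space[OF space_age_spine_space])
  define a where "a Y k = emeasure (marked_law {v. length v = k}) Y" for Y k
  have level: "emeasure (marked_law UNIV) Y = (\<Sum>k. a Y k)" if "Y \<in> sets T'" for Y
  proof -
    have "(\<Union>k. {v :: nat list. length v = k}) = UNIV" by auto
    then show ?thesis
      unfolding a_def using emeasure_marked_law_UNION[OF that, of "\<lambda>k. {v. length v = k}"]
      by (auto simp: disjoint_family_on_def)
  qed
  \<comment> \<open>The mass of the marked law on spines of length less than \<open>k\<close> is a partial sum of the series
    \<open>level\<close>.\<close>
  have below: "emeasure M' (Y \<inter> spine_below k) = (\<Sum>j<k. a Y j)" if Y: "Y \<in> sets T'" for Y k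
  proof -
    let ?V = "\<lambda>j. if j < k then {v :: nat list. length v = j} else {}"
    have "disjoint_family ?V" by (auto simp: disjoint_family_on_def)
    moreover have "(\<Union>j. ?V j) = {v. length v < k}" by auto
    ultimately have "emeasure (marked_law {v. length v < k}) Y = (\<Sum>j. emeasure (marked_law (?V j)) Y)"
      using emeasure_marked_law_UNION[OF Y, of ?V] by simp
    also have "\<dots> = (\<Sum>j<k. emeasure (marked_law (?V j)) Y)"
      by (rule suminf_finite) (auto simp: emeasure_marked_law[OF Y])
    finally show ?thesis unfolding emeasure_spine_below[OF Y] by (simp add: a_def)
  qed
  have "(\<Sum>j<k. a UNIV j) \<le> 1" for k
    using below[OF U, of k] Hhat.M.emeasure_le_1 by metis
  then have "(\<Sum>k. a UNIV k) \<le> 1" by (intro suminf_le_const) auto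
  then have fin: "(\<Sum>k. a UNIV k) \<noteq> \<top>" by (auto simp: top_unique)
  have a_lim: "a UNIV \<longlonglongrightarrow> 0"
  proof -
    have "a UNIV k < \<top>" for k
      using fin sum_le_suminf[of "a UNIV" "{k}"] by (auto simp: less_top[symmetric] top_unique)
    then have eq: "a UNIV = (\<lambda>k. ennreal (enn2real (a UNIV k)))" by (simp add: fun_eq_iff)
    have "summable (\<lambda>k. enn2real (a UNIV k))"
      using fin eq by (intro summable_suminf_not_top) auto
    then have "(\<lambda>k. enn2real (a UNIV k)) \<longlonglongrightarrow> 0" by (rule summable_LIMSEQ_zero)
    then have "(\<lambda>k. ennreal (enn2real (a UNIV k))) \<longlonglongrightarrow> ennreal 0" by (intro tendsto_ennrealI)
    then show ?thesis using eq by simp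
  qed
  have lim: "(\<lambda>k. \<Sum>j<k. a A j) \<longlonglongrightarrow> emeasure (marked_law UNIV) A"
    unfolding level[OF A] by (rule summable_LIMSEQ) simp
  show "emeasure M' A = emeasure (marked_law UNIV) A"
  proof (rule antisym)
    show "emeasure (marked_law UNIV) A \<le> emeasure M' A"
    proof (rule LIMSEQ_le_const2[OF lim])
      have "(\<Sum>j<k. a A j) \<le> emeasure M' A" for k
        unfolding below[OF A, symmetric] using A by (intro emeasure_mono) (auto simp: Hhat.sets_M)
      then show "\<exists>N. \<forall>k\<ge>N. (\<Sum>j<k. a A j) \<le> emeasure M' A" by blast
    qed
    have "(\<lambda>k. (\<Sum>j<k. a A j) + ennreal (1 / tanh (x / 2)) * a UNIV k)
        \<longlonglongrightarrow> emeasure (marked_law UNIV) A + ennreal (1 / tanh (x / 2)) * 0"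
      by (intro tendsto_add lim tendsto_mult_ennreal tendsto_const a_lim) auto
    then have lim': "(\<lambda>k. (\<Sum>j<k. a A j) + ennreal (1 / tanh (x / 2)) * a UNIV k)
        \<longlonglongrightarrow> emeasure (marked_law UNIV) A" by simp
    show "emeasure M' A \<le> emeasure (marked_law UNIV) A"
    proof (rule LIMSEQ_le_const[OF lim'])
      have "emeasure M' A \<le> (\<Sum>j<k. a A j) + ennreal (1 / tanh (x / 2)) * a UNIV k" for k
      proof -
        have c: "- spine_below k \<in> sets M'"
          using sets.compl_sets[OF spine_below_in_sets[of k]] by (simp add: Hhat.sets_M space_tree_space[OF space_age_spine_space] Compl_eq_Diff_UNIV)
        have "emeasure M' A \<le> emeasure M' (A \<inter> spine_below k) + emeasure M' (- spine_below k)"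
          using A spine_below_in_sets[of k] c
          by (intro order_trans[OF emeasure_mono emeasure_subadditive]) (auto simp: Hhat.sets_M)
        also have "\<dots> \<le> (\<Sum>j<k. a A j) + ennreal (1 / tanh (x / 2)) * a UNIV k"
          unfolding below[OF A] a_def[of UNIV] by (intro add_left_mono emeasure_not_spine_below)
        finally show ?thesis .
      qed
      then show "\<exists>N. \<forall>k\<ge>N. emeasure M' A \<le> (\<Sum>j<k. a A j) + ennreal (1 / tanh (x / 2)) * a UNIV k" by blast
    qed
  qed
qed

theorem spine_identity:
  assumes f: "f \<in> borel_measurable T'"
  shows "(\<integral>\<^sup>+s. f s \<partial>M') =
    (\<integral>\<^sup>+t. (\<integral>\<^sup>+v. (if v \<in> dom t then f (mark v t) else 0) \<partial>count_space UNIV) \<partial>M) / ennreal E"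
  using nn_integral_marked_law[OF f, of UNIV] by (simp flip: M'_eq_marked_law)

end

section \<open>Geodesics\<close>

definition neighbours :: "nat list \<Rightarrow> nat list \<Rightarrow> bool" where
  "neighbours u v \<longleftrightarrow> (\<exists>i. v = u @ [i] \<or> u = v @ [i])"

definition step_towards :: "nat list \<Rightarrow> nat list \<Rightarrow> nat list" where
  "step_towards v u = (if prefix u v then take (Suc (length u)) v else butlast u)"

text \<open>
  The geodesic between two addresses does not depend on the tree, as a tree contains, with two
  vertices, all vertices between them.
\<close>

function geodesic :: "nat list \<Rightarrow> nat list \<Rightarrow> nat list list" where
  "geodesic u v = (if u = v then [u] else u # geodesic (step_towards v u) v)"
  by auto
termination
proof (relation "Wellfounded.measure (\<lambda>(u, v). if prefix u v then length v - length u else length u + length v + 1)", goal_cases)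
  case (2 u v)
  show ?case
  proof (cases "prefix u v")
    case True
    then have "length u < length v" using 2 by (auto simp: prefix_def)
    then show ?thesis using True by (auto simp: step_towards_def take_is_prefix)
  next
    case False
    then have "u \<noteq> []" by auto
    then have "length (butlast u) < length u" by simp
    then show ?thesis using False by (auto simp: step_towards_def)
  qed
qed simp

declare geodesic.simps [simp del]

lemma geodesic_refl [simp]: "geodesic u u = [u]"
  by (simp add: geodesic.simps)

lemma geodesic_step: "u \<noteq> v \<Longrightarrow> geodesic u v = u # geodesic (step_towards v u) v"
  by (subst geodesic.simps) simp

lemma geodesic_ne [simp]: "geodesic u v \<noteq> []"
  by (subst geodesic.simps) simp

lemma hd_geodesic [simp]: "hd (geodesic u v) = u"
  by (subst geodesic.simps) simp

lemma last_geodesic [simp]: "last (geodesic u v) = v"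
  by (induction u v rule: geodesic.induct) (subst geodesic.simps, simp)

definition tree_distance :: "nat list \<Rightarrow> nat list \<Rightarrow> nat" where
  "tree_distance u v = length (geodesic u v) - 1"

lemma tree_distance_step: "u \<noteq> v \<Longrightarrow> tree_distance u v = Suc (tree_distance (step_towards v u) v)"
  by (simp add: tree_distance_def geodesic_step Suc_diff_1 del: One_nat_def)

lemma tree_distance_eq_0 [simp]: "tree_distance u v = 0 \<longleftrightarrow> u = v"
  by (cases "u = v") (simp_all add: tree_distance_step, simp add: tree_distance_def)

lemma tree_distance_refl [simp]: "tree_distance u u = 0"
  by simp

lemma neighbours_sym: "neighbours u v \<longleftrightarrow> neighbours v u"
  by (auto simp: neighbours_def)

lemma neighbours_step_towards:
  assumes "u \<noteq> v" shows "neighbours u (step_towards v u)"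
proof (cases "prefix u v")
  case True
  then obtain zs where "v = u @ zs" "zs \<noteq> []" using assms by (auto simp: prefix_def)
  then obtain i w where "v = u @ i # w" by (cases zs) auto
  then show ?thesis using True by (auto simp: step_towards_def neighbours_def)
next
  case False
  then have "u = butlast u @ [last u]" by (cases u rule: rev_cases) auto
  then show ?thesis using False by (auto simp: step_towards_def neighbours_def)
qed

text \<open>
  This is where the absence of cycles enters: of two neighbours, one lies one step closer to any
  third vertex than the other.
\<close>

lemma neighbours_cases:
  assumes "neighbours u w"
  shows "u \<noteq> v \<and> w = step_towards v u \<or> w \<noteq> v \<and> u = step_towards v w"
proof -
  have *: "u \<noteq> v \<and> w = step_towards v u \<or> w \<noteq> v \<and> u = step_towards v w" if w: "w = u @ [i]" for u w i
  proof (cases "prefix w v")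
    case True
    then have "prefix u v" "u \<noteq> v" "take (Suc (length u)) v = w"
      using w by (auto simp: prefix_def)
    then show ?thesis by (simp add: step_towards_def)
  next
    case False
    then show ?thesis using w by (auto simp: step_towards_def)
  qed
  from assms obtain i where "w = u @ [i] \<or> u = w @ [i]" by (auto simp: neighbours_def)
  then show ?thesis using *[of w u i] *[of u w i] by auto
qed

lemma tree_distance_neighbours:
  assumes d: "tree_distance u v = Suc n"
  shows "neighbours u w \<and> tree_distance w v = n \<longleftrightarrow> w = step_towards v u"
proof -
  have uv: "u \<noteq> v" using d by auto
  show ?thesis
  proof
    assume a: "neighbours u w \<and> tree_distance w v = n"
    then consider "w = step_towards v u" | "w \<noteq> v" "u = step_towards v w" using neighbours_cases[of u w v] by blast
    then show "w = step_towards v u"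
    proof cases
      case 2
      then have "tree_distance w v = Suc (tree_distance u v)" using tree_distance_step[of w v] by simp
      then show ?thesis using a d by simp
    qed
  qed (use uv d tree_distance_step[OF uv] neighbours_step_towards[OF uv] in auto)
qed

lemma geodesic_Nil:
  assumes "prefix u v"
  shows "sorted_wrt (\<lambda>u v. length u < length v) (geodesic u v) \<and> set (geodesic u v) = {w. prefix u w \<and> prefix w v}"
  using assms
proof (induction u v rule: geodesic.induct)
  case (1 u v)
  show ?case
  proof (cases "u = v")
    case True
    then show ?thesis by (auto simp: prefix_order.antisym)
  next
    case False
    then obtain zs where "v = u @ zs" "zs \<noteq> []" using 1(2) by (auto simp: prefix_def)
    then obtain i w where v: "v = u @ i # w" by (cases zs) auto
    have s: "step_towards v u = u @ [i]" using 1(2) by (simp add: step_towards_def v)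
    have IH: "sorted_wrt (\<lambda>u v. length u < length v) (geodesic (u @ [i]) v)"
      "set (geodesic (u @ [i]) v) = {w. prefix (u @ [i]) w \<and> prefix w v}"
      using 1(1)[OF False] by (simp_all add: s) (simp_all add: v)
    have "{w. prefix u w \<and> prefix w v} = insert u {w. prefix (u @ [i]) w \<and> prefix w v}"
      by (auto simp: v prefix_def append_eq_append_conv2 append_eq_Cons_conv Cons_eq_append_conv)
    then show ?thesis
      using IH by (auto simp: geodesic_step[OF False] s dest!: prefix_length_le)
  qed
qed

lemma step_towards_in_dom:
  assumes t: "t \<in> ltrees" and uv: "u \<in> dom t" "v \<in> dom t"
  shows "step_towards v u \<in> dom t"
proof (cases "prefix u v")
  case True
  then show ?thesis using ltrees_prefix[OF t uv(2) take_is_prefix[of "Suc (length u)" v]] by (simp only: step_towards_def if_True)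
next
  case False
  have "prefix (butlast u) u" by (simp add: prefixeq_butlast)
  then show ?thesis using False ltrees_prefix[OF t uv(1)] by (simp only: step_towards_def if_False)
qed

lemma adjacent_iff: "adjacent t u v \<longleftrightarrow> u \<in> dom t \<and> v \<in> dom t \<and> neighbours u v"
  by (auto simp: adjacent_def neighbours_def)

lemma walk_geodesic:
  assumes "t \<in> ltrees" "u \<in> dom t" "v \<in> dom t"
  shows "walk t u v (geodesic u v)"
proof -
  have "set (geodesic u v) \<subseteq> dom t \<and> successively (adjacent t) (geodesic u v)"
    using assms(2,3)
  proof (induction u v rule: geodesic.induct)
    case (1 u v)
    show ?case
    proof (cases "u = v")
      case False
      have d: "step_towards v u \<in> dom t" by (rule step_towards_in_dom[OF assms(1) 1(2,3)])
      have "adjacent t u (hd (geodesic (step_towards v u) v))"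
        using d 1(2) neighbours_step_towards[OF False] by (simp add: adjacent_iff)
      then show ?thesis
        using 1(1)[OF False d 1(3)] 1(2) False by (simp add: geodesic_step successively_Cons)
    qed (use 1 in simp)
  qed
  then show ?thesis by (simp add: walk_def)
qed

text \<open>
  A first step towards \<open>v\<close> is the first step of the geodesic; a first step away from \<open>v\<close> only
  prepends an edge to the geodesic. Hence the geodesic is the unique shortest walk.
\<close>

lemma walk_length:
  assumes "walk t u v p"
  shows "length (geodesic u v) \<le> length p \<and> (length p = length (geodesic u v) \<longrightarrow> p = geodesic u v)"
  using assms
proof (induction p arbitrary: u)
  case Nil
  then show ?case by (simp add: walk_def)
next
  case (Cons a p)
  then have a: "a = u" by (simp add: walk_def)
  show ?case
  proof (cases p)
    case Nil
    then have "u = v" using Cons.prems a by (simp add: walk_def)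
    then show ?thesis using Nil a by simp
  next
    case (Cons b q)
    have w: "walk t b v p" and n: "neighbours u b"
      using Cons.prems a Cons by (auto simp: walk_def adjacent_iff)
    note IH = Cons.IH[OF w]
    from neighbours_cases[OF n, of v] show ?thesis
    proof
      assume "u \<noteq> v \<and> b = step_towards v u"
      then have "geodesic u v = u # geodesic b v" by (simp add: geodesic_step)
      then show ?thesis using IH a by auto
    next
      assume "b \<noteq> v \<and> u = step_towards v b"
      then have "geodesic b v = b # geodesic u v" by (simp add: geodesic_step)
      then show ?thesis using IH a by auto
    qed
  qed
qed

lemma shortest_path_eq_geodesic:
  assumes "t \<in> ltrees" "u \<in> dom t" "v \<in> dom t"
  shows "shortest_path t u v = geodesic u v"
proof -
  have g: "walk t u v (geodesic u v)" by (rule walk_geodesic[OF assms])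
  have *: "walk t u v (shortest_path t u v) \<and> (\<forall>p. walk t u v p \<longrightarrow> length (shortest_path t u v) \<le> length p)"
    unfolding shortest_path_def by (rule arg_min_nat_lemma[where P = "walk t u v", OF g])
  then have "length (shortest_path t u v) \<le> length (geodesic u v)" using g by blast
  then show ?thesis using walk_length[of t u v "shortest_path t u v"] * by auto
qed

lemma unrooted_iso_inverse:
  assumes "unrooted_iso t s f"
  shows "unrooted_iso s t (inv_into (dom t) f)"
proof -
  let ?g = "inv_into (dom t) f"
  have bij: "bij_betw f (dom t) (dom s)" using assms by (simp add: unrooted_iso_def)
  have g: "?g y \<in> dom t" "f (?g y) = y" if "y \<in> dom s" for y
    using that bij by (auto simp: bij_betw_def inv_into_into f_inv_into_f)
  have "adjacent t (?g u) (?g v) \<longleftrightarrow> adjacent s u v" if "u \<in> dom s" "v \<in> dom s" for u v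
    using assms g[OF that(1)] g[OF that(2)] unfolding unrooted_iso_def by metis
  moreover have "t (?g u) = s u" if "u \<in> dom s" for u
    using assms g[OF that] unfolding unrooted_iso_def by metis
  ultimately show ?thesis
    using bij_betw_inv_into[OF bij] by (simp add: unrooted_iso_def)
qed

lemma walk_map:
  assumes iso: "unrooted_iso t s f" and w: "walk t u v p"
  shows "walk s (f u) (f v) (map f p)"
proof -
  have d: "set p \<subseteq> dom t" and p: "p \<noteq> []" "hd p = u" "last p = v" "successively (adjacent t) p"
    using w by (auto simp: walk_def)
  have "successively (\<lambda>a b. adjacent s (f a) (f b)) p"
  proof (rule successively_mono[OF p(4)])
    show "adjacent s (f a) (f b)" if "a \<in> set p" "b \<in> set p" "adjacent t a b" for a b
      using iso d that unfolding unrooted_iso_def by blast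
  qed
  moreover have "f ` set p \<subseteq> dom s" using iso image_mono[OF d, of f] by (simp add: unrooted_iso_def bij_betw_def)
  ultimately show ?thesis using p by (simp add: walk_def successively_map hd_map last_map)
qed

text \<open>
  The image of the geodesic is a walk of the same length, and conversely, so it is the shortest one.
\<close>

lemma geodesic_iso:
  assumes iso: "unrooted_iso t s f" and t: "t \<in> ltrees" and s: "s \<in> ltrees" and uv: "u \<in> dom t" "v \<in> dom t"
  shows "geodesic (f u) (f v) = map f (geodesic u v)"
proof -
  let ?g = "inv_into (dom t) f"
  have bij: "bij_betw f (dom t) (dom s)" using iso by (simp add: unrooted_iso_def)
  then have fuv: "f u \<in> dom s" "f v \<in> dom s" using uv bij_betwE by blast+
  have g: "?g (f u) = u" "?g (f v) = v" using bij uv by (auto simp: bij_betw_def)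
  have w': "walk t u v (map ?g (geodesic (f u) (f v)))"
    using walk_map[OF unrooted_iso_inverse[OF iso] walk_geodesic[OF s fuv]] g by simp
  have "length (geodesic u v) \<le> length (geodesic (f u) (f v))"
    using walk_length[OF w'] by simp
  moreover have w: "walk s (f u) (f v) (map f (geodesic u v))"
    by (rule walk_map[OF iso walk_geodesic[OF t uv]])
  ultimately show ?thesis using walk_length[OF w] by auto
qed

lemma tree_distance_iso:
  assumes "unrooted_iso t s f" "t \<in> ltrees" "s \<in> ltrees" "u \<in> dom t" "v \<in> dom t"
  shows "tree_distance (f u) (f v) = tree_distance u v"
  using geodesic_iso[OF assms] by (simp add: tree_distance_def)

lemma sorted_wrt_length_unique:
  assumes "sorted_wrt (\<lambda>u v. length u < length v) p" "sorted_wrt (\<lambda>u v. length u < length v) q" "set p = set q"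
  shows "p = q"
  using assms
proof (induction p arbitrary: q)
  case (Cons a p)
  then obtain b r where q: "q = b # r" by (cases q) auto
  have ab: "a = b"
  proof (rule ccontr)
    assume "a \<noteq> b"
    then have "b \<in> set p" "a \<in> set r" using Cons.prems(3) q by auto
    then show False using Cons.prems(1,2) q by fastforce
  qed
  have "a \<notin> set p" "b \<notin> set r" using Cons.prems(1,2) q by auto
  then have "set p = set r" using Cons.prems(3) q ab by auto
  then show ?case using Cons.IH[of r] Cons.prems(1,2) q ab by simp
qed simp

text \<open>
  The spinal vertices are the prefixes of \<open>v\<close>, and sorted by length they form a geodesic.
\<close>

lemma spine_mark:
  assumes "t \<in> ltrees" "v \<in> dom t"
  shows "spine (mark v t) = geodesic [] v"
proof -
  have "{u. \<exists>b. mark v t u = Some (b, True)} = {w. prefix [] w \<and> prefix w v}"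
    using ltrees_prefix[OF assms] by (auto simp: mark_def dom_def)
  then have g: "set (geodesic [] v) = {u. \<exists>b. mark v t u = Some (b, True)}"
    "sorted_wrt (\<lambda>u v. length u < length v) (geodesic [] v)"
    using geodesic_Nil[of "[]" v] by auto
  show ?thesis
    unfolding spine_def
  proof (rule the_equality)
    show "p = geodesic [] v" if "set p = {u. \<exists>b. mark v t u = Some (b, True)} \<and> sorted_wrt (\<lambda>u v. length u < length v) p" for p
      using that g by (intro sorted_wrt_length_unique) auto
  qed (use g in simp)
qed

lemma forget_spine_mark [simp]: "forget_spine (mark v t) = t"
proof
  fix u show "forget_spine (mark v t) u = t u"
    by (cases "t u") (simp_all add: forget_spine_def mark_def)
qed

text \<open>
  Sums over the vertices of a tree are written as integrals over all addresses; an isomorphism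
  permutes their terms.
\<close>

lemma nn_integral_dom_iso:
  fixes t s :: "real ltree"
  assumes "bij_betw f (dom t) (dom s)"
  shows "(\<integral>\<^sup>+v. (if v \<in> dom s then g v else 0) \<partial>count_space UNIV)
    = (\<integral>\<^sup>+v. (if v \<in> dom t then g (f v) else 0 :: ennreal) \<partial>count_space UNIV)"
proof -
  have *: "(\<integral>\<^sup>+v. (if v \<in> A then h v else 0) \<partial>count_space UNIV) = (\<integral>\<^sup>+v. h v \<partial>count_space A)" for A and h :: "nat list \<Rightarrow> ennreal"
  proof -
    have "(\<integral>\<^sup>+v. (if v \<in> A then h v else 0) \<partial>count_space UNIV) = (\<integral>\<^sup>+v. h v * indicator A v \<partial>count_space UNIV)"
      by (intro nn_integral_cong) auto
    then show ?thesis by (simp add: nn_integral_count_space_indicator)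
  qed
  show ?thesis unfolding * by (rule nn_integral_bij_count_space[OF assms, symmetric])
qed

section \<open>Joining two trees by an edge\<close>

text \<open>
  The tree \<open>graft j t1 t0\<close> is \<open>t0\<close> with \<open>t1\<close> attached to its root as the child
  with label \<open>j\<close>; the children of \<open>t0\<close> from label \<open>j\<close> on are moved up by one.
\<close>

definition shift_down :: "nat \<Rightarrow> nat list \<Rightarrow> nat list" where
  "shift_down j u = (case u of [] \<Rightarrow> [] | i # w \<Rightarrow> (if i < j then i else i - 1) # w)"

definition shift_up :: "nat \<Rightarrow> nat list \<Rightarrow> nat list" where
  "shift_up j u = (case u of [] \<Rightarrow> [] | i # w \<Rightarrow> (if i < j then i else Suc i) # w)"

definition graft :: "nat \<Rightarrow> 'l ltree \<Rightarrow> 'l ltree \<Rightarrow> 'l ltree" where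
  "graft j t1 t0 u = (if u \<in> range ((#) j) then t1 (tl u) else t0 (shift_down j u))"

lemma shift_down_up [simp]: "shift_down j (shift_up j u) = u"
  by (auto simp: shift_down_def shift_up_def split: list.splits)

lemma shift_up_down: "u \<notin> range ((#) j) \<Longrightarrow> shift_up j (shift_down j u) = u"
  by (auto simp: shift_down_def shift_up_def split: list.splits)

lemma shift_up_notin_range: "shift_up j u \<notin> range ((#) j)"
  by (auto simp: shift_up_def split: list.splits)

lemma inj_on_shift_down: "inj_on (shift_down j) (- range ((#) j))"
  by (rule inj_on_inverseI[where g = "shift_up j"]) (simp add: shift_up_down)

lemma inj_on_tl: "inj_on tl (range ((#) j))"
  by (auto simp: inj_on_def)

lemma length_shift_up [simp]: "length (shift_up j u) = length u"
  by (auto simp: shift_up_def split: list.splits)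

lemma shift_down_Nil [simp]: "shift_down j [] = []"
  by (simp add: shift_down_def)

lemma shift_up_Nil [simp]: "shift_up j [] = []"
  by (simp add: shift_up_def)

lemma graft_Cons [simp]: "graft j t1 t0 (j # u) = t1 u"
  by (simp add: graft_def)

lemma graft_shift_up [simp]: "graft j t1 t0 (shift_up j u) = t0 u"
  using shift_up_notin_range[of j u] by (simp add: graft_def)

lemma graft_Nil [simp]: "graft j t1 t0 [] = t0 []"
  using graft_shift_up[of j t1 t0 "[]"] by simp

lemma graft_address_cases:
  obtains w where "u = j # w" | w where "u = shift_up j w"
  by (metis rangeE shift_up_down)

lemma up_to_height_graft:
  "up_to_height (Suc n) (graft j t1 t0) = graft j (up_to_height n t1) (up_to_height (Suc n) t0)"
proof
  fix u
  show "up_to_height (Suc n) (graft j t1 t0) u = graft j (up_to_height n t1) (up_to_height (Suc n) t0) u"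
    by (rule graft_address_cases[of u j]) (simp_all add: up_to_height_def restrict_map_def)
qed

lemma neighbours_graft:
  "neighbours (j # u) (j # v) \<longleftrightarrow> neighbours u v"
  "neighbours (shift_up j u) (shift_up j v) \<longleftrightarrow> neighbours u v"
  "neighbours (j # u) (shift_up j v) \<longleftrightarrow> u = [] \<and> v = []"
  "neighbours (shift_up j u) (j # v) \<longleftrightarrow> u = [] \<and> v = []"
proof -
  show "neighbours (j # u) (j # v) \<longleftrightarrow> neighbours u v" by (auto simp: neighbours_def)
  have inj: "shift_up j a = shift_up j b \<longleftrightarrow> a = b" for a b by (metis shift_down_up)
  have app: "a \<noteq> [] \<Longrightarrow> shift_up j (a @ [i]) = shift_up j a @ [i]" for a i
    by (auto simp: shift_up_def split: list.splits)
  have s: "shift_up j v = shift_up j u @ [i] \<longleftrightarrow> (u \<noteq> [] \<and> v = u @ [i]) \<or> (u = [] \<and> (\<exists>k. v = [k] \<and> i = (if k < j then k else Suc k)))" for u v i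
  proof (cases "u = []")
    case True
    then show ?thesis by (auto simp: shift_up_def split: list.splits)
  next
    case False
    then show ?thesis using app[OF False, of i] inj[of v "u @ [i]"] by auto
  qed
  have *: "(\<exists>i. shift_up j v = shift_up j u @ [i]) \<longleftrightarrow> (\<exists>i. v = u @ [i])" for u v
    unfolding s by auto
  then show "neighbours (shift_up j u) (shift_up j v) \<longleftrightarrow> neighbours u v"
    unfolding neighbours_def by blast
  have a: "j # u = shift_up j v @ [i] \<longleftrightarrow> u = [] \<and> v = [] \<and> i = j" for u v i
    by (auto simp: shift_up_def Cons_eq_append_conv split: list.splits if_splits)
  have b: "shift_up j v \<noteq> j # u @ [i]" for u v i
    by (auto simp: shift_up_def split: list.splits if_splits)
  have c: "neighbours (j # u) (shift_up j v) \<longleftrightarrow> u = [] \<and> v = []" for u v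
    by (auto simp: neighbours_def a b)
  then show "neighbours (j # u) (shift_up j v) \<longleftrightarrow> u = [] \<and> v = []" .
  show "neighbours (shift_up j u) (j # v) \<longleftrightarrow> u = [] \<and> v = []"
    by (subst neighbours_sym) (auto simp: c)
qed

lemma graft_in_ltrees:
  assumes "t1 \<in> ltrees" "t0 \<in> ltrees"
  shows "graft j t1 t0 \<in> ltrees"
proof -
  have "u \<in> dom (graft j t1 t0)" if "u @ [i] \<in> dom (graft j t1 t0)" for u i
  proof (rule graft_address_cases[of u j])
    fix w assume "u = j # w"
    then show ?thesis using that assms by (auto simp: ltrees_def dom_def)
  next
    fix w assume u: "u = shift_up j w"
    show ?thesis
    proof (cases "w = []")
      case True
      then show ?thesis using u assms by (auto simp: ltrees_def dom_def)
    next
      case False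
      then have "shift_up j (w @ [i]) = u @ [i]"
        using u by (auto simp: shift_up_def split: list.splits)
      then have "w @ [i] \<in> dom t0" using that by (metis domD domI graft_shift_up)
      then have "w \<in> dom t0" using assms(2) unfolding ltrees_def by blast
      then show ?thesis using u by (auto simp: dom_def)
    qed
  qed
  then show ?thesis using assms by (auto simp: ltrees_def dom_def)
qed

text \<open>Both trees become the two sides of an edge, so that their roles can be exchanged.\<close>

definition graft_swap :: "nat \<Rightarrow> nat \<Rightarrow> nat list \<Rightarrow> nat list" where
  "graft_swap j i u = (if u \<in> range ((#) j) then shift_up i (tl u) else i # shift_down j u)"

lemma graft_swap_simps [simp]:
  "graft_swap j i (j # u) = shift_up i u" "graft_swap j i (shift_up j u) = i # u"
  "graft_swap j i [] = [i]"
  using shift_up_notin_range[of j u] shift_up_notin_range[of j "[]"] by (simp_all add: graft_swap_def)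

lemma unrooted_iso_graft: "unrooted_iso (graft j t1 t0) (graft i t0 t1) (graft_swap j i)"
  unfolding unrooted_iso_def
proof (intro conjI ballI)
  have inv: "graft_swap i j (graft_swap j i u) = u" for i j u
    by (rule graft_address_cases[of u j]) simp_all
  have val: "graft i t0 t1 (graft_swap j i u) = graft j t1 t0 u" for i j u and t0 t1 :: "'a ltree"
    by (rule graft_address_cases[of u j]) simp_all
  show "bij_betw (graft_swap j i) (dom (graft j t1 t0)) (dom (graft i t0 t1))"
    by (rule bij_betwI[where g = "graft_swap i j"]) (auto simp: dom_def val inv)
  show "graft i t0 t1 (graft_swap j i u) = graft j t1 t0 u" for u by (rule val)
  fix u v assume uv: "u \<in> dom (graft j t1 t0)" "v \<in> dom (graft j t1 t0)"
  have "neighbours (graft_swap j i u) (graft_swap j i v) \<longleftrightarrow> neighbours u v"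
    by (rule graft_address_cases[of u j]; rule graft_address_cases[of v j]) (auto simp: neighbours_graft)
  then show "adjacent (graft i t0 t1) (graft_swap j i u) (graft_swap j i v) = adjacent (graft j t1 t0) u v"
    using uv by (auto simp: adjacent_iff dom_def val)
qed

lemma measurable_graft:
  assumes S: "space S = UNIV"
  shows "(\<lambda>p. graft j (fst p) (snd p)) \<in> tree_space S \<Otimes>\<^sub>M tree_space S \<rightarrow>\<^sub>M tree_space S"
proof (rule measurable_into_tree_space[OF S])
  fix u
  show "(\<lambda>p. graft j (fst p) (snd p) u) \<in> tree_space S \<Otimes>\<^sub>M tree_space S \<rightarrow>\<^sub>M option_space S"
    using measurable_compose[OF measurable_fst measurable_tree_component[of "tl u" S]]
      measurable_compose[OF measurable_snd measurable_tree_component[of "shift_down j u" S]]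
    by (cases "u \<in> range ((#) j)") (simp_all only: graft_def if_True if_False)
qed

definition root_degree :: "'l ltree \<Rightarrow> nat" where
  "root_degree t = card {i. t [i] \<noteq> None}"

lemma (in offspring_kernel) add_generation_graft:
  "add_generation (Suc n) (graft j t1 t0) (\<lambda>u. if u \<in> range ((#) j) then c1 (tl u) else c0 (shift_down j u))
    = graft j (add_generation n t1 c1) (add_generation (Suc n) t0 c0)"
proof
  fix u
  show "add_generation (Suc n) (graft j t1 t0) (\<lambda>u. if u \<in> range ((#) j) then c1 (tl u) else c0 (shift_down j u)) u
    = graft j (add_generation n t1 c1) (add_generation (Suc n) t0 c0) u"
  proof (rule graft_address_cases[of u j])
    fix w assume u: "u = j # w"
    show ?thesis
    proof (cases "length w = Suc n")
      case True
      then have "w \<noteq> []" by auto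
      then show ?thesis using True u by (simp add: add_generation_def)
    qed (simp add: u add_generation_def)
  next
    fix w assume u: "u = shift_up j w"
    show ?thesis
    proof (cases "length w = Suc (Suc n)")
      case True
      then obtain i w' k where w: "w = i # w' @ [k]"
        by (cases w; cases "tl w" rule: rev_cases) auto
      have "butlast u = shift_up j (i # w')" "last u = k"
        by (auto simp: u w shift_up_def butlast_append)
      then show ?thesis
        using True u w shift_up_notin_range[of j "i # w'"] by (simp add: add_generation_def)
    qed (simp add: u add_generation_def)
  qed
qed

text \<open>
  Growth is local: two trees that are joined by an edge grow independently, the attached one being
  one generation behind.
\<close>

lemma (in offspring_kernel) nn_integral_next_generation_graft:
  assumes f: "f \<in> borel_measurable (tree_space S)"
  shows "(\<integral>\<^sup>+s. f s \<partial>next_generation S K (Suc n) (graft j t1 t0))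
    = (\<integral>\<^sup>+s1. (\<integral>\<^sup>+s0. f (graft j s1 s0) \<partial>next_generation S K (Suc n) t0) \<partial>next_generation S K n t1)"
proof -
  let ?LA = "children_law S K t1" and ?LB = "children_law S K t0" and ?L = "children_law S K (graft j t1 t0)"
  define F where "F c = f (add_generation (Suc n) (graft j t1 t0) c)" for c
  have F: "F \<in> borel_measurable (PiM UNIV ?L)"
    unfolding F_def measurable_cong_sets[OF sets_PiM_children_law refl]
    by (rule measurable_compose[OF measurable_add_generation f])
  have g0: "(\<lambda>s0. f (graft j s1 s0)) \<in> borel_measurable (tree_space S)" for s1
    using measurable_compose[OF measurable_Pair2[OF measurable_graft[OF space_S], of s1] f]
    by (simp add: space_tree_space space_S)
  have g1: "(\<lambda>s1. \<integral>\<^sup>+s0. f (graft j s1 s0) \<partial>next_generation S K (Suc n) t0) \<in> borel_measurable (tree_space S)"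
  proof (rule nn_integral_measurable_subprob_algebra2)
    show "(\<lambda>(s1, s0). f (graft j s1 s0)) \<in> borel_measurable (tree_space S \<Otimes>\<^sub>M tree_space S)"
      using measurable_compose[OF measurable_graft[OF space_S] f] by (simp add: split_beta)
    show "(\<lambda>_. next_generation S K (Suc n) t0) \<in> tree_space S \<rightarrow>\<^sub>M subprob_algebra (tree_space S)"
      using measurable_space[OF measurable_prob_algebraD[OF measurable_next_generation], of t0 "Suc n"]
      by (intro measurable_const) (simp add: space_tree_space space_S)
  qed
  have "(\<integral>\<^sup>+s. f s \<partial>next_generation S K (Suc n) (graft j t1 t0)) = (\<integral>\<^sup>+c. F c \<partial>PiM UNIV ?L)"
    unfolding F_def by (rule nn_integral_next_generation[OF f])
  also have "\<dots> = (\<integral>\<^sup>+c1. (\<integral>\<^sup>+c0. F (\<lambda>u. if u \<in> range ((#) j) then c1 (tl u) else c0 (shift_down j u)) \<partial>PiM UNIV ?LB) \<partial>PiM UNIV ?LA)"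
  proof (rule nn_integral_PiM_merge(1)[OF _ _ _ inj_on_tl _ inj_on_shift_down _ F])
    show "?LA (tl u) = ?L u" if "u \<in> range ((#) j)" for u
      using that by (simp only: children_law_def graft_def if_True)
    show "?LB (shift_down j u) = ?L u" if "u \<notin> range ((#) j)" for u
      using that by (simp only: children_law_def graft_def if_False)
  qed (rule children_law(1))+
  also have "\<dots> = (\<integral>\<^sup>+c1. (\<integral>\<^sup>+c0. f (graft j (add_generation n t1 c1) (add_generation (Suc n) t0 c0)) \<partial>PiM UNIV ?LB) \<partial>PiM UNIV ?LA)"
    unfolding F_def add_generation_graft ..
  also have "\<dots> = (\<integral>\<^sup>+c1. (\<integral>\<^sup>+s0. f (graft j (add_generation n t1 c1) s0) \<partial>next_generation S K (Suc n) t0) \<partial>PiM UNIV ?LA)"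
    by (simp only: nn_integral_next_generation[OF g0])
  also have "\<dots> = (\<integral>\<^sup>+s1. (\<integral>\<^sup>+s0. f (graft j s1 s0) \<partial>next_generation S K (Suc n) t0) \<partial>next_generation S K n t1)"
    by (rule nn_integral_next_generation[OF g1, symmetric])
  finally show ?thesis .
qed

section \<open>The edges at the root\<close>

lemma measurable_root_degree: "root_degree \<in> tree_space S \<rightarrow>\<^sub>M count_space UNIV"
proof -
  have "(\<lambda>t. card {i. [i] \<in> dom t}) \<in> tree_space S \<rightarrow>\<^sub>M count_space UNIV"
  proof (rule measurable_card)
    show "{t \<in> space (tree_space S). i \<in> {i. [i] \<in> dom t}} \<in> sets (tree_space S)" for i
      using measurable_in_dom[of "[i]" S] by (simp add: pred_def)
  qed
  then show ?thesis by (simp add: root_degree_def[abs_def] dom_def)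
qed

lemma measurable_root_age: "root_age \<in> tree_space borel \<rightarrow>\<^sub>M borel"
  unfolding root_age_def[abs_def] by (rule measurable_tree_label[where f = "\<lambda>a. a"]) auto

text \<open>
  \<open>child_sum\<close> runs over the edges at the root of a tree, and \<open>graft_average\<close> over the
  positions at which a tree can be attached to the root of another one. The factor
  \<open>edge_weight\<close> is the symmetric part of the child intensity.
\<close>

definition child_sum :: "(nat \<Rightarrow> real ltree \<Rightarrow> ennreal) \<Rightarrow> real ltree \<Rightarrow> ennreal" where
  "child_sum f t = (\<integral>\<^sup>+j. (if [j] \<in> dom t then f j t else 0) \<partial>count_space UNIV)"

definition graft_average :: "(nat \<Rightarrow> real ltree \<Rightarrow> ennreal) \<Rightarrow> real ltree \<Rightarrow> real ltree \<Rightarrow> ennreal" where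
  "graft_average f t1 t0 = (\<Sum>j\<le>root_degree t0. f j (graft j t1 t0)) / of_nat (Suc (root_degree t0))"

definition edge_weight :: "real ltree \<Rightarrow> real ltree \<Rightarrow> ennreal" where
  "edge_weight t0 t1 = ennreal (min (root_age t0) (root_age t1))"

lemma edge_weight_commute: "edge_weight t0 t1 = edge_weight t1 t0"
  by (simp add: edge_weight_def min.commute)

lemma measurable_edge_weight: "(\<lambda>p. edge_weight (fst p) (snd p)) \<in> borel_measurable (tree_space borel \<Otimes>\<^sub>M tree_space borel)"
  unfolding edge_weight_def
  using measurable_compose[OF measurable_fst measurable_root_age] measurable_compose[OF measurable_snd measurable_root_age]
  by measurable

lemma measurable_child_sum:
  assumes "\<And>j. f j \<in> borel_measurable (tree_space borel)"
  shows "child_sum f \<in> borel_measurable (tree_space borel)"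
proof -
  have "(\<lambda>t. if [j] \<in> dom t then f j t else 0) \<in> borel_measurable (tree_space borel)" for j
    using assms by measurable
  then show ?thesis
    unfolding child_sum_def[abs_def] by (rule measurable_nn_integral_count_space)
qed

lemma measurable_graft_swapped:
  "(\<lambda>p. graft j (snd p) (fst p)) \<in> tree_space borel \<Otimes>\<^sub>M tree_space borel \<rightarrow>\<^sub>M tree_space (borel :: real measure)"
  using measurable_compose[OF measurable_pair_swap' measurable_graft[of borel j]] by (simp add: split_beta)

lemma measurable_graft_average:
  assumes f: "\<And>j. f j \<in> borel_measurable (tree_space borel)"
  shows "(\<lambda>p. graft_average f (snd p) (fst p)) \<in> borel_measurable (tree_space borel \<Otimes>\<^sub>M tree_space borel)"
  unfolding graft_average_def
proof (rule measurable_compose_countable[where f = "\<lambda>n p. (\<Sum>j\<le>n. f j (graft j (snd p) (fst p))) / of_nat (Suc n)"])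
  show "(\<lambda>p. root_degree (fst p)) \<in> tree_space borel \<Otimes>\<^sub>M tree_space borel \<rightarrow>\<^sub>M count_space UNIV"
    by (rule measurable_compose[OF measurable_fst measurable_root_degree])
  have "(\<lambda>p. (\<Sum>j\<le>n. f j (graft j (snd p) (fst p))) / d) \<in> borel_measurable (tree_space borel \<Otimes>\<^sub>M tree_space borel)" for n d
    using measurable_compose[OF measurable_graft_swapped f] by measurable
  then show "(\<lambda>p. (\<Sum>j\<le>n. f j (graft j (snd p) (fst p))) / of_nat (Suc n)) \<in> borel_measurable (tree_space borel \<Otimes>\<^sub>M tree_space borel)" for n .
qed

lemma root_age_up_to_height [simp]: "root_age (up_to_height n t) = root_age t"
  by (simp add: root_age_def up_to_height_def)

lemma edge_weight_up_to_height [simp]: "edge_weight (up_to_height n t0) (up_to_height k t1) = edge_weight t0 t1"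
  by (simp add: edge_weight_def)

lemma root_degree_up_to_height [simp]: "root_degree (up_to_height (Suc n) t) = root_degree t"
  by (simp add: root_degree_def up_to_height_def restrict_map_def)

definition star :: "real \<Rightarrow> nat \<times> (nat \<Rightarrow> real) \<Rightarrow> real ltree" where
  "star b c = add_generation 0 [[] \<mapsto> b] (\<lambda>_. c)"

lemma star_simps [simp]:
  "star b c [] = Some b" "star b c [i] = (if i < fst c then Some (snd c i) else None)"
  "star b c (i # k # w) = None"
  by (simp_all add: star_def add_generation_def)

lemma add_generation_star: "add_generation 0 [[] \<mapsto> b] c = star b (c [])"
  by (auto simp: star_def add_generation_def fun_eq_iff length_Suc_conv)

lemma root_degree_star [simp]: "root_degree (star b c) = fst c"
proof -
  have "{i. star b c [i] \<noteq> None} = {..<fst c}" by auto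
  then show ?thesis by (simp add: root_degree_def)
qed

lemma graft_star:
  assumes "j \<le> fst c"
  shows "graft j [[] \<mapsto> a] (star b c) = star b (Suc (fst c), insert_point j a (snd c))"
proof
  fix u :: "nat list"
  consider "u = []" | i where "u = [i]" | i k w where "u = i # k # w"
    by (metis neq_Nil_conv)
  then show "graft j [[] \<mapsto> a] (star b c) u = star b (Suc (fst c), insert_point j a (snd c)) u"
    using assms by cases (auto simp: graft_def shift_down_def insert_point_def)
qed

context spinal_trees
begin

lemma measurable_star: "(\<lambda>p. star (fst p) (snd p)) \<in> borel \<Otimes>\<^sub>M C \<rightarrow>\<^sub>M T"
proof (rule measurable_into_tree_space)
  fix u :: "nat list"
  consider "u = []" | i where "u = [i]" | i k w where "u = i # k # w"
    by (metis neq_Nil_conv)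
  then show "(\<lambda>p. star (fst p) (snd p) u) \<in> borel \<Otimes>\<^sub>M C \<rightarrow>\<^sub>M option_space borel"
  proof cases
    case 1
    then show ?thesis using measurable_compose[OF measurable_fst measurable_Some] by simp
  next
    case 2
    have l: "(\<lambda>p. Some (snd (snd p) i)) \<in> borel \<Otimes>\<^sub>M C \<rightarrow>\<^sub>M option_space borel"
      by (rule measurable_compose[OF measurable_compose[OF measurable_snd measurable_snd_config] measurable_Some])
    have "Measurable.pred (borel \<Otimes>\<^sub>M C) (\<lambda>p. i < fst (snd p))"
      by (rule measurable_compose[OF measurable_compose[OF measurable_snd measurable_fst_config]]) simp
    then have "(\<lambda>p. if i < fst (snd p) then Some (snd (snd p) i) else None) \<in> borel \<Otimes>\<^sub>M C \<rightarrow>\<^sub>M option_space borel"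
      by (intro measurable_If l) (auto simp: space_option_space pred_def)
    then show ?thesis using 2 by simp
  next
    case 3
    then show ?thesis by (simp add: space_option_space)
  qed
qed simp

lemma measurable_single: "(\<lambda>a. [[] \<mapsto> a]) \<in> borel \<rightarrow>\<^sub>M T"
proof (rule measurable_into_tree_space)
  fix u :: "nat list"
  show "(\<lambda>l. [[] \<mapsto> l] u) \<in> borel \<rightarrow>\<^sub>M option_space borel"
    by (cases "u = []") (auto simp: space_option_space)
qed simp

lemma nn_integral_next_generation_single:
  assumes g: "g \<in> borel_measurable T"
  shows "(\<integral>\<^sup>+s. g s \<partial>next_generation borel K 0 [[] \<mapsto> b]) = (\<integral>\<^sup>+c. g (star b c) \<partial>K b)"
proof -
  let ?L = "children_law borel K [[] \<mapsto> b]"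
  have sK: "sets (K b) = sets C" using poisson_child_in[of x b] by (simp add: space_prob_algebra)
  have st: "(\<lambda>c. g (star b c)) \<in> borel_measurable (K b)"
    using measurable_compose[OF measurable_Pair2[OF measurable_star, of b] g] by (simp add: measurable_cong_sets[OF sK refl])
  have L: "?L [] = K b" by (simp add: children_law_def)
  have "(\<integral>\<^sup>+s. g s \<partial>next_generation borel K 0 [[] \<mapsto> b]) = (\<integral>\<^sup>+c. g (star b (c [])) \<partial>PiM UNIV ?L)"
    by (simp add: H.nn_integral_next_generation[OF g] add_generation_star)
  also have "\<dots> = (\<integral>\<^sup>+c. g (star b c) \<partial>distr (PiM UNIV ?L) (?L []) (\<lambda>c. c []))"
    using st by (subst nn_integral_distr) (simp_all add: L[symmetric])
  also have "distr (PiM UNIV ?L) (?L []) (\<lambda>c. c []) = ?L []"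
    by (intro distr_PiM_component H.children_law) simp
  finally show ?thesis by (simp only: L)
qed

abbreviation root_mass where "root_mass \<equiv> ennreal (1 - tanh (x / 2))"

text \<open>
  For a root with its children this is the Mecke formula: a child is singled out, its age becomes that
  of an independent root with weight \<open>min b a\<close>, and the other children are a Poisson configuration
  as before.
\<close>

lemma edge_identity_truncated_0:
  assumes f: "\<And>j. f j \<in> borel_measurable T"
  shows "(\<integral>\<^sup>+t. child_sum f (up_to_height 1 t) \<partial>M) =
    root_mass * (\<integral>\<^sup>+t0. (\<integral>\<^sup>+t1. edge_weight t0 t1 * graft_average f (up_to_height 0 t1) (up_to_height 1 t0) \<partial>M) \<partial>M)"
proof -
  let ?R = "H_root_age x"
  let ?h = "\<lambda>t0 t1. edge_weight t0 t1 * graft_average f t1 t0"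
  have sR: "sets ?R = sets borel" by (simp add: H_root_age_def)
  interpret R: prob_space ?R by (rule H_root_age_eq)
  have h: "(\<lambda>p. ?h (fst p) (snd p)) \<in> borel_measurable (T \<Otimes>\<^sub>M T)"
    by (rule borel_measurable_times_ennreal[OF measurable_edge_weight measurable_graft_average[OF f]])
  have ha: "(\<lambda>p. ?h (fst p) [[] \<mapsto> snd p]) \<in> borel_measurable (T \<Otimes>\<^sub>M borel)"
  proof -
    have "(\<lambda>p. (fst p, [[] \<mapsto> snd p])) \<in> T \<Otimes>\<^sub>M borel \<rightarrow>\<^sub>M T \<Otimes>\<^sub>M T"
      by (intro measurable_Pair measurable_fst measurable_compose[OF measurable_snd measurable_single])
    from measurable_compose[OF this h] show ?thesis by simp
  qed
  define g where "g s = (\<integral>\<^sup>+a. ?h s [[] \<mapsto> a] \<partial>?R)" for s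
  have g: "g \<in> borel_measurable T"
    unfolding g_def using ha
    by (intro R.borel_measurable_nn_integral) (simp add: split_beta measurable_cong_sets[OF sets_pair_measure_cong[OF refl sR] refl])
  have c_sum: "child_sum f (star b c) = (\<Sum>j<fst c. f j (star b c))" for b c
  proof -
    have "child_sum f (star b c) = (\<integral>\<^sup>+j. f j (star b c) * indicator {..<fst c} j \<partial>count_space UNIV)"
      unfolding child_sum_def by (intro nn_integral_cong) (auto simp: indicator_def split: if_splits)
    then show ?thesis by (simp add: nn_integral_count_space_indicator[symmetric] nn_integral_count_space_finite)
  qed
  \<comment> \<open>The case of a fixed age \<open>b\<close> of the root.\<close>
  have key: "(\<integral>\<^sup>+c. child_sum f (star b c) \<partial>K b) = root_mass * (\<integral>\<^sup>+c. g (star b c) \<partial>K b)" for b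
  proof -
    interpret P: prob_space "K b" using poisson_child_in by (simp add: space_prob_algebra)
    interpret PR: pair_sigma_finite ?R "K b" ..
    have sK: "sets (K b) = sets C" using poisson_child_in[of x b] by (simp add: space_prob_algebra)
    have st: "star b \<in> C \<rightarrow>\<^sub>M T"
      using measurable_Pair2[OF measurable_star, of b] by simp
    have pair: "(\<lambda>p. ?h (star b (snd p)) [[] \<mapsto> fst p]) \<in> borel_measurable (?R \<Otimes>\<^sub>M K b)"
    proof -
      have "(\<lambda>p. (star b (snd p), fst p)) \<in> borel \<Otimes>\<^sub>M C \<rightarrow>\<^sub>M T \<Otimes>\<^sub>M borel"
        by (intro measurable_Pair measurable_fst measurable_compose[OF measurable_snd st])
      from measurable_compose[OF this ha] show ?thesis
        by (simp add: measurable_cong_sets[OF sets_pair_measure_cong[OF sR sK] refl])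
    qed
    have avg: "(\<Sum>j\<le>fst c. f j (star b (Suc (fst c), insert_point j a (snd c)))) / of_nat (Suc (fst c)) = graft_average f [[] \<mapsto> a] (star b c)" for a c
      unfolding graft_average_def root_degree_star
      by (intro arg_cong2[where f = "(/)"] sum.cong refl) (subst graft_star, simp_all)
    have avm: "(\<lambda>a. \<integral>\<^sup>+c. graft_average f [[] \<mapsto> a] (star b c) \<partial>K b) \<in> borel_measurable borel"
    proof -
      have "(\<lambda>p. (star b (snd p), [[] \<mapsto> fst p])) \<in> borel \<Otimes>\<^sub>M C \<rightarrow>\<^sub>M T \<Otimes>\<^sub>M T"
        by (intro measurable_Pair measurable_compose[OF measurable_fst measurable_single] measurable_compose[OF measurable_snd st])
      from measurable_compose[OF this measurable_graft_average[OF f]]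
      show ?thesis
        by (intro P.borel_measurable_nn_integral) (simp add: split_beta measurable_cong_sets[OF sets_pair_measure_cong[OF refl sK] refl])
    qed
    have "(\<integral>\<^sup>+c. child_sum f (star b c) \<partial>K b) = (\<integral>\<^sup>+c. (\<Sum>j<fst c. f j (star b c)) \<partial>K b)"
      unfolding c_sum ..
    also have "\<dots> = (\<integral>\<^sup>+a. (\<integral>\<^sup>+c. graft_average f [[] \<mapsto> a] (star b c) \<partial>K b) \<partial>child_intensity x b)"
    proof (subst nn_integral_poisson_points_Mecke[OF finite_measure_child_intensity])
      have "sets (config_space (child_intensity x b)) = sets C"
        unfolding config_space_def by (intro sets_pair_measure_cong sets_PiM_cong) auto
      then show "(\<lambda>c. f j (star b c)) \<in> borel_measurable (config_space (child_intensity x b))" for j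
        using measurable_compose[OF st f] by (simp cong: measurable_cong_sets)
    qed (simp_all only: avg child_intensity_simps)
    also have "\<dots> = root_mass * (\<integral>\<^sup>+a. ennreal (min b a) * (\<integral>\<^sup>+c. graft_average f [[] \<mapsto> a] (star b c) \<partial>K b) \<partial>?R)"
      by (rule nn_integral_child_intensity_root[OF avm])
    also have "(\<integral>\<^sup>+a. ennreal (min b a) * (\<integral>\<^sup>+c. graft_average f [[] \<mapsto> a] (star b c) \<partial>K b) \<partial>?R)
        = (\<integral>\<^sup>+a. (\<integral>\<^sup>+c. ?h (star b c) [[] \<mapsto> a] \<partial>K b) \<partial>?R)"
    proof (intro nn_integral_cong)
      fix a
      have "(\<lambda>c. graft_average f [[] \<mapsto> a] (star b c)) \<in> borel_measurable (K b)"
        using measurable_compose[OF st measurable_Pair1[OF measurable_graft_average[OF f], of "[[] \<mapsto> a]"]]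
        by (simp add: space_tree_space measurable_cong_sets[OF sK refl])
      then show "ennreal (min b a) * (\<integral>\<^sup>+c. graft_average f [[] \<mapsto> a] (star b c) \<partial>K b) = (\<integral>\<^sup>+c. ?h (star b c) [[] \<mapsto> a] \<partial>K b)"
        by (simp add: edge_weight_def root_age_def nn_integral_cmult)
    qed
    also have "\<dots> = (\<integral>\<^sup>+c. g (star b c) \<partial>K b)"
      unfolding g_def using pair by (intro PR.Fubini'[symmetric]) (simp add: split_beta)
    finally show ?thesis .
  qed
  have gK: "(\<lambda>b. \<integral>\<^sup>+c. g (star b c) \<partial>K b) \<in> borel_measurable borel"
  proof (rule nn_integral_measurable_subprob_algebra2)
    show "(\<lambda>(b, c). g (star b c)) \<in> borel_measurable (borel \<Otimes>\<^sub>M C)"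
      using measurable_compose[OF measurable_star g] by (simp add: split_beta)
    show "K \<in> borel \<rightarrow>\<^sub>M subprob_algebra C"
      by (rule measurable_prob_algebraD[OF measurable_poisson_child_intensity])
  qed
  have level1: "(\<integral>\<^sup>+t. k (up_to_height 1 t) \<partial>M) = (\<integral>\<^sup>+b. (\<integral>\<^sup>+c. k (star b c) \<partial>K b) \<partial>?R)" if k: "k \<in> borel_measurable T" for k
    using H.nn_integral_up_to_height_Suc[OF k, of 0]
      H.nn_integral_up_to_height_0[OF H.measurable_nn_integral_next_generation[OF k, of 0]]
    by (simp add: nn_integral_next_generation_single[OF k])
  have "(\<integral>\<^sup>+t. child_sum f (up_to_height 1 t) \<partial>M) = (\<integral>\<^sup>+b. (\<integral>\<^sup>+c. child_sum f (star b c) \<partial>K b) \<partial>?R)"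
    by (rule level1[OF measurable_child_sum[OF f]])
  also have "\<dots> = (\<integral>\<^sup>+b. root_mass * (\<integral>\<^sup>+c. g (star b c) \<partial>K b) \<partial>?R)"
    by (simp only: key)
  also have "\<dots> = root_mass * (\<integral>\<^sup>+b. (\<integral>\<^sup>+c. g (star b c) \<partial>K b) \<partial>?R)"
    using gK by (intro nn_integral_cmult) (simp add: measurable_cong_sets[OF sR refl])
  also have "(\<integral>\<^sup>+b. (\<integral>\<^sup>+c. g (star b c) \<partial>K b) \<partial>?R) = (\<integral>\<^sup>+t0. g (up_to_height 1 t0) \<partial>M)"
    by (rule level1[OF g, symmetric])
  also have "\<dots> = (\<integral>\<^sup>+t0. (\<integral>\<^sup>+t1. edge_weight t0 t1 * graft_average f (up_to_height 0 t1) (up_to_height 1 t0) \<partial>M) \<partial>M)"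
  proof (intro nn_integral_cong)
    fix t0
    have "(\<lambda>t1. ?h (up_to_height 1 t0) t1) \<in> borel_measurable T"
      using measurable_Pair2[OF h, of "up_to_height 1 t0"] by (simp add: space_tree_space)
    from H.nn_integral_up_to_height_0[OF this]
    show "g (up_to_height 1 t0) = (\<integral>\<^sup>+t1. edge_weight t0 t1 * graft_average f (up_to_height 0 t1) (up_to_height 1 t0) \<partial>M)"
      by (simp add: g_def)
  qed
  finally show ?thesis .
qed

text \<open>
  From one height to the next, both sides are integrated over the new generation: on the left in the
  whole tree, on the right separately in the two trees that are joined, by
  \<open>nn_integral_next_generation_graft\<close>. Root ages and root degrees do not change.
\<close>

lemma edge_identity_truncated:
  assumes f: "\<And>j. f j \<in> borel_measurable T"
  shows "(\<integral>\<^sup>+t. child_sum f (up_to_height (Suc n) t) \<partial>M) =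
    root_mass * (\<integral>\<^sup>+t0. (\<integral>\<^sup>+t1. edge_weight t0 t1 * graft_average f (up_to_height n t1) (up_to_height (Suc n) t0) \<partial>M) \<partial>M)"
  using f
proof (induction n arbitrary: f)
  case 0
  then show ?case using edge_identity_truncated_0[of f] by simp
next
  case (Suc n)
  note f = Suc.prems
  let ?h = "\<lambda>t0 t1. edge_weight t0 t1 * graft_average f t1 t0"
  have h: "(\<lambda>p. ?h (fst p) (snd p)) \<in> borel_measurable (T \<Otimes>\<^sub>M T)"
    by (rule borel_measurable_times_ennreal[OF measurable_edge_weight measurable_graft_average[OF f]])
  let ?N = "next_generation borel K"
  have N: "prob_space (?N k t)" "sets (?N k t) = sets T" for k t
    using measurable_space[OF H.measurable_next_generation, of t k]
    by (auto simp: space_prob_algebra space_tree_space)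
  define f' where "f' j t = (\<integral>\<^sup>+s. f j s \<partial>?N (Suc n) t)" for j t
  have f': "f' j \<in> borel_measurable T" for j
    unfolding f'_def by (rule H.measurable_nn_integral_next_generation[OF f])
  have cs: "(\<integral>\<^sup>+s. child_sum f s \<partial>?N (Suc n) t) = child_sum f' t" for t
  proof -
    have fm: "(\<lambda>s. if [j] \<in> dom s then f j s else 0) \<in> borel_measurable T" for j
      using f by measurable
    have "(\<integral>\<^sup>+s. child_sum f s \<partial>?N (Suc n) t) = (\<integral>\<^sup>+j. (\<integral>\<^sup>+s. (if [j] \<in> dom s then f j s else 0) \<partial>?N (Suc n) t) \<partial>count_space UNIV)"
      unfolding child_sum_def using fm
      by (intro nn_integral_count_space_nn_integral) (simp_all add: measurable_cong_sets[OF N(2) refl])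
    also have "\<dots> = child_sum f' t"
      unfolding child_sum_def
    proof (intro nn_integral_cong)
      fix j
      have "(\<integral>\<^sup>+s. (if [j] \<in> dom s then f j s else 0) \<partial>?N (Suc n) t)
        = (\<integral>\<^sup>+c. (if [j] \<in> dom t then f j (add_generation (Suc n) t c) else 0) \<partial>PiM UNIV (children_law borel K t))"
        unfolding H.nn_integral_next_generation[OF fm] by (intro nn_integral_cong) (auto simp: add_generation_def dom_def)
      then show "(\<integral>\<^sup>+s. (if [j] \<in> dom s then f j s else 0) \<partial>?N (Suc n) t) = (if [j] \<in> dom t then f' j t else 0)"
        by (simp add: f'_def H.nn_integral_next_generation[OF f])
    qed
    finally show ?thesis .
  qed
  have split: "edge_weight t0 t1 * graft_average f' t1 t0 = (\<integral>\<^sup>+s1. (\<integral>\<^sup>+s0. ?h s0 s1 \<partial>?N (Suc n) t0) \<partial>?N n t1)" for t0 t1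
  proof -
    let ?d = "root_degree t0"
    have gf: "(\<lambda>s0. f j (graft j s1 s0)) \<in> borel_measurable T" for j s1
      using measurable_compose[OF measurable_Pair2[OF measurable_graft, of borel s1 j] f] by (simp add: space_tree_space)
    have gf2: "(\<lambda>s1. \<integral>\<^sup>+s0. f j (graft j s1 s0) \<partial>?N (Suc n) t0) \<in> borel_measurable T" for j
    proof (rule nn_integral_measurable_subprob_algebra2)
      show "(\<lambda>(s1, s0). f j (graft j s1 s0)) \<in> borel_measurable (T \<Otimes>\<^sub>M T)"
        using measurable_compose[OF measurable_graft f] by (simp add: split_beta)
      show "(\<lambda>_. ?N (Suc n) t0) \<in> T \<rightarrow>\<^sub>M subprob_algebra T"
        using N by (intro measurable_const) (simp add: space_subprob_algebra prob_space_imp_subprob_space)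
    qed
    have hm: "(\<lambda>s0. ?h s0 s1) \<in> borel_measurable T" for s1
      using measurable_Pair1[OF h, of s1] by (simp add: space_tree_space)
    have hm2: "(\<lambda>s1. \<integral>\<^sup>+s0. ?h s0 s1 \<partial>?N (Suc n) t0) \<in> borel_measurable T"
    proof (rule nn_integral_measurable_subprob_algebra2)
      show "(\<lambda>(s1, s0). ?h s0 s1) \<in> borel_measurable (T \<Otimes>\<^sub>M T)"
        using measurable_compose[OF measurable_pair_swap' h] by (simp add: split_beta)
      show "(\<lambda>_. ?N (Suc n) t0) \<in> T \<rightarrow>\<^sub>M subprob_algebra T"
        using N by (intro measurable_const) (simp add: space_subprob_algebra prob_space_imp_subprob_space)
    qed
    have old: "root_age (add_generation k t c) = root_age t" for k c and t :: "real ltree"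
      by (simp add: root_age_def add_generation_def)
    have old': "root_degree (add_generation (Suc n) t0 c) = ?d" for c
      by (simp add: root_degree_def add_generation_def)
    have "(\<integral>\<^sup>+s1. (\<integral>\<^sup>+s0. ?h s0 s1 \<partial>?N (Suc n) t0) \<partial>?N n t1)
      = (\<integral>\<^sup>+s1. (\<integral>\<^sup>+s0. edge_weight t0 t1 * ((\<Sum>j\<le>?d. f j (graft j s1 s0)) / of_nat (Suc ?d)) \<partial>?N (Suc n) t0) \<partial>?N n t1)"
    proof -
      have m0: "(\<lambda>s0. edge_weight t0 t1 * ((\<Sum>j\<le>?d. f j (graft j s1 s0)) / d)) \<in> borel_measurable T" for s1 d
        using gf by measurable
      have m1: "(\<lambda>s1. \<integral>\<^sup>+s0. edge_weight t0 t1 * ((\<Sum>j\<le>?d. f j (graft j s1 s0)) / d) \<partial>?N (Suc n) t0) \<in> borel_measurable T" for d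
      proof (rule nn_integral_measurable_subprob_algebra2)
        show "(\<lambda>(s1, s0). edge_weight t0 t1 * ((\<Sum>j\<le>?d. f j (graft j s1 s0)) / d)) \<in> borel_measurable (T \<Otimes>\<^sub>M T)"
          using measurable_compose[OF measurable_graft f] by (simp add: split_beta)
        show "(\<lambda>_. ?N (Suc n) t0) \<in> T \<rightarrow>\<^sub>M subprob_algebra T"
          using N by (intro measurable_const) (simp add: space_subprob_algebra prob_space_imp_subprob_space)
      qed
      show ?thesis
        unfolding H.nn_integral_next_generation[OF hm2] H.nn_integral_next_generation[OF m1]
      proof (rule nn_integral_cong)
        fix c1
        show "(\<integral>\<^sup>+s0. ?h s0 (add_generation n t1 c1) \<partial>?N (Suc n) t0)
          = (\<integral>\<^sup>+s0. edge_weight t0 t1 * ((\<Sum>j\<le>?d. f j (graft j (add_generation n t1 c1) s0)) / of_nat (Suc ?d)) \<partial>?N (Suc n) t0)"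
          unfolding H.nn_integral_next_generation[OF hm] H.nn_integral_next_generation[OF m0]
          by (intro nn_integral_cong) (simp add: edge_weight_def old graft_average_def old')
      qed
    qed
    also have "\<dots> = edge_weight t0 t1 * ((\<Sum>j\<le>?d. \<integral>\<^sup>+s1. (\<integral>\<^sup>+s0. f j (graft j s1 s0) \<partial>?N (Suc n) t0) \<partial>?N n t1) / of_nat (Suc ?d))"
      using gf gf2
      by (simp add: nn_integral_cmult nn_integral_divide nn_integral_sum measurable_cong_sets[OF N(2) refl] measurable_const del: of_nat_Suc)
    also have "\<dots> = edge_weight t0 t1 * graft_average f' t1 t0"
      unfolding graft_average_def f'_def H.nn_integral_next_generation_graft[OF f] ..
    finally show ?thesis ..
  qed
  have "(\<integral>\<^sup>+t. child_sum f (up_to_height (Suc (Suc n)) t) \<partial>M) = (\<integral>\<^sup>+t. child_sum f' (up_to_height (Suc n) t) \<partial>M)"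
    unfolding H.nn_integral_up_to_height_Suc[OF measurable_child_sum[OF f]] cs ..
  also have "\<dots> = root_mass * (\<integral>\<^sup>+t0. (\<integral>\<^sup>+t1. edge_weight (up_to_height (Suc n) t0) (up_to_height n t1) * graft_average f' (up_to_height n t1) (up_to_height (Suc n) t0) \<partial>M) \<partial>M)"
    using Suc.IH[OF f'] by simp
  also have "(\<integral>\<^sup>+t0. (\<integral>\<^sup>+t1. edge_weight (up_to_height (Suc n) t0) (up_to_height n t1) * graft_average f' (up_to_height n t1) (up_to_height (Suc n) t0) \<partial>M) \<partial>M)
      = (\<integral>\<^sup>+t0. (\<integral>\<^sup>+s0. (\<integral>\<^sup>+t1. ?h s0 (up_to_height (Suc n) t1) \<partial>M) \<partial>?N (Suc n) (up_to_height (Suc n) t0)) \<partial>M)"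
    unfolding split
  proof (intro nn_integral_cong)
    fix t0
    let ?NN = "?N (Suc n) (up_to_height (Suc n) t0)"
    interpret N0: prob_space ?NN by (rule N)
    interpret MN: pair_sigma_finite M ?NN ..
    have m: "(\<lambda>s1. \<integral>\<^sup>+s0. ?h s0 s1 \<partial>?NN) \<in> borel_measurable T"
    proof (rule nn_integral_measurable_subprob_algebra2)
      show "(\<lambda>(s1, s0). ?h s0 s1) \<in> borel_measurable (T \<Otimes>\<^sub>M T)"
        using measurable_compose[OF measurable_pair_swap' h] by (simp add: split_beta)
      show "(\<lambda>_. ?NN) \<in> T \<rightarrow>\<^sub>M subprob_algebra T"
        using N by (intro measurable_const) (simp add: space_subprob_algebra prob_space_imp_subprob_space)
    qed
    have pair: "(\<lambda>p. ?h (snd p) (up_to_height (Suc n) (fst p))) \<in> borel_measurable (M \<Otimes>\<^sub>M ?NN)"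
    proof -
      have "(\<lambda>p. (snd p, up_to_height (Suc n) (fst p))) \<in> T \<Otimes>\<^sub>M T \<rightarrow>\<^sub>M T \<Otimes>\<^sub>M T"
        by (intro measurable_Pair measurable_snd measurable_compose[OF measurable_fst H.measurable_up])
      from measurable_compose[OF this h] show ?thesis
        by (simp add: measurable_cong_sets[OF sets_pair_measure_cong[OF H.sets_M N(2)] refl])
    qed
    have "(\<integral>\<^sup>+t1. (\<integral>\<^sup>+s1. (\<integral>\<^sup>+s0. ?h s0 s1 \<partial>?NN) \<partial>?N n (up_to_height n t1)) \<partial>M)
        = (\<integral>\<^sup>+t1. (\<integral>\<^sup>+s0. ?h s0 (up_to_height (Suc n) t1) \<partial>?NN) \<partial>M)"
      by (rule H.nn_integral_up_to_height_Suc[OF m, symmetric])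
    also have "\<dots> = (\<integral>\<^sup>+s0. (\<integral>\<^sup>+t1. ?h s0 (up_to_height (Suc n) t1) \<partial>M) \<partial>?NN)"
      using pair by (intro MN.Fubini'[symmetric]) (simp add: split_beta)
    finally show "(\<integral>\<^sup>+t1. (\<integral>\<^sup>+s1. (\<integral>\<^sup>+s0. ?h s0 s1 \<partial>?NN) \<partial>?N n (up_to_height n t1)) \<partial>M)
        = (\<integral>\<^sup>+s0. (\<integral>\<^sup>+t1. ?h s0 (up_to_height (Suc n) t1) \<partial>M) \<partial>?NN)" .
  qed
  also have "\<dots> = (\<integral>\<^sup>+t0. (\<integral>\<^sup>+t1. ?h (up_to_height (Suc (Suc n)) t0) (up_to_height (Suc n) t1) \<partial>M) \<partial>M)"
  proof (rule H.nn_integral_up_to_height_Suc[symmetric])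
    have "(\<lambda>p. (fst p, up_to_height (Suc n) (snd p))) \<in> T \<Otimes>\<^sub>M T \<rightarrow>\<^sub>M T \<Otimes>\<^sub>M T"
      by (intro measurable_Pair measurable_fst measurable_compose[OF measurable_snd H.measurable_up])
    from measurable_compose[OF this h]
    show "(\<lambda>s0. \<integral>\<^sup>+t1. ?h s0 (up_to_height (Suc n) t1) \<partial>M) \<in> borel_measurable T"
      by (intro H.M.borel_measurable_nn_integral) (simp add: split_beta measurable_cong_sets[OF sets_pair_measure_cong[OF refl H.sets_M] refl])
  qed
  finally show ?case by simp
qed

text \<open>
  Singling out a child of the root decomposes \<open>H\<close> into two independent copies of \<open>H\<close>, one of which
  is attached at a uniform position; the density \<open>edge_weight\<close> is symmetric in the two copies. The
  identity at finite heights determines, for every position \<open>j\<close>, the measure on either side.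
\<close>

theorem edge_identity:
  assumes f: "\<And>j. f j \<in> borel_measurable T"
  shows "(\<integral>\<^sup>+t. child_sum f t \<partial>M)
    = root_mass * (\<integral>\<^sup>+t0. (\<integral>\<^sup>+t1. edge_weight t0 t1 * graft_average f t1 t0 \<partial>M) \<partial>M)"
proof -
  let ?MM = "M \<Otimes>\<^sub>M M"
  have sMM: "sets ?MM = sets (T \<Otimes>\<^sub>M T)" by (intro sets_pair_measure_cong H.sets_M)
  \<comment> \<open>The two sides as measures, for a child in position \<open>j\<close>.\<close>
  define L where "L j = density M (\<lambda>t. if [j] \<in> dom t then 1 else 0)" for j
  define w where "w j p = root_mass * (edge_weight (fst p) (snd p) *
      ((if j \<le> root_degree (fst p) then 1 else 0) / of_nat (Suc (root_degree (fst p)))))" for j and p :: "real ltree \<times> real ltree"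
  define R where "R j = distr (density ?MM (w j)) T (\<lambda>p. graft j (snd p) (fst p))" for j
  have ind: "(\<lambda>t. if [j] \<in> dom t then 1 else 0 :: ennreal) \<in> borel_measurable T" for j
    by measurable
  have LI: "(\<integral>\<^sup>+t. g t \<partial>L j) = (\<integral>\<^sup>+t. (if [j] \<in> dom t then g t else 0) \<partial>M)"
    if "g \<in> borel_measurable T" for g j
  proof -
    have "(\<integral>\<^sup>+t. g t \<partial>L j) = (\<integral>\<^sup>+t. (if [j] \<in> dom t then 1 else 0) * g t \<partial>M)"
      unfolding L_def using that ind by (intro nn_integral_density) (simp_all add: measurable_cong_sets[OF H.sets_M refl])
    also have "\<dots> = (\<integral>\<^sup>+t. (if [j] \<in> dom t then g t else 0) \<partial>M)"
      by (intro nn_integral_cong) simp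
    finally show ?thesis .
  qed
  have wm: "w j \<in> borel_measurable ?MM" for j
  proof -
    have deg: "(\<lambda>p. root_degree (fst p)) \<in> T \<Otimes>\<^sub>M T \<rightarrow>\<^sub>M count_space UNIV"
      by (rule measurable_compose[OF measurable_fst measurable_root_degree])
    have "(\<lambda>p. (if j \<le> root_degree (fst p) then 1 else 0) / of_nat (Suc (root_degree (fst p))) :: ennreal) \<in> borel_measurable (T \<Otimes>\<^sub>M T)"
      by (rule measurable_compose[OF deg]) simp
    then have "(\<lambda>p. edge_weight (fst p) (snd p) * ((if j \<le> root_degree (fst p) then 1 else 0) / of_nat (Suc (root_degree (fst p))))) \<in> borel_measurable (T \<Otimes>\<^sub>M T)"
      by (rule borel_measurable_times_ennreal[OF measurable_edge_weight])
    from borel_measurable_times_ennreal[OF _ this, of "\<lambda>_. root_mass"] show ?thesis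
      unfolding w_def[abs_def] measurable_cong_sets[OF sMM refl] by simp
  qed
  have gr: "(\<lambda>p. graft j (snd p) (fst p)) \<in> ?MM \<rightarrow>\<^sub>M T" for j
    using measurable_graft_swapped[of j] by (simp add: measurable_cong_sets[OF sMM refl])
  have RI: "(\<integral>\<^sup>+t. g t \<partial>R j) = (\<integral>\<^sup>+p. w j p * g (graft j (snd p) (fst p)) \<partial>?MM)"
    if "g \<in> borel_measurable T" for g j
    unfolding R_def using that gr wm measurable_compose[OF gr that]
    by (subst nn_integral_distr) (simp_all add: nn_integral_density)
  have avg: "graft_average f t1 t0 = (\<integral>\<^sup>+j. (if j \<le> root_degree t0 then f j (graft j t1 t0) else 0) / of_nat (Suc (root_degree t0)) \<partial>count_space UNIV)"
    for f t1 t0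
  proof -
    have "(\<Sum>j\<le>root_degree t0. f j (graft j t1 t0)) = (\<integral>\<^sup>+j. f j (graft j t1 t0) * indicator {..root_degree t0} j \<partial>count_space UNIV)"
      by (simp add: nn_integral_count_space_indicator[symmetric] nn_integral_count_space_finite)
    also have "\<dots> = (\<integral>\<^sup>+j. (if j \<le> root_degree t0 then f j (graft j t1 t0) else 0) \<partial>count_space UNIV)"
      by (intro nn_integral_cong) (auto simp: indicator_def)
    finally show ?thesis
      unfolding graft_average_def by (simp only:) (subst nn_integral_divide, simp_all)
  qed
  have summed: "root_mass * (\<integral>\<^sup>+t0. (\<integral>\<^sup>+t1. edge_weight t0 t1 * graft_average f t1 t0 \<partial>M) \<partial>M)
      = (\<integral>\<^sup>+j. (\<integral>\<^sup>+t. f j t \<partial>R j) \<partial>count_space UNIV)"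
    if f: "\<And>j. f j \<in> borel_measurable T" for f
  proof -
    have h: "(\<lambda>p. edge_weight (fst p) (snd p) * graft_average f (snd p) (fst p)) \<in> borel_measurable ?MM"
      unfolding measurable_cong_sets[OF sMM refl]
      by (rule borel_measurable_times_ennreal[OF measurable_edge_weight measurable_graft_average[OF f]])
    have "root_mass * (\<integral>\<^sup>+t0. (\<integral>\<^sup>+t1. edge_weight t0 t1 * graft_average f t1 t0 \<partial>M) \<partial>M)
        = root_mass * (\<integral>\<^sup>+p. edge_weight (fst p) (snd p) * graft_average f (snd p) (fst p) \<partial>?MM)"
      by (subst H.M.nn_integral_fst[OF h, symmetric]) simp
    also have "\<dots> = (\<integral>\<^sup>+p. root_mass * (edge_weight (fst p) (snd p) * graft_average f (snd p) (fst p)) \<partial>?MM)"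
      by (rule nn_integral_cmult[OF h, symmetric])
    also have "\<dots> = (\<integral>\<^sup>+p. (\<integral>\<^sup>+j. w j p * f j (graft j (snd p) (fst p)) \<partial>count_space UNIV) \<partial>?MM)"
    proof (intro nn_integral_cong)
      fix p :: "real ltree \<times> real ltree"
      have "root_mass * (edge_weight (fst p) (snd p) * graft_average f (snd p) (fst p))
          = (\<integral>\<^sup>+j. root_mass * (edge_weight (fst p) (snd p) * ((if j \<le> root_degree (fst p) then f j (graft j (snd p) (fst p)) else 0) / of_nat (Suc (root_degree (fst p))))) \<partial>count_space UNIV)"
        unfolding avg by (simp add: nn_integral_cmult)
      also have "\<dots> = (\<integral>\<^sup>+j. w j p * f j (graft j (snd p) (fst p)) \<partial>count_space UNIV)"
        by (intro nn_integral_cong) (simp add: w_def divide_ennreal_def mult_ac)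
      finally show "root_mass * (edge_weight (fst p) (snd p) * graft_average f (snd p) (fst p))
          = (\<integral>\<^sup>+j. w j p * f j (graft j (snd p) (fst p)) \<partial>count_space UNIV)" .
    qed
    also have "\<dots> = (\<integral>\<^sup>+j. (\<integral>\<^sup>+p. w j p * f j (graft j (snd p) (fst p)) \<partial>?MM) \<partial>count_space UNIV)"
      by (intro nn_integral_count_space_nn_integral borel_measurable_times_ennreal wm measurable_compose[OF gr f]) simp
    finally show ?thesis by (simp only: RI[OF f])
  qed
  have eq: "L i = R i" for i
  proof (rule measure_eqI_up_to_height[where k = 1])
    show sL: "sets (L i) = sets T" by (simp add: L_def H.sets_M)
    show "sets (R i) = sets T" by (simp add: R_def)
    have sp: "space (L i) = UNIV" using sets_eq_imp_space_eq[OF sL] by (simp add: space_tree_space)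
    show "finite_measure (L i)"
    proof (rule finite_measureI)
      have "emeasure (L i) (space (L i)) = (\<integral>\<^sup>+t. 1 \<partial>L i)" by simp
      also have "\<dots> = (\<integral>\<^sup>+t. (if [i] \<in> dom t then 1 else 0) \<partial>M)" by (rule LI) simp
      also have "\<dots> \<le> (\<integral>\<^sup>+t. 1 \<partial>M)" by (intro nn_integral_mono) simp
      also have "\<dots> = 1" by (simp add: H.M.emeasure_space_1)
      finally show "emeasure (L i) (space (L i)) \<noteq> \<infinity>" by (auto simp: top_unique)
    qed
    fix n X assume n: "1 \<le> (n::nat)" and X: "X \<in> sets T"
    then obtain k where k: "n = Suc k" by (cases n) auto
    let ?g = "\<lambda>j. if j = i then indicator X else (\<lambda>_. 0) :: real ltree \<Rightarrow> ennreal"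
    have g: "?g j \<in> borel_measurable T" for j using X by simp
    have gn: "(\<lambda>t. ?g j (up_to_height n t)) \<in> borel_measurable T" for j
      by (rule measurable_compose[OF H.measurable_up g])
    have up: "up_to_height n -` X \<in> sets T"
      using measurable_sets[OF H.measurable_up X] by (simp add: space_tree_space)
    have single: "(\<integral>\<^sup>+j. (if j = i then c else 0) \<partial>count_space UNIV) = c" for c :: ennreal
    proof -
      have "(\<integral>\<^sup>+j. (if j = i then c else 0) \<partial>count_space UNIV) = (\<integral>\<^sup>+j. c * indicator {i} j \<partial>count_space UNIV)"
        by (intro nn_integral_cong) simp
      then show ?thesis by (simp add: nn_integral_cmult_indicator)
    qed
    have "emeasure (L i) (up_to_height n -` X) = (\<integral>\<^sup>+t. indicator (up_to_height n -` X) t \<partial>L i)"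
      using up by (simp add: sL)
    also have "\<dots> = (\<integral>\<^sup>+t. (if [i] \<in> dom t then indicator (up_to_height n -` X) t else 0) \<partial>M)"
      by (rule LI[OF borel_measurable_indicator[OF up]])
    also have "\<dots> = (\<integral>\<^sup>+t. child_sum ?g (up_to_height (Suc k) t) \<partial>M)"
    proof (intro nn_integral_cong)
      fix t :: "real ltree"
      have "child_sum ?g (up_to_height (Suc k) t) = (\<integral>\<^sup>+j. (if j = i then (if [i] \<in> dom t then indicator X (up_to_height n t) else 0) else 0) \<partial>count_space UNIV)"
        unfolding child_sum_def by (intro nn_integral_cong) (auto simp: k up_to_height_def dom_def restrict_map_def)
      then show "(if [i] \<in> dom t then indicator (up_to_height n -` X) t else 0) = child_sum ?g (up_to_height (Suc k) t)"
        unfolding single by (simp add: indicator_def)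
    qed
    also have "\<dots> = root_mass * (\<integral>\<^sup>+t0. (\<integral>\<^sup>+t1. edge_weight t0 t1 * graft_average ?g (up_to_height k t1) (up_to_height (Suc k) t0) \<partial>M) \<partial>M)"
      by (rule edge_identity_truncated[OF g])
    also have "\<dots> = root_mass * (\<integral>\<^sup>+t0. (\<integral>\<^sup>+t1. edge_weight t0 t1 * graft_average (\<lambda>j t. ?g j (up_to_height n t)) t1 t0 \<partial>M) \<partial>M)"
      unfolding graft_average_def root_degree_up_to_height k up_to_height_graft ..
    also have "\<dots> = (\<integral>\<^sup>+j. (\<integral>\<^sup>+t. ?g j (up_to_height n t) \<partial>R j) \<partial>count_space UNIV)"
      by (rule summed[OF gn])
    also have "\<dots> = (\<integral>\<^sup>+j. (if j = i then (\<integral>\<^sup>+t. indicator (up_to_height n -` X) t \<partial>R i) else 0) \<partial>count_space UNIV)"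
      by (rule nn_integral_cong) (auto simp: indicator_def[abs_def])
    also have "\<dots> = emeasure (R i) (up_to_height n -` X)"
      unfolding single using up by (simp add: R_def)
    finally show "emeasure (L i) (up_to_height n -` X) = emeasure (R i) (up_to_height n -` X)" .
  qed simp
  have "(\<integral>\<^sup>+t. child_sum f t \<partial>M) = (\<integral>\<^sup>+j. (\<integral>\<^sup>+t. (if [j] \<in> dom t then f j t else 0) \<partial>M) \<partial>count_space UNIV)"
    unfolding child_sum_def
  proof (rule nn_integral_count_space_nn_integral)
    have "(\<lambda>t. if [j] \<in> dom t then f j t else 0) \<in> borel_measurable T" for j
      using f by measurable
    then show "(\<lambda>t. if [j] \<in> dom t then f j t else 0) \<in> borel_measurable M" for j
      by (simp add: measurable_cong_sets[OF H.sets_M refl])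
  qed simp
  also have "\<dots> = (\<integral>\<^sup>+j. (\<integral>\<^sup>+t. f j t \<partial>R j) \<partial>count_space UNIV)"
    by (simp only: LI[OF f, symmetric] eq)
  finally show ?thesis by (simp only: summed[OF f])
qed

section \<open>Exchanging the root with a marked vertex\<close>

text \<open>
  Such a functional sees neither the addresses nor which of the vertices is the root, so that it can
  be evaluated after the root has been moved.
\<close>

definition bipointed_functional :: "(real ltree \<Rightarrow> nat list \<Rightarrow> nat list \<Rightarrow> ennreal) \<Rightarrow> bool" where
  "bipointed_functional F \<longleftrightarrow>
     (\<forall>u v. (\<lambda>t. F t u v) \<in> borel_measurable T) \<and>
     (\<forall>t\<in>ltrees. \<forall>s\<in>ltrees. \<forall>f. unrooted_iso t s f \<longrightarrow>
        (\<forall>u\<in>dom t. \<forall>v\<in>dom t. F s (f u) (f v) = F t u v))"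

definition root_total :: "(real ltree \<Rightarrow> nat list \<Rightarrow> nat list \<Rightarrow> ennreal) \<Rightarrow> ennreal" where
  "root_total F = (\<integral>\<^sup>+t. (\<integral>\<^sup>+v. (if v \<in> dom t then F t [] v else 0) \<partial>count_space UNIV) \<partial>M)"

lemma nn_integral_graft_average_const:
  fixes f :: "nat \<Rightarrow> real ltree \<Rightarrow> ennreal" and G :: "real ltree \<Rightarrow> real ltree \<Rightarrow> ennreal"
  assumes "\<And>t0 t1 j. t0 \<in> ltrees \<Longrightarrow> t1 \<in> ltrees \<Longrightarrow> f j (graft j t1 t0) = G t0 t1"
  shows "(\<integral>\<^sup>+t0. (\<integral>\<^sup>+t1. edge_weight t0 t1 * graft_average f t1 t0 \<partial>M) \<partial>M)
    = (\<integral>\<^sup>+t0. (\<integral>\<^sup>+t1. edge_weight t0 t1 * G t0 t1 \<partial>M) \<partial>M)"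
proof (intro nn_integral_cong_AE)
  show "AE t0 in M. (\<integral>\<^sup>+t1. edge_weight t0 t1 * graft_average f t1 t0 \<partial>M) = (\<integral>\<^sup>+t1. edge_weight t0 t1 * G t0 t1 \<partial>M)"
    using H.AE_ltrees
  proof eventually_elim
    fix t0 :: "real ltree" assume t: "t0 \<in> ltrees"
    show "(\<integral>\<^sup>+t1. edge_weight t0 t1 * graft_average f t1 t0 \<partial>M) = (\<integral>\<^sup>+t1. edge_weight t0 t1 * G t0 t1 \<partial>M)"
    proof (rule nn_integral_cong_AE, use H.AE_ltrees in eventually_elim)
      fix t1 :: "real ltree" assume "t1 \<in> ltrees"
      then show "edge_weight t0 t1 * graft_average f t1 t0 = edge_weight t0 t1 * G t0 t1"
        by (simp add: graft_average_def assms[OF t] average_const del: of_nat_Suc sum_constant)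
    qed
  qed
qed

text \<open>
  By \<open>edge_identity\<close> the functional is integrated over two independent trees that are joined by an
  edge. Its value depends only on the unrooted tree and the two ends of the edge, so exchanging the
  two trees exchanges the roles of these ends, while the weight of the edge is symmetric.
\<close>

lemma transport_along_edges:
  assumes F: "bipointed_functional F"
  shows "(\<integral>\<^sup>+t. child_sum (\<lambda>j t. F t [] [j]) t \<partial>M) = (\<integral>\<^sup>+t. child_sum (\<lambda>j t. F t [j] []) t \<partial>M)"
proof -
  have Fm: "(\<lambda>t. F t u v) \<in> borel_measurable T" for u v using F by (simp add: bipointed_functional_def)
  have inv: "F (graft j t1 t0) u v = F (graft i t0 t1) (graft_swap j i u) (graft_swap j i v)"
    if "t0 \<in> ltrees" "t1 \<in> ltrees" "u \<in> dom (graft j t1 t0)" "v \<in> dom (graft j t1 t0)" for i j u v t0 t1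
    using F that graft_in_ltrees[OF that(2,1)] graft_in_ltrees[OF that(1,2)] unrooted_iso_graft[of j t1 t0 i]
    unfolding bipointed_functional_def by metis
  have root: "[] \<in> dom (graft j t1 t0)" "[j] \<in> dom (graft j t1 t0)" if "t0 \<in> ltrees" "t1 \<in> ltrees" for j and t0 t1 :: "real ltree"
    using that by (auto simp: ltrees_def dom_def)
  have swap: "graft_swap j i [j] = []" for i j
    using graft_swap_simps(1)[of j i "[]"] by simp
  \<comment> \<open>The positions at which the trees are attached do not matter up to isomorphism, so position 0 can
    be used throughout.\<close>
  define G where "G t0 t1 = F (graft 0 t0 t1) [] [0]" for t0 t1
  have up: "F (graft j t1 t0) [j] [] = G t0 t1" if "t0 \<in> ltrees" "t1 \<in> ltrees" for j t0 t1
    using inv[OF that root(2,1)[OF that], of j 0] by (simp add: G_def swap)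
  have down: "F (graft j t1 t0) [] [j] = G t1 t0" if "t0 \<in> ltrees" "t1 \<in> ltrees" for j t0 t1
    using inv[OF that root[OF that], of j 0] inv[OF that(2,1) root(2,1)[OF that(2,1)], of 0 0]
    by (simp add: G_def swap)
  have sMM: "sets (M \<Otimes>\<^sub>M M) = sets (T \<Otimes>\<^sub>M T)" by (intro sets_pair_measure_cong H.sets_M)
  interpret MM: pair_sigma_finite M M ..
  have "(\<integral>\<^sup>+t. child_sum (\<lambda>j t. F t [] [j]) t \<partial>M) = root_mass * (\<integral>\<^sup>+t0. (\<integral>\<^sup>+t1. edge_weight t0 t1 * G t1 t0 \<partial>M) \<partial>M)"
    unfolding edge_identity[OF Fm] using down by (subst nn_integral_graft_average_const) auto
  also have "(\<integral>\<^sup>+t0. (\<integral>\<^sup>+t1. edge_weight t0 t1 * G t1 t0 \<partial>M) \<partial>M) = (\<integral>\<^sup>+t1. (\<integral>\<^sup>+t0. edge_weight t0 t1 * G t1 t0 \<partial>M) \<partial>M)"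
  proof (rule MM.Fubini')
    have "(\<lambda>p. G (fst p) (snd p)) \<in> borel_measurable (T \<Otimes>\<^sub>M T)"
      unfolding G_def by (rule measurable_compose[OF measurable_graft Fm]) simp
    moreover have "(\<lambda>p. edge_weight (snd p) (fst p)) \<in> borel_measurable (T \<Otimes>\<^sub>M T)"
      using measurable_edge_weight by (simp add: edge_weight_commute)
    ultimately have "(\<lambda>p. edge_weight (snd p) (fst p) * G (fst p) (snd p)) \<in> borel_measurable (T \<Otimes>\<^sub>M T)"
      by measurable
    then show "(\<lambda>(t1, t0). edge_weight t0 t1 * G t1 t0) \<in> borel_measurable (M \<Otimes>\<^sub>M M)"
      by (simp add: split_beta measurable_cong_sets[OF sMM refl])
  qed
  also have "\<dots> = (\<integral>\<^sup>+t0. (\<integral>\<^sup>+t1. edge_weight t0 t1 * G t0 t1 \<partial>M) \<partial>M)"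
    by (simp add: edge_weight_commute)
  also have "root_mass * \<dots> = (\<integral>\<^sup>+t. child_sum (\<lambda>j t. F t [j] []) t \<partial>M)"
    unfolding edge_identity[OF Fm] using up by (subst nn_integral_graft_average_const) auto
  finally show ?thesis .
qed

lemma sum_over_children:
  fixes g :: "nat list \<Rightarrow> ennreal"
  assumes "\<And>v. \<not> neighbours [] v \<Longrightarrow> g v = 0"
  shows "(\<integral>\<^sup>+v. g v \<partial>count_space UNIV) = (\<integral>\<^sup>+j. g [j] \<partial>count_space UNIV)"
proof -
  have "(\<integral>\<^sup>+j. g [j] \<partial>count_space UNIV) = (\<integral>\<^sup>+v. g v \<partial>count_space (range (\<lambda>j. [j])))"
    by (rule nn_integral_bij_count_space) (auto simp: bij_betw_def inj_on_def)
  also have "\<dots> = (\<integral>\<^sup>+v. g v * indicator (range (\<lambda>j. [j])) v \<partial>count_space UNIV)"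
    by (simp add: nn_integral_count_space_indicator)
  also have "\<dots> = (\<integral>\<^sup>+v. g v \<partial>count_space UNIV)"
  proof (intro nn_integral_cong)
    fix v
    show "g v * indicator (range (\<lambda>j. [j])) v = g v"
      using assms[of v] by (cases "v \<in> range (\<lambda>j. [j])") (auto simp: neighbours_def)
  qed
  finally show ?thesis ..
qed

lemma nn_integral_count_space_swap:
  fixes g :: "'a :: countable \<Rightarrow> 'b :: countable \<Rightarrow> ennreal"
  shows "(\<integral>\<^sup>+v. (\<integral>\<^sup>+w. g v w \<partial>count_space UNIV) \<partial>count_space UNIV) = (\<integral>\<^sup>+w. (\<integral>\<^sup>+v. g v w \<partial>count_space UNIV) \<partial>count_space UNIV)"
  by (rule nn_integral_count_space_nn_integral) auto

text \<open>
  The value of a functional at two vertices at distance \<open>n + 1\<close> is carried along the geodesic: by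
  its first edge and then, for the neighbour that was reached, over the remaining distance \<open>n\<close>.
\<close>

lemma transport_at_distance:
  assumes "bipointed_functional F" and "\<And>t u v. tree_distance u v \<noteq> n \<Longrightarrow> F t u v = 0"
  shows "root_total F = root_total (\<lambda>t u v. F t v u)"
  using assms
proof (induction n arbitrary: F)
  case 0
  have "F t [] v = F t v []" for t v
    using 0(2)[of "[]" v t] 0(2)[of v "[]" t] by (cases "v = []") auto
  then show ?case unfolding root_total_def by (intro nn_integral_cong if_cong refl)
next
  case (Suc n)
  note F = Suc.prems(1) and supp = Suc.prems(2)
  have Fm: "(\<lambda>t. F t u v) \<in> borel_measurable T" for u v using F by (simp add: bipointed_functional_def)
  \<comment> \<open>Here \<open>w\<close> is the vertex after \<open>u\<close> on the way to \<open>v\<close>. Summing over \<open>v\<close> leaves a functional of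
    the edge from \<open>u\<close> to \<open>w\<close>, and summing over \<open>u\<close> one of the path from \<open>w\<close> to \<open>v\<close>.\<close>
  define H where "H t u w v = (if u \<in> dom t \<and> w \<in> dom t \<and> v \<in> dom t \<and> neighbours u w \<and> tree_distance w v = n then F t u v else 0)" for t u w v
  define F1 where "F1 t u w = (\<integral>\<^sup>+v. H t u w v \<partial>count_space UNIV)" for t u w
  define F2 where "F2 t u v = (\<integral>\<^sup>+w. H t w u v \<partial>count_space UNIV)" for t u v
  have Hm: "(\<lambda>t. H t u w v) \<in> borel_measurable T" for u w v
    unfolding H_def using Fm[of u v] by measurable
  have Hiso: "H s (f u) (f w) (f v) = H t u w v"
    if t: "t \<in> ltrees" "s \<in> ltrees" and iso: "unrooted_iso t s f" and uwv: "u \<in> dom t" "w \<in> dom t" "v \<in> dom t" for t s f u w v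
  proof -
    have b: "bij_betw f (dom t) (dom s)" using iso by (simp add: unrooted_iso_def)
    then have "f u \<in> dom s" "f w \<in> dom s" "f v \<in> dom s" using uwv bij_betwE by blast+
    moreover have "adjacent s (f u) (f w) \<longleftrightarrow> adjacent t u w" using iso uwv unfolding unrooted_iso_def by blast
    moreover have "tree_distance (f w) (f v) = tree_distance w v" by (rule tree_distance_iso[OF iso t uwv(2,3)])
    moreover have "F s (f u) (f v) = F t u v" using F t iso uwv unfolding bipointed_functional_def by blast
    ultimately show ?thesis using uwv by (simp add: H_def adjacent_iff)
  qed
  have F1: "bipointed_functional F1"
    unfolding bipointed_functional_def
  proof (intro conjI allI ballI impI)
    show "(\<lambda>t. F1 t u v) \<in> borel_measurable T" for u v
      unfolding F1_def by (rule measurable_nn_integral_count_space[OF Hm])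
    fix t s :: "real ltree" and f u w assume a: "t \<in> ltrees" "s \<in> ltrees" "unrooted_iso t s f" "u \<in> dom t" "w \<in> dom t"
    have "F1 s (f u) (f w) = (\<integral>\<^sup>+v. (if v \<in> dom s then H s (f u) (f w) v else 0) \<partial>count_space UNIV)"
      unfolding F1_def by (intro nn_integral_cong) (simp add: H_def)
    also have "\<dots> = (\<integral>\<^sup>+v. (if v \<in> dom t then H s (f u) (f w) (f v) else 0) \<partial>count_space UNIV)"
      using a by (intro nn_integral_dom_iso) (simp add: unrooted_iso_def)
    also have "\<dots> = F1 t u w"
      unfolding F1_def using Hiso[OF a(1-5)] by (intro nn_integral_cong) (auto simp: H_def)
    finally show "F1 s (f u) (f w) = F1 t u w" .
  qed
  have F2: "bipointed_functional F2"
    unfolding bipointed_functional_def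
  proof (intro conjI allI ballI impI)
    show "(\<lambda>t. F2 t u v) \<in> borel_measurable T" for u v
      unfolding F2_def by (rule measurable_nn_integral_count_space[OF Hm])
    fix t s :: "real ltree" and f u v assume a: "t \<in> ltrees" "s \<in> ltrees" "unrooted_iso t s f" "u \<in> dom t" "v \<in> dom t"
    have "F2 s (f u) (f v) = (\<integral>\<^sup>+w. (if w \<in> dom s then H s w (f u) (f v) else 0) \<partial>count_space UNIV)"
      unfolding F2_def by (intro nn_integral_cong) (simp add: H_def)
    also have "\<dots> = (\<integral>\<^sup>+w. (if w \<in> dom t then H s (f w) (f u) (f v) else 0) \<partial>count_space UNIV)"
      using a by (intro nn_integral_dom_iso) (simp add: unrooted_iso_def)
    also have "\<dots> = F2 t u v"
      unfolding F2_def using Hiso[OF a(1-3) _ a(4,5)] by (intro nn_integral_cong) (auto simp: H_def)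
    finally show "F2 s (f u) (f v) = F2 t u v" .
  qed
  have first: "(\<integral>\<^sup>+w. H t u w v \<partial>count_space UNIV) = F t u v"
    if t: "t \<in> ltrees" "u \<in> dom t" "v \<in> dom t" for t u v
  proof (cases "tree_distance u v = Suc n")
    case True
    have "(\<integral>\<^sup>+w. H t u w v \<partial>count_space UNIV) = (\<integral>\<^sup>+w. F t u v * indicator {step_towards v u} w \<partial>count_space UNIV)"
    proof (intro nn_integral_cong)
      fix w
      show "H t u w v = F t u v * indicator {step_towards v u} w"
        using tree_distance_neighbours[OF True, of w] step_towards_in_dom[OF t] t(2,3)
        by (cases "w = step_towards v u") (auto simp: H_def)
    qed
    then show ?thesis by (simp add: nn_integral_cmult_indicator)
  next
    case False
    then show ?thesis using supp[OF False] by (simp add: H_def cong: if_cong)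
  qed
  have dom1: "(if w \<in> dom t then F1 t u w else 0) = F1 t u w" "(if w \<in> dom t then F1 t w u else 0) = F1 t w u" for t u w
    by (auto simp: F1_def H_def)
  have dom2: "(if w \<in> dom t then F2 t u w else 0) = F2 t u w" "(if w \<in> dom t then F2 t w u else 0) = F2 t w u" for t u w
    by (auto simp: F2_def H_def)
  have "root_total F = root_total F1"
    unfolding root_total_def
  proof (rule nn_integral_cong_AE)
    show "AE t in M. (\<integral>\<^sup>+v. (if v \<in> dom t then F t [] v else 0) \<partial>count_space UNIV)
        = (\<integral>\<^sup>+v. (if v \<in> dom t then F1 t [] v else 0) \<partial>count_space UNIV)"
      using H.AE_ltrees
    proof eventually_elim
      fix t :: "real ltree" assume t: "t \<in> ltrees"
      then have "[] \<in> dom t" by (simp add: ltrees_def)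
      then have "(\<integral>\<^sup>+v. (if v \<in> dom t then F t [] v else 0) \<partial>count_space UNIV)
          = (\<integral>\<^sup>+v. (\<integral>\<^sup>+w. H t [] w v \<partial>count_space UNIV) \<partial>count_space UNIV)"
        using first[OF t] by (intro nn_integral_cong) (auto simp: H_def)
      also have "\<dots> = (\<integral>\<^sup>+w. (\<integral>\<^sup>+v. H t [] w v \<partial>count_space UNIV) \<partial>count_space UNIV)"
        by (rule nn_integral_count_space_swap)
      finally show "(\<integral>\<^sup>+v. (if v \<in> dom t then F t [] v else 0) \<partial>count_space UNIV)
        = (\<integral>\<^sup>+v. (if v \<in> dom t then F1 t [] v else 0) \<partial>count_space UNIV)"
        unfolding dom1 by (simp add: F1_def)
    qed
  qed
  also have "\<dots> = (\<integral>\<^sup>+t. child_sum (\<lambda>j t. F1 t [] [j]) t \<partial>M)"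
    unfolding root_total_def child_sum_def
    by (intro nn_integral_cong sum_over_children) (auto simp: F1_def H_def)
  \<comment> \<open>The root moves along the first edge: it was \<open>u\<close> and becomes \<open>w\<close>.\<close>
  also have "\<dots> = (\<integral>\<^sup>+t. child_sum (\<lambda>j t. F1 t [j] []) t \<partial>M)"
    by (rule transport_along_edges[OF F1])
  also have "\<dots> = root_total (\<lambda>t u v. F1 t v u)"
    unfolding root_total_def child_sum_def
    by (intro nn_integral_cong sum_over_children[symmetric]) (auto simp: F1_def H_def neighbours_sym)
  also have "\<dots> = root_total F2"
    unfolding root_total_def dom1 dom2 unfolding F1_def F2_def
    by (intro nn_integral_cong nn_integral_count_space_swap)
  \<comment> \<open>The root moves from \<open>w\<close> to \<open>v\<close>.\<close>
  also have "\<dots> = root_total (\<lambda>t u v. F2 t v u)"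
    by (rule Suc.IH[OF F2]) (auto simp: F2_def H_def)
  also have "\<dots> = root_total (\<lambda>t u v. F t v u)"
    unfolding root_total_def
  proof (rule nn_integral_cong_AE)
    show "AE t in M. (\<integral>\<^sup>+v. (if v \<in> dom t then F2 t v [] else 0) \<partial>count_space UNIV)
        = (\<integral>\<^sup>+v. (if v \<in> dom t then F t v [] else 0) \<partial>count_space UNIV)"
      using H.AE_ltrees
    proof eventually_elim
      fix t :: "real ltree" assume t: "t \<in> ltrees"
      then have "[] \<in> dom t" by (simp add: ltrees_def)
      then have "(\<integral>\<^sup>+w. (if w \<in> dom t then F t w [] else 0) \<partial>count_space UNIV)
          = (\<integral>\<^sup>+w. (\<integral>\<^sup>+v. H t w v [] \<partial>count_space UNIV) \<partial>count_space UNIV)"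
        using first[OF t] by (intro nn_integral_cong) (auto simp: H_def)
      also have "\<dots> = (\<integral>\<^sup>+v. (\<integral>\<^sup>+w. H t w v [] \<partial>count_space UNIV) \<partial>count_space UNIV)"
        by (rule nn_integral_count_space_swap)
      finally show "(\<integral>\<^sup>+v. (if v \<in> dom t then F2 t v [] else 0) \<partial>count_space UNIV)
        = (\<integral>\<^sup>+v. (if v \<in> dom t then F t v [] else 0) \<partial>count_space UNIV)"
        unfolding dom2 by (simp add: F2_def)
    qed
  qed
  finally show ?case .
qed

text \<open>
  The mass transport principle for the law of \<open>H\<close>: the expected mass sent by the root equals the
  expected mass received by it. A functional is the sum of its parts at the distances \<open>n\<close>.
\<close>

theorem mass_transport:
  assumes F: "bipointed_functional F"
  shows "root_total F = root_total (\<lambda>t u v. F t v u)"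
proof -
  define Fn where "Fn n t u v = (if tree_distance u v = n \<and> u \<in> dom t \<and> v \<in> dom t then F t u v else 0)" for n t u v
  have Fm: "(\<lambda>t. F t u v) \<in> borel_measurable T" for u v using F by (simp add: bipointed_functional_def)
  have Fn_m: "(\<lambda>t. Fn n t u v) \<in> borel_measurable T" for n u v
    unfolding Fn_def using Fm[of u v] by measurable
  have Fn: "bipointed_functional (Fn n)" for n
    unfolding bipointed_functional_def
  proof (intro conjI allI ballI impI Fn_m)
    fix t s :: "real ltree" and f u v assume a: "t \<in> ltrees" "s \<in> ltrees" "unrooted_iso t s f" "u \<in> dom t" "v \<in> dom t"
    have "f u \<in> dom s" "f v \<in> dom s" using a bij_betwE unfolding unrooted_iso_def by blast+
    moreover have "F s (f u) (f v) = F t u v" using F a unfolding bipointed_functional_def by blast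
    ultimately show "Fn n s (f u) (f v) = Fn n t u v"
      using a tree_distance_iso[OF a(3,1,2,4,5)] by (simp add: Fn_def)
  qed
  have single: "(\<Sum>n. (if d = n then c else 0)) = c" for d :: nat and c :: ennreal
    using suminf_finite[of "{d}" "\<lambda>n. if d = n then c else 0"] by simp
  have gm: "(\<lambda>t. \<integral>\<^sup>+v. (if v \<in> dom t then g t v else 0) \<partial>count_space UNIV) \<in> borel_measurable M"
    if "\<And>v. (\<lambda>t. g t v) \<in> borel_measurable T" for g :: "real ltree \<Rightarrow> nat list \<Rightarrow> ennreal"
  proof -
    have "(\<lambda>t. if v \<in> dom t then g t v else 0) \<in> borel_measurable T" for v using that by measurable
    from measurable_nn_integral_count_space[OF this] show ?thesis
      by (simp add: measurable_cong_sets[OF H.sets_M refl])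
  qed
  have AE_root: "AE t in M. [] \<in> dom t"
    using H.AE_ltrees by eventually_elim (simp add: ltrees_def)
  have down: "root_total F = (\<Sum>n. root_total (Fn n))"
  proof -
    have "root_total F = (\<integral>\<^sup>+t. (\<Sum>n. \<integral>\<^sup>+v. (if v \<in> dom t then Fn n t [] v else 0) \<partial>count_space UNIV) \<partial>M)"
      unfolding root_total_def
    proof (rule nn_integral_cong_AE, use AE_root in eventually_elim)
      fix t :: "real ltree" assume "[] \<in> dom t"
      then have "(\<integral>\<^sup>+v. (if v \<in> dom t then F t [] v else 0) \<partial>count_space UNIV)
          = (\<integral>\<^sup>+v. (\<Sum>n. (if v \<in> dom t then Fn n t [] v else 0)) \<partial>count_space UNIV)"
        by (intro nn_integral_cong) (auto simp: Fn_def single)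
      then show "(\<integral>\<^sup>+v. (if v \<in> dom t then F t [] v else 0) \<partial>count_space UNIV)
          = (\<Sum>n. \<integral>\<^sup>+v. (if v \<in> dom t then Fn n t [] v else 0) \<partial>count_space UNIV)"
        by (simp add: nn_integral_suminf)
    qed
    then show ?thesis unfolding root_total_def by (simp add: nn_integral_suminf gm[OF Fn_m])
  qed
  have up: "root_total (\<lambda>t u v. F t v u) = (\<Sum>n. root_total (\<lambda>t u v. Fn n t v u))"
  proof -
    have "root_total (\<lambda>t u v. F t v u) = (\<integral>\<^sup>+t. (\<Sum>n. \<integral>\<^sup>+v. (if v \<in> dom t then Fn n t v [] else 0) \<partial>count_space UNIV) \<partial>M)"
      unfolding root_total_def
    proof (rule nn_integral_cong_AE, use AE_root in eventually_elim)
      fix t :: "real ltree" assume "[] \<in> dom t"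
      then have "(\<integral>\<^sup>+v. (if v \<in> dom t then F t v [] else 0) \<partial>count_space UNIV)
          = (\<integral>\<^sup>+v. (\<Sum>n. (if v \<in> dom t then Fn n t v [] else 0)) \<partial>count_space UNIV)"
        by (intro nn_integral_cong) (auto simp: Fn_def single)
      then show "(\<integral>\<^sup>+v. (if v \<in> dom t then F t v [] else 0) \<partial>count_space UNIV)
          = (\<Sum>n. \<integral>\<^sup>+v. (if v \<in> dom t then Fn n t v [] else 0) \<partial>count_space UNIV)"
        by (simp add: nn_integral_suminf)
    qed
    then show ?thesis unfolding root_total_def by (simp add: nn_integral_suminf gm[OF Fn_m])
  qed
  have "root_total (Fn n) = root_total (\<lambda>t u v. Fn n t v u)" for n
    by (rule transport_at_distance[OF Fn[of n], of n]) (simp add: Fn_def)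
  then show ?thesis unfolding down up by simp
qed

end

section \<open>The tilted law\<close>

lemma progeny_eq_nn_integral: "progeny t = (\<integral>\<^sup>+v. (if v \<in> dom t then 1 else 0) \<partial>count_space UNIV)"
proof -
  have "(\<integral>\<^sup>+v. (if v \<in> dom t then 1 else 0) \<partial>count_space UNIV) = (\<integral>\<^sup>+v. indicator (dom t) v \<partial>count_space UNIV)"
    by (intro nn_integral_cong) auto
  then show ?thesis by (simp add: progeny_def)
qed

lemma measurable_progeny: "progeny \<in> borel_measurable (tree_space S)"
  unfolding progeny_eq_nn_integral[abs_def] by (rule measurable_nn_integral_count_space) measurable

lemma progeny_finite: "progeny t \<noteq> \<infinity> \<longleftrightarrow> finite (dom t)"
  by (simp add: progeny_def emeasure_count_space)

lemma progeny_card: "finite (dom t) \<Longrightarrow> progeny t = of_nat (card (dom t))"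
  by (simp add: progeny_def emeasure_count_space)

lemma progeny_ltrees: "t \<in> ltrees \<Longrightarrow> progeny t \<noteq> 0"
  by (auto simp: progeny_def emeasure_count_space ltrees_def)

lemma measurable_forget_spine: "forget_spine \<in> tree_space age_spine_space \<rightarrow>\<^sub>M tree_space borel"
proof (rule measurable_into_tree_space)
  fix u
  have "map_option fst \<in> option_space age_spine_space \<rightarrow>\<^sub>M option_space (borel :: real measure)"
    by (rule measurable_map_option) simp
  from measurable_compose[OF measurable_tree_component this]
  show "(\<lambda>t. forget_spine t u) \<in> tree_space age_spine_space \<rightarrow>\<^sub>M option_space borel"
    by (simp add: forget_spine_def)
qed simp

text \<open>
  Regular conditional laws are determined event by event up to null sets; a countable generator makes
  these null sets independent of the event.
\<close>

lemma countable_generator_tree_space: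
  obtains P :: "real ltree set set"
  where "countable P" "Int_stable P" "UNIV \<in> P" "sets (tree_space borel) = sigma_sets UNIV P"
proof -
  let ?T = "tree_space (borel :: real measure)"
  have sT: "space ?T = UNIV" by (simp add: space_tree_space)
  define below where "below u q = {t :: real ltree. \<exists>b. t u = Some b \<and> b \<le> real_of_rat q}" for u q
  define absent where "absent u = {t :: real ltree. t u = None}" for u
  \<comment> \<open>The label at \<open>u\<close> is generated by its comparison with the rationals.\<close>
  define G where "G = range (\<lambda>(u, q). below u q) \<union> range absent"
  define P where "P = Inter ` {F. finite F \<and> F \<subseteq> G}"
  have cG: "countable G" unfolding G_def by (intro countable_Un countable_image) auto
  have cP: "countable P" unfolding P_def by (intro countable_image countable_Collect_finite_subset cG)
  have stable: "Int_stable P"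
  proof (rule Int_stableI)
    fix a b assume "a \<in> P" "b \<in> P"
    then obtain A B where "finite A" "A \<subseteq> G" "a = \<Inter>A" "finite B" "B \<subseteq> G" "b = \<Inter>B" by (auto simp: P_def)
    then show "a \<inter> b \<in> P" unfolding P_def by (intro image_eqI[where x = "A \<union> B"]) auto
  qed
  have "\<Inter>{} \<in> P" unfolding P_def by (intro imageI) simp
  then have U: "UNIV \<in> P" by simp
  have GP: "G \<subseteq> P"
  proof
    fix g assume "g \<in> G"
    then show "g \<in> P" unfolding P_def by (intro image_eqI[where x = "{g}"]) auto
  qed
  have absent_T: "absent u \<in> sets ?T" for u
  proof -
    have "{t \<in> space ?T. u \<notin> dom t} \<in> sets ?T"
      using measurable_in_dom[of u borel] by measurable
    then show ?thesis by (simp add: sT absent_def dom_def)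
  qed
  have below_T: "below u q \<in> sets ?T" for u q
  proof -
    have "Measurable.pred (option_space borel) (case_option False (\<lambda>b :: real. b \<le> real_of_rat q))"
      by (rule measurable_case_option) auto
    from measurable_compose[OF measurable_tree_component this, of u]
    have "{t \<in> space ?T. case_option False (\<lambda>b. b \<le> real_of_rat q) (t u)} \<in> sets ?T" by (simp add: pred_def)
    also have "{t \<in> space ?T. case_option False (\<lambda>b. b \<le> real_of_rat q) (t u)} = below u q"
      by (auto simp: sT below_def split: option.splits)
    finally show ?thesis .
  qed
  have "P \<subseteq> sets ?T"
  proof
    fix a assume "a \<in> P"
    then obtain F where F: "finite F" "F \<subseteq> G" "a = \<Inter>F" by (auto simp: P_def)
    have "F \<subseteq> sets ?T" using F(2) absent_T below_T by (auto simp: G_def)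
    then show "a \<in> sets ?T"
      using F(1,3) sets.finite_INT[of F "\<lambda>X. X" ?T] sets.top[of ?T] sT by (cases "F = {}") auto
  qed
  then have le: "sigma_sets UNIV P \<subseteq> sets ?T" using sets.sigma_sets_subset[of P ?T] sT by simp
  let ?N = "sigma UNIV P :: real ltree measure"
  have sN: "sets ?N = sigma_sets UNIV P" "space ?N = UNIV" by (simp_all add: sets_measure_of space_measure_of)
  have inN: "g \<in> sets ?N" if "g \<in> G" for g using that GP by (auto simp: sN)
  have "id \<in> ?N \<rightarrow>\<^sub>M ?T"
  proof (rule measurable_into_tree_space)
    fix u
    define r where "r t = (case t u of None \<Rightarrow> 0 | Some b \<Rightarrow> b)" for t :: "real ltree"
    have absent_N: "absent u \<in> sets ?N" by (rule inN) (auto simp: G_def)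
    have r: "r \<in> borel_measurable ?N"
    proof (rule borel_measurableI_le)
      fix a :: real
      have "{t \<in> space ?N. r t \<le> a} = (\<Inter>q \<in> {q. a < real_of_rat q}. below u q) \<union> (if 0 \<le> a then absent u else {})"
      proof (rule set_eqI)
        fix t :: "real ltree"
        show "t \<in> {t \<in> space ?N. r t \<le> a} \<longleftrightarrow> t \<in> (\<Inter>q \<in> {q. a < real_of_rat q}. below u q) \<union> (if 0 \<le> a then absent u else {})"
        proof (cases "t u")
          case None
          obtain q where "a < real_of_rat q" using of_rat_dense[of a "a + 1"] by auto
          then show ?thesis using None by (auto simp: r_def below_def absent_def sN)
        next
          case (Some b)
          have "b \<le> a" if "\<forall>q. a < real_of_rat q \<longrightarrow> b \<le> real_of_rat q"
          proof (rule ccontr)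
            assume "\<not> b \<le> a"
            then obtain q where "a < real_of_rat q" "real_of_rat q < b" using of_rat_dense[of a b] by auto
            then show False using that by (auto simp: not_le[symmetric])
          qed
          then show ?thesis using Some by (auto simp: r_def below_def absent_def sN)
        qed
      qed
      moreover have "(\<Inter>q \<in> {q. a < real_of_rat q}. below u q) \<in> sets ?N"
      proof -
        have "\<exists>q. a < real_of_rat q" using of_rat_dense[of a "a + 1"] by auto
        moreover have "below u q' \<in> sets ?N" for q' by (rule inN) (auto simp: G_def)
        ultimately show ?thesis by (intro sets.countable_INT') (auto simp del: sN)
      qed
      moreover have "(if 0 \<le> a then absent u else {}) \<in> sets ?N"
      proof (cases "0 \<le> a")
        case True then show ?thesis using absent_N by simp
      next
        case False then show ?thesis using sets.empty_sets[of ?N] by (simp only: if_False)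
      qed
      ultimately show "{t \<in> space ?N. r t \<le> a} \<in> sets ?N" by (simp only: sets.Un)
    qed
    have "(\<lambda>t. if t \<in> absent u then None else Some (r t)) \<in> ?N \<rightarrow>\<^sub>M option_space borel"
    proof (rule measurable_If)
      show "(\<lambda>t. Some (r t)) \<in> ?N \<rightarrow>\<^sub>M option_space borel" by (rule measurable_compose[OF r measurable_Some])
      show "{t \<in> space ?N. t \<in> absent u} \<in> sets ?N" using absent_N by (simp add: sN)
    qed (simp add: space_option_space)
    then show "(\<lambda>t. id t u) \<in> ?N \<rightarrow>\<^sub>M option_space borel"
      by (rule measurable_cong[THEN iffD1, rotated]) (auto simp: absent_def r_def split: option.splits)
  qed simp
  then have ge: "sets ?T \<subseteq> sigma_sets UNIV P"
    using measurable_sets[of id ?N ?T] sN by auto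
  show thesis by (rule that[OF cP stable U]) (use le ge in auto)
qed

context spinal_trees
begin

lemma nn_integral_forget_spine:
  assumes g: "g \<in> borel_measurable T"
  shows "(\<integral>\<^sup>+s. g (forget_spine s) \<partial>M') = (\<integral>\<^sup>+t. progeny t * g t \<partial>M) / ennreal E"
proof -
  have "(\<integral>\<^sup>+s. g (forget_spine s) \<partial>M')
      = (\<integral>\<^sup>+t. (\<integral>\<^sup>+v. (if v \<in> dom t then g t else 0) \<partial>count_space UNIV) \<partial>M) / ennreal E"
    using spine_identity[OF measurable_compose[OF measurable_forget_spine g]] by (simp cong: if_cong)
  also have "(\<integral>\<^sup>+t. (\<integral>\<^sup>+v. (if v \<in> dom t then g t else 0) \<partial>count_space UNIV) \<partial>M) = (\<integral>\<^sup>+t. progeny t * g t \<partial>M)"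
  proof (intro nn_integral_cong)
    fix t
    have "(\<integral>\<^sup>+v. (if v \<in> dom t then g t else 0) \<partial>count_space UNIV) = (\<integral>\<^sup>+v. (if v \<in> dom t then 1 else 0) * g t \<partial>count_space UNIV)"
      by (intro nn_integral_cong) simp
    then show "(\<integral>\<^sup>+v. (if v \<in> dom t then g t else 0) \<partial>count_space UNIV) = progeny t * g t"
      by (simp add: progeny_eq_nn_integral nn_integral_multc)
  qed
  finally show ?thesis .
qed

lemma progeny_M: "progeny \<in> borel_measurable M"
  using measurable_progeny by (simp add: measurable_cong_sets[OF H.sets_M refl])

lemma expected_progeny: "(\<integral>\<^sup>+t. progeny t \<partial>M) = ennreal E"
proof -
  have "(\<integral>\<^sup>+t. progeny t \<partial>M) / ennreal E = 1"
    using nn_integral_forget_spine[of "\<lambda>_. 1"] by (simp add: Hhat.M.emeasure_space_1)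
  then have "(\<integral>\<^sup>+t. progeny t \<partial>M) / ennreal E * ennreal E = ennreal E" by simp
  moreover have "y / ennreal E * ennreal E = y" for y
    using E_pos by (simp add: ennreal_divide_times mult_divide_eq_ennreal)
  ultimately show ?thesis by simp
qed

text \<open>
  A functional that does not depend on the spine is counted once for every vertex.
\<close>

theorem distr_forget_spine: "distr M' T forget_spine = tilted progeny M"
proof (rule measure_eqI)
  show "sets (distr M' T forget_spine) = sets (tilted progeny M)" by (simp add: tilted_def H.sets_M)
  fix A assume "A \<in> sets (distr M' T forget_spine)"
  then have A: "A \<in> sets T" by simp
  have fm: "forget_spine \<in> M' \<rightarrow>\<^sub>M T"
    using measurable_forget_spine by (simp add: measurable_cong_sets[OF Hhat.sets_M refl])
  have "emeasure (distr M' T forget_spine) A = (\<integral>\<^sup>+t. indicator A t \<partial>distr M' T forget_spine)"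
    using A by simp
  also have "\<dots> = (\<integral>\<^sup>+s. indicator A (forget_spine s) \<partial>M')"
    using A fm by (intro nn_integral_distr) simp_all
  also have "\<dots> = (\<integral>\<^sup>+t. progeny t * indicator A t \<partial>M) / ennreal E"
    using A by (intro nn_integral_forget_spine) simp
  also have "\<dots> = (\<integral>\<^sup>+t. progeny t * indicator A t / ennreal E \<partial>M)"
    using A progeny_M by (intro nn_integral_divide[symmetric]) (simp_all add: H.sets_M)
  also have "\<dots> = (\<integral>\<^sup>+t. progeny t / ennreal E * indicator A t \<partial>M)"
    by (intro nn_integral_cong) (simp add: divide_ennreal_def mult_ac)
  also have "\<dots> = emeasure (tilted progeny M) A"
    unfolding tilted_def expected_progeny using A progeny_M by (intro emeasure_density[symmetric]) (simp_all add: H.sets_M)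
  finally show "emeasure (distr M' T forget_spine) A = emeasure (tilted progeny M) A" .
qed

lemma nn_integral_root_age:
  assumes g: "g \<in> borel_measurable borel"
  shows "(\<integral>\<^sup>+t. g (root_age t) \<partial>M) = (\<integral>\<^sup>+b. g b \<partial>H_root_age x)"
  using H.nn_integral_up_to_height_0[OF measurable_compose[OF measurable_root_age g]]
  by (simp add: root_age_def[of "[[] \<mapsto> _]"])

lemma measurable_root_age_M: "root_age \<in> borel_measurable M"
  using measurable_root_age by (simp add: measurable_cong_sets[OF H.sets_M refl])

lemma distr_root_age: "distr M borel root_age = H_root_age x"
proof (rule measure_eqI)
  show "sets (distr M borel root_age) = sets (H_root_age x)" by (simp add: H_root_age_def)
  fix A assume "A \<in> sets (distr M borel root_age)"
  then have A: "A \<in> sets borel" by simp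
  have "emeasure (distr M borel root_age) A = (\<integral>\<^sup>+b. indicator A b \<partial>distr M borel root_age)" using A by simp
  also have "\<dots> = (\<integral>\<^sup>+t. indicator A (root_age t) \<partial>M)"
    using A measurable_root_age_M by (intro nn_integral_distr) simp_all
  also have "\<dots> = (\<integral>\<^sup>+b. indicator A b \<partial>H_root_age x)" using A by (intro nn_integral_root_age) simp
  also have "\<dots> = emeasure (H_root_age x) A" using A by (simp add: H_root_age_def)
  finally show "emeasure (distr M borel root_age) A = emeasure (H_root_age x) A" .
qed

lemma distr_root_age_Hhat: "distr M' borel (root_age \<circ> forget_spine) = Hhat_root_age x"
proof (rule measure_eqI)
  show "sets (distr M' borel (root_age \<circ> forget_spine)) = sets (Hhat_root_age x)" by (simp add: Hhat_root_age_def)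
  fix A assume "A \<in> sets (distr M' borel (root_age \<circ> forget_spine))"
  then have A: "A \<in> sets borel" by simp
  have r: "(\<lambda>s. root_age (forget_spine s)) \<in> T' \<rightarrow>\<^sub>M borel"
    by (rule measurable_compose[OF measurable_forget_spine measurable_root_age])
  have rd: "(\<lambda>l. [[] \<mapsto> l]) \<in> age_spine_space \<rightarrow>\<^sub>M T'"
  proof (rule measurable_into_tree_space[OF space_age_spine_space])
    fix u :: "nat list"
    show "(\<lambda>l. [[] \<mapsto> l] u) \<in> age_spine_space \<rightarrow>\<^sub>M option_space age_spine_space"
      by (cases "u = []") (auto simp: space_option_space)
  qed
  have ra: "root_age (forget_spine (up_to_height 0 s)) = root_age (forget_spine s)" for s
    by (simp add: root_age_def forget_spine_def up_to_height_def)
  have rs: "root_age (forget_spine [[] \<mapsto> l]) = fst l" for l :: "real \<times> bool"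
    by (simp add: root_age_def forget_spine_def)
  have im: "(\<lambda>s. indicator A (root_age (forget_spine s)) :: ennreal) \<in> borel_measurable T'"
    by (rule measurable_compose[OF r borel_measurable_indicator[OF A]])
  have "emeasure (distr M' borel (root_age \<circ> forget_spine)) A = (\<integral>\<^sup>+b. indicator A b \<partial>distr M' borel (root_age \<circ> forget_spine))"
    using A by simp
  also have "\<dots> = (\<integral>\<^sup>+s. indicator A (root_age (forget_spine s)) \<partial>M')"
    using A r by (subst nn_integral_distr) (simp_all add: comp_def measurable_cong_sets[OF Hhat.sets_M refl])
  also have "\<dots> = (\<integral>\<^sup>+l. indicator A (fst l) \<partial>distr (Hhat_root_age x) age_spine_space (\<lambda>b. (b, True)))"
    using Hhat.nn_integral_up_to_height_0[OF im] by (simp add: ra rs)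
  also have "\<dots> = (\<integral>\<^sup>+b. indicator A b \<partial>Hhat_root_age x)"
  proof (subst nn_integral_distr)
    show "(\<lambda>b. (b, True)) \<in> Hhat_root_age x \<rightarrow>\<^sub>M age_spine_space" by (simp add: Hhat_root_age_def)
    have "(\<lambda>l. indicator A (fst l) :: ennreal) \<in> borel_measurable age_spine_space"
      by (rule measurable_compose[OF measurable_fst borel_measurable_indicator[OF A]])
    then show "(\<lambda>l. indicator A (fst l) :: ennreal) \<in> borel_measurable (distr (Hhat_root_age x) age_spine_space (\<lambda>b. (b, True)))"
      by (simp only: measurable_distr_eq1)
  qed simp
  also have "\<dots> = emeasure (Hhat_root_age x) A" using A by (simp add: Hhat_root_age_def)
  finally show "emeasure (distr M' borel (root_age \<circ> forget_spine)) A = emeasure (Hhat_root_age x) A" .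
qed

text \<open>
  The root age of the hatted tree has density \<open>m / E\<close> with respect to that of \<open>H\<close>, and the joint
  law of tree and root age has density \<open>progeny / E\<close>. Hence, given the root age \<open>b\<close>, the density is
  \<open>progeny / m b\<close>, where \<open>m b\<close> is the conditional mean of the progeny. As the density of the root
  age is positive on the half-line, its null sets there are Lebesgue null sets.
\<close>

theorem conditional_distr_forget_spine:
  assumes \<kappa>: "regular_conditional_law M root_age \<kappa>"
    and \<kappa>': "regular_conditional_law M' (root_age \<circ> forget_spine) \<kappa>'"
  shows "AE b in lborel. b \<ge> 0 \<longrightarrow> distr (\<kappa>' b) T forget_spine = tilted progeny (\<kappa> b)"
proof -
  let ?R = "H_root_age x"
  have sR: "sets ?R = sets borel" by (simp add: H_root_age_def)
  interpret R: prob_space ?R by (rule H_root_age_eq)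
  obtain P :: "real ltree set set" where P: "countable P" "Int_stable P" "UNIV \<in> P" "sets T = sigma_sets UNIV P"
    by (rule countable_generator_tree_space)
  have PT: "A \<in> sets T" if "A \<in> P" for A using that P(4) by auto
  have k: "\<kappa> \<in> borel \<rightarrow>\<^sub>M subprob_algebra T" and k': "\<kappa>' \<in> borel \<rightarrow>\<^sub>M subprob_algebra T'"
    using \<kappa> \<kappa>' subprob_algebra_cong[OF H.sets_M] subprob_algebra_cong[OF Hhat.sets_M]
    by (auto simp: regular_conditional_law_def dest!: measurable_prob_algebraD)
  have kp: "prob_space (\<kappa> b)" "sets (\<kappa> b) = sets T" for b
    using \<kappa> measurable_space[of \<kappa> borel "prob_algebra M" b] by (auto simp: regular_conditional_law_def space_prob_algebra H.sets_M)
  have kp': "prob_space (\<kappa>' b)" "sets (\<kappa>' b) = sets T'" for b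
    using \<kappa>' measurable_space[of \<kappa>' borel "prob_algebra M'" b] by (auto simp: regular_conditional_law_def space_prob_algebra Hhat.sets_M)
  define p where "p A b = (\<integral>\<^sup>+t. progeny t * indicator A t \<partial>\<kappa> b)" for A b
  define q where "q A b = emeasure (\<kappa>' b) (forget_spine -` A)" for A b
  have fA: "forget_spine -` A \<in> sets T'" if "A \<in> sets T" for A
    using measurable_sets[OF measurable_forget_spine that] by (simp add: space_tree_space[OF space_age_spine_space])
  have pi: "(\<lambda>t. progeny t * indicator A t) \<in> borel_measurable T" if "A \<in> sets T" for A
    using that measurable_progeny by measurable
  have pm: "p A \<in> borel_measurable borel" if "A \<in> sets T" for A
    unfolding p_def[abs_def] by (rule measurable_compose[OF k nn_integral_measurable_subprob_algebra[OF pi[OF that]]])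
  have qm: "q A \<in> borel_measurable borel" if "A \<in> sets T" for A
    unfolding q_def[abs_def] by (rule measurable_emeasure_kernel[OF k' fA[OF that]])
  \<comment> \<open>For a fixed event \<open>A\<close>, two densities with respect to the law of the root age are compared.\<close>
  have eq: "AE b in ?R. ennreal (m b) * q A b = p A b" if A: "A \<in> sets T" for A
  proof -
    have d: "emeasure (density ?R (\<lambda>b. ennreal (m b) * q A b)) B = emeasure (density ?R (p A)) B" if B: "B \<in> sets borel" for B
    proof -
      define dm where "dm v = {t \<in> A. v \<in> dom t}" for v :: "nat list"
      have dm: "dm v \<in> sets T" for v
      proof -
        have "dm v = A \<inter> {t \<in> space T. v \<in> dom t}" by (auto simp: dm_def space_tree_space)
        then show ?thesis using A measurable_in_dom[of v borel] by (simp add: pred_def)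
      qed
      \<comment> \<open>The conditional laws are defined through events. The progeny is therefore written as a sum of
        indicators over all addresses.\<close>
      have pk: "p A b = (\<integral>\<^sup>+v. emeasure (\<kappa> b) (dm v) \<partial>count_space UNIV)" for b
      proof -
        have "p A b = (\<integral>\<^sup>+t. (\<integral>\<^sup>+v. indicator (dm v) t \<partial>count_space UNIV) \<partial>\<kappa> b)"
          unfolding p_def
        proof (intro nn_integral_cong)
          fix t
          have "progeny t * indicator A t = (\<integral>\<^sup>+v. (if v \<in> dom t then 1 else 0) * indicator A t \<partial>count_space UNIV)"
            by (simp add: progeny_eq_nn_integral nn_integral_multc)
          also have "\<dots> = (\<integral>\<^sup>+v. indicator (dm v) t \<partial>count_space UNIV)"
            by (intro nn_integral_cong) (auto simp: dm_def indicator_def)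
          finally show "progeny t * indicator A t = (\<integral>\<^sup>+v. indicator (dm v) t \<partial>count_space UNIV)" .
        qed
        also have "\<dots> = (\<integral>\<^sup>+v. (\<integral>\<^sup>+t. indicator (dm v) t \<partial>\<kappa> b) \<partial>count_space UNIV)"
          using dm by (intro nn_integral_count_space_nn_integral borel_measurable_indicator) (simp_all add: kp)
        finally show ?thesis using dm by (simp add: kp)
      qed
      have "emeasure (density ?R (p A)) B = (\<integral>\<^sup>+b. p A b * indicator B b \<partial>?R)"
        using pm[OF A] B by (intro emeasure_density) (simp_all add: sR measurable_cong_sets[OF sR refl])
      also have "\<dots> = (\<integral>\<^sup>+b. (\<integral>\<^sup>+v. emeasure (\<kappa> b) (dm v) * indicator B b \<partial>count_space UNIV) \<partial>?R)"
        unfolding pk by (simp add: nn_integral_multc)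
      also have "\<dots> = (\<integral>\<^sup>+v. (\<integral>\<^sup>+b. emeasure (\<kappa> b) (dm v) * indicator B b \<partial>?R) \<partial>count_space UNIV)"
      proof (rule nn_integral_count_space_nn_integral)
        fix v
        have "(\<lambda>b. emeasure (\<kappa> b) (dm v)) \<in> borel_measurable borel" by (rule measurable_emeasure_kernel[OF k dm])
        then show "(\<lambda>b. emeasure (\<kappa> b) (dm v) * indicator B b) \<in> borel_measurable ?R"
          using B by (simp add: measurable_cong_sets[OF sR refl])
      qed simp
      also have "\<dots> = (\<integral>\<^sup>+v. emeasure M {t \<in> dm v. root_age t \<in> B} \<partial>count_space UNIV)"
        using \<kappa> dm B unfolding regular_conditional_law_def distr_root_age by (simp add: H.sets_M)
      also have "\<dots> = (\<integral>\<^sup>+v. (\<integral>\<^sup>+t. indicator {t \<in> dm v. root_age t \<in> B} t \<partial>M) \<partial>count_space UNIV)"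
      proof -
        have "{t \<in> dm v. root_age t \<in> B} \<in> sets M" for v
        proof -
          have "{t \<in> dm v. root_age t \<in> B} = dm v \<inter> (root_age -` B \<inter> space T)" by (auto simp: space_tree_space)
          then show ?thesis using dm measurable_sets[OF measurable_root_age B] by (simp add: H.sets_M)
        qed
        then show ?thesis by simp
      qed
      also have "\<dots> = (\<integral>\<^sup>+t. (\<integral>\<^sup>+v. indicator {t \<in> dm v. root_age t \<in> B} t \<partial>count_space UNIV) \<partial>M)"
      proof (rule nn_integral_count_space_nn_integral[symmetric])
        fix v
        have "{t \<in> dm v. root_age t \<in> B} = dm v \<inter> (root_age -` B \<inter> space T)" by (auto simp: space_tree_space)
        then show "(\<lambda>t. indicator {t \<in> dm v. root_age t \<in> B} t :: ennreal) \<in> borel_measurable M"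
          using dm measurable_sets[OF measurable_root_age B] by (simp add: H.sets_M)
      qed simp
      also have "\<dots> = (\<integral>\<^sup>+t. progeny t * (indicator A t * indicator B (root_age t)) \<partial>M)"
      proof (intro nn_integral_cong)
        fix t
        have "progeny t * (indicator A t * indicator B (root_age t)) = (\<integral>\<^sup>+v. (if v \<in> dom t then 1 else 0) * (indicator A t * indicator B (root_age t)) \<partial>count_space UNIV)"
          by (simp add: progeny_eq_nn_integral nn_integral_multc)
        also have "\<dots> = (\<integral>\<^sup>+v. indicator {t \<in> dm v. root_age t \<in> B} t \<partial>count_space UNIV)"
          by (intro nn_integral_cong) (auto simp: dm_def indicator_def)
        finally show "(\<integral>\<^sup>+v. indicator {t \<in> dm v. root_age t \<in> B} t \<partial>count_space UNIV) = progeny t * (indicator A t * indicator B (root_age t))" ..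
      qed
      also have "\<dots> = ennreal E * ((\<integral>\<^sup>+t. progeny t * (indicator A t * indicator B (root_age t)) \<partial>M) / ennreal E)"
        using E_pos by (simp add: ennreal_times_divide mult.commute[of "ennreal E"] mult_divide_eq_ennreal)
      also have "\<dots> = ennreal E * (\<integral>\<^sup>+s. indicator A (forget_spine s) * indicator B (root_age (forget_spine s)) \<partial>M')"
      proof (subst nn_integral_forget_spine)
        have "(\<lambda>t. indicator B (root_age t) :: ennreal) \<in> borel_measurable T"
          by (rule measurable_compose[OF measurable_root_age borel_measurable_indicator[OF B]])
        then show "(\<lambda>t. indicator A t * indicator B (root_age t) :: ennreal) \<in> borel_measurable T" using A by measurable
      qed simp
      also have "(\<integral>\<^sup>+s. indicator A (forget_spine s) * indicator B (root_age (forget_spine s)) \<partial>M')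
          = emeasure M' {s \<in> forget_spine -` A. (root_age \<circ> forget_spine) s \<in> B}"
      proof -
        have "{s \<in> forget_spine -` A. (root_age \<circ> forget_spine) s \<in> B} = forget_spine -` A \<inter> ((\<lambda>s. root_age (forget_spine s)) -` B \<inter> space T')"
          by (auto simp: space_tree_space[OF space_age_spine_space])
        then have "{s \<in> forget_spine -` A. (root_age \<circ> forget_spine) s \<in> B} \<in> sets M'"
          using fA[OF A] measurable_sets[OF measurable_compose[OF measurable_forget_spine measurable_root_age] B] by (simp add: Hhat.sets_M)
        from nn_integral_indicator[OF this, symmetric] show ?thesis
          by (simp only:) (intro nn_integral_cong, auto simp: indicator_def)
      qed
      also have "\<dots> = (\<integral>\<^sup>+b. q A b * indicator B b \<partial>Hhat_root_age x)"
        using \<kappa>'[unfolded regular_conditional_law_def distr_root_age_Hhat Hhat.sets_M] fA[OF A] B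
        unfolding q_def by blast
      also have "ennreal E * \<dots> = (\<integral>\<^sup>+b. ennreal (m b) * (q A b * indicator B b) \<partial>?R)"
        using B qm[OF A] E_pos
        by (simp add: nn_integral_Hhat_root_age[OF x_pos] ennreal_times_divide mult.commute[of "ennreal E"] mult_divide_eq_ennreal)
      also have "\<dots> = (\<integral>\<^sup>+b. (ennreal (m b) * q A b) * indicator B b \<partial>?R)"
        by (simp add: mult.assoc)
      also have "\<dots> = emeasure (density ?R (\<lambda>b. ennreal (m b) * q A b)) B"
        using qm[OF A] B by (intro emeasure_density[symmetric]) (simp_all add: sR measurable_cong_sets[OF sR refl])
      finally show ?thesis by simp
    qed
    show ?thesis
    proof (rule R.density_unique)
      show "(\<lambda>b. ennreal (m b) * q A b) \<in> borel_measurable ?R" "p A \<in> borel_measurable ?R"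
        using qm[OF A] pm[OF A] by (simp_all add: measurable_cong_sets[OF sR refl])
      show "density ?R (\<lambda>b. ennreal (m b) * q A b) = density ?R (p A)"
        using d by (intro measure_eqI) (simp_all add: sR)
    qed
  qed
  have "AE b in ?R. \<forall>A\<in>P. ennreal (m b) * q A b = p A b"
    using P(1) eq PT by (simp add: AE_ball_countable)
  then have "AE b in ?R. distr (\<kappa>' b) T forget_spine = tilted progeny (\<kappa> b)"
  proof eventually_elim
    fix b assume b: "\<forall>A\<in>P. ennreal (m b) * q A b = p A b"
    have fm: "forget_spine \<in> \<kappa>' b \<rightarrow>\<^sub>M T" using measurable_forget_spine by (simp add: measurable_cong_sets[OF kp'(2) refl])
    have prog: "progeny \<in> borel_measurable (\<kappa> b)" using measurable_progeny by (simp add: measurable_cong_sets[OF kp(2) refl])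
    have sp: "space (\<kappa>' b) = UNIV" using sets_eq_imp_space_eq[OF kp'(2)] by (simp add: space_tree_space[OF space_age_spine_space])
    have q1: "q UNIV b = 1" using prob_space.emeasure_space_1[OF kp'(1)[of b]] sp by (simp add: q_def)
    have m: "m b > 0" using mean_progeny_bounds(1)[OF x_pos, of b] by simp
    \<comment> \<open>The event \<open>UNIV\<close> belongs to the generator, so the normalising constant is \<open>m b\<close>.\<close>
    have tot: "(\<integral>\<^sup>+t. progeny t \<partial>\<kappa> b) = ennreal (m b)"
      using b P(3) q1 by (auto simp: p_def)
    interpret D: prob_space "distr (\<kappa>' b) T forget_spine"
      using kp'(1) fm by (intro prob_space.prob_space_distr)
    show "distr (\<kappa>' b) T forget_spine = tilted progeny (\<kappa> b)"
    proof (rule measure_eqI_generator_eq[OF P(2), where \<Omega> = UNIV and A = "\<lambda>_. UNIV"])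
      fix A assume A: "A \<in> P"
      have "emeasure (tilted progeny (\<kappa> b)) A = (\<integral>\<^sup>+t. progeny t / ennreal (m b) * indicator A t \<partial>\<kappa> b)"
        unfolding tilted_def tot using PT[OF A] prog by (intro emeasure_density) (simp_all add: kp)
      also have "\<dots> = (\<integral>\<^sup>+t. progeny t * indicator A t / ennreal (m b) \<partial>\<kappa> b)"
        by (intro nn_integral_cong) (simp add: divide_ennreal_def mult_ac)
      also have "\<dots> = p A b / ennreal (m b)"
        unfolding p_def using pi[OF PT[OF A]] by (intro nn_integral_divide) (simp_all add: measurable_cong_sets[OF kp(2) refl])
      also have "\<dots> = q A b"
        using b A m by (auto simp: mult.commute[of "ennreal (m b)"] mult_divide_eq_ennreal dest!: bspec[OF _ A] sym[of _ "p A b"])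
      also have "\<dots> = emeasure (distr (\<kappa>' b) T forget_spine) A"
        using PT[OF A] fm sp by (simp add: emeasure_distr q_def)
      finally show "emeasure (distr (\<kappa>' b) T forget_spine) A = emeasure (tilted progeny (\<kappa> b)) A" ..
    qed (use P D.emeasure_finite in \<open>auto simp: tilted_def kp\<close>)
  qed
  then have "AE b in lborel. 0 < ennreal (indicator {0..} b * H_root_density x b) \<longrightarrow> distr (\<kappa>' b) T forget_spine = tilted progeny (\<kappa> b)"
    unfolding H_root_age_eq by (subst (asm) AE_density) measurable
  then show ?thesis
    by eventually_elim (use H_root_density_pos[of x] in \<open>auto simp: indicator_def\<close>)
qed

end

section \<open>Conditioning on the isomorphism class\<close>

lemma measurable_spine: "spine \<in> tree_space age_spine_space \<rightarrow>\<^sub>M count_space UNIV"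
proof -
  let ?T' = "tree_space age_spine_space"
  define Q where "Q s p \<longleftrightarrow> set p = {u. \<exists>b. s u = Some (b, True)} \<and> sorted_wrt (\<lambda>u v. length u < length v) p"
    for s :: "(real \<times> bool) ltree" and p :: "nat list list"
  have sp: "space ?T' = UNIV" by (simp add: space_tree_space[OF space_age_spine_space])
  have flag: "Measurable.pred ?T' (\<lambda>s. \<exists>b. s u = Some (b, True))" for u
  proof -
    have "Measurable.pred (option_space age_spine_space) (case_option False snd)"
      by (rule measurable_case_option) auto
    from measurable_compose[OF measurable_tree_component this, of u] show ?thesis
      by (rule measurable_cong[THEN iffD1, rotated]) (auto split: option.splits)
  qed
  have Qm: "Measurable.pred ?T' (\<lambda>s. Q s p)" for p
  proof -
    have "Measurable.pred ?T' (\<lambda>s. (\<forall>u. u \<in> set p \<longleftrightarrow> (\<exists>b. s u = Some (b, True))) \<and> sorted_wrt (\<lambda>u v. length u < length v) p)"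
      using flag by measurable
    then show ?thesis by (rule measurable_cong[THEN iffD1, rotated]) (auto simp: Q_def)
  qed
  have unique: "p = q" if "Q s p" "Q s q" for s p q
    using that sorted_wrt_length_unique[of p q] by (auto simp: Q_def)
  have spine_eq: "spine s = (THE p. Q s p)" for s by (simp add: spine_def Q_def)
  \<comment> \<open>The value of the definite description when it is not satisfied.\<close>
  define d where "d = (THE p :: nat list list. False)"
  have "spine -` {p} = {s. Q s p} \<union> (if p = d then {s. \<forall>q. \<not> Q s q} else {})" for p
  proof (rule set_eqI)
    fix s
    show "s \<in> spine -` {p} \<longleftrightarrow> s \<in> {s. Q s p} \<union> (if p = d then {s. \<forall>q. \<not> Q s q} else {})"
    proof (cases "\<exists>q. Q s q")
      case True
      then obtain q where q: "Q s q" ..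
      then have "spine s = q" unfolding spine_eq using unique by blast
      then show ?thesis using q unique by auto
    next
      case False
      then have none: "Q s = (\<lambda>_. False)" by auto
      have "spine s = d" unfolding spine_eq d_def by (simp only: none)
      then show ?thesis using False by auto
    qed
  qed
  moreover have "{s. Q s p} \<in> sets ?T'" for p using Qm[of p] sp by (simp add: pred_def)
  moreover have "{s. \<forall>q. \<not> Q s q} \<in> sets ?T'"
  proof -
    have "Measurable.pred ?T' (\<lambda>s. \<forall>q. \<not> Q s q)" using Qm by measurable
    then show ?thesis using sp by (simp add: pred_def)
  qed
  ultimately have "spine -` {p} \<in> sets ?T'" for p by (cases "p = d") simp_all
  then show ?thesis by (simp add: measurable_count_space_eq2_countable sp)
qed

text \<open>
  Rooted and unrooted isomorphism are treated together: both are preserved by inversion, and both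
  preserve geodesics.
\<close>

definition tree_isomorphism :: "(real ltree \<Rightarrow> real ltree \<Rightarrow> (nat list \<Rightarrow> nat list) \<Rightarrow> bool) \<Rightarrow> bool" where
  "tree_isomorphism R \<longleftrightarrow> (\<forall>t\<in>ltrees. \<forall>s\<in>ltrees. \<forall>f. R t s f \<longrightarrow>
     unrooted_iso t s f \<and> R s t (inv_into (dom t) f))"

lemma tree_isomorphism_unrooted: "tree_isomorphism unrooted_iso"
  by (simp add: tree_isomorphism_def unrooted_iso_inverse)

lemma tree_isomorphism_rooted: "tree_isomorphism rooted_iso"
  unfolding tree_isomorphism_def
proof (intro ballI allI impI)
  fix t s :: "real ltree" and f assume t: "t \<in> ltrees" and iso: "rooted_iso t s f"
  have "inj_on f (dom t)" "[] \<in> dom t" "f [] = []"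
    using t iso by (auto simp: rooted_iso_def unrooted_iso_def bij_betw_def ltrees_def)
  then have "inv_into (dom t) f [] = []" by (metis inv_into_f_f)
  then show "unrooted_iso t s f \<and> rooted_iso s t (inv_into (dom t) f)"
    using iso unrooted_iso_inverse by (auto simp: rooted_iso_def)
qed

lemma iso_events_cong:
  assumes "tree_isomorphism R" "A \<in> iso_events R" "t \<in> ltrees" "s \<in> ltrees" "R t s f"
  shows "t \<in> A \<longleftrightarrow> s \<in> A"
proof
  show "t \<in> A \<Longrightarrow> s \<in> A" using assms unfolding iso_events_def by blast
  have "R s t (inv_into (dom t) f)" using assms unfolding tree_isomorphism_def by blast
  then show "s \<in> A \<Longrightarrow> t \<in> A" using assms unfolding iso_events_def by blast
qed

text \<open>
  Closure under complements uses that isomorphisms can be inverted.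
\<close>

lemma sigma_algebra_iso_events:
  assumes R: "tree_isomorphism R"
  shows "sigma_algebra UNIV (iso_events R)"
proof -
  let ?T = "tree_space (borel :: real measure)"
  have sp: "space ?T = UNIV" by (simp add: space_tree_space)
  show ?thesis
    unfolding sigma_algebra_iff2
  proof (intro conjI ballI allI impI)
    show "{} \<in> iso_events R" by (simp add: iso_events_def)
    show "UNIV - A \<in> iso_events R" if A: "A \<in> iso_events R" for A
    proof -
      have "UNIV - A \<in> sets ?T" using A sets.compl_sets[of A ?T] sp by (auto simp: iso_events_def)
      then show ?thesis using iso_events_cong[OF R A] by (simp add: iso_events_def) metis
    qed
    show "(\<Union>i::nat. A i) \<in> iso_events R" if "range A \<subseteq> iso_events R" for A
    proof -
      have "A i \<in> sets ?T" for i using that by (auto simp: iso_events_def)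
      then have "(\<Union>i. A i) \<in> sets ?T" by auto
      moreover have "s \<in> (\<Union>i. A i)" if ts: "t \<in> ltrees" "s \<in> ltrees" "R t s f" "t \<in> (\<Union>i. A i)" for t s f
      proof -
        obtain i where i: "t \<in> A i" using ts(4) by blast
        have "A i \<in> iso_events R" using \<open>range A \<subseteq> iso_events R\<close> by blast
        then have "s \<in> A i" using ts(1-3) i unfolding iso_events_def by blast
        then show ?thesis by blast
      qed
      ultimately show ?thesis unfolding iso_events_def mem_Collect_eq by blast
    qed
  qed simp
qed

text \<open>
  Preimages commute with generating a sigma-algebra, and the events \<open>iso_events R\<close> are one already.
\<close>

lemma sets_iso_class_algebra:
  assumes R: "tree_isomorphism R"
  shows "sets (iso_class_algebra R) = (\<lambda>A. forget_spine -` A) ` iso_events R"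
proof -
  interpret sigma_algebra UNIV "iso_events R" by (rule sigma_algebra_iso_events[OF R])
  have "sets (iso_class_algebra R) = sigma_sets UNIV ((\<lambda>A. forget_spine -` A) ` iso_events R)"
    unfolding iso_class_algebra_def by (rule sets_measure_of) simp
  also have "(\<lambda>A. forget_spine -` A) ` iso_events R = {forget_spine -` A \<inter> UNIV |A. A \<in> iso_events R}"
    by auto
  also have "sigma_sets UNIV \<dots> = {forget_spine -` A \<inter> UNIV |A. A \<in> sigma_sets UNIV (iso_events R)}"
    by (rule sigma_sets_vimage_commute[symmetric]) simp
  also have "sigma_sets UNIV (iso_events R) = iso_events R" by (rule sigma_sets_eq)
  finally show ?thesis by auto
qed

lemma space_iso_class_algebra: "space (iso_class_algebra R) = UNIV"
  unfolding iso_class_algebra_def by (rule space_measure_of) simp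

lemma iso_events_sets: "A \<in> iso_events R \<Longrightarrow> A \<in> sets (tree_space borel)"
  by (simp add: iso_events_def)

text \<open>
  In terms of the geodesic, which is given by its ends alone and is the shortest path in every tree
  that contains them.
\<close>

definition path_indicator :: "(real ltree \<times> nat list list) set \<Rightarrow> real ltree \<Rightarrow> nat list \<Rightarrow> nat list \<Rightarrow> ennreal" where
  "path_indicator B t u v = indicator B (t, geodesic u v)"

definition path_count :: "(real ltree \<times> nat list list) set \<Rightarrow> real ltree \<Rightarrow> nat list \<Rightarrow> ennreal" where
  "path_count B t u = (\<integral>\<^sup>+v. (if v \<in> dom t then path_indicator B t u v else 0) \<partial>count_space UNIV)"

lemma iso_path_events_sets:
  "B \<in> iso_path_events R \<Longrightarrow> B \<in> sets (tree_space borel \<Otimes>\<^sub>M count_space UNIV)"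
  by (simp add: iso_path_events_def)

lemma measurable_path_indicator:
  assumes "B \<in> sets (tree_space borel \<Otimes>\<^sub>M count_space UNIV)"
  shows "(\<lambda>t. path_indicator B t u v) \<in> borel_measurable (tree_space borel)"
proof -
  have "(\<lambda>t. (t, geodesic u v)) \<in> tree_space borel \<rightarrow>\<^sub>M tree_space borel \<Otimes>\<^sub>M count_space UNIV"
    by measurable
  from measurable_compose[OF this borel_measurable_indicator[OF assms]]
  show ?thesis by (simp add: path_indicator_def)
qed

lemma measurable_path_count:
  assumes "B \<in> sets (tree_space borel \<Otimes>\<^sub>M count_space UNIV)"
  shows "(\<lambda>t. path_count B t u) \<in> borel_measurable (tree_space borel)"
proof -
  have "(\<lambda>t. if v \<in> dom t then path_indicator B t u v else 0) \<in> borel_measurable (tree_space borel)" for v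
    using measurable_path_indicator[OF assms] by measurable
  then show ?thesis unfolding path_count_def by (rule measurable_nn_integral_count_space)
qed

text \<open>
  Membership in \<open>B\<close> is assumed to pass along isomorphisms in one direction only; the inverse
  isomorphism gives the other one.
\<close>

lemma path_indicator_iso:
  assumes R: "tree_isomorphism R" and B: "B \<in> iso_path_events R"
    and ts: "t \<in> ltrees" "s \<in> ltrees" and iso: "R t s f" and uv: "u \<in> dom t" "v \<in> dom t"
  shows "path_indicator B s (f u) (f v) = path_indicator B t u v"
proof -
  let ?g = "inv_into (dom t) f"
  have uiso: "unrooted_iso t s f" and inv: "R s t ?g"
    using R ts iso unfolding tree_isomorphism_def by blast+
  have bij: "bij_betw f (dom t) (dom s)" using uiso by (simp add: unrooted_iso_def)
  have w: "set (geodesic u v) \<subseteq> dom t" using walk_geodesic[OF ts(1) uv] by (simp add: walk_def)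
  have geo: "geodesic (f u) (f v) = map f (geodesic u v)" by (rule geodesic_iso[OF uiso ts uv])
  have ws: "set (map f (geodesic u v)) \<subseteq> dom s" using w bij_betwE[OF bij] by auto
  have inverse: "map ?g (map f (geodesic u v)) = geodesic u v"
    using w bij by (auto simp: bij_betw_def comp_def intro!: map_idI inv_into_f_f)
  have "(t, geodesic u v) \<in> B \<longleftrightarrow> (s, map f (geodesic u v)) \<in> B"
  proof
    assume "(t, geodesic u v) \<in> B"
    then show "(s, map f (geodesic u v)) \<in> B" using B ts iso w unfolding iso_path_events_def by blast
  next
    assume "(s, map f (geodesic u v)) \<in> B"
    then have "(t, map ?g (map f (geodesic u v))) \<in> B" using B ts inv ws unfolding iso_path_events_def by blast
    then show "(t, geodesic u v) \<in> B" by (simp only: inverse)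
  qed
  then show ?thesis by (simp add: path_indicator_def geo indicator_def)
qed

lemma path_count_iso:
  assumes R: "tree_isomorphism R" and B: "B \<in> iso_path_events R"
    and ts: "t \<in> ltrees" "s \<in> ltrees" and iso: "R t s f" and u: "u \<in> dom t"
  shows "path_count B s (f u) = path_count B t u"
proof -
  have "unrooted_iso t s f" using R ts iso unfolding tree_isomorphism_def by blast
  then have "bij_betw f (dom t) (dom s)" by (simp add: unrooted_iso_def)
  then have "path_count B s (f u) = (\<integral>\<^sup>+v. (if v \<in> dom t then path_indicator B s (f u) (f v) else 0) \<partial>count_space UNIV)"
    unfolding path_count_def by (rule nn_integral_dom_iso[where g = "path_indicator B s (f u)"])
  also have "\<dots> = path_count B t u"
    unfolding path_count_def by (intro nn_integral_cong if_cong refl path_indicator_iso[where R = R and t = t and s = s and f = f, OF R B ts iso u])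
  finally show ?thesis .
qed

lemma progeny_iso:
  fixes t s :: "real ltree"
  assumes "unrooted_iso t s f" shows "progeny s = progeny t"
proof -
  have "bij_betw f (dom t) (dom s)" using assms by (simp add: unrooted_iso_def)
  from nn_integral_dom_iso[OF this, of "\<lambda>_. 1"] show ?thesis by (simp add: progeny_eq_nn_integral)
qed

lemma path_count_finite:
  assumes "finite (dom t)"
  shows "path_count B t u = ennreal (card {v \<in> dom t. (t, geodesic u v) \<in> B})"
proof -
  have "path_count B t u = (\<integral>\<^sup>+v. indicator {v \<in> dom t. (t, geodesic u v) \<in> B} v \<partial>count_space UNIV)"
    unfolding path_count_def path_indicator_def by (intro nn_integral_cong) (auto simp: indicator_def)
  also have "\<dots> = emeasure (count_space UNIV) {v \<in> dom t. (t, geodesic u v) \<in> B}" by simp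
  finally show ?thesis using assms by (simp add: emeasure_count_space_finite ennreal_of_nat_eq_real_of_nat)
qed

lemma path_count_le_progeny: "path_count B t u \<le> progeny t"
  unfolding path_count_def progeny_eq_nn_integral path_indicator_def
  by (intro nn_integral_mono) (auto simp: indicator_def)

lemma ennreal_divide_le_1:
  fixes a b :: ennreal
  assumes "a \<le> b" shows "a / b \<le> 1"
proof (cases "b = 0 \<or> b = top")
  case True
  then show ?thesis using assms by (auto simp: divide_ennreal_def)
next
  case False
  then have "b / b = 1" by (intro ennreal_divide_self) (auto simp: less_top)
  then show ?thesis using divide_right_mono_ennreal[OF assms, of b] by simp
qed

lemma ennreal_mult_divide_cancel:
  fixes a b :: ennreal
  assumes "a \<noteq> 0" "a \<noteq> top" shows "a * (b / a) = b"
  using assms by (simp add: ennreal_times_divide mult.commute[of a] mult_divide_eq_ennreal)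

lemma enn2real_divide_nat: "n > 0 \<Longrightarrow> enn2real (ennreal (real k) / of_nat n) = k / n"
  by (simp add: ennreal_of_nat_eq_real_of_nat divide_ennreal)

lemma nn_integral_dom_finite:
  assumes "finite D"
  shows "(\<integral>\<^sup>+v. (if v \<in> D then g v else 0 :: ennreal) \<partial>count_space UNIV) = sum g D"
proof -
  have "(\<integral>\<^sup>+v. (if v \<in> D then g v else 0) \<partial>count_space UNIV) = (\<integral>\<^sup>+v. g v * indicator D v \<partial>count_space UNIV)"
    by (intro nn_integral_cong) auto
  also have "\<dots> = (\<integral>\<^sup>+v. g v \<partial>count_space D)" by (simp add: nn_integral_count_space_indicator)
  finally show ?thesis using assms by (simp add: nn_integral_count_space_finite)
qed

lemma pair_pmf_of_set:
  assumes "finite A" "A \<noteq> {}" "finite B" "B \<noteq> {}"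
  shows "pair_pmf (pmf_of_set A) (pmf_of_set B) = pmf_of_set (A \<times> B)"
proof (rule pmf_eqI)
  fix z :: "'a \<times> 'b"
  show "pmf (pair_pmf (pmf_of_set A) (pmf_of_set B)) z = pmf (pmf_of_set (A \<times> B)) z"
    using assms by (cases z) (simp add: pmf_pair indicator_def card_cartesian_product)
qed

context spinal_trees
begin

lemma AE_finite: "AE t in M. progeny t \<noteq> \<infinity>"
  using expected_progeny by (intro nn_integral_PInf_AE progeny_M) simp

lemma AE_forget_spine:
  assumes "AE t in M. P t"
  shows "AE s in M'. P (forget_spine s)"
proof (rule AE_distrD[of forget_spine M' T P])
  show "forget_spine \<in> M' \<rightarrow>\<^sub>M T" using measurable_forget_spine by (simp add: measurable_cong_sets[OF Hhat.sets_M refl])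
  have "(\<lambda>t. progeny t / (\<integral>\<^sup>+t. progeny t \<partial>M)) \<in> borel_measurable M" using progeny_M by measurable
  then have "AE t in tilted progeny M. P t"
    unfolding tilted_def using assms by (subst AE_density) (auto elim: eventually_mono)
  then show "AE t in distr M' T forget_spine. P t" by (simp only: distr_forget_spine)
qed

text \<open>
  Given the tree, the end of the spine is distributed as a uniform vertex. So the conditional
  probability of a property of the spine is \<open>G\<close> as soon as \<open>G\<close> is invariant and has, weighted by
  the total progeny, the same integral over every invariant event as the number of vertices \<open>v\<close> for
  which the path from the root to \<open>v\<close> has the property.
\<close>

lemma cond_exp_spine:
  assumes R: "tree_isomorphism R" and B: "B \<in> sets (T \<Otimes>\<^sub>M count_space UNIV)"
    and G: "G \<in> borel_measurable T" "\<And>t. 0 \<le> G t" "\<And>t. G t \<le> 1"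
    and G_iso: "\<And>t s f. t \<in> ltrees \<Longrightarrow> s \<in> ltrees \<Longrightarrow> R t s f \<Longrightarrow> G s = G t"
    and eq: "\<And>A. A \<in> iso_events R \<Longrightarrow>
      (\<integral>\<^sup>+t. indicator A t * path_count B t [] \<partial>M) = (\<integral>\<^sup>+t. indicator A t * (progeny t * ennreal (G t)) \<partial>M)"
  shows "AE s in M'. real_cond_exp M' (iso_class_algebra R) (\<lambda>s. indicator B (forget_spine s, spine s)) s = G (forget_spine s)"
proof -
  let ?F = "iso_class_algebra R"
  let ?f = "\<lambda>s. indicator B (forget_spine s, spine s) :: real"
  have fs: "forget_spine \<in> M' \<rightarrow>\<^sub>M T"
    using measurable_forget_spine by (simp add: measurable_cong_sets[OF Hhat.sets_M refl])
  have pair: "(\<lambda>s. (forget_spine s, spine s)) \<in> T' \<rightarrow>\<^sub>M T \<Otimes>\<^sub>M count_space UNIV"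
    by (intro measurable_Pair measurable_forget_spine measurable_spine)
  have fm': "(\<lambda>s. indicator B (forget_spine s, spine s) :: ennreal) \<in> borel_measurable T'"
    by (rule measurable_compose[OF pair borel_measurable_indicator[OF B]])
  have fm: "?f \<in> borel_measurable M'"
    using measurable_compose[OF pair borel_measurable_indicator[OF B]] by (simp add: measurable_cong_sets[OF Hhat.sets_M refl])
  have Gm: "(\<lambda>s. G (forget_spine s)) \<in> borel_measurable M'" by (rule measurable_compose[OF fs G(1)])
  have events: "forget_spine -` A \<in> sets M'" if "A \<in> iso_events R" for A
    using measurable_sets[OF fs iso_events_sets[OF that]] by (simp add: Hhat.space_M)
  have sub: "subalgebra M' ?F"
    using events by (auto simp: subalgebra_def sets_iso_class_algebra[OF R] space_iso_class_algebra Hhat.space_M)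
  interpret finite_measure_subalgebra M' ?F
    using sub by unfold_locales
  have int_f: "integrable M' ?f"
    by (rule Hhat.M.integrable_const_bound[where B = 1]) (use fm in \<open>auto simp: indicator_def\<close>)
  have int_G: "integrable M' (\<lambda>s. G (forget_spine s))"
    using G(2,3) by (intro Hhat.M.integrable_const_bound[where B = 1] AE_I2 Gm) auto
  show ?thesis
  proof (rule real_cond_exp_charact[OF _ int_f int_G])
    show "(\<lambda>s. G (forget_spine s)) \<in> borel_measurable ?F"
    proof (rule measurableI)
      fix X :: "real set" assume X: "X \<in> sets borel"
      have "G -` X \<in> iso_events R"
      proof -
        have "G -` X \<in> sets T" using measurable_sets[OF G(1) X] by (simp add: space_tree_space)
        moreover have "s \<in> G -` X" if "t \<in> ltrees" "s \<in> ltrees" "R t s f" "t \<in> G -` X" for t s f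
          using that G_iso[OF that(1-3)] by simp
        ultimately show ?thesis by (auto simp: iso_events_def)
      qed
      then show "(\<lambda>s. G (forget_spine s)) -` X \<inter> space ?F \<in> sets ?F"
        by (auto simp: sets_iso_class_algebra[OF R] space_iso_class_algebra intro!: image_eqI[where x = "G -` X"])
    qed simp
    fix A' assume "A' \<in> sets ?F"
    then obtain A where A: "A \<in> iso_events R" "A' = forget_spine -` A" by (auto simp: sets_iso_class_algebra[OF R])
    have AT: "A \<in> sets T" by (rule iso_events_sets[OF A(1)])
    have ind: "indicator A' s = (indicator A (forget_spine s) :: real)" for s by (simp add: A indicator_def)
    have iA: "(\<lambda>s. indicator A (forget_spine s) :: real) \<in> borel_measurable M'"
      by (rule measurable_compose[OF fs borel_measurable_indicator[OF AT]])
    have iA': "(\<lambda>s. indicator A (forget_spine s) :: ennreal) \<in> borel_measurable T'"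
      by (rule measurable_compose[OF measurable_forget_spine borel_measurable_indicator[OF AT]])
    have "(\<integral>\<^sup>+s. ennreal (indicator A (forget_spine s) * ?f s) \<partial>M') = (\<integral>\<^sup>+s. indicator A (forget_spine s) * indicator B (forget_spine s, spine s) \<partial>M')"
      by (intro nn_integral_cong) (simp add: indicator_def)
    also have "\<dots> = (\<integral>\<^sup>+t. (\<integral>\<^sup>+v. (if v \<in> dom t then indicator A t * indicator B (t, spine (mark v t)) else 0) \<partial>count_space UNIV) \<partial>M) / ennreal E"
      using spine_identity[OF borel_measurable_times_ennreal[OF iA' fm']] by (simp cong: if_cong)
    also have "(\<integral>\<^sup>+t. (\<integral>\<^sup>+v. (if v \<in> dom t then indicator A t * indicator B (t, spine (mark v t)) else 0) \<partial>count_space UNIV) \<partial>M)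
        = (\<integral>\<^sup>+t. indicator A t * path_count B t [] \<partial>M)"
    proof (rule nn_integral_cong_AE, use H.AE_ltrees in eventually_elim)
      fix t :: "real ltree" assume t: "t \<in> ltrees"
      have "(\<integral>\<^sup>+v. (if v \<in> dom t then indicator A t * indicator B (t, spine (mark v t)) else 0) \<partial>count_space UNIV)
          = (\<integral>\<^sup>+v. indicator A t * (if v \<in> dom t then path_indicator B t [] v else 0) \<partial>count_space UNIV)"
        by (intro nn_integral_cong) (auto simp: spine_mark[OF t] path_indicator_def)
      then show "(\<integral>\<^sup>+v. (if v \<in> dom t then indicator A t * indicator B (t, spine (mark v t)) else 0) \<partial>count_space UNIV) = indicator A t * path_count B t []"
        by (simp add: path_count_def nn_integral_cmult)
    qed
    also have "\<dots> = (\<integral>\<^sup>+t. progeny t * (indicator A t * ennreal (G t)) \<partial>M)"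
      unfolding eq[OF A(1)] by (simp add: mult_ac)
    also have "\<dots> / ennreal E = (\<integral>\<^sup>+s. indicator A (forget_spine s) * ennreal (G (forget_spine s)) \<partial>M')"
    proof (rule nn_integral_forget_spine[symmetric])
      show "(\<lambda>t. indicator A t * ennreal (G t)) \<in> borel_measurable T" using AT G(1) by measurable
    qed
    also have "\<dots> = (\<integral>\<^sup>+s. ennreal (indicator A (forget_spine s) * G (forget_spine s)) \<partial>M')"
      by (intro nn_integral_cong) (simp add: indicator_def)
    finally have nn: "(\<integral>\<^sup>+s. ennreal (indicator A (forget_spine s) * ?f s) \<partial>M')
        = (\<integral>\<^sup>+s. ennreal (indicator A (forget_spine s) * G (forget_spine s)) \<partial>M')" .
    show "(\<integral>s\<in>A'. ?f s \<partial>M') = (\<integral>s\<in>A'. G (forget_spine s) \<partial>M')"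
      unfolding set_lebesgue_integral_def ind real_scaleR_def
    proof (subst (1 2) integral_eq_nn_integral)
      show "(\<lambda>s. indicator A (forget_spine s) * ?f s) \<in> borel_measurable M'" using iA fm by measurable
      show "(\<lambda>s. indicator A (forget_spine s) * G (forget_spine s)) \<in> borel_measurable M'" using iA Gm by measurable
    qed (use nn G(2) in \<open>auto simp: indicator_def\<close>)
  qed
qed

text \<open>
  Here the proportion of vertices \<open>v\<close> for which the path from the root has the property is itself
  invariant.
\<close>

lemma cond_exp_spine_rooted:
  assumes B: "B \<in> iso_path_events rooted_iso"
  shows "AE s in M'. real_cond_exp M' (iso_class_algebra rooted_iso) (\<lambda>s. indicator B (forget_spine s, spine s)) s =
    measure_pmf.prob (pmf_of_set (dom (forget_spine s))) {v. (forget_spine s, shortest_path (forget_spine s) [] v) \<in> B}"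
proof -
  note BT = iso_path_events_sets[OF B]
  \<comment> \<open>A proportion in infinite trees has the value 0, as the quotient by \<open>\<infinity>\<close> is 0; these trees have
    probability 0.\<close>
  define W where "W t = path_count B t [] / progeny t" for t
  have W_le: "W t \<le> 1" for t
    unfolding W_def by (rule ennreal_divide_le_1[OF path_count_le_progeny])
  have W_enn: "ennreal (enn2real (W t)) = W t" for t
    using W_le[of t] by (intro ennreal_enn2real) (auto intro: le_less_trans)
  have cond: "AE s in M'. real_cond_exp M' (iso_class_algebra rooted_iso) (\<lambda>s. indicator B (forget_spine s, spine s)) s
      = enn2real (W (forget_spine s))"
  proof (rule cond_exp_spine[OF tree_isomorphism_rooted BT])
    show "(\<lambda>t. enn2real (W t)) \<in> borel_measurable T"
      unfolding W_def using measurable_path_count[OF BT] measurable_progeny by measurable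
    show "enn2real (W t) \<le> 1" for t using enn2real_mono[OF W_le[of t]] by simp
    show "enn2real (W s) = enn2real (W t)" if ts: "t \<in> ltrees" "s \<in> ltrees" and iso: "rooted_iso t s f" for t s f
    proof -
      have f: "unrooted_iso t s f" "f [] = []" using iso by (auto simp: rooted_iso_def)
      have "[] \<in> dom t" using ts(1) by (simp add: ltrees_def)
      from path_count_iso[where R = rooted_iso and t = t and s = s and f = f, OF tree_isomorphism_rooted B ts iso this] show ?thesis
        by (simp only: W_def f(2) progeny_iso[OF f(1)])
    qed
    fix A
    show "(\<integral>\<^sup>+t. indicator A t * path_count B t [] \<partial>M) = (\<integral>\<^sup>+t. indicator A t * (progeny t * ennreal (enn2real (W t))) \<partial>M)"
    proof (rule nn_integral_cong_AE, use H.AE_ltrees AE_finite in eventually_elim)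
      fix t :: "real ltree" assume "t \<in> ltrees" "progeny t \<noteq> \<infinity>"
      then show "indicator A t * path_count B t [] = indicator A t * (progeny t * ennreal (enn2real (W t)))"
        unfolding W_enn unfolding W_def by (simp add: ennreal_mult_divide_cancel progeny_ltrees)
    qed
  qed simp
  have "AE s in M'. forget_spine s \<in> ltrees \<and> progeny (forget_spine s) \<noteq> \<infinity>"
    by (rule AE_forget_spine) (use H.AE_ltrees AE_finite in eventually_elim, simp)
  with cond show ?thesis
  proof eventually_elim
    fix s assume *: "forget_spine s \<in> ltrees \<and> progeny (forget_spine s) \<noteq> \<infinity>"
      and c: "real_cond_exp M' (iso_class_algebra rooted_iso) (\<lambda>s. indicator B (forget_spine s, spine s)) s = enn2real (W (forget_spine s))"
    define t where "t = forget_spine s"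
    have t: "t \<in> ltrees" and fin: "finite (dom t)" using * by (auto simp: t_def progeny_finite[symmetric])
    have root: "[] \<in> dom t" using t by (simp add: ltrees_def)
    have "dom t \<inter> {v. (t, shortest_path t [] v) \<in> B} = {v \<in> dom t. (t, geodesic [] v) \<in> B}"
      using shortest_path_eq_geodesic[OF t root] by (intro set_eqI) (simp cong: conj_cong)
    then have "measure_pmf.prob (pmf_of_set (dom t)) {v. (t, shortest_path t [] v) \<in> B}
        = card {v \<in> dom t. (t, geodesic [] v) \<in> B} / card (dom t)"
      using fin root by (subst measure_pmf_of_set) auto
    also have "\<dots> = enn2real (W t)"
      unfolding W_def path_count_finite[OF fin] progeny_card[OF fin] by (rule enn2real_divide_nat[symmetric]) (use fin root in \<open>auto simp: card_gt_0_iff\<close>)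
    finally show "real_cond_exp M' (iso_class_algebra rooted_iso) (\<lambda>s. indicator B (forget_spine s, spine s)) s =
        measure_pmf.prob (pmf_of_set (dom (forget_spine s))) {v. (forget_spine s, shortest_path (forget_spine s) [] v) \<in> B}"
      using c by (simp add: t_def)
  qed
qed

text \<open>
  The proportion of vertices \<open>v\<close> now depends on the root. Every vertex \<open>u\<close> distributes, in equal
  parts to all vertices, the mass \<open>path_count B t u\<close>; what the root receives is the average of this mass
  over all \<open>u\<close>, which is an invariant function, and mass transport says that it has the right mean.
\<close>

lemma cond_exp_spine_unrooted:
  assumes B: "B \<in> iso_path_events unrooted_iso"
  shows "AE s in M'. real_cond_exp M' (iso_class_algebra unrooted_iso) (\<lambda>s. indicator B (forget_spine s, spine s)) s =
    measure_pmf.prob (pair_pmf (pmf_of_set (dom (forget_spine s))) (pmf_of_set (dom (forget_spine s))))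
      {(u, v). (forget_spine s, shortest_path (forget_spine s) u v) \<in> B}"
proof -
  note BT = iso_path_events_sets[OF B]
  define V where "V t u = path_count B t u / progeny t" for t u
  define S where "S t = (\<integral>\<^sup>+u. (if u \<in> dom t then V t u else 0) \<partial>count_space UNIV)" for t
  define W where "W t = S t / progeny t" for t
  have V_le: "V t u \<le> 1" for t u
    unfolding V_def by (rule ennreal_divide_le_1[OF path_count_le_progeny])
  have "S t \<le> progeny t" for t
    unfolding S_def progeny_eq_nn_integral using V_le by (intro nn_integral_mono) auto
  then have W_le: "W t \<le> 1" for t unfolding W_def by (rule ennreal_divide_le_1)
  have W_enn: "ennreal (enn2real (W t)) = W t" for t
    using W_le[of t] by (intro ennreal_enn2real) (auto intro: le_less_trans)
  have Vm: "(\<lambda>t. V t u) \<in> borel_measurable T" for u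
    unfolding V_def using measurable_path_count[OF BT] measurable_progeny by measurable
  have Sm: "S \<in> borel_measurable T"
  proof -
    have "(\<lambda>t. if u \<in> dom t then V t u else 0) \<in> borel_measurable T" for u using Vm by measurable
    then show ?thesis unfolding S_def[abs_def] by (rule measurable_nn_integral_count_space)
  qed
  have V_iso: "V s (f u) = V t u"
    if "t \<in> ltrees" "s \<in> ltrees" "unrooted_iso t s f" "u \<in> dom t" for t s f u
    using path_count_iso[where R = unrooted_iso and t = t and s = s and f = f, OF tree_isomorphism_unrooted B that] progeny_iso[OF that(3)] by (simp add: V_def)
  have S_iso: "S s = S t" if ts: "t \<in> ltrees" "s \<in> ltrees" "unrooted_iso t s f" for t s f
  proof -
    have "bij_betw f (dom t) (dom s)" using ts(3) by (simp add: unrooted_iso_def)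
    then have "S s = (\<integral>\<^sup>+u. (if u \<in> dom t then V s (f u) else 0) \<partial>count_space UNIV)"
      unfolding S_def by (rule nn_integral_dom_iso[where g = "V s"])
    also have "\<dots> = S t" unfolding S_def by (intro nn_integral_cong if_cong refl V_iso[OF ts])
    finally show ?thesis .
  qed
  have cond: "AE s in M'. real_cond_exp M' (iso_class_algebra unrooted_iso) (\<lambda>s. indicator B (forget_spine s, spine s)) s
      = enn2real (W (forget_spine s))"
  proof (rule cond_exp_spine[OF tree_isomorphism_unrooted BT])
    show "(\<lambda>t. enn2real (W t)) \<in> borel_measurable T"
      unfolding W_def using Sm measurable_progeny by measurable
    show "enn2real (W t) \<le> 1" for t using enn2real_mono[OF W_le[of t]] by simp
    show "enn2real (W s) = enn2real (W t)" if "t \<in> ltrees" "s \<in> ltrees" "unrooted_iso t s f" for t s f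
      by (simp only: W_def S_iso[OF that] progeny_iso[OF that(3)])
    fix A assume A: "A \<in> iso_events unrooted_iso"
    \<comment> \<open>The mass that \<open>u\<close> sends to \<open>v\<close> is \<open>path_count B t u\<close> divided by the number of vertices.\<close>
    define F where "F t u v = indicator A t * V t u" for t and u v :: "nat list"
    have F: "bipointed_functional F"
      unfolding bipointed_functional_def
    proof (intro conjI allI ballI impI)
      show "(\<lambda>t. F t u v) \<in> borel_measurable T" for u v
        unfolding F_def using iso_events_sets[OF A] Vm by measurable
      fix t s :: "real ltree" and f u v
      assume ts: "t \<in> ltrees" "s \<in> ltrees" "unrooted_iso t s f" and u: "u \<in> dom t"
      show "F s (f u) (f v) = F t u v"
        using iso_events_cong[where R = unrooted_iso and t = t and s = s and f = f, OF tree_isomorphism_unrooted A ts] V_iso[OF ts u] by (simp add: F_def indicator_def)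
    qed
    have "(\<integral>\<^sup>+t. indicator A t * path_count B t [] \<partial>M) = root_total F"
      unfolding root_total_def
    proof (rule nn_integral_cong_AE, use H.AE_ltrees AE_finite in eventually_elim)
      fix t :: "real ltree" assume t: "t \<in> ltrees" "progeny t \<noteq> \<infinity>"
      have "(\<integral>\<^sup>+v. (if v \<in> dom t then F t [] v else 0) \<partial>count_space UNIV)
          = (\<integral>\<^sup>+v. indicator A t * V t [] * (if v \<in> dom t then 1 else 0) \<partial>count_space UNIV)"
        by (intro nn_integral_cong) (auto simp: F_def)
      also have "\<dots> = indicator A t * (progeny t * V t [])"
        by (simp add: nn_integral_cmult progeny_eq_nn_integral[symmetric] mult_ac)
      also have "progeny t * V t [] = path_count B t []"
        using t by (simp add: V_def ennreal_mult_divide_cancel progeny_ltrees)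
      finally show "indicator A t * path_count B t [] = (\<integral>\<^sup>+v. (if v \<in> dom t then F t [] v else 0) \<partial>count_space UNIV)" ..
    qed
    also have "root_total F = root_total (\<lambda>t u v. F t v u)" by (rule mass_transport[OF F])
    also have "\<dots> = (\<integral>\<^sup>+t. indicator A t * (progeny t * ennreal (enn2real (W t))) \<partial>M)"
      unfolding root_total_def
    proof (rule nn_integral_cong_AE, use H.AE_ltrees AE_finite in eventually_elim)
      fix t :: "real ltree" assume t: "t \<in> ltrees" "progeny t \<noteq> \<infinity>"
      have "(\<integral>\<^sup>+v. (if v \<in> dom t then F t v [] else 0) \<partial>count_space UNIV)
          = (\<integral>\<^sup>+v. indicator A t * (if v \<in> dom t then V t v else 0) \<partial>count_space UNIV)"
        by (intro nn_integral_cong) (auto simp: F_def)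
      also have "\<dots> = indicator A t * S t" by (simp add: nn_integral_cmult S_def)
      also have "S t = progeny t * W t"
        using t by (simp add: W_def ennreal_mult_divide_cancel progeny_ltrees)
      finally show "(\<integral>\<^sup>+v. (if v \<in> dom t then F t v [] else 0) \<partial>count_space UNIV) = indicator A t * (progeny t * ennreal (enn2real (W t)))"
        by (simp only: W_enn)
    qed
    finally show "(\<integral>\<^sup>+t. indicator A t * path_count B t [] \<partial>M) = (\<integral>\<^sup>+t. indicator A t * (progeny t * ennreal (enn2real (W t))) \<partial>M)" .
  qed simp
  have "AE s in M'. forget_spine s \<in> ltrees \<and> progeny (forget_spine s) \<noteq> \<infinity>"
    by (rule AE_forget_spine) (use H.AE_ltrees AE_finite in eventually_elim, simp)
  with cond show ?thesis
  proof eventually_elim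
    fix s assume *: "forget_spine s \<in> ltrees \<and> progeny (forget_spine s) \<noteq> \<infinity>"
      and c: "real_cond_exp M' (iso_class_algebra unrooted_iso) (\<lambda>s. indicator B (forget_spine s, spine s)) s = enn2real (W (forget_spine s))"
    define t where "t = forget_spine s"
    have t: "t \<in> ltrees" and fin: "finite (dom t)" using * by (auto simp: t_def progeny_finite[symmetric])
    have root: "[] \<in> dom t" using t by (simp add: ltrees_def)
    define n where "n = card (dom t)"
    have n: "n > 0" using fin root by (auto simp: n_def card_gt_0_iff)
    define c where "c u = card {v \<in> dom t. (t, geodesic u v) \<in> B}" for u
    have V: "V t u = ennreal (c u / n)" for u
      using n by (simp add: V_def path_count_finite[OF fin] progeny_card[OF fin] c_def n_def ennreal_of_nat_eq_real_of_nat divide_ennreal)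
    have "S t = (\<Sum>u\<in>dom t. V t u)"
      unfolding S_def by (rule nn_integral_dom_finite[OF fin])
    also have "\<dots> = ennreal ((\<Sum>u\<in>dom t. c u) / n)"
      unfolding V by (subst sum_ennreal) (simp_all add: sum_divide_distrib)
    finally have W: "enn2real (W t) = (\<Sum>u\<in>dom t. c u) / (n * n)"
      using n by (simp add: W_def progeny_card[OF fin] n_def[symmetric] ennreal_of_nat_eq_real_of_nat divide_ennreal sum_nonneg)
    have "dom t \<times> dom t \<inter> {(u, v). (t, shortest_path t u v) \<in> B} = Sigma (dom t) (\<lambda>u. {v \<in> dom t. (t, geodesic u v) \<in> B})"
    proof (rule set_eqI)
      fix z
      show "z \<in> dom t \<times> dom t \<inter> {(u, v). (t, shortest_path t u v) \<in> B}
          \<longleftrightarrow> z \<in> Sigma (dom t) (\<lambda>u. {v \<in> dom t. (t, geodesic u v) \<in> B})"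
        using shortest_path_eq_geodesic[OF t] by (cases z) (simp add: conj_assoc cong: conj_cong)
    qed
    then have "card (dom t \<times> dom t \<inter> {(u, v). (t, shortest_path t u v) \<in> B}) = (\<Sum>u\<in>dom t. c u)"
      using fin by (simp add: c_def)
    then have "measure_pmf.prob (pair_pmf (pmf_of_set (dom t)) (pmf_of_set (dom t))) {(u, v). (t, shortest_path t u v) \<in> B}
        = (\<Sum>u\<in>dom t. c u) / (n * n)"
    proof -
      have ne: "dom t \<noteq> {}" using root by blast
      then show ?thesis
        using fin \<open>card _ = sum c _\<close>
        by (simp add: pair_pmf_of_set measure_pmf_of_set n_def card_cartesian_product)
    qed
    then show "real_cond_exp M' (iso_class_algebra unrooted_iso) (\<lambda>s. indicator B (forget_spine s, spine s)) s =
        measure_pmf.prob (pair_pmf (pmf_of_set (dom (forget_spine s))) (pmf_of_set (dom (forget_spine s))))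
          {(u, v). (forget_spine s, shortest_path (forget_spine s) u v) \<in> B}"
      using \<open>real_cond_exp _ _ _ _ = _\<close> W by (simp add: t_def)
  qed
qed

end

theorem lemma33:
  fixes x :: real
    and M :: "real ltree measure"
    and M' :: "(real \<times> bool) ltree measure"
  assumes "x > 0"
    and "H_law x M"
    and "Hhat_law x M'"
  shows
    "(\<forall>A \<in> iso_events rooted_iso.
        emeasure (distr M' (tree_space borel) forget_spine) A = emeasure (tilted progeny M) A) \<and>
     (\<forall>\<kappa> \<kappa>'.
        regular_conditional_law M root_age \<kappa> \<longrightarrow>
        regular_conditional_law M' (root_age \<circ> forget_spine) \<kappa>' \<longrightarrow>
        (AE b in lborel. b \<ge> 0 \<longrightarrow>
          (\<forall>A \<in> iso_events rooted_iso.
             emeasure (distr (\<kappa>' b) (tree_space borel) forget_spine) A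
               = emeasure (tilted progeny (\<kappa> b)) A))) \<and>
     (\<forall>B \<in> iso_path_events rooted_iso.
        AE t in M'.
          real_cond_exp M' (iso_class_algebra rooted_iso)
            (\<lambda>t. indicator B (forget_spine t, spine t)) t =
          measure_pmf.prob (pmf_of_set (dom (forget_spine t)))
            {v. (forget_spine t, shortest_path (forget_spine t) [] v) \<in> B}) \<and>
     (\<forall>B \<in> iso_path_events unrooted_iso.
        AE t in M'.
          real_cond_exp M' (iso_class_algebra unrooted_iso)
            (\<lambda>t. indicator B (forget_spine t, spine t)) t =
          measure_pmf.prob
            (pair_pmf (pmf_of_set (dom (forget_spine t))) (pmf_of_set (dom (forget_spine t))))
            {(u, v). (forget_spine t, shortest_path (forget_spine t) u v) \<in> B})"
proof -
  interpret spinal_trees x M M' using assms by unfold_locales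
  show ?thesis
  proof (intro conjI allI ballI impI)
    fix \<kappa> \<kappa>' assume "regular_conditional_law M root_age \<kappa>" "regular_conditional_law M' (root_age \<circ> forget_spine) \<kappa>'"
    from conditional_distr_forget_spine[OF this]
    show "AE b in lborel. b \<ge> 0 \<longrightarrow>
          (\<forall>A \<in> iso_events rooted_iso.
             emeasure (distr (\<kappa>' b) (tree_space borel) forget_spine) A
               = emeasure (tilted progeny (\<kappa> b)) A)"
      by eventually_elim simp
  qed (simp_all only: distr_forget_spine cond_exp_spine_rooted cond_exp_spine_unrooted)
qed

end
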